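(* Let $M$ be a polarised toric manifold with Delzant moment polytope $P\subset\mathbb{R}^n$. Assume that there is a solution $(u,\xi)$ of the toric HcscK system $$\begin{cases}\xi^{ab}{}_{,ab}=0,\\ \left(\left(\mathbb{1}-\xi\,D^2u\,\bar\xi\,D^2u\right)^{1/2}(D^2u)^{-1}\right)^{ab}{}_{,ab}=-C\end{cases}$$ on $P^\circ$, with $u$ a symplectic potential, $\xi$ a Higgs tensor on $P$, and $r(\xi\,D^2u\,\bar\xi\,D^2u)<1$. Then $M$ is uniformly $K$-stable (with respect to toric test-configurations).
   Context: $P=\{y\in\mathbb{R}^n:\ell^r(y)\ge0\ \forall r\}$ is a Delzant polytope with interior $P^\circ$, where the $\ell^r$ are the affine-linear functions defining the facets $S_r$, normalized to have primitive integral inward normals. $d\mu$ is Lebesgue measure. $d\sigma$ is Donaldson's boundary measure, equal on each facet $S_r$ to the $(n-1)$-dimensional Lebesgue measure times $|\nabla\ell^r|^{-1}$. $C=4\hat s=\sigma(\partial P)/\mu(P)$, where $\hat s$ is the average scalar curvature. Indices after a comma are partial derivatives, and repeated indices are summed. A symplectic potential is $u=u_P+h$ with $u_P=\sum_r\ell^r\log\ell^r$, $h\in C^\infty(P)$ (smooth up to the boundary), $D^2u$ positive definite on $P^\circ$, and $\det D^2u=(\delta\prod_r\ell^r)^{-1}$ for a strictly positive $\delta\in C^0(P)$. A Higgs tensor is a smooth complex-symmetric-matrix-valued function $\xi$ on $P^\circ$ such that $D^2u_P\,\xi\,D^2u_P$ extends smoothly to $P$ (then $\xi\,D^2u\,\bar\xi\,D^2u$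 extends smoothly to $P$). $r$ is the spectral radius, and the bound $r<1$ holds on all of $P$; the eigenvalues of $\xi\,D^2u\,\bar\xi\,D^2u$ are in $[0,1)$, and the square root is the one with positive eigenvalues. Uniform $K$-stability: let $\mathcal L_C(f)=\int_{\partial P}f\,d\sigma-\int_PC\,f\,d\mu$. For a chosen $p_0\in P^\circ$ let $\mathcal C_\infty$ be the set of convex functions $f\in C^0(P)\cap C^\infty(P^\circ)$ with $f(p_0)=0$ and $df(p_0)=0$. $M$ is uniformly $K$-stable if $\mathcal L_C$ vanishes on affine-linear functions and there is $\lambda>0$ such that $\mathcal L_C(f)\ge\lambda\int_{\partial P}f\,d\sigma$ for all $f\in\mathcal C_\infty$. *)

theory Defs
  imports "HOL-Analysis.Analysis"
begin

section \<open>Smooth functions\<close>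

text \<open>For functions on an open set \<open>S\<close>.\<close>

primrec Ck_on :: "nat \<Rightarrow> 'a::euclidean_space set \<Rightarrow> ('a \<Rightarrow> 'b::real_normed_vector) \<Rightarrow> bool" where
  "Ck_on 0 S f \<longleftrightarrow> continuous_on S f"
| "Ck_on (Suc k) S f \<longleftrightarrow>
     (\<forall>x\<in>S. f differentiable (at x)) \<and> (\<forall>v. Ck_on k S (\<lambda>x. frechet_derivative f (at x) v))"

definition smooth_on :: "'a::euclidean_space set \<Rightarrow> ('a \<Rightarrow> 'b::real_normed_vector) \<Rightarrow> bool" where
  "smooth_on S f \<longleftrightarrow> (\<forall>k. Ck_on k S f)"

text \<open>\<open>C\<^sup>\<infinity>(P)\<close> for a closed set \<open>P\<close> with interior, i.e. smooth up to the boundary.\<close>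

definition smooth_up_to_boundary ::
    "'a::euclidean_space set \<Rightarrow> ('a \<Rightarrow> 'b::real_normed_vector) \<Rightarrow> bool" where
  "smooth_up_to_boundary P f \<longleftrightarrow>
     (\<exists>U g. open U \<and> P \<subseteq> U \<and> smooth_on U g \<and> (\<forall>x\<in>P. g x = f x))"

definition extends_smoothly ::
    "'a::euclidean_space set \<Rightarrow> ('a \<Rightarrow> 'b::real_normed_vector) \<Rightarrow> bool" where
  "extends_smoothly P f \<longleftrightarrow>
     (\<exists>F. smooth_up_to_boundary P F \<and> (\<forall>x\<in>interior P. F x = f x))"

definition partial :: "'n \<Rightarrow> (real^'n \<Rightarrow> 'b::real_normed_vector) \<Rightarrow> real^'n \<Rightarrow> 'b" where
  "partial a f x = frechet_derivative f (at x) (axis a 1)"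

definition hess :: "(real^'n \<Rightarrow> real) \<Rightarrow> real^'n \<Rightarrow> real^'n^'n" where
  "hess f x = (\<chi> a b. partial b (partial a f) x)"

definition double_div :: "(real^'n \<Rightarrow> complex^'n^'n) \<Rightarrow> real^'n \<Rightarrow> complex" where
  "double_div V x = (\<Sum>a\<in>UNIV. \<Sum>b\<in>UNIV. partial b (partial a (\<lambda>y. V y $ a $ b)) x)"


section \<open>Matrices\<close>

abbreviation complex_matrix :: "real^'n^'m \<Rightarrow> complex^'n^'m" where
  "complex_matrix \<equiv> map_matrix complex_of_real"

definition positive_definite :: "real^'n^'n \<Rightarrow> bool" where
  "positive_definite A \<longleftrightarrow> transpose A = A \<and> (\<forall>v. v \<noteq> 0 \<longrightarrow> v \<bullet> (A *v v) > 0)"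

definition eigenvalues :: "complex^'n^'n \<Rightarrow> complex set" where
  "eigenvalues A = {k. \<exists>v. v \<noteq> 0 \<and> A *v v = k *s v}"

definition spectral_radius :: "complex^'n^'n \<Rightarrow> real" where
  "spectral_radius A = Max (cmod ` eigenvalues A)"

text \<open>Unique when \<open>A\<close> has only positive eigenvalues, whether or not \<open>A\<close> is Hermitian.\<close>

definition matrix_sqrt :: "complex^'n^'n \<Rightarrow> complex^'n^'n" where
  "matrix_sqrt A = (THE B. B ** B = A \<and> eigenvalues B \<subseteq> complex_of_real ` {0<..})"


section \<open>Delzant polytopes\<close>

definition real_vec :: "int^'n \<Rightarrow> real^'n" where
  "real_vec w = (\<chi> i. real_of_int (w $ i))"

text \<open>A polytope is given by the inward normals \<open>\<nu> r\<close> and the constant terms \<open>c r\<close> of the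
  affine-linear functions \<open>\<ell>\<^sup>r\<close>, indexed by a finite type.\<close>

definition ell :: "('r \<Rightarrow> int^'n) \<Rightarrow> ('r \<Rightarrow> real) \<Rightarrow> 'r \<Rightarrow> real^'n \<Rightarrow> real" where
  "ell \<nu> c r y = real_vec (\<nu> r) \<bullet> y + c r"

definition moment_polytope :: "('r \<Rightarrow> int^'n) \<Rightarrow> ('r \<Rightarrow> real) \<Rightarrow> (real^'n) set" where
  "moment_polytope \<nu> c = {y. \<forall>r. ell \<nu> c r y \<ge> 0}"

definition facet :: "('r \<Rightarrow> int^'n) \<Rightarrow> ('r \<Rightarrow> real) \<Rightarrow> 'r \<Rightarrow> (real^'n) set" where
  "facet \<nu> c r = {y \<in> moment_polytope \<nu> c. ell \<nu> c r y = 0}"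

definition primitive :: "int^'n \<Rightarrow> bool" where
  "primitive w \<longleftrightarrow> Gcd (range (\<lambda>i. w $ i)) = 1"

text \<open>The family \<open>(\<nu> r)\<close>, \<open>r \<in> A\<close>, is a \<open>\<int>\<close>-basis of \<open>\<int>\<^sup>n\<close>.\<close>

definition lattice_basis :: "'r set \<Rightarrow> ('r \<Rightarrow> int^'n) \<Rightarrow> bool" where
  "lattice_basis A \<nu> \<longleftrightarrow>
     (\<forall>w. \<exists>!k. (\<forall>r. r \<notin> A \<longrightarrow> k r = 0) \<and> w = (\<Sum>r\<in>A. k r *s \<nu> r))"

definition delzant :: "('r::finite \<Rightarrow> int^'n) \<Rightarrow> ('r \<Rightarrow> real) \<Rightarrow> bool" where
  "delzant \<nu> c \<longleftrightarrow>
     bounded (moment_polytope \<nu> c) \<and>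
     interior (moment_polytope \<nu> c) \<noteq> {} \<and>
     (\<forall>r. primitive (\<nu> r)) \<and>
     (\<forall>r. facet \<nu> c r facet_of moment_polytope \<nu> c) \<and>
     inj (facet \<nu> c) \<and>
     (\<forall>v. v extreme_point_of moment_polytope \<nu> c \<longrightarrow>
          lattice_basis {r. ell \<nu> c r v = 0} \<nu>)"

text \<open>The polytope comes from a polarisation when its vertices are lattice points. The translation
  \<open>t\<close> accounts for the free additive constant in the moment map, the factor \<open>s\<close> for the
  normalisation of the Kaehler form relative to the first Chern class (e.g. \<open>2\<pi>\<close>).\<close>

definition polarised :: "(real^'n) set \<Rightarrow> bool" where
  "polarised P \<longleftrightarrow>
     (\<exists>t s. s > 0 \<and> (\<forall>v. v extreme_point_of P \<longrightarrow> (\<exists>w. v = t + s *\<^sub>R real_vec w)))"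


section \<open>The boundary measure and the functional\<close>

text \<open>Lebesgue measure on the hyperplane \<open>{y. a \<bullet> y + b = 0}\<close> (\<open>a \<noteq> 0\<close>), constructed like
  \<^const>\<open>lborel\<close>: transport of the product measure along an orthonormal frame of the direction
  space, based at a point of the hyperplane. It does not depend on the choice of the frame.\<close>

definition hyperplane_lborel :: "real^'n \<Rightarrow> real \<Rightarrow> (real^'n) measure" where
  "hyperplane_lborel a b =
     (let B = (SOME B. pairwise orthogonal B \<and> (\<forall>e\<in>B. norm e = 1) \<and> span B = {v. a \<bullet> v = 0})
      in distr (\<Pi>\<^sub>M e\<in>B. lborel) borel
           (\<lambda>x. - (b / (a \<bullet> a)) *\<^sub>R a + (\<Sum>e\<in>B. x e *\<^sub>R e)))"

text \<open>\<open>\<integral>\<^bsub>\<partial>P\<^esub> f d\<sigma>\<close>; distinct facets overlap in \<open>\<sigma>\<close>-null sets.\<close>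

definition boundary_integral ::
    "('r::finite \<Rightarrow> int^'n) \<Rightarrow> ('r \<Rightarrow> real) \<Rightarrow> (real^'n \<Rightarrow> real) \<Rightarrow> real" where
  "boundary_integral \<nu> c f =
     (\<Sum>r\<in>UNIV. (LINT y:facet \<nu> c r|hyperplane_lborel (real_vec (\<nu> r)) (c r). f y)
                / norm (real_vec (\<nu> r)))"

definition const_C :: "('r::finite \<Rightarrow> int^'n) \<Rightarrow> ('r \<Rightarrow> real) \<Rightarrow> real" where
  "const_C \<nu> c = boundary_integral \<nu> c (\<lambda>_. 1) / measure lborel (moment_polytope \<nu> c)"

definition L_C :: "('r::finite \<Rightarrow> int^'n) \<Rightarrow> ('r \<Rightarrow> real) \<Rightarrow> (real^'n \<Rightarrow> real) \<Rightarrow> real" where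
  "L_C \<nu> c f = boundary_integral \<nu> c f - (LINT y:moment_polytope \<nu> c|lborel. const_C \<nu> c * f y)"

definition C_infinity :: "(real^'n) set \<Rightarrow> real^'n \<Rightarrow> (real^'n \<Rightarrow> real) set" where
  "C_infinity P p0 =
     {f. convex_on P f \<and> continuous_on P f \<and> smooth_on (interior P) f \<and>
         f p0 = 0 \<and> (f has_derivative (\<lambda>_. 0)) (at p0)}"

definition uniformly_K_stable ::
    "('r::finite \<Rightarrow> int^'n) \<Rightarrow> ('r \<Rightarrow> real) \<Rightarrow> real^'n \<Rightarrow> bool" where
  "uniformly_K_stable \<nu> c p0 \<longleftrightarrow>
     (\<forall>a b. L_C \<nu> c (\<lambda>y. a \<bullet> y + b) = 0) \<and>
     (\<exists>\<kappa>>0. \<forall>f\<in>C_infinity (moment_polytope \<nu> c) p0.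
        L_C \<nu> c f \<ge> \<kappa> * boundary_integral \<nu> c f)"


section \<open>The toric HcscK system\<close>

text \<open>The convention \<open>0 log 0 = 0\<close> on the boundary holds by \<open>0 * x = 0\<close>.\<close>

definition u_P :: "('r::finite \<Rightarrow> int^'n) \<Rightarrow> ('r \<Rightarrow> real) \<Rightarrow> real^'n \<Rightarrow> real" where
  "u_P \<nu> c y = (\<Sum>r\<in>UNIV. ell \<nu> c r y * ln (ell \<nu> c r y))"

definition symplectic_potential ::
    "('r::finite \<Rightarrow> int^'n) \<Rightarrow> ('r \<Rightarrow> real) \<Rightarrow> (real^'n \<Rightarrow> real) \<Rightarrow> bool" where
  "symplectic_potential \<nu> c u \<longleftrightarrow>
     (let P = moment_polytope \<nu> c in
      (\<exists>h. smooth_up_to_boundary P h \<and> (\<forall>y\<in>P. u y = u_P \<nu> c y + h y)) \<and>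
      (\<forall>y\<in>interior P. positive_definite (hess u y)) \<and>
      (\<exists>\<delta>. continuous_on P \<delta> \<and> (\<forall>y\<in>P. \<delta> y > 0) \<and>
           (\<forall>y\<in>interior P. det (hess u y) = inverse (\<delta> y * (\<Prod>r\<in>UNIV. ell \<nu> c r y)))))"

definition higgs_tensor ::
    "('r::finite \<Rightarrow> int^'n) \<Rightarrow> ('r \<Rightarrow> real) \<Rightarrow> (real^'n \<Rightarrow> complex^'n^'n) \<Rightarrow> bool" where
  "higgs_tensor \<nu> c \<xi> \<longleftrightarrow>
     (let P = moment_polytope \<nu> c; G = (\<lambda>y. complex_matrix (hess (u_P \<nu> c) y)) in
      smooth_on (interior P) \<xi> \<and>
      (\<forall>y\<in>interior P. transpose (\<xi> y) = \<xi> y) \<and>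
      extends_smoothly P (\<lambda>y. G y ** \<xi> y ** G y))"

definition higgs_endo ::
    "(real^'n \<Rightarrow> real) \<Rightarrow> (real^'n \<Rightarrow> complex^'n^'n) \<Rightarrow> real^'n \<Rightarrow> complex^'n^'n" where
  "higgs_endo u \<xi> y =
     \<xi> y ** complex_matrix (hess u y) ** map_matrix cnj (\<xi> y) ** complex_matrix (hess u y)"

text \<open>The limit is the value at \<open>y\<close> of the continuous extension to \<open>P\<close> of
  \<^const>\<open>higgs_endo\<close>, which exists for symplectic potentials and Higgs tensors.\<close>

definition higgs_bound ::
    "(real^'n) set \<Rightarrow> (real^'n \<Rightarrow> real) \<Rightarrow> (real^'n \<Rightarrow> complex^'n^'n) \<Rightarrow> bool" where
  "higgs_bound P u \<xi> \<longleftrightarrow>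
     (\<forall>y\<in>P. spectral_radius (Lim (at y within interior P) (higgs_endo u \<xi>)) < 1)"

definition toric_HcscK ::
    "('r::finite \<Rightarrow> int^'n) \<Rightarrow> ('r \<Rightarrow> real) \<Rightarrow> (real^'n \<Rightarrow> real) \<Rightarrow> (real^'n \<Rightarrow> complex^'n^'n) \<Rightarrow> bool"
  where
  "toric_HcscK \<nu> c u \<xi> \<longleftrightarrow>
     (\<forall>y\<in>interior (moment_polytope \<nu> c).
        double_div \<xi> y = 0 \<and>
        double_div (\<lambda>x. matrix_sqrt (mat 1 - higgs_endo u \<xi> x)
                        ** complex_matrix (matrix_inv (hess u x))) y
          = - complex_of_real (const_C \<nu> c))"

end

theory Submission
  imports Defs
begin

text \<open>
  Write \<open>R\<close> for the real part of the coefficient matrix \<open>(1 - \<xi> G \<xi>\<^sup>* G)\<^sup>1\<^sup>/\<^sup>2 G\<^sup>-\<^sup>1\<close>, where \<open>G = D\<^sup>2u\<close>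
  and \<open>\<xi>\<^sup>*\<close> is the conjugate of the symmetric matrix \<open>\<xi>\<close>.
  The endomorphism \<open>\<xi> G \<xi>\<^sup>* G\<close> is self-adjoint for the Hermitian form \<open>G\<close> with spectrum in \<open>[0, 1)\<close>, so
  \<open>R\<close> is symmetric, positive definite and smooth in the interior, \<open>R \<le> G\<^sup>-\<^sup>1\<close>, and the boundary behaviour
  of \<open>G\<^sup>-\<^sup>1\<close> together with that of \<open>\<xi>\<close> gives \<open>R \<nu>\<^sub>r = O(\<ell>\<^sup>r)\<close> and
  \<open>\<nu>\<^sub>r \<cdot> R \<nu>\<^sub>r = \<ell>\<^sup>r + O((\<ell>\<^sup>r)\<^sup>2)\<close> at the facets. Integrating the second equation by parts twice
  against a convex \<open>f\<close> with cutoffs yields \<open>\<L>\<^sub>C(f) = \<integral>\<^sub>P R\<^sup>a\<^sup>b f\<^sub>,\<^sub>a\<^sub>b\<close>. Thus \<open>\<L>\<^sub>C\<close> vanishes on affine functions,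
  and on a compact convex \<open>K \<subseteq> int P\<close> it dominates \<open>\<integral>\<^sub>K \<Delta>f\<close>. For \<open>f\<close> normalised at \<open>p\<^sub>0\<close> the latter
  dominates \<open>\<integral>\<^sub>K f\<close>, while convexity bounds \<open>\<integral>\<^sub>P f - \<integral>\<^sub>K f\<close> by a small multiple of the boundary integral \<open>\<sigma>(f)\<close>
  when \<open>K\<close> is a slightly shrunk copy of \<open>P\<close>. Inserting both into \<open>\<sigma>(f) = \<L>\<^sub>C(f) + C \<integral>\<^sub>P f\<close> bounds \<open>\<sigma>(f)\<close> by
  a multiple of \<open>\<L>\<^sub>C(f)\<close>.\<close>

section \<open>Calculus of \<open>C\<^sup>k\<close> functions\<close>

text \<open>The test functions are only continuous up to the boundary: their gradients may blow up
  there and boundary terms cannot be written down directly. Hence every integration by parts is done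
  against a cutoff whose derivatives live in a layer of width \<delta>. The terms with the gradient
  of \<open>f\<close> disappear because convexity and uniform continuity make \<delta> times the
  gradient tend to 0 in the layer, while \<open>R\<close> applied to a normal is of order \<delta>
  near its facet. The square root is a definite description, taken of a matrix that is self-adjoint
  only for a form varying with the point. Its binomial series gives existence, uniqueness through
  commutation, the inequalities \<open>1 - S \<le> sqrt (1 - S) \<le> 1\<close> between forms, and
  smoothness through geometric decay of powers. By the lower inequality, the inverse of
  \<open>G\<close> minus \<open>R\<close> lies between 0 and an explicit form in \<xi> whose value
  on a normal is quadratic in the facet function, so only the inverse of \<open>G\<close> has to be
  expanded. The determinant condition on \<open>u\<close> bounds that inverse relative to the
  inverse of the Hessian of \<open>u_P\<close>.\<close>

lemma frechet_derivative_cong_open: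
  assumes "open S" "x \<in> S" "\<And>y. y \<in> S \<Longrightarrow> f y = g y"
  shows "frechet_derivative f (at x) = frechet_derivative g (at x)"
proof -
  \<comment> \<open>\<open>frechet_derivative\<close> is a choice among all derivatives, so it is
    enough that \<open>f\<close> and \<open>g\<close> have the same ones at \<open>x\<close>;
    neither has to be differentiable.\<close>
  have "(f has_derivative D) (at x) \<longleftrightarrow> (g has_derivative D) (at x)" for D
    using assms has_derivative_transform_within_open[of _ D x UNIV S] by (metis (no_types))
  then show ?thesis unfolding frechet_derivative_def by simp
qed

lemma Ck_on_cong:
  assumes "open S" "\<And>x. x \<in> S \<Longrightarrow> f x = g x"
  shows "Ck_on k S f \<longleftrightarrow> Ck_on k S g"
  using assms(2)
proof (induction k arbitrary: f g)
  case 0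
  then show ?case by (auto cong: continuous_on_cong)
next
  case (Suc k)
  have "f differentiable (at x) \<longleftrightarrow> g differentiable (at x)" if "x \<in> S" for x
    unfolding differentiable_def
    using Suc.prems that assms(1) has_derivative_transform_within_open[of _ _ x UNIV S] by (metis (no_types))
  moreover have "Ck_on k S (\<lambda>x. frechet_derivative f (at x) v) \<longleftrightarrow>
        Ck_on k S (\<lambda>x. frechet_derivative g (at x) v)" for v
    by (rule Suc.IH) (simp add: frechet_derivative_cong_open[OF assms(1) _ Suc.prems])
  ultimately show ?case by simp
qed

text \<open>Replaces the chosen \<open>frechet_derivative\<close> by an explicit formula
  \<open>f'\<close>, so that each closure property below becomes an induction on \<open>k\<close>
  whose step is a product or chain rule.\<close>

lemma Ck_on_SucI:
  assumes "open S" "\<And>x. x \<in> S \<Longrightarrow> (f has_derivative f' x) (at x)"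
    and "\<And>v. Ck_on k S (\<lambda>x. f' x v)"
  shows "Ck_on (Suc k) S f"
proof -
  have "Ck_on k S (\<lambda>x. frechet_derivative f (at x) v)" for v
    using assms(3)[of v] Ck_on_cong[OF assms(1), of "\<lambda>x. frechet_derivative f (at x) v" "\<lambda>x. f' x v" k]
      frechet_derivative_at[OF assms(2)] by metis
  then show ?thesis using assms(2) by (auto simp: differentiable_def)
qed

lemma Ck_on_has_derivative:
  assumes "Ck_on (Suc k) S f" "x \<in> S"
  shows "(f has_derivative frechet_derivative f (at x)) (at x)"
  using assms by (auto simp: frechet_derivative_works)

lemma Ck_on_pred: "Ck_on (Suc k) S f \<Longrightarrow> Ck_on k S f"
proof (induction k arbitrary: f)
  case 0
  then show ?case
    by (auto intro!: continuous_at_imp_continuous_on differentiable_imp_continuous_within)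
next
  case (Suc k)
  then show ?case by auto
qed

lemma Ck_on_le: "Ck_on k S f \<Longrightarrow> j \<le> k \<Longrightarrow> Ck_on j S f"
  by (induction k) (use Ck_on_pred le_Suc_eq in blast)+

lemma Ck_on_continuous: "Ck_on k S f \<Longrightarrow> continuous_on S f"
  using Ck_on_le[of k S f 0] by simp

lemma Ck_on_subset: "Ck_on k S f \<Longrightarrow> T \<subseteq> S \<Longrightarrow> Ck_on k T f"
  by (induction k arbitrary: f) (auto intro: continuous_on_subset)

lemma Ck_on_const [intro!]: "open S \<Longrightarrow> Ck_on k S (\<lambda>_. c)"
proof (induction k arbitrary: c)
  case (Suc k)
  show ?case by (rule Ck_on_SucI[where f' = "\<lambda>_ _. 0"]) (use Suc in auto)
qed auto

lemma Ck_on_linear: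
  assumes "bounded_linear h" "open S" "Ck_on k S f"
  shows "Ck_on k S (\<lambda>x. h (f x))"
  using assms(3)
proof (induction k arbitrary: f)
  case 0
  then show ?case using bounded_linear.continuous_on[OF assms(1)] by auto
next
  case (Suc k)
  show ?case
  proof (rule Ck_on_SucI[OF assms(2)])
    show "((\<lambda>x. h (f x)) has_derivative (\<lambda>v. h (frechet_derivative f (at x) v))) (at x)" if "x \<in> S" for x
      using bounded_linear.has_derivative[OF assms(1) Ck_on_has_derivative[OF Suc.prems that]] .
    show "Ck_on k S (\<lambda>x. h (frechet_derivative f (at x) v))" for v
      using Suc by auto
  qed
qed

lemma Ck_on_add:
  assumes "open S" "Ck_on k S f" "Ck_on k S g"
  shows "Ck_on k S (\<lambda>x. f x + g x)"
  using assms(2,3)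
proof (induction k arbitrary: f g)
  case 0
  then show ?case by (auto intro: continuous_intros)
next
  case (Suc k)
  show ?case
  proof (rule Ck_on_SucI[OF assms(1)])
    show "((\<lambda>x. f x + g x) has_derivative
        (\<lambda>v. frechet_derivative f (at x) v + frechet_derivative g (at x) v)) (at x)" if "x \<in> S" for x
      using has_derivative_add Ck_on_has_derivative[OF _ that] Suc.prems by blast
  qed (use Suc in auto)
qed

lemma Ck_on_sum:
  assumes "open S" "\<And>i. i \<in> I \<Longrightarrow> Ck_on k S (f i)"
  shows "Ck_on k S (\<lambda>x. \<Sum>i\<in>I. f i x)"
  using assms(2) by (induction I rule: infinite_finite_induct) (auto intro: Ck_on_add assms(1))

text \<open>The product rule for an arbitrary bounded bilinear map: products of reals, matrix
  products and the action of matrices on vectors are all instances.\<close>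

lemma Ck_on_bilinear:
  assumes "bounded_bilinear b" "open S" "Ck_on k S f" "Ck_on k S g"
  shows "Ck_on k S (\<lambda>x. b (f x) (g x))"
  using assms(3,4)
proof (induction k arbitrary: f g)
  case 0
  then show ?case using bounded_bilinear.continuous_on[OF assms(1)] by auto
next
  case (Suc k)
  show ?case
  proof (rule Ck_on_SucI[OF assms(2)])
    show "((\<lambda>x. b (f x) (g x)) has_derivative
        (\<lambda>v. b (f x) (frechet_derivative g (at x) v) + b (frechet_derivative f (at x) v) (g x))) (at x)"
      if "x \<in> S" for x
      by (rule bounded_bilinear.FDERIV[OF assms(1) Suc.prems(1)[THEN Ck_on_has_derivative, OF that]
            Suc.prems(2)[THEN Ck_on_has_derivative, OF that]])
    show "Ck_on k S (\<lambda>x. b (f x) (frechet_derivative g (at x) v) + b (frechet_derivative f (at x) v) (g x))" for v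
      using Suc Ck_on_pred[OF Suc.prems(1)] Ck_on_pred[OF Suc.prems(2)]
      by (intro Ck_on_add[OF assms(2)] Suc.IH) auto
  qed
qed

lemmas Ck_on_mult = Ck_on_bilinear[OF bounded_bilinear_mult]

lemma Ck_on_uminus: "open S \<Longrightarrow> Ck_on k S f \<Longrightarrow> Ck_on k S (\<lambda>x. - f x)"
  by (rule Ck_on_linear[OF bounded_linear_minus[OF bounded_linear_ident]])

lemma Ck_on_diff: "open S \<Longrightarrow> Ck_on k S f \<Longrightarrow> Ck_on k S g \<Longrightarrow> Ck_on k S (\<lambda>x. f x - g x)"
  using Ck_on_add[of S k f "\<lambda>x. - g x"] Ck_on_uminus[of S k g] by simp

lemma Ck_on_component:
  fixes f :: "'a::euclidean_space \<Rightarrow> 'b::real_normed_vector^'n"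
  shows "open S \<Longrightarrow> Ck_on k S f \<Longrightarrow> Ck_on k S (\<lambda>x. f x $ i)"
  by (rule Ck_on_linear[OF bounded_linear_vec_nth])

lemma bounded_linear_axis: "bounded_linear (axis i :: 'b::real_normed_vector \<Rightarrow> 'b^'n)"
proof -
  have "linear (axis i :: 'b \<Rightarrow> 'b^'n)"
    by (auto intro!: linearI simp: axis_def vec_eq_iff)
  moreover have "norm (axis i x :: 'b^'n) \<le> norm x * 1" for x
    by (simp add: norm_vec_def axis_def L2_set_def if_distrib if_distribR cong: if_cong)
  ultimately show ?thesis by (intro bounded_linear_intro[where K = 1]) (auto simp: linear_add linear_scale)
qed

lemma vec_eq_sum_axis: "(x :: 'b::real_normed_vector^'n) = (\<Sum>i\<in>UNIV. axis i (x $ i))"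
  by (simp add: vec_eq_iff axis_def if_distrib cong: if_cong)

lemma Ck_on_vec:
  fixes f :: "'a::euclidean_space \<Rightarrow> 'b::real_normed_vector^'n"
  assumes "open S" "\<And>i. Ck_on k S (\<lambda>x. f x $ i)"
  shows "Ck_on k S f"
proof -
  have "Ck_on k S (\<lambda>x. \<Sum>i\<in>UNIV. axis i (f x $ i))"
    by (intro Ck_on_sum[OF assms(1)] Ck_on_linear[OF bounded_linear_axis assms(1)] assms(2))
  then show ?thesis using vec_eq_sum_axis[of "f _"] by simp
qed

text \<open>The derivative is made of \<open>inverse (f x)\<close> and a derivative of
  \<open>f\<close>, so the induction on \<open>k\<close> closes with \<open>f\<close> fixed.\<close>

lemma Ck_on_inverse:
  fixes f :: "'a::euclidean_space \<Rightarrow> real"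
  assumes "open S" "\<And>x. x \<in> S \<Longrightarrow> f x \<noteq> 0" "Ck_on k S f"
  shows "Ck_on k S (\<lambda>x. inverse (f x))"
  using assms(3)
proof (induction k)
  case 0
  then show ?case using assms(2) by (auto intro: continuous_intros)
next
  case (Suc k)
  show ?case
  proof (rule Ck_on_SucI[OF assms(1)])
    show "((\<lambda>x. inverse (f x)) has_derivative
        (\<lambda>v. - (inverse (f x) * frechet_derivative f (at x) v * inverse (f x)))) (at x)" if "x \<in> S" for x
      by (rule Deriv.has_derivative_inverse[OF assms(2)[OF that] Ck_on_has_derivative[OF Suc.prems that]])
    show "Ck_on k S (\<lambda>x. - (inverse (f x) * frechet_derivative f (at x) v * inverse (f x)))" for v
      using Suc Ck_on_pred[OF Suc.prems]
      by (intro Ck_on_uminus Ck_on_mult assms(1) Suc.IH) auto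
  qed
qed

lemma Ck_on_affine:
  fixes a :: "'a::euclidean_space"
  assumes "open S"
  shows "Ck_on k S (\<lambda>x. a \<bullet> x + b)"
proof (cases k)
  case (Suc j)
  show ?thesis unfolding Suc
    by (rule Ck_on_SucI[OF assms, where f' = "\<lambda>_ v. a \<bullet> v"]) (use assms in \<open>auto intro!: derivative_eq_intros\<close>)
qed (auto intro!: continuous_intros)

lemma Ck_on_ln:
  fixes f :: "'a::euclidean_space \<Rightarrow> real"
  assumes "open S" "\<And>x. x \<in> S \<Longrightarrow> f x > 0" "Ck_on k S f"
  shows "Ck_on k S (\<lambda>x. ln (f x))"
proof (cases k)
  case 0
  then show ?thesis using assms by (force intro!: continuous_on_ln)
next
  case (Suc j)
  have C: "Ck_on (Suc j) S f" using assms Suc by simp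
  show ?thesis unfolding Suc
  proof (rule Ck_on_SucI[OF assms(1)])
    show "((\<lambda>x. ln (f x)) has_derivative
        (\<lambda>v. inverse (f x) * frechet_derivative f (at x) v)) (at x)" if "x \<in> S" for x
      using has_derivative_ln[OF assms(2)[OF that] Ck_on_has_derivative[OF C that]]
      by (simp add: mult.commute)
    show "Ck_on j S (\<lambda>x. inverse (f x) * frechet_derivative f (at x) v)" for v
      using C assms(2) by (intro Ck_on_mult assms(1) Ck_on_inverse Ck_on_pred[OF C]) (auto dest: less_imp_neq[symmetric] simp: less_le)
  qed
qed

lemma Ck_on_partial: "Ck_on (Suc k) S f \<Longrightarrow> Ck_on k S (partial a f)"
  unfolding partial_def by simp

lemma partial_cong_open:
  assumes "open S" "x \<in> S" "\<And>y. y \<in> S \<Longrightarrow> f y = g y"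
  shows "partial a f x = partial a g x"
  unfolding partial_def using frechet_derivative_cong_open[OF assms] by simp

lemma partial_eq:
  assumes "(f has_derivative D) (at x)"
  shows "partial a f x = D (axis a 1)"
  unfolding partial_def using frechet_derivative_at[OF assms] by simp

lemma Ck_on_hess:
  fixes u :: "real^'n \<Rightarrow> real"
  assumes "open S" "Ck_on (Suc (Suc k)) S u"
  shows "Ck_on k S (hess u)"
  unfolding hess_def
  by (intro Ck_on_vec[OF assms(1)]) (use assms in \<open>auto intro!: Ck_on_partial\<close>)

lemma hess_cong_open:
  assumes "open S" "x \<in> S" "\<And>y. y \<in> S \<Longrightarrow> f y = g y"
  shows "hess f x = hess g x"
proof -
  have "partial b (partial a f) x = partial b (partial a g) x" for a b
    by (rule partial_cong_open[OF assms(1,2)]) (rule partial_cong_open[OF assms(1) _ assms(3)])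
  then show ?thesis by (simp add: hess_def)
qed

lemma hess_add:
  fixes f g :: "real^'n \<Rightarrow> real"
  assumes "open S" "x \<in> S" "Ck_on 2 S f" "Ck_on 2 S g"
  shows "hess (\<lambda>y. f y + g y) x = hess f x + hess g x"
proof -
  have C: "Ck_on (Suc (Suc 0)) S f" "Ck_on (Suc (Suc 0)) S g" using assms by (simp_all add: numeral_2_eq_2)
  have 1: "partial a (\<lambda>y. f y + g y) y = partial a f y + partial a g y" if "y \<in> S" for a y
    using partial_eq[OF has_derivative_add[OF C(1)[THEN Ck_on_has_derivative, OF that] C(2)[THEN Ck_on_has_derivative, OF that]]]
    by (simp add: partial_def)
  have "partial b (partial a (\<lambda>y. f y + g y)) x = partial b (partial a f) x + partial b (partial a g) x" for a b
  proof -
    have "partial b (partial a (\<lambda>y. f y + g y)) x = partial b (\<lambda>y. partial a f y + partial a g y) x"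
      by (rule partial_cong_open[OF assms(1,2) 1])
    also have "\<dots> = partial b (partial a f) x + partial b (partial a g) x"
      using partial_eq[OF has_derivative_add[OF Ck_on_partial[OF C(1), THEN Ck_on_has_derivative, OF assms(2)]
        Ck_on_partial[OF C(2), THEN Ck_on_has_derivative, OF assms(2)]]]
      by (simp add: partial_def)
    finally show ?thesis .
  qed
  then show ?thesis by (simp add: hess_def vec_eq_iff)
qed

section \<open>Matrix-valued functions: products, determinants, inverses\<close>

lemma bounded_bilinear_matrix_matrix_mult:
  "bounded_bilinear ((**) :: 'b::{real_normed_algebra_1,euclidean_space}^'m^'n \<Rightarrow> 'b^'k^'m \<Rightarrow> 'b^'k^'n)"
proof -
  have "bilinear ((**) :: 'b^'m^'n \<Rightarrow> 'b^'k^'m \<Rightarrow> 'b^'k^'n)"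
    by (auto simp: bilinear_def matrix_matrix_mult_def vec_eq_iff algebra_simps sum.distrib scaleR_sum_right
        intro!: linearI)
  then show ?thesis by (simp add: bilinear_conv_bounded_bilinear)
qed

lemma bounded_bilinear_matrix_vector_mult:
  "bounded_bilinear ((*v) :: 'b::{real_normed_algebra_1,euclidean_space}^'m^'n \<Rightarrow> 'b^'m \<Rightarrow> 'b^'n)"
proof -
  have "bilinear ((*v) :: 'b^'m^'n \<Rightarrow> 'b^'m \<Rightarrow> 'b^'n)"
    by (auto simp: bilinear_def matrix_vector_mult_def vec_eq_iff algebra_simps sum.distrib scaleR_sum_right
        intro!: linearI)
  then show ?thesis by (simp add: bilinear_conv_bounded_bilinear)
qed

lemmas Ck_on_matrix_mult = Ck_on_bilinear[OF bounded_bilinear_matrix_matrix_mult]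
lemmas Ck_on_matrix_vector_mult = Ck_on_bilinear[OF bounded_bilinear_matrix_vector_mult]

lemma Ck_on_prod:
  fixes f :: "'i \<Rightarrow> 'a::euclidean_space \<Rightarrow> real"
  assumes "open S" "\<And>i. i \<in> I \<Longrightarrow> Ck_on k S (f i)"
  shows "Ck_on k S (\<lambda>x. \<Prod>i\<in>I. f i x)"
  using assms(2) by (induction I rule: infinite_finite_induct) (auto intro: Ck_on_mult assms(1))

lemma Ck_on_det:
  fixes A :: "'a::euclidean_space \<Rightarrow> real^'n^'n"
  assumes "open S" "\<And>i j. Ck_on k S (\<lambda>x. A x $ i $ j)"
  shows "Ck_on k S (\<lambda>x. det (A x))"
  unfolding det_def by (intro Ck_on_sum Ck_on_mult Ck_on_prod Ck_on_const assms)

lemma matrix_inv_right: "invertible A \<Longrightarrow> A ** matrix_inv A = mat 1"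
  and matrix_inv_left: "invertible A \<Longrightarrow> matrix_inv A ** A = mat 1"
  using someI_ex[of "\<lambda>A'. A ** A' = mat 1 \<and> A' ** A = mat 1"] unfolding invertible_def matrix_inv_def by auto

text \<open>Cramer's rule for the columns of the inverse. It writes the entries as quotients of
  determinants, which reduces smoothness of the inverse to that of polynomials in the
  entries.\<close>

lemma matrix_inv_cramer:
  fixes A :: "real^'n^'n"
  assumes "det A \<noteq> 0"
  shows "matrix_inv A $ k $ b = det (\<chi> i j. if j = k then axis b 1 $ i else A $ i $ j) / det A"
proof -
  have "A *v column b (matrix_inv A) = axis b 1"
    using matrix_inv_right[of A] assms
    by (simp add: invertible_det_nz matrix_vector_mult_basis[symmetric] matrix_vector_mul_assoc)
  then have "column b (matrix_inv A) = (\<chi> k. det (\<chi> i j. if j = k then axis b 1 $ i else A $ i $ j) / det A)"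
    using cramer[OF assms] by blast
  then show ?thesis by (simp add: column_def vec_eq_iff)
qed

lemma Ck_on_matrix_inv:
  fixes A :: "'a::euclidean_space \<Rightarrow> real^'n^'n"
  assumes S: "open S" and "\<And>x. x \<in> S \<Longrightarrow> det (A x) \<noteq> 0" and A: "Ck_on k S A"
  shows "Ck_on k S (\<lambda>x. matrix_inv (A x))"
proof (intro Ck_on_vec[OF S])
  fix a b
  have C: "Ck_on k S (\<lambda>x. A x $ i $ j)" for i j by (intro Ck_on_component S A)
  have "Ck_on k S (\<lambda>x. det (\<chi> i j. if j = a then axis b 1 $ i else A x $ i $ j) * inverse (det (A x)))"
  proof (intro Ck_on_mult[OF S] Ck_on_inverse[OF S] Ck_on_det[OF S] C assms)
    show "Ck_on k S (\<lambda>x. (\<chi> i j. if j = a then axis b 1 $ i else A x $ i $ j) $ i $ j)" for i j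
      by (cases "j = a") (use C S in auto)
  qed auto
  moreover have "matrix_inv (A x) $ a $ b =
      det (\<chi> i j. if j = a then axis b 1 $ i else A x $ i $ j) * inverse (det (A x))" if "x \<in> S" for x
    using matrix_inv_cramer[OF assms(2)[OF that]] by (simp add: divide_inverse)
  ultimately show "Ck_on k S (\<lambda>x. matrix_inv (A x) $ a $ b)"
    by (subst Ck_on_cong[OF S])
qed

lemma bounded_linear_complex_matrix:
  "bounded_linear (complex_matrix :: real^'n^'m \<Rightarrow> complex^'n^'m)"
  by (intro linear_conv_bounded_linear[THEN iffD1])
    (auto intro!: linearI simp: vec_eq_iff map_matrix_def complex_eq_iff)

lemma bounded_linear_cnj_matrix:
  "bounded_linear (map_matrix cnj :: complex^'n^'m \<Rightarrow> complex^'n^'m)"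
  by (intro linear_conv_bounded_linear[THEN iffD1])
    (auto intro!: linearI simp: vec_eq_iff map_matrix_def complex_eq_iff)

section \<open>Lebesgue measure on hyperplanes\<close>

lemma lborel_distr_plus': "distr lborel borel (\<lambda>x. x + v) = (lborel :: 'a::euclidean_space measure)"
proof -
  have "(\<lambda>x. x + v) = (+) v" by (auto simp: add.commute)
  then show ?thesis using lborel_distr_plus[of v] by simp
qed

lemma lborel_distr_diff: "distr lborel borel (\<lambda>x. v - x) = (lborel :: 'a::euclidean_space measure)"
proof -
  have "lborel = density (distr lborel borel (\<lambda>x. v + (\<Sum>j\<in>Basis. (- 1 * (x \<bullet> j)) *\<^sub>R j))) (\<lambda>_. (\<Prod>j\<in>Basis. \<bar>- 1 :: real\<bar>))"
    using lborel_affine_euclidean[of "\<lambda>_. -1" v] by (simp add: ennreal_1)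
  moreover have "(\<Sum>j\<in>Basis. (- 1 * (x \<bullet> j)) *\<^sub>R j) = - x" for x :: 'a
    by (simp add: sum_negf euclidean_representation)
  ultimately show ?thesis by (simp add: density_1)
qed

text \<open>A translation invariant measure is determined by its value on the unit ball: compute
  \<open>\<integral>\<integral> 1\<^sub>A(y) 1\<^sub>E(x + y)\<close> in both orders.\<close>

lemma lborel_distr_orthogonal:
  fixes f :: "'a::euclidean_space \<Rightarrow> 'a"
  assumes f: "orthogonal_transformation f"
  shows "distr lborel borel f = lborel"
proof (rule measure_eqI)
  define M where "M = distr lborel borel f"
  have lin: "linear f" using f by (simp add: orthogonal_transformation_linear)
  have [measurable]: "f \<in> borel_measurable borel"
    by (intro borel_measurable_continuous_onI linear_continuous_on linear_conv_bounded_linear[THEN iffD1] lin)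
  have sM[simp, measurable_cong]: "sets M = sets borel" and [simp]: "space M = UNIV" by (auto simp: M_def)
  \<comment> \<open>Norm preservation enters through balls about the origin: they provide both
    sigma-finiteness of \<open>M\<close> and its normalisation.\<close>
  have fball: "f -` cball (0::'a) r = cball 0 r" for r
    using orthogonal_transformation_norm[OF f] by auto
  have Mball: "emeasure M (cball 0 r) = emeasure lborel (cball (0::'a) r)" for r
    unfolding M_def by (subst emeasure_distr) (auto simp: fball)
  \<comment> \<open>Every \<open>v\<close> is of the form \<open>f w\<close>, and a translation by
    \<open>f w\<close> after \<open>f\<close> is a translation by \<open>w\<close> before
    it.\<close>
  have trans: "distr M borel (\<lambda>x. x + v) = M" for v
  proof -
    obtain w where w: "v = f w" using orthogonal_transformation_surj[OF f] by (meson surjD)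
    have "distr M borel (\<lambda>x. x + v) = distr lborel borel (f \<circ> (\<lambda>x. x + w))"
      unfolding M_def by (subst distr_distr) (auto simp: comp_def w linear_add[OF lin])
    also have "\<dots> = distr (distr lborel borel (\<lambda>x. x + w)) borel f"
      by (subst distr_distr) auto
    finally show ?thesis by (simp add: lborel_distr_plus' M_def)
  qed
  have sf: "sigma_finite_measure M"
  proof
    show "\<exists>A. countable A \<and> A \<subseteq> sets M \<and> \<Union> A = space M \<and> (\<forall>a\<in>A. emeasure M a \<noteq> \<infinity>)"
      using emeasure_lborel_cball_finite[of 0]
      by (intro exI[of _ "range (\<lambda>n::nat. cball 0 (real n))"])
        (auto simp: Mball real_arch_simple less_top[symmetric])
  qed
  interpret M: sigma_finite_measure M by (rule sf)
  interpret P: pair_sigma_finite M "lborel :: 'a measure" ..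
  show "sets (distr lborel borel f) = sets lborel" by simp
  fix A :: "'a set" assume "A \<in> sets (distr lborel borel f)"
  then have A[measurable]: "A \<in> sets borel" by simp
  define E where "E = (cball 0 1 :: 'a set)"
  have [measurable]: "E \<in> sets borel" by (simp add: E_def)
  have I1: "(\<integral>\<^sup>+x. indicator E (x + y) \<partial>lborel) = emeasure lborel E" for y
  proof -
    have "(\<integral>\<^sup>+x. indicator E (x + y) \<partial>lborel) = (\<integral>\<^sup>+x. indicator E x \<partial>distr lborel borel (\<lambda>x. x + y))"
      by (subst nn_integral_distr) auto
    then show ?thesis by (simp add: lborel_distr_plus')
  qed
  have I2: "(\<integral>\<^sup>+y. indicator A y * indicator E (x + y) \<partial>M) = (\<integral>\<^sup>+y. indicator A (y - x) * indicator E y \<partial>M)" for x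
  proof -
    have "(\<integral>\<^sup>+y. indicator A (y - x) * indicator E y \<partial>M) =
        (\<integral>\<^sup>+y. indicator A (y - x) * indicator E y \<partial>distr M borel (\<lambda>y. y + x))" by (simp add: trans)
    also have "\<dots> = (\<integral>\<^sup>+y. indicator A y * indicator E (x + y) \<partial>M)"
      by (subst nn_integral_distr) (auto simp: add.commute)
    finally show ?thesis by simp
  qed
  have I3: "(\<integral>\<^sup>+x. indicator A (y - x) \<partial>lborel) = emeasure lborel A" for y
  proof -
    have "(\<integral>\<^sup>+x. indicator A (y - x) \<partial>lborel) = (\<integral>\<^sup>+x. indicator A x \<partial>distr lborel borel (\<lambda>x. y - x))"
      by (subst nn_integral_distr) auto
    then show ?thesis by (simp add: lborel_distr_diff)
  qed
  have "emeasure M A * emeasure lborel E = (\<integral>\<^sup>+y. indicator A y * (\<integral>\<^sup>+x. indicator E (x + y) \<partial>lborel) \<partial>M)"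
    by (simp add: I1 nn_integral_multc)
  also have "\<dots> = (\<integral>\<^sup>+y. (\<integral>\<^sup>+x. indicator A y * indicator E (x + y) \<partial>lborel) \<partial>M)"
    by (simp add: nn_integral_cmult)
  also have "\<dots> = (\<integral>\<^sup>+x. (\<integral>\<^sup>+y. indicator A y * indicator E (x + y) \<partial>M) \<partial>lborel)"
    by (rule P.Fubini'[symmetric]) measurable
  also have "\<dots> = (\<integral>\<^sup>+x. (\<integral>\<^sup>+y. indicator A (y - x) * indicator E y \<partial>M) \<partial>lborel)"
    by (simp add: I2)
  also have "\<dots> = (\<integral>\<^sup>+y. (\<integral>\<^sup>+x. indicator A (y - x) * indicator E y \<partial>lborel) \<partial>M)"
    by (rule P.Fubini') measurable
  also have "\<dots> = (\<integral>\<^sup>+y. emeasure lborel A * indicator E y \<partial>M)"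
    by (simp add: nn_integral_multc I3)
  also have "\<dots> = emeasure lborel A * emeasure lborel E"
    by (subst nn_integral_cmult_indicator) (simp_all add: E_def Mball)
  finally have "emeasure lborel E * emeasure M A = emeasure lborel E * emeasure lborel A"
    by (simp add: mult.commute)
  moreover have "emeasure lborel E \<noteq> 0" "emeasure lborel E \<noteq> \<infinity>"
    using emeasure_lborel_cball_finite[of "0::'a" 1] content_cball_pos[of 1 "0::'a"]
    by (auto simp: E_def measure_def)
  ultimately show "emeasure (distr lborel borel f) A = emeasure lborel A"
    by (simp add: ennreal_mult_cancel_left M_def)
qed

text \<open>Every vector differs from a multiple of \<open>e0\<close> by an element of
  \<open>span B\<close>, so \<open>insert e0 B\<close> is an orthonormal basis of the whole space;
  its cardinality permits a bijection with \<open>Basis\<close>.\<close>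

lemma orthonormal_hyperplane_basis:
  fixes e0 :: "'a::euclidean_space"
  assumes e0: "norm e0 = 1" and B: "pairwise orthogonal B" "\<And>e. e \<in> B \<Longrightarrow> norm e = 1" "span B = {v. e0 \<bullet> v = 0}"
  shows "finite B" "e0 \<notin> B" "pairwise orthogonal (insert e0 B)" "card (insert e0 B) = DIM('a)"
proof -
  have o: "e0 \<bullet> e = 0" if "e \<in> B" for e using span_base[OF that] B(3) by auto
  show p: "pairwise orthogonal (insert e0 B)"
    using B(1) o by (auto simp: pairwise_insert orthogonal_def inner_commute)
  have i: "independent (insert e0 B)"
    using pairwise_orthogonal_independent[OF p] B(2) e0 by (metis insert_iff norm_zero zero_neq_one)
  show f: "finite B" using independent_imp_finite[OF i] by simp
  show n: "e0 \<notin> B" using o[of e0] e0 by (auto simp: norm_eq_1)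
  have "x \<in> span (insert e0 B)" for x
  proof -
    have "x - (e0 \<bullet> x) *\<^sub>R e0 \<in> span B" using e0 by (simp add: B(3) inner_diff_right norm_eq_1)
    then show ?thesis using span_breakdown_eq by blast
  qed
  then show "card (insert e0 B) = DIM('a)"
    using dim_eq_card[of "insert e0 B" UNIV] i by (auto simp: dim_UNIV set_eq_iff)
qed

text \<open>Fubini in coordinates adapted to a hyperplane. The orthogonal map taking
  \<open>Basis\<close> to the frame \<open>insert e0 B\<close> preserves \<open>lborel\<close>, and
  the product measure over this frame splits off the normal coordinate.\<close>

lemma lborel_hyperplane_coords:
  fixes e0 p :: "'a::euclidean_space"
  assumes e0: "norm e0 = 1" and B: "pairwise orthogonal B" "\<And>e. e \<in> B \<Longrightarrow> norm e = 1" "span B = {v. e0 \<bullet> v = 0}"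
  shows "lborel = distr ((\<Pi>\<^sub>M e\<in>B. lborel) \<Otimes>\<^sub>M lborel) borel
           (\<lambda>(x, s). p + (\<Sum>e\<in>B. x e *\<^sub>R e) + s *\<^sub>R e0)"
proof -
  note bas = orthonormal_hyperplane_basis[OF assms]
  let ?B = "insert e0 B"
  interpret L: product_sigma_finite "\<lambda>_::'a. lborel :: real measure" ..
  obtain \<pi> where \<pi>: "bij_betw \<pi> (Basis::'a set) ?B"
    using finite_same_card_bij[of "Basis::'a set" ?B] bas by auto
  have on: "e \<bullet> e' = (if e = e' then 1 else 0)" if "e \<in> ?B" "e' \<in> ?B" for e e'
    using that bas(3) B(2) e0 by (auto simp: pairwise_def orthogonal_def norm_eq_1)
  define f where "f x = (\<Sum>i\<in>Basis. (x \<bullet> i) *\<^sub>R \<pi> i)" for x :: 'a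
  have "f x \<bullet> f y = x \<bullet> y" for x y
  proof -
    have "\<pi> i \<bullet> \<pi> j = (if i = j then 1 else 0)" if "i \<in> Basis" "j \<in> Basis" for i j
    proof -
      have "\<pi> i \<in> ?B" "\<pi> j \<in> ?B" using that \<pi> by (metis bij_betw_apply)+
      moreover have "\<pi> i = \<pi> j \<longleftrightarrow> i = j" using that \<pi> by (auto simp: bij_betw_def inj_on_def)
      ultimately show ?thesis using on by simp
    qed
    then have "f x \<bullet> f y = (\<Sum>j\<in>Basis. (y \<bullet> j) * (\<Sum>i\<in>Basis. (x \<bullet> i) * (if i = j then 1 else 0)))"
      by (simp add: f_def inner_sum_left inner_sum_right)
    also have "\<dots> = x \<bullet> y" by (simp add: euclidean_inner[of x y] if_distrib mult.commute cong: if_cong)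
    finally show ?thesis .
  qed
  moreover have "linear f"
    by (auto intro!: linearI simp: f_def inner_add_left scaleR_add_left sum.distrib scaleR_sum_right)
  ultimately have f: "orthogonal_transformation f"
    by (auto simp: orthogonal_transformation_def)
  have [measurable]: "f \<in> borel_measurable borel"
    unfolding f_def by measurable
  \<comment> \<open>Relabels coordinates along \<open>\<pi>\<close>: the product measures are
    indexed by the basis vectors themselves, so a change of basis is also a change of index
    set.\<close>
  define \<rho> where "\<rho> x = (\<lambda>e\<in>?B. x (inv_into Basis \<pi> e))" for x :: "'a \<Rightarrow> real"
  have inv: "inv_into Basis \<pi> (\<pi> i) = i" if "i \<in> Basis" for i
    using \<pi> that by (simp add: bij_betw_def inv_into_f_f)
  have invB: "inv_into Basis \<pi> e \<in> Basis" if "e \<in> ?B" for e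
    using \<pi> that by (metis bij_betw_def inv_into_into)
  have \<rho>m[measurable]: "\<rho> \<in> (\<Pi>\<^sub>M b\<in>Basis. lborel) \<rightarrow>\<^sub>M (\<Pi>\<^sub>M e\<in>?B. lborel)"
    unfolding \<rho>_def by (intro measurable_restrict measurable_component_singleton invB)
  have \<rho>: "distr (\<Pi>\<^sub>M b\<in>Basis. lborel) (\<Pi>\<^sub>M e\<in>?B. lborel) \<rho> = (\<Pi>\<^sub>M e\<in>?B. lborel)"
  proof (rule L.PiM_eqI)
    show "finite ?B" using bas by simp
    fix A :: "'a \<Rightarrow> real set" assume A: "\<And>e. e \<in> ?B \<Longrightarrow> A e \<in> sets lborel"
    have A': "A (\<pi> i) \<in> sets lborel" if "i \<in> Basis" for i using A \<pi> that by (auto simp: bij_betw_def)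
    have "\<rho> -` (Pi\<^sub>E ?B A) \<inter> space (\<Pi>\<^sub>M b\<in>Basis. lborel) = (\<Pi>\<^sub>E i\<in>Basis. A (\<pi> i))"
    proof -
      have "(\<forall>e\<in>?B. x (inv_into Basis \<pi> e) \<in> A e) \<longleftrightarrow> (\<forall>i\<in>Basis. x i \<in> A (\<pi> i))" for x
      proof -
        have "(\<forall>e\<in>?B. Q e) \<longleftrightarrow> (\<forall>i\<in>Basis. Q (\<pi> i))" for Q
          using \<pi> by (metis bij_betw_def imageE imageI)
        from this[of "\<lambda>e. x (inv_into Basis \<pi> e) \<in> A e"] show ?thesis using inv by simp
      qed
      then show ?thesis by (auto simp: \<rho>_def space_PiM PiE_def Pi_def extensional_def)
    qed
    moreover have "Pi\<^sub>E ?B A \<in> sets (\<Pi>\<^sub>M e\<in>?B. lborel)"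
      using A bas(1) by (intro sets_PiM_I_finite) auto
    ultimately have "emeasure (distr (\<Pi>\<^sub>M b\<in>Basis. lborel) (\<Pi>\<^sub>M e\<in>?B. lborel) \<rho>) (Pi\<^sub>E ?B A)
        = (\<Prod>i\<in>Basis. emeasure lborel (A (\<pi> i)))"
      using L.emeasure_PiM[of Basis "\<lambda>i. A (\<pi> i)"] A' by (simp add: emeasure_distr)
    also have "\<dots> = (\<Prod>e\<in>?B. emeasure lborel (A e))"
      by (rule prod.reindex_bij_betw[OF \<pi>])
    finally show "emeasure (distr (\<Pi>\<^sub>M b\<in>Basis. lborel) (\<Pi>\<^sub>M e\<in>?B. lborel) \<rho>) (Pi\<^sub>E ?B A)
        = (\<Prod>e\<in>?B. emeasure lborel (A e))" .
  qed simp
  have "lborel = distr (distr lborel borel f) borel (\<lambda>x. p + x)"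
    by (simp add: lborel_distr_orthogonal[OF f] lborel_distr_plus)
  also have "\<dots> = distr (\<Pi>\<^sub>M b\<in>Basis. lborel) borel (\<lambda>x. p + (\<Sum>i\<in>Basis. x i *\<^sub>R \<pi> i))"
    by (subst lborel_eq, subst distr_distr, simp, simp, subst distr_distr)
      (auto intro!: distr_cong simp: f_def comp_def inner_sum_left inner_Basis if_distrib cong: if_cong)
  also have "\<dots> = distr (\<Pi>\<^sub>M b\<in>Basis. lborel) borel ((\<lambda>x. p + (\<Sum>e\<in>?B. x e *\<^sub>R e)) \<circ> \<rho>)"
  proof (rule distr_cong)
    fix x :: "'a \<Rightarrow> real"
    have "(\<Sum>e\<in>?B. \<rho> x e *\<^sub>R e) = (\<Sum>e\<in>?B. x (inv_into Basis \<pi> e) *\<^sub>R e)"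
      by (intro sum.cong) (auto simp: \<rho>_def)
    also have "\<dots> = (\<Sum>i\<in>Basis. x i *\<^sub>R \<pi> i)"
      using inv by (subst sum.reindex_bij_betw[OF \<pi>, symmetric]) auto
    finally show "p + (\<Sum>i\<in>Basis. x i *\<^sub>R \<pi> i) = ((\<lambda>x. p + (\<Sum>e\<in>?B. x e *\<^sub>R e)) \<circ> \<rho>) x" by simp
  qed auto
  also have "\<dots> = distr (\<Pi>\<^sub>M e\<in>?B. lborel) borel (\<lambda>x. p + (\<Sum>e\<in>?B. x e *\<^sub>R e))"
  proof -
    have "distr (distr (\<Pi>\<^sub>M b\<in>Basis. lborel) (\<Pi>\<^sub>M e\<in>?B. lborel) \<rho>) borel (\<lambda>x. p + (\<Sum>e\<in>?B. x e *\<^sub>R e)) =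
        distr (\<Pi>\<^sub>M b\<in>Basis. lborel) borel ((\<lambda>x. p + (\<Sum>e\<in>?B. x e *\<^sub>R e)) \<circ> \<rho>)"
      by (rule distr_distr) measurable
    then show ?thesis unfolding \<rho> by simp
  qed
  finally have eq: "lborel = distr (\<Pi>\<^sub>M e\<in>?B. lborel) borel (\<lambda>x. p + (\<Sum>e\<in>?B. x e *\<^sub>R e))" .
  interpret PB: sigma_finite_measure "\<Pi>\<^sub>M e\<in>B. lborel :: real measure"
    by (rule L.sigma_finite[OF bas(1)])
  show ?thesis
  proof (rule measure_eqI)
    fix A :: "'a set" assume "A \<in> sets lborel"
    then have [measurable]: "A \<in> sets borel" by simp
    have J: "p + (\<Sum>e\<in>?B. (x(e0 := s)) e *\<^sub>R e) = p + (\<Sum>e\<in>B. x e *\<^sub>R e) + s *\<^sub>R e0" for x s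
    proof -
      have "(\<Sum>e\<in>B. (x(e0 := s)) e *\<^sub>R e) = (\<Sum>e\<in>B. x e *\<^sub>R e)"
        using bas(2) by (intro sum.cong) auto
      then show ?thesis using bas(1,2) by (simp add: algebra_simps)
    qed
    have "emeasure lborel A = (\<integral>\<^sup>+x. indicator A (p + (\<Sum>e\<in>?B. x e *\<^sub>R e)) \<partial>(\<Pi>\<^sub>M e\<in>?B. lborel))"
      by (subst eq, subst nn_integral_indicator[symmetric], simp, subst nn_integral_distr) auto
    also have "\<dots> = (\<integral>\<^sup>+x. \<integral>\<^sup>+s. indicator A (p + (\<Sum>e\<in>?B. (x(e0 := s)) e *\<^sub>R e)) \<partial>lborel \<partial>(\<Pi>\<^sub>M e\<in>B. lborel))"
      by (rule L.product_nn_integral_insert[OF bas(1,2)]) measurable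
    also have "\<dots> = (\<integral>\<^sup>+x. \<integral>\<^sup>+s. indicator A (p + (\<Sum>e\<in>B. x e *\<^sub>R e) + s *\<^sub>R e0) \<partial>lborel \<partial>(\<Pi>\<^sub>M e\<in>B. lborel))"
      unfolding J ..
    also have "\<dots> = (\<integral>\<^sup>+z. indicator A (case z of (x, s) \<Rightarrow> p + (\<Sum>e\<in>B. x e *\<^sub>R e) + s *\<^sub>R e0) \<partial>((\<Pi>\<^sub>M e\<in>B. lborel) \<Otimes>\<^sub>M lborel))"
      by (subst lborel.nn_integral_fst[symmetric]) auto
    also have "\<dots> = emeasure (distr ((\<Pi>\<^sub>M e\<in>B. lborel) \<Otimes>\<^sub>M lborel) borel
           (\<lambda>(x, s). p + (\<Sum>e\<in>B. x e *\<^sub>R e) + s *\<^sub>R e0)) A"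
      by (subst nn_integral_indicator[symmetric], simp, subst nn_integral_distr) auto
    finally show "emeasure lborel A = \<dots>" .
  qed simp
qed

text \<open>Opens the choice in \<open>hyperplane_lborel\<close>: the direction space has an
  orthonormal basis, so the chosen \<open>B\<close> is one.\<close>

lemma hyperplane_lborel_frame:
  fixes a :: "real^'n"
  assumes "a \<noteq> 0"
  obtains B where "pairwise orthogonal B" "\<And>e. e \<in> B \<Longrightarrow> norm e = 1" "span B = {v. a \<bullet> v = 0}"
    "hyperplane_lborel a b = distr (\<Pi>\<^sub>M e\<in>B. lborel) borel
           (\<lambda>x. - (b / (a \<bullet> a)) *\<^sub>R a + (\<Sum>e\<in>B. x e *\<^sub>R e))"
proof -
  let ?Q = "\<lambda>B. pairwise orthogonal B \<and> (\<forall>e\<in>B. norm e = 1) \<and> span B = {v. a \<bullet> v = 0}"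
  have "subspace {v. a \<bullet> v = 0}" by (rule subspace_hyperplane)
  then have "\<exists>B. ?Q B" using orthonormal_basis_subspace by metis
  then have Q: "?Q (SOME B. ?Q B)" by (rule someI_ex)
  show thesis
    by (rule that[of "SOME B. ?Q B"]) (use Q in \<open>auto simp: hyperplane_lborel_def Let_def\<close>)
qed

section \<open>Thin layers along a hyperplane\<close>

lemma integrable_bounded_support:
  fixes g :: "'a::euclidean_space \<Rightarrow> real"
  assumes [measurable]: "g \<in> borel_measurable borel"
    and "\<And>y. \<bar>g y\<bar> \<le> M" "\<And>y. g y \<noteq> 0 \<Longrightarrow> norm y \<le> \<rho>"
  shows "integrable lborel g"
proof (rule Bochner_Integration.integrable_bound)
  show "integrable lborel (\<lambda>y. M * indicator (cball (0::'a) \<rho>) y)"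
    using emeasure_lborel_cball_finite[of "0::'a" \<rho>] by (auto simp: less_top)
  show "AE y in lborel. norm (g y) \<le> norm (M * indicator (cball (0::'a) \<rho>) y)"
  proof (intro AE_I2)
    fix y show "norm (g y) \<le> norm (M * indicator (cball (0::'a) \<rho>) y)"
      using assms(2,3)[of y] by (cases "g y = 0") auto
  qed
qed simp

text \<open>The normal coordinate is rescaled by \<open>\<delta> k / norm a\<close>; the shrinking
  layer becomes the fixed slab \<open>{0..2}\<close> over the hyperplane and dominated convergence
  yields a product integral. Pointwise convergence \<open>conv\<close> is demanded only where the
  other constraints are strict. By \<open>npar\<close> no other constraint vanishes identically on
  the hyperplane, so the points left out form a null set.\<close>

lemma layer_limit:
  fixes a :: "real^'n" and b :: real and \<nu> :: "'r \<Rightarrow> real^'n" and c :: "'r \<Rightarrow> real" and I :: "'r set"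
  defines "P \<equiv> {y. a \<bullet> y + b \<ge> 0 \<and> (\<forall>s\<in>I. \<nu> s \<bullet> y + c s \<ge> 0)}"
  assumes a: "a \<noteq> 0" and I: "finite I"
    and npar: "\<And>s k. s \<in> I \<Longrightarrow> \<nu> s = k *\<^sub>R a \<Longrightarrow> c s = k * b \<Longrightarrow> False"
    and bdd: "bounded P"
    and \<delta>: "\<And>k. \<delta> k > 0" "\<delta> \<longlonglongrightarrow> 0"
    and gm: "\<And>k. g k \<in> borel_measurable borel"
    and gM: "\<And>k y. \<bar>g k y\<bar> \<le> M"
    and gsupp: "\<And>k y. g k y \<noteq> 0 \<Longrightarrow> y \<in> P \<and> a \<bullet> y + b \<le> 2 * \<delta> k"
    and f: "continuous_on P f" and \<kappa>: "continuous_on {0..2} \<kappa>"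
    and conv: "\<And>z \<tau>. \<lbrakk>a \<bullet> z + b = 0; \<And>s. s \<in> I \<Longrightarrow> \<nu> s \<bullet> z + c s > 0; 0 \<le> \<tau>; \<tau> \<le> 2\<rbrakk> \<Longrightarrow>
        (\<lambda>k. g k (z + (\<tau> * \<delta> k / (norm a)\<^sup>2) *\<^sub>R a)) \<longlonglongrightarrow> \<kappa> \<tau> * f z"
  shows "(\<lambda>k. (1 / \<delta> k) * (LINT y|lborel. g k y)) \<longlonglongrightarrow>
    (LBINT \<tau>:{0..2}. \<kappa> \<tau>) * (LINT y:{y \<in> P. a \<bullet> y + b = 0}|hyperplane_lborel a b. f y) / norm a"
proof -
  note [measurable] = gm
  define e0 where "e0 = a /\<^sub>R norm a"
  define p where "p = - (b / (a \<bullet> a)) *\<^sub>R a"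
  obtain B where B: "pairwise orthogonal B" "\<And>e. e \<in> B \<Longrightarrow> norm e = 1" "span B = {v. a \<bullet> v = 0}"
    and hyp: "hyperplane_lborel a b = distr (\<Pi>\<^sub>M e\<in>B. lborel) borel (\<lambda>x. p + (\<Sum>e\<in>B. x e *\<^sub>R e))"
    by (rule hyperplane_lborel_frame[OF a, of b, folded p_def]) blast
  have na: "norm a > 0" "a \<bullet> a = (norm a)\<^sup>2" using a by (auto simp: dot_square_norm)
  have e0: "norm e0 = 1" using na by (simp add: e0_def)
  have e0a: "e0 \<bullet> v = (a \<bullet> v) / norm a" for v by (simp add: e0_def divide_inverse mult.commute)
  have B': "span B = {v. e0 \<bullet> v = 0}" using na by (simp add: B(3) e0a)
  have e00: "e0 \<bullet> e0 = 1" using e0 by (simp add: norm_eq_1)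
  have aeq: "a = norm a *\<^sub>R e0" using na by (simp add: e0_def)
  note bas = orthonormal_hyperplane_basis[OF e0 B(1,2) B']
  define N where "N = (\<Pi>\<^sub>M e\<in>B. lborel :: real measure)"
  define J where "J x = p + (\<Sum>e\<in>B. x e *\<^sub>R e)" for x :: "real^'n \<Rightarrow> real"
  have [measurable]: "J \<in> borel_measurable N" unfolding J_def N_def by measurable
  interpret L: product_sigma_finite "\<lambda>_::real^'n. lborel :: real measure" ..
  interpret N: sigma_finite_measure N unfolding N_def by (rule L.sigma_finite[OF bas(1)])
  interpret NL: pair_sigma_finite N "lborel :: real measure" ..
  have coords: "lborel = distr (N \<Otimes>\<^sub>M lborel) borel (\<lambda>(x, s). J x + s *\<^sub>R e0)"
    using lborel_hyperplane_coords[OF e0 B(1,2) B', of p] by (simp add: N_def J_def)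
  have aB: "a \<bullet> e = 0" if "e \<in> B" for e using span_base[OF that] B(3) by auto
  have aJ: "a \<bullet> J x + b = 0" for x
    using na aB by (simp add: J_def p_def inner_add_right inner_diff_right inner_sum_right)
  have e0J: "e0 \<bullet> J x = - b / norm a" for x
  proof -
    have "a \<bullet> J x = - b" using aJ[of x] by simp
    then show ?thesis by (simp add: e0a)
  qed
  have ay: "a \<bullet> (J x + s *\<^sub>R e0) + b = norm a * s" for x s
  proof -
    have "a \<bullet> e0 = norm a" using na by (simp add: e0_def power2_eq_square)
    then show ?thesis using aJ[of x] by (simp add: inner_add_right)
  qed
  have JB: "x e = (J x + s *\<^sub>R e0 - p) \<bullet> e" if "e \<in> B" for x s e
  proof -
    have "(\<Sum>e'\<in>B. x e' *\<^sub>R e') \<bullet> e = (\<Sum>e'\<in>B. if e' = e then x e' else 0)"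
      unfolding inner_sum_left using B(1) B(2)[OF that] that
      by (intro sum.cong) (auto simp: pairwise_def orthogonal_def norm_eq_1)
    also have "\<dots> = x e" using bas(1) that by simp
    finally show ?thesis using aB[OF that] by (simp add: J_def inner_add_left e0a)
  qed
  obtain \<rho> where \<rho>: "\<And>y. y \<in> P \<Longrightarrow> norm y \<le> \<rho>" using bdd bounded_iff by blast
  have Pclosed: "closed P"
  proof -
    have "P = {y. a \<bullet> y + b \<ge> 0} \<inter> (\<Inter>s\<in>I. {y. \<nu> s \<bullet> y + c s \<ge> 0})" by (auto simp: P_def)
    then show ?thesis
      by (auto intro!: closed_Int closed_INT closed_Collect_le continuous_intros)
  qed
  define F where "F = {y \<in> P. a \<bullet> y + b = 0}"
  have Fclosed: "closed F"
  proof -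
    have "F = P \<inter> {y. a \<bullet> y + b = 0}" by (auto simp: F_def)
    then show ?thesis using Pclosed by (auto intro!: closed_Int closed_Collect_eq continuous_intros)
  qed
  define fF where "fF y = indicator F y *\<^sub>R f y" for y
  have [measurable]: "fF \<in> borel_measurable borel"
    unfolding fF_def using Fclosed f
    by (intro borel_measurable_continuous_on_indicator) (auto intro: continuous_on_subset simp: F_def)
  define \<kappa>I where "\<kappa>I \<tau> = indicator {0..2} \<tau> *\<^sub>R \<kappa> \<tau>" for \<tau> :: real
  have [measurable]: "\<kappa>I \<in> borel_measurable borel"
    unfolding \<kappa>I_def using \<kappa> by (intro borel_measurable_continuous_on_indicator) auto
  define H where "H k = (\<lambda>(x, \<tau>). g k (J x + (\<tau> * \<delta> k / norm a) *\<^sub>R e0))" for k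
  have Hm[measurable]: "H k \<in> borel_measurable (N \<Otimes>\<^sub>M lborel)" for k unfolding H_def by measurable
  define H0 where "H0 = (\<lambda>(x, \<tau>). \<kappa>I \<tau> * fF (J x))"
  have H0m[measurable]: "H0 \<in> borel_measurable (N \<Otimes>\<^sub>M lborel)" unfolding H0_def by measurable
  \<comment> \<open>Points of \<open>P\<close> have tangential coordinates in this box, so
    \<open>w\<close> is one integrable majorant for all \<open>H k\<close>.\<close>
  define X where "X = (\<Pi>\<^sub>E e\<in>B. {- (\<rho> + norm p)..\<rho> + norm p})"
  define w where "w z = M * indicator (X \<times> {0..2}) z" for z :: "(real^'n \<Rightarrow> real) \<times> real"
  have M0: "M \<ge> 0" using gM[of 0 0] by linarith
  have [measurable]: "X \<in> sets N" unfolding X_def N_def using bas(1) by (intro sets_PiM_I_finite) auto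
  have "emeasure N X < \<infinity>"
    unfolding X_def N_def using bas(1)
    by (subst L.emeasure_PiM) (auto simp: emeasure_lborel_Icc_eq power_less_top_ennreal)
  then have "emeasure (N \<Otimes>\<^sub>M lborel) (X \<times> {0..2::real}) < \<infinity>"
    by (subst lborel.emeasure_pair_measure_Times) (auto simp: ennreal_mult_less_top)
  then have wint: "integrable (N \<Otimes>\<^sub>M lborel) w"
    unfolding w_def by (auto intro!: integrable_real_indicator)
  have Hw: "norm (H k z) \<le> w z" if "z \<in> space (N \<Otimes>\<^sub>M lborel)" for k z
  proof (cases "H k z = 0")
    case True
    then show ?thesis using M0 by (simp add: w_def indicator_def)
  next
    case False
    obtain x \<tau> where z: "z = (x, \<tau>)" by force
    let ?y = "J x + (\<tau> * \<delta> k / norm a) *\<^sub>R e0"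
    have x: "x \<in> space N" using that z by (simp add: space_pair_measure)
    have y: "?y \<in> P" "a \<bullet> ?y + b \<le> 2 * \<delta> k" using gsupp[of k ?y] False by (auto simp: H_def z)
    have "a \<bullet> ?y + b \<ge> 0" using y(1) by (auto simp: P_def)
    then have "\<tau> \<in> {0..2}" using y(2) na(1) \<delta>(1)[of k] unfolding ay
      by (auto simp: zero_le_mult_iff mult.commute)
    moreover have "\<bar>x e\<bar> \<le> \<rho> + norm p" if "e \<in> B" for e
    proof -
      have "\<bar>x e\<bar> \<le> norm (?y - p) * norm e" unfolding JB[OF that, of x "\<tau> * \<delta> k / norm a"]
        by (rule Cauchy_Schwarz_ineq2)
      also have "\<dots> \<le> \<rho> + norm p" using B(2)[OF that] \<rho>[OF y(1)] norm_triangle_ineq4[of ?y p] by simp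
      finally show ?thesis .
    qed
    then have "x \<in> X" using x unfolding X_def N_def space_PiM PiE_def Pi_def by (auto simp: extensional_def) (smt (verit))+
    ultimately show ?thesis using gM by (simp add: w_def z H_def)
  qed
  \<comment> \<open>\<open>n'\<close> is the tangential part of \<open>\<nu> s\<close>. If it is 0,
    the constraint is constant along the hyperplane and \<open>npar\<close> excludes the value 0.
    Otherwise the exceptional set, which does not depend on the normal coordinate, is described by
    the equation of another hyperplane, a null set of the full space.\<close>
  have AE0: "AE z in N \<Otimes>\<^sub>M (lborel :: real measure). \<nu> s \<bullet> J (fst z) + c s \<noteq> 0" if s: "s \<in> I" for s
  proof -
    define m where "m = \<nu> s \<bullet> e0"
    define n' where "n' = \<nu> s - m *\<^sub>R e0"
    have Ls: "\<nu> s \<bullet> J x + c s = n' \<bullet> (J x + t *\<^sub>R e0) - m * b / norm a + c s" for x t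
      by (simp add: n'_def inner_diff_left inner_add_right e00 e0J m_def[symmetric] algebra_simps)
    show ?thesis
    proof (cases "n' = 0")
      case True
      have "c s \<noteq> m * b / norm a"
      proof
        assume "c s = m * b / norm a"
        moreover have "\<nu> s = (m / norm a) *\<^sub>R a" using True by (simp add: n'_def e0_def divide_inverse)
        ultimately show False using npar[OF s, of "m / norm a"] by simp
      qed
      then show ?thesis using Ls[of _ 0] True by (intro AE_I2) simp
    next
      case False
      have "{y. n' \<bullet> y = m * b / norm a - c s} \<in> null_sets lebesgue"
        using negligible_hyperplane[of n'] False by (simp add: negligible_iff_null_sets)
      then have "AE y in lborel. y \<notin> {y. n' \<bullet> y = m * b / norm a - c s}"
        using AE_not_in by (subst AE_completion_iff[symmetric]) blast
      then have "AE z in N \<Otimes>\<^sub>M lborel. n' \<bullet> (case z of (x, s) \<Rightarrow> J x + s *\<^sub>R e0) \<noteq> m * b / norm a - c s"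
        by (subst (asm) coords, subst (asm) AE_distr_iff) (auto simp: split_beta)
      then show ?thesis
      proof (rule AE_mp, intro AE_I2 impI)
        fix z assume "n' \<bullet> (case z of (x, s) \<Rightarrow> J x + s *\<^sub>R e0) \<noteq> m * b / norm a - c s"
        then have "n' \<bullet> (J (fst z) + snd z *\<^sub>R e0) \<noteq> m * b / norm a - c s" by (simp add: split_beta)
        then show "\<nu> s \<bullet> J (fst z) + c s \<noteq> 0" using Ls[of "fst z" "snd z"] by linarith
      qed
    qed
  qed
  have AEI: "AE z in N \<Otimes>\<^sub>M (lborel :: real measure). \<forall>s\<in>I. \<nu> s \<bullet> J (fst z) + c s \<noteq> 0"
    using AE_finite_allI[OF I AE0] by simp
  have lim: "(\<lambda>k. H k z) \<longlonglongrightarrow> H0 z" if nz: "\<forall>s\<in>I. \<nu> s \<bullet> J (fst z) + c s \<noteq> 0" for z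
  proof -
    obtain x \<tau> where z: "z = (x, \<tau>)" by force
    define y where "y k = J x + (\<tau> * \<delta> k / norm a) *\<^sub>R e0" for k
    have Hy: "H k (x, \<tau>) = g k (y k)" for k by (simp add: H_def y_def)
    have ylim: "y \<longlonglongrightarrow> J x"
    proof -
      have "y \<longlonglongrightarrow> J x + (\<tau> * 0 / norm a) *\<^sub>R e0" unfolding y_def
        by (intro tendsto_intros \<delta>) (use na in auto)
      then show ?thesis by simp
    qed
    have ayk: "a \<bullet> y k + b = \<tau> * \<delta> k" for k unfolding y_def ay using na by simp
    \<comment> \<open>The second alternative uses that a constraint negative at \<open>J x\<close>
      stays negative near it, so that \<open>H k\<close> is eventually 0 there; constraints equal to
      0 were excluded by \<open>nz\<close>.\<close>
    consider "\<tau> \<notin> {0..2}" | s where "\<tau> \<in> {0..2}" "s \<in> I" "\<nu> s \<bullet> J x + c s < 0"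
      | "\<tau> \<in> {0..2}" "\<forall>s\<in>I. \<nu> s \<bullet> J x + c s > 0"
      using nz z by (fastforce simp: neq_iff)
    then show ?thesis
    proof cases
      case 1
      have "g k (y k) = 0" for k
      proof (rule ccontr)
        assume "g k (y k) \<noteq> 0"
        then have "0 \<le> \<tau> * \<delta> k" "\<tau> * \<delta> k \<le> 2 * \<delta> k" using gsupp[of k "y k"] ayk[of k] by (auto simp: P_def)
        then show False using 1 \<delta>(1)[of k] by (auto simp: zero_le_mult_iff)
      qed
      then show ?thesis using 1 by (simp add: Hy H0_def z \<kappa>I_def)
    next
      case (2 s)
      have "(\<lambda>k. \<nu> s \<bullet> y k + c s) \<longlonglongrightarrow> \<nu> s \<bullet> J x + c s" by (intro tendsto_intros ylim)
      then have "\<forall>\<^sub>F k in sequentially. \<nu> s \<bullet> y k + c s < 0" using 2(3) by (rule order_tendstoD)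
      then have "\<forall>\<^sub>F k in sequentially. H k (x, \<tau>) = 0"
      proof eventually_elim
        case (elim k)
        then have "y k \<notin> P" using 2(2) by (auto simp: P_def not_le)
        then show ?case using gsupp Hy by metis
      qed
      moreover have "J x \<notin> F" using 2 by (auto simp: F_def P_def not_le)
      ultimately show ?thesis by (simp add: H0_def z fF_def tendsto_eventually)
    next
      case 3
      have yk: "J x + (\<tau> * \<delta> k / (norm a)\<^sup>2) *\<^sub>R a = y k" for k
        using na by (simp add: y_def e0_def power2_eq_square divide_inverse)
      have "J x \<in> F" using 3(2) aJ[of x] by (auto simp: F_def P_def less_imp_le)
      then show ?thesis
        using conv[of "J x" \<tau>] 3 aJ[of x] unfolding yk z Hy by (simp add: H0_def fF_def \<kappa>I_def)
    qed
  qed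
  have AElim: "AE z in N \<Otimes>\<^sub>M lborel. (\<lambda>k. H k z) \<longlonglongrightarrow> H0 z"
    using AEI by eventually_elim (rule lim)
  have Hwae: "AE z in N \<Otimes>\<^sub>M lborel. norm (H k z) \<le> w z" for k by (rule AE_I2) (rule Hw)
  note dom = integral_dominated_convergence[OF H0m Hm wint AElim Hwae]
    integrable_dominated_convergence[OF H0m Hm wint AElim Hwae]
    integrable_dominated_convergence2[OF H0m Hm wint AElim Hwae]
  \<comment> \<open>The substitution contributes \<open>\<delta> k / norm a\<close>. Its first
    factor cancels the prefactor \<open>1 / \<delta> k\<close>; what remains is the weight
    \<open>1 / norm a\<close> of the boundary measure.\<close>
  have scale: "(LINT y|lborel. g k y) = (\<delta> k / norm a) * (LINT z|(N \<Otimes>\<^sub>M lborel). H k z)" for k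
  proof -
    have gi: "integrable lborel (g k)"
      using gsupp \<rho> by (intro integrable_bounded_support[where M = M and \<rho> = \<rho>] gM) auto
    have "(LINT y|lborel. g k y) = (LINT z|(N \<Otimes>\<^sub>M lborel). g k (case z of (x, s) \<Rightarrow> J x + s *\<^sub>R e0))"
      by (subst coords, subst integral_distr) auto
    also have "\<dots> = (LINT x|N. LINT s|lborel. g k (J x + s *\<^sub>R e0))"
    proof (subst NL.integral_fst'[symmetric])
      show "integrable (N \<Otimes>\<^sub>M lborel) (\<lambda>z. g k (case z of (x, s) \<Rightarrow> J x + s *\<^sub>R e0))"
        using gi by (subst (asm) coords, subst (asm) integrable_distr_eq) auto
    qed simp
    also have "\<dots> = (LINT x|N. (\<delta> k / norm a) * (LINT \<tau>|lborel. H k (x, \<tau>)))"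
    proof (intro Bochner_Integration.integral_cong refl)
      fix x
      show "(LINT s|lborel. g k (J x + s *\<^sub>R e0)) = (\<delta> k / norm a) * (LINT \<tau>|lborel. H k (x, \<tau>))"
        using lborel_integral_real_affine[of "\<delta> k / norm a" "\<lambda>s. g k (J x + s *\<^sub>R e0)" 0] \<delta>(1)[of k] na
        by (simp add: H_def mult.commute)
    qed
    also have "\<dots> = (\<delta> k / norm a) * (LINT x|N. LINT \<tau>|lborel. H k (x, \<tau>))" by simp
    also have "(LINT x|N. LINT \<tau>|lborel. H k (x, \<tau>)) = (LINT z|(N \<Otimes>\<^sub>M lborel). H k z)"
      by (rule NL.integral_fst'[OF dom(3)])
    finally show ?thesis .
  qed
  have "(LINT z|(N \<Otimes>\<^sub>M lborel). H0 z) = (LINT x|N. LINT \<tau>|lborel. \<kappa>I \<tau> * fF (J x))"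
    using NL.integral_fst'[OF dom(2)] by (simp add: H0_def)
  also have "\<dots> = (LINT \<tau>|lborel. \<kappa>I \<tau>) * (LINT x|N. fF (J x))" by simp
  also have "(LINT x|N. fF (J x)) = (LINT y:F|hyperplane_lborel a b. f y)"
    unfolding set_lebesgue_integral_def hyp fF_def[symmetric]
    by (subst integral_distr) (auto simp: N_def[symmetric] J_def[symmetric])
  also have "(LINT \<tau>|lborel. \<kappa>I \<tau>) = (LBINT \<tau>:{0..2}. \<kappa> \<tau>)"
    by (simp add: set_lebesgue_integral_def \<kappa>I_def)
  finally have H0i: "(LINT z|(N \<Otimes>\<^sub>M lborel). H0 z) = (LBINT \<tau>:{0..2}. \<kappa> \<tau>) * (LINT y:F|hyperplane_lborel a b. f y)" .
  have "(\<lambda>k. (LINT z|(N \<Otimes>\<^sub>M lborel). H k z) / norm a) \<longlonglongrightarrow> (LINT z|(N \<Otimes>\<^sub>M lborel). H0 z) / norm a"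
    by (intro tendsto_intros dom(1)) (use na in auto)
  moreover have "(LINT z|(N \<Otimes>\<^sub>M lborel). H k z) / norm a = (1 / \<delta> k) * (LINT y|lborel. g k y)" for k
    unfolding scale using \<delta>(1)[of k] by simp
  ultimately show ?thesis unfolding H0i F_def by simp
qed

text \<open>The discriminant argument along \<open>x + t *R y\<close>. Only semidefiniteness, and
  only on a subspace, is assumed, because the inequality is applied to defect forms that degenerate,
  such as \<open>k\<close> times \<open>G\<close> minus \<open>G S\<close> at an eigenvector for
  \<open>k\<close>.\<close>

lemma psd_Cauchy_Schwarz:
  fixes \<beta> :: "'a::real_vector \<Rightarrow> 'a \<Rightarrow> real"
  assumes add: "\<And>x y z. \<beta> x (y + z) = \<beta> x y + \<beta> x z" and scl: "\<And>x y r. \<beta> x (r *\<^sub>R y) = r * \<beta> x y"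
    and sym: "\<And>x y. \<beta> x y = \<beta> y x"
    and N: "subspace N" and psd: "\<And>x. x \<in> N \<Longrightarrow> 0 \<le> \<beta> x x" and xy: "x \<in> N" "y \<in> N"
  shows "(\<beta> x y)\<^sup>2 \<le> \<beta> x x * \<beta> y y"
proof -
  have q: "0 \<le> \<beta> x x + 2 * t * \<beta> x y + t\<^sup>2 * \<beta> y y" for t
  proof -
    have "0 \<le> \<beta> (x + t *\<^sub>R y) (x + t *\<^sub>R y)"
      using N xy by (intro psd) (auto simp: subspace_def)
    also have "\<dots> = \<beta> x x + 2 * t * \<beta> x y + t\<^sup>2 * \<beta> y y"
      using add scl sym by (simp add: power2_eq_square algebra_simps)
    finally show ?thesis .
  qed
  show ?thesis
  proof (cases "\<beta> y y = 0")
    case True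
    have "\<beta> x y = 0"
    proof (rule ccontr)
      assume "\<beta> x y \<noteq> 0"
      \<comment> \<open>With \<open>\<beta> y y = 0\<close> the quadratic in \<open>t\<close> is
        affine; this \<open>t\<close> gives it the value -1.\<close>
      then show False using q[of "- (\<beta> x x + 1) / (2 * \<beta> x y)"] True by (simp add: field_simps)
    qed
    then show ?thesis by (simp add: True)
  next
    case False
    then have p: "\<beta> y y > 0" using psd[OF xy(2)] by simp
    have "0 \<le> \<beta> x x - (\<beta> x y)\<^sup>2 / \<beta> y y"
      using q[of "- \<beta> x y / \<beta> y y"] p by (simp add: power2_eq_square)
    then show ?thesis using p by (simp add: field_simps)
  qed
qed

section \<open>The binomial series of the square root\<close>

text \<open>The Taylor coefficients of \<open>sqrt (1 - x)\<close> at 0.\<close>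

definition sqrt_coeff :: "nat \<Rightarrow> real" where "sqrt_coeff k = (- 1) ^ k * ((1 / 2) gchoose k)"

lemma sqrt_coeff_0 [simp]: "sqrt_coeff 0 = 1" by (simp add: sqrt_coeff_def)

lemma sqrt_coeff_Suc: "sqrt_coeff (Suc k) = sqrt_coeff k * (real k - 1 / 2) / (real k + 1)"
proof -
  define g where "g = (1 / 2 :: real) gchoose k"
  have "((1 / 2 :: real) gchoose Suc k) = g * (1 / 2 - real k) / (real k + 1)"
    using gbinomial_mult_1[of "1/2 :: real" k] by (simp add: g_def[symmetric] field_simps)
  then have "sqrt_coeff (Suc k) = (- 1) ^ Suc k * (g * (1 / 2 - real k) / (real k + 1))" by (simp only: sqrt_coeff_def)
  also have "\<dots> = (- 1) ^ k * g * (real k - 1 / 2) / (real k + 1)"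
    by (simp add: divide_simps) (simp add: algebra_simps)
  finally show ?thesis by (simp only: sqrt_coeff_def g_def)
qed

text \<open>The partial sums are multiplied by \<open>(2 n + 1) / (2 n + 2)\<close> at each step,
  hence stay positive. Consequently every coefficient after the first is negative and their absolute
  values sum to at most 1, which is all that the form estimates need.\<close>

lemma sqrt_coeff_partial_sum: "sqrt_coeff (Suc n) = - (\<Sum>k\<le>n. sqrt_coeff k) / (2 * (real n + 1))" "(\<Sum>k\<le>n. sqrt_coeff k) > 0"
proof (induction n)
  case 0
  show "sqrt_coeff (Suc 0) = - (\<Sum>k\<le>0. sqrt_coeff k) / (2 * (real 0 + 1))" by (simp add: sqrt_coeff_Suc)
  show "(\<Sum>k\<le>0. sqrt_coeff k) > 0" by simp
next
  case (Suc n)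
  define T where "T = (\<Sum>k\<le>n. sqrt_coeff k)"
  have 1: "(\<Sum>k\<le>Suc n. sqrt_coeff k) = T * (2 * real n + 1) / (2 * (real n + 1))"
    using Suc(1) by (simp add: T_def[symmetric] field_simps)
  then show "(\<Sum>k\<le>Suc n. sqrt_coeff k) > 0" using Suc(2) by (simp add: T_def[symmetric])
  show "sqrt_coeff (Suc (Suc n)) = - (\<Sum>k\<le>Suc n. sqrt_coeff k) / (2 * (real (Suc n) + 1))"
    unfolding 1 sqrt_coeff_Suc[of "Suc n"] Suc(1) T_def[symmetric]
    by (simp add: divide_simps) (simp add: algebra_simps)
qed

lemma sqrt_coeff_neg: "k \<ge> 1 \<Longrightarrow> sqrt_coeff k < 0"
proof (cases k)
  case (Suc j)
  show ?thesis unfolding Suc sqrt_coeff_partial_sum(1)[of j] using sqrt_coeff_partial_sum(2)[of j]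
    by (intro divide_neg_pos) auto
qed simp

lemma sqrt_coeff_abs_sum: "(\<Sum>k=1..n. - sqrt_coeff k) \<le> 1"
proof -
  have "(\<Sum>k\<le>n. sqrt_coeff k) = sqrt_coeff 0 + (\<Sum>k=1..n. sqrt_coeff k)"
    by (metis One_nat_def atLeast0AtMost le0 sum.atLeast_Suc_atMost)
  then show ?thesis using sqrt_coeff_partial_sum(2)[of n] by (simp add: sum_negf)
qed

lemma sqrt_coeff_abs_le: "\<bar>sqrt_coeff k\<bar> \<le> 1"
proof (cases k)
  case (Suc j)
  have "- sqrt_coeff k \<le> (\<Sum>i=1..k. - sqrt_coeff i)"
    using sqrt_coeff_neg by (intro member_le_sum[of k "{1..k}" "\<lambda>i. - sqrt_coeff i"]) (auto simp: Suc less_imp_le)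
  then show ?thesis using sqrt_coeff_abs_sum[of k] sqrt_coeff_neg[of k] Suc by simp
qed simp

text \<open>Vandermonde's identity with \<open>1/2 + 1/2 = 1\<close>: the formal square of the
  series is \<open>1 - x\<close>.\<close>

lemma sqrt_coeff_convolution: "(\<Sum>i\<le>k. sqrt_coeff i * sqrt_coeff (k - i)) = (if k = 0 then 1 else if k = 1 then - 1 else 0)"
proof -
  have "(\<Sum>i\<le>k. sqrt_coeff i * sqrt_coeff (k - i)) = (\<Sum>i\<le>k. (- 1) ^ k * (((1 / 2 :: real) gchoose i) * ((1 / 2) gchoose (k - i))))"
    by (intro sum.cong) (auto simp: sqrt_coeff_def power_add[symmetric] mult_ac)
  also have "\<dots> = (- 1) ^ k * ((1 / 2 + 1 / 2 :: real) gchoose k)"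
    by (simp only: sum_distrib_left[symmetric] atMost_atLeast0 gbinomial_Vandermonde[symmetric])
  also have "\<dots> = (- 1) ^ k * real (1 choose k)" by (simp add: binomial_gbinomial)
  also have "\<dots> = (if k = 0 then 1 else if k = 1 then - 1 else 0)"
    by (cases "k \<le> 1") (auto simp: binomial_eq_0 le_Suc_eq)
  finally show ?thesis .
qed

section \<open>Matrix powers and Hermitian forms\<close>

primrec mat_power :: "complex^'n^'n \<Rightarrow> nat \<Rightarrow> complex^'n^'n" where
  "mat_power S 0 = mat 1"
| "mat_power S (Suc k) = S ** mat_power S k"

lemma mat_power_add: "mat_power S (i + j) = mat_power S i ** mat_power S j"
  by (induction i) (auto simp: matrix_mul_assoc)

lemma mat_power_commute: "A ** S = S ** A \<Longrightarrow> A ** mat_power S k = mat_power S k ** A"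
  by (induction k) (auto simp: matrix_mul_assoc, metis matrix_mul_assoc)

definition sqrt_series :: "complex^'n^'n \<Rightarrow> complex^'n^'n" where
  "sqrt_series S = (\<Sum>k. sqrt_coeff k *\<^sub>R mat_power S k)"

text \<open>Converts bounds for the action on vectors into bounds for the Euclidean norm of the
  matrix. Each column norm is counted once per row, which is crude but keeps the bound
  uniform.\<close>

lemma norm_matrix_le_axis:
  fixes A :: "'b::real_normed_algebra_1^'n^'n"
  shows "norm A \<le> (\<Sum>i\<in>(UNIV::'n set). \<Sum>j\<in>(UNIV::'n set). norm (A *v axis j 1))"
proof -
  have "norm A \<le> (\<Sum>i\<in>UNIV. norm (A $ i))"
    unfolding norm_vec_def[of A] by (rule L2_set_le_sum) simp
  also have "\<dots> \<le> (\<Sum>i\<in>UNIV. \<Sum>j\<in>UNIV. norm (A $ i $ j))"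
  proof (intro sum_mono)
    fix i show "norm (A $ i) \<le> (\<Sum>j\<in>UNIV. norm (A $ i $ j))"
      unfolding norm_vec_def[of "A $ i"] by (rule L2_set_le_sum) simp
  qed
  also have "\<dots> \<le> (\<Sum>i\<in>(UNIV::'n set). \<Sum>j\<in>(UNIV::'n set). norm (A *v axis j 1))"
  proof (intro sum_mono)
    fix i j :: 'n
    have "A $ i $ j = (A *v axis j 1) $ i" by (simp add: matrix_vector_mult_def axis_def if_distrib cong: if_cong)
    then show "norm (A $ i $ j) \<le> norm (A *v axis j 1)" by (metis Finite_Cartesian_Product.norm_nth_le)
  qed
  finally show ?thesis .
qed

lemma mv_scaleR [simp]: "A *v (r *\<^sub>R x) = r *\<^sub>R (A *v (x :: complex^'n))"
  by (rule bounded_bilinear.scaleR_right[OF bounded_bilinear_matrix_vector_mult])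

lemma mm_diff: "A ** (X - Y) = A ** X - A ** (Y :: complex^'n^'n)" "(X - Y) ** A = X ** A - Y ** (A :: complex^'n^'n)"
  by (rule bounded_bilinear.diff_right[OF bounded_bilinear_matrix_matrix_mult],
      rule bounded_bilinear.diff_left[OF bounded_bilinear_matrix_matrix_mult])

lemma matrix_vector_mult_scaleC:
  fixes A :: "complex^'n^'n"
  shows "A *v (k *s x) = k *s (A *v x)"
  by (simp add: matrix_vector_mult_def vec_eq_iff sum_distrib_left mult_ac)

text \<open>The inner product on \<open>complex^'n\<close> is the real part of the Hermitian one, so
  multiplication by i is skew for it.\<close>

lemma inner_ii: "x \<bullet> (\<i> *s y) = - ((\<i> *s x) \<bullet> (y :: complex^'n))"
  by (simp add: inner_vec_def inner_complex_def sum_negf[symmetric])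

lemma inner_ii_ii: "(\<i> *s x) \<bullet> (\<i> *s y) = x \<bullet> (y :: complex^'n)"
  by (simp add: inner_vec_def inner_complex_def add.commute)

lemma scaleC_eq: "k *s (v :: complex^'n) = Re k *\<^sub>R v + Im k *\<^sub>R (\<i> *s v)"
  by (simp add: vec_eq_iff complex_eq_iff)

lemma matrix_eqI_vec: "(\<And>x. A *v x = B *v (x :: complex^'n)) \<Longrightarrow> A = B"
  by (simp add: matrix_eq)

text \<open>Positive definite Hermitian forms expressed through the real inner product: as
  \<open>G\<close> is complex linear, symmetry of the real part already makes the form
  Hermitian.\<close>

locale herm_form =
  fixes G :: "complex^'n^'n"
  assumes Gsym: "x \<bullet> (G *v y) = (G *v x) \<bullet> y" and Gpos: "x \<noteq> 0 \<Longrightarrow> x \<bullet> (G *v x) > 0"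
begin

lemma G0: "x \<bullet> (G *v x) \<ge> 0" using Gpos[of x] by (cases "x = 0") auto

text \<open>The Hermitian value at \<open>(x, x)\<close> is real. This is the source of real
  eigenvalues further down.\<close>

lemma G_ii: "x \<bullet> (G *v (\<i> *s x)) = 0"
proof -
  have "x \<bullet> (G *v (\<i> *s x)) = - ((\<i> *s x) \<bullet> (G *v x))"
    by (simp add: matrix_vector_mult_scaleC inner_ii)
  also have "(\<i> *s x) \<bullet> (G *v x) = x \<bullet> (G *v (\<i> *s x))"
    by (metis Gsym inner_commute)
  finally show ?thesis by simp
qed

lemma form_bounds: obtains \<alpha> \<beta> where "\<alpha> > 0" "\<beta> > 0" "\<And>x. \<alpha> * (norm x)\<^sup>2 \<le> x \<bullet> (G *v x)"
    "\<And>x. x \<bullet> (G *v x) \<le> \<beta> * (norm x)\<^sup>2"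
proof -
  let ?q = "\<lambda>x. x \<bullet> (G *v x)"
  have c: "continuous_on (sphere 0 1) ?q"
    by (intro continuous_intros bounded_bilinear.continuous_on[OF bounded_bilinear_matrix_vector_mult])
  have ne: "sphere (0::complex^'n) 1 \<noteq> {}" by simp
  obtain v where v: "v \<in> sphere 0 1" "\<And>x. x \<in> sphere 0 1 \<Longrightarrow> ?q v \<le> ?q x"
    using continuous_attains_inf[OF compact_sphere ne c] by blast
  obtain w where w: "w \<in> sphere 0 1" "\<And>x. x \<in> sphere 0 1 \<Longrightarrow> ?q x \<le> ?q w"
    using continuous_attains_sup[OF compact_sphere ne c] by blast
  have hom: "?q x = (norm x)\<^sup>2 * ?q (x /\<^sub>R norm x)" if "x \<noteq> 0" for x
    using that by (simp add: power2_eq_square field_simps)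
  have nx: "x /\<^sub>R norm x \<in> sphere 0 1" if "x \<noteq> 0" for x :: "complex^'n" using that by simp
  have v0: "v \<noteq> 0" "w \<noteq> 0" using v(1) w(1) by auto
  show ?thesis
  proof (rule that[of "?q v" "?q w"])
    show "?q v > 0" "?q w > 0" using v0 Gpos by auto
    show "?q v * (norm x)\<^sup>2 \<le> ?q x" for x
    proof (cases "x = 0")
      case False
      show ?thesis unfolding hom[OF False] using v(2)[OF nx[OF False]]
        by (subst mult.commute) (rule mult_left_mono, simp_all)
    qed simp
    show "?q x \<le> ?q w * (norm x)\<^sup>2" for x
    proof (cases "x = 0")
      case False
      show ?thesis unfolding hom[OF False] using w(2)[OF nx[OF False]]
        by (subst (2) mult.commute) (rule mult_left_mono, simp_all)
    qed simp
  qed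
qed

text \<open>At a maximiser \<open>v\<close> of the Rayleigh quotient on the unit sphere of
  \<open>N\<close>, the form \<open>k\<close> times \<open>G\<close> minus \<open>G S\<close> is
  semidefinite on \<open>N\<close> and vanishes at \<open>v\<close>. Cauchy-Schwarz for this form
  then forces \<open>S *v v = k *R v\<close>, without differentiating the quotient.\<close>

lemma rayleigh:
  assumes Ssym: "\<And>x y. x \<bullet> (G *v (S *v y)) = (G *v (S *v x)) \<bullet> y"
    and N: "subspace N" "N \<noteq> {0}" and inv: "\<And>x. x \<in> N \<Longrightarrow> S *v x \<in> N"
  obtains v k where "v \<in> N" "v \<noteq> 0" "S *v v = k *\<^sub>R v" "\<And>x. x \<in> N \<Longrightarrow> x \<bullet> (G *v (S *v x)) \<le> k * (x \<bullet> (G *v x))"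
proof -
  define K where "K = N \<inter> sphere 0 1"
  have c1: "compact K" unfolding K_def using closed_subspace[OF N(1)] by (simp add: closed_Int_compact)
  have c2: "K \<noteq> {}"
  proof -
    obtain x where x: "x \<in> N" "x \<noteq> 0" using N subspace_0 by blast
    then have "x /\<^sub>R norm x \<in> K" using N(1) by (simp add: K_def subspace_scale)
    then show ?thesis by blast
  qed
  have c3: "continuous_on K (\<lambda>x. (x \<bullet> (G *v (S *v x))) / (x \<bullet> (G *v x)))"
  proof -
    have "x \<bullet> (G *v x) \<noteq> 0" if "x \<in> K" for x
      using Gpos[of x] that by (cases "x = 0") (auto simp: K_def)
    then show ?thesis
      by (intro continuous_intros bounded_bilinear.continuous_on[OF bounded_bilinear_matrix_vector_mult]) auto
  qed
  obtain v where v: "v \<in> K"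
    "\<And>x. x \<in> K \<Longrightarrow> (x \<bullet> (G *v (S *v x))) / (x \<bullet> (G *v x)) \<le> (v \<bullet> (G *v (S *v v))) / (v \<bullet> (G *v v))"
    using continuous_attains_sup[OF c1 c2 c3] by blast
  define k where "k = (v \<bullet> (G *v (S *v v))) / (v \<bullet> (G *v v))"
  have vN: "v \<in> N" "v \<noteq> 0" using v(1) by (auto simp: K_def)
  have max: "x \<bullet> (G *v (S *v x)) \<le> k * (x \<bullet> (G *v x))" if "x \<in> N" for x
  proof (cases "x = 0")
    case False
    have "x /\<^sub>R norm x \<in> K" using that N(1) False by (simp add: K_def subspace_scale)
    from v(2)[OF this] have "(x \<bullet> (G *v (S *v x))) / (x \<bullet> (G *v x)) \<le> k"
      using False by (simp add: k_def)
    then show ?thesis using Gpos[OF False] by (simp add: pos_divide_le_eq)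
  qed simp
  define \<beta> where "\<beta> x y = x \<bullet> (G *v (k *\<^sub>R y - S *v y))" for x y
  have \<beta>: "\<beta> x y = k * (x \<bullet> (G *v y)) - x \<bullet> (G *v (S *v y))" for x y
    by (simp add: \<beta>_def matrix_vector_mult_diff_distrib mv_scaleR inner_diff_right)
  \<comment> \<open>\<open>\<beta> w v\<close> is the \<open>G\<close>-square of \<open>w\<close>,
    and \<open>\<beta> v v = 0\<close>; so Cauchy-Schwarz gives \<open>w = 0\<close>.\<close>
  define w where "w = k *\<^sub>R v - S *v v"
  have wN: "w \<in> N" unfolding w_def using N(1) vN inv by (auto intro: subspace_diff subspace_scale)
  have "(\<beta> w v)\<^sup>2 \<le> \<beta> w w * \<beta> v v"
  proof (rule psd_Cauchy_Schwarz[OF _ _ _ N(1) _ wN vN(1)])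
    show "\<beta> x y = \<beta> y x" for x y unfolding \<beta> by (metis (no_types) Gsym[of x y] Ssym[of x y] inner_commute)
    show "0 \<le> \<beta> x x" if "x \<in> N" for x using max[OF that] by (simp add: \<beta>)
  qed (auto simp: \<beta> matrix_vector_right_distrib mv_scaleR inner_add_right algebra_simps)
  moreover have "\<beta> v v = 0" using Gpos[OF vN(2)] by (simp add: \<beta> k_def)
  ultimately have "w \<bullet> (G *v w) = 0" by (simp add: \<beta>_def w_def)
  then have "w = 0" using Gpos[of w] by fastforce
  then show ?thesis using that[OF vN, of k] max by (simp add: w_def)
qed

end

text \<open>Expresses by quadratic forms that \<open>S\<close> is self-adjoint for \<open>G\<close>
  with spectrum in \<open>[0, m]\<close>; no diagonalisation is involved.\<close>

locale contraction_form = herm_form +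
  fixes S :: "complex^'n^'n" and m :: real
  assumes Ssym: "x \<bullet> (G *v (S *v y)) = (G *v (S *v x)) \<bullet> y"
    and S0: "0 \<le> x \<bullet> (G *v (S *v x))" and Sm: "x \<bullet> (G *v (S *v x)) \<le> m * (x \<bullet> (G *v x))"
    and m: "0 \<le> m" "m < 1"
begin

text \<open>The counterpart of \<mu>\<mu> \<le> m\<mu> for an eigenvalue \<mu> in
  \<open>[0, m]\<close>. It follows from Cauchy-Schwarz for the semidefinite form
  \<open>G S\<close>, applied to \<open>x\<close> and \<open>S *v x\<close>.\<close>

lemma S_step: "(S *v x) \<bullet> (G *v (S *v x)) \<le> m * (x \<bullet> (G *v (S *v x)))"
proof -
  define a where "a = (S *v x) \<bullet> (G *v (S *v x))"
  have "(x \<bullet> (G *v (S *v (S *v x))))\<^sup>2 \<le> (x \<bullet> (G *v (S *v x))) * ((S *v x) \<bullet> (G *v (S *v (S *v x))))"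
  proof (rule psd_Cauchy_Schwarz[where N = UNIV])
    show "x \<bullet> (G *v (S *v y)) = y \<bullet> (G *v (S *v x))" for x y using Ssym by (metis inner_commute)
  qed (auto simp: S0 matrix_vector_right_distrib mv_scaleR inner_add_right)
  moreover have "x \<bullet> (G *v (S *v (S *v x))) = a"
    unfolding a_def using Ssym[of x "S *v x"] Gsym by (metis inner_commute)
  ultimately have "a\<^sup>2 \<le> (x \<bullet> (G *v (S *v x))) * (m * a)"
    using mult_left_mono[OF Sm[of "S *v x"] S0[of x]] by (simp add: a_def)
  then have "a * a \<le> (m * (x \<bullet> (G *v (S *v x)))) * a" by (simp add: power2_eq_square mult_ac)
  moreover have "a \<ge> 0" unfolding a_def by (rule G0)
  ultimately show ?thesis unfolding a_def[symmetric]
    using m S0[of x] by (cases "a = 0") (auto simp: mult_le_cancel_right)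
qed

lemma S_norm: "(S *v x) \<bullet> (G *v (S *v x)) \<le> m\<^sup>2 * (x \<bullet> (G *v x))"
  using S_step[of x] mult_left_mono[OF Sm[of x] m(1)] by (simp add: power2_eq_square)

lemma mat_power_sym: "x \<bullet> (G *v (mat_power S k *v y)) = (G *v (mat_power S k *v x)) \<bullet> y"
proof (induction k arbitrary: x y)
  case 0
  then show ?case using Gsym by simp
next
  case (Suc k)
  have "x \<bullet> (G *v (mat_power S (Suc k) *v y)) = (S *v x) \<bullet> (G *v (mat_power S k *v y))"
    by (simp add: matrix_vector_mul_assoc[symmetric]) (metis Gsym Ssym inner_commute)
  also have "\<dots> = (G *v (mat_power S k *v (S *v x))) \<bullet> y" by (rule Suc)
  also have "mat_power S k *v (S *v x) = mat_power S (Suc k) *v x"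
    by (simp add: matrix_vector_mul_assoc mat_power_commute[of S S k])
  finally show ?case .
qed

text \<open>Self-adjointness moves half of the factors to the other argument: even powers reduce to
  the form \<open>G\<close>, odd powers to \<open>G S\<close>, each evaluated at
  \<open>mat_power S j *v x\<close>.\<close>

lemma mat_power_form_step:
  "0 \<le> x \<bullet> (G *v (mat_power S k *v x))"
  "x \<bullet> (G *v (mat_power S (Suc k) *v x)) \<le> x \<bullet> (G *v (mat_power S k *v x))"
proof -
  have split: "x \<bullet> (G *v (mat_power S (j + (i + j)) *v x)) = (mat_power S j *v x) \<bullet> (G *v (mat_power S i *v (mat_power S j *v x)))" for i j
    unfolding mat_power_add by (simp add: matrix_vector_mul_assoc[symmetric]) (metis mat_power_sym Gsym inner_commute)
  have m1: "m * r \<le> r" if "0 \<le> r" for r using m that by (simp add: mult_left_le_one_le)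
  have "\<exists>i j. i \<le> 1 \<and> k = j + (i + j)" by presburger
  then obtain i j where ij: "i \<le> 1" "k = j + (i + j)" by blast
  let ?z = "mat_power S j *v x"
  show "0 \<le> x \<bullet> (G *v (mat_power S k *v x))"
    unfolding ij(2) split using ij(1) S0[of ?z] G0[of ?z] by (cases "i = 0") (auto simp: le_Suc_eq)
  show "x \<bullet> (G *v (mat_power S (Suc k) *v x)) \<le> x \<bullet> (G *v (mat_power S k *v x))"
  proof (cases "i = 0")
    case True
    then have "Suc k = j + (1 + j)" using ij by simp
    then show ?thesis using split[of j 0] split[of j 1] True Sm[of ?z] m1[OF G0[of ?z]] ij(2) by simp
  next
    case False
    then have i: "i = 1" using ij by simp
    have "Suc k = Suc j + (0 + Suc j)" using ij i by simp
    moreover have "mat_power S (Suc j) *v x = S *v ?z" by (simp add: matrix_vector_mul_assoc)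
    ultimately show ?thesis using i S_step[of ?z] m1[OF S0[of ?z]] split[of j 1] split[of "Suc j" 0] ij(2) by simp
  qed
qed

lemma mat_power_form_le: "k \<ge> 1 \<Longrightarrow> x \<bullet> (G *v (mat_power S k *v x)) \<le> x \<bullet> (G *v (S *v x))"
proof (induction k rule: nat_induct_at_least)
  case (Suc k)
  then show ?case using mat_power_form_step(2)[of x k] by linarith
qed simp

text \<open>In the norm of \<open>G\<close> the matrix \<open>S\<close> contracts with ratio
  \<open>m\<close>; \<open>C\<close> pays for the comparison with the Euclidean norm.\<close>

lemma mat_power_norm: obtains C where "C > 0" "\<And>k. norm (mat_power S k) \<le> C * m ^ k"
proof -
  obtain \<alpha> \<beta> where ab: "\<alpha> > 0" "\<beta> > 0" "\<And>x. \<alpha> * (norm x)\<^sup>2 \<le> x \<bullet> (G *v x)" "\<And>x. x \<bullet> (G *v x) \<le> \<beta> * (norm x)\<^sup>2"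
    using form_bounds by metis
  have f: "(mat_power S k *v x) \<bullet> (G *v (mat_power S k *v x)) \<le> (m ^ k)\<^sup>2 * (x \<bullet> (G *v x))" for k x
  proof (induction k)
    case (Suc k)
    have "(mat_power S (Suc k) *v x) \<bullet> (G *v (mat_power S (Suc k) *v x)) \<le> m\<^sup>2 * ((mat_power S k *v x) \<bullet> (G *v (mat_power S k *v x)))"
      using S_norm[of "mat_power S k *v x"] by (simp add: matrix_vector_mul_assoc[symmetric])
    also have "\<dots> \<le> m\<^sup>2 * ((m ^ k)\<^sup>2 * (x \<bullet> (G *v x)))" using Suc by (intro mult_left_mono) auto
    finally show ?case by (simp add: power_mult_distrib mult_ac)
  qed simp
  have n: "norm (mat_power S k *v x) \<le> sqrt (\<beta> / \<alpha>) * m ^ k * norm x" for k x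
  proof -
    have "\<alpha> * (norm (mat_power S k *v x))\<^sup>2 \<le> (m ^ k)\<^sup>2 * (\<beta> * (norm x)\<^sup>2)"
      using ab(3)[of "mat_power S k *v x"] f[of k x] mult_left_mono[OF ab(4)[of x], of "(m ^ k)\<^sup>2"] by simp
    then have "(norm (mat_power S k *v x))\<^sup>2 \<le> (m ^ k)\<^sup>2 * (\<beta> * (norm x)\<^sup>2) / \<alpha>"
      using ab(1) by (subst pos_le_divide_eq) (simp_all add: mult.commute)
    also have "\<dots> = (\<beta> / \<alpha>) * (m ^ k)\<^sup>2 * (norm x)\<^sup>2" by simp
    also have "\<dots> = (sqrt (\<beta> / \<alpha>) * m ^ k * norm x)\<^sup>2" using ab by (simp add: power_mult_distrib)
    finally show ?thesis by (rule power2_le_imp_le) (use m ab(1,2) in auto)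
  qed
  define C where "C = (\<Sum>i\<in>(UNIV::'n set). \<Sum>j\<in>(UNIV::'n set). sqrt (\<beta> / \<alpha>))"
  have "norm (mat_power S k) \<le> (\<Sum>i\<in>(UNIV::'n set). \<Sum>j\<in>(UNIV::'n set). sqrt (\<beta> / \<alpha>) * m ^ k)" for k
    using n[of k "axis _ 1"] by (intro order_trans[OF norm_matrix_le_axis] sum_mono) (simp add: norm_eq_1 inner_axis)
  then have "norm (mat_power S k) \<le> C * m ^ k" for k by (simp add: C_def mult.assoc)
  moreover have "C > 0" using ab by (simp add: C_def)
  ultimately show ?thesis using that by blast
qed

abbreviation "B \<equiv> sqrt_series S"

lemma sqrt_series_sums: "(\<lambda>k. sqrt_coeff k *\<^sub>R mat_power S k) sums B"
proof -
  obtain C where C: "C > 0" "\<And>k. norm (mat_power S k) \<le> C * m ^ k" using mat_power_norm by blast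
  have "summable (\<lambda>k. sqrt_coeff k *\<^sub>R mat_power S k)"
  proof (rule summable_comparison_test')
    show "summable (\<lambda>k. C * m ^ k)" using m by (intro summable_mult summable_geometric) simp
    show "norm (sqrt_coeff k *\<^sub>R mat_power S k) \<le> C * m ^ k" if "k \<ge> 0" for k
      using C(2)[of k] mult_mono[OF sqrt_coeff_abs_le[of k] C(2)[of k]] by simp
  qed
  then show ?thesis unfolding sqrt_series_def by (rule summable_sums)
qed

lemma sqrt_series_limit: "(\<lambda>N. \<Sum>k<N. sqrt_coeff k *\<^sub>R mat_power S k) \<longlonglongrightarrow> B"
  using sqrt_series_sums by (simp add: sums_def)

lemma sqrt_series_vec: "(\<lambda>k. sqrt_coeff k *\<^sub>R (mat_power S k *v x)) sums (B *v x)"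
proof -
  note bl = bounded_bilinear_matrix_vector_mult[where 'b = complex]
  show ?thesis using bounded_linear.sums[OF bounded_bilinear.bounded_linear_left[OF bl] sqrt_series_sums]
    by (simp add: bounded_bilinear.scaleR_left[OF bl])
qed

lemma sqrt_series_form: "(\<lambda>k. sqrt_coeff k * (y \<bullet> (G *v (mat_power S k *v x)))) sums (y \<bullet> (G *v (B *v x)))"
proof -
  have "bounded_linear (\<lambda>v. y \<bullet> (G *v v))"
    by (intro bounded_linear_compose[OF bounded_linear_inner_right] bounded_bilinear.bounded_linear_right[OF bounded_bilinear_matrix_vector_mult])
  from bounded_linear.sums[OF this sqrt_series_vec[of x]] show ?thesis
    by (simp add: mv_scaleR)
qed

lemma sqrt_series_sym: "x \<bullet> (G *v (B *v y)) = (G *v (B *v x)) \<bullet> y"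
proof -
  have "y \<bullet> (G *v (mat_power S k *v x)) = x \<bullet> (G *v (mat_power S k *v y))" for k
    by (metis mat_power_sym inner_commute)
  then have "(\<lambda>k. sqrt_coeff k * (x \<bullet> (G *v (mat_power S k *v y)))) sums (y \<bullet> (G *v (B *v x)))"
    using sqrt_series_form[of y x] by simp
  then have "x \<bullet> (G *v (B *v y)) = y \<bullet> (G *v (B *v x))"
    using sums_unique2[OF sqrt_series_form] by blast
  then show ?thesis by (simp only: inner_commute)
qed

text \<open>Spectrally this is \<open>1 - x \<le> sqrt (1 - x) \<le> 1\<close>. The forms of all
  powers from the first on lie between 0 and the form of \<open>S\<close>, and their coefficients
  are negative with absolute sum at most 1.\<close>

lemma sqrt_series_bounds:
  "x \<bullet> (G *v (B *v x)) \<le> x \<bullet> (G *v x)"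
  "x \<bullet> (G *v x) - x \<bullet> (G *v (S *v x)) \<le> x \<bullet> (G *v (B *v x))"
proof -
  define p where "p k = x \<bullet> (G *v (mat_power S k *v x))" for k
  have p0: "p 0 = x \<bullet> (G *v x)" by (simp add: p_def)
  have split: "(\<Sum>k<Suc n. sqrt_coeff k * p k) = p 0 + (\<Sum>k=1..n. sqrt_coeff k * p k)" for n
    by (simp add: sum.atLeast1_atMost_eq lessThan_Suc_atMost sum.atMost_shift)
  have lim: "(\<lambda>n. \<Sum>k<Suc n. sqrt_coeff k * p k) \<longlonglongrightarrow> x \<bullet> (G *v (B *v x))"
    using sqrt_series_form[of x x] unfolding sums_def p_def by (rule LIMSEQ_Suc)
  show "x \<bullet> (G *v (B *v x)) \<le> x \<bullet> (G *v x)"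
  proof (rule LIMSEQ_le_const2[OF lim], intro exI allI impI)
    fix n
    have "(\<Sum>k=1..n. sqrt_coeff k * p k) \<le> 0"
      using sqrt_coeff_neg mat_power_form_step(1) by (intro sum_nonpos mult_nonpos_nonneg) (auto simp: p_def less_imp_le)
    then show "(\<Sum>k<Suc n. sqrt_coeff k * p k) \<le> x \<bullet> (G *v x)" unfolding split p0 by simp
  qed
  show "x \<bullet> (G *v x) - x \<bullet> (G *v (S *v x)) \<le> x \<bullet> (G *v (B *v x))"
  proof (rule LIMSEQ_le_const[OF lim], intro exI allI impI)
    fix n
    have "(\<Sum>k=1..n. - sqrt_coeff k * p k) \<le> (\<Sum>k=1..n. - sqrt_coeff k * (x \<bullet> (G *v (S *v x))))"
      using sqrt_coeff_neg mat_power_form_le by (intro sum_mono mult_left_mono) (auto simp: p_def less_imp_le)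
    also have "\<dots> = (\<Sum>k=1..n. - sqrt_coeff k) * (x \<bullet> (G *v (S *v x)))" by (simp add: sum_distrib_right)
    also have "\<dots> \<le> 1 * (x \<bullet> (G *v (S *v x)))" by (intro mult_right_mono sqrt_coeff_abs_sum S0)
    finally have "- (x \<bullet> (G *v (S *v x))) \<le> (\<Sum>k=1..n. sqrt_coeff k * p k)" by (simp add: sum_negf)
    then show "x \<bullet> (G *v x) - x \<bullet> (G *v (S *v x)) \<le> (\<Sum>k<Suc n. sqrt_coeff k * p k)" unfolding split p0 by simp
  qed
qed

lemma sqrt_series_pos: "x \<noteq> 0 \<Longrightarrow> x \<bullet> (G *v (B *v x)) > 0"
proof -
  assume x: "x \<noteq> 0"
  have "m * (x \<bullet> (G *v x)) < x \<bullet> (G *v x)" using m Gpos[OF x] by (simp add: mult_less_cancel_right1)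
  then show ?thesis using sqrt_series_bounds(2)[of x] Sm[of x] by linarith
qed

lemma sqrt_series_commute:
  assumes "A ** S = S ** A"
  shows "A ** B = B ** A"
proof -
  note bl = bounded_bilinear_matrix_matrix_mult[where 'b = complex]
  have 1: "(\<lambda>k. A ** (sqrt_coeff k *\<^sub>R mat_power S k)) sums (A ** B)"
    using bounded_linear.sums[OF bounded_bilinear.bounded_linear_right[OF bl, of A] sqrt_series_sums] .
  have 2: "(\<lambda>k. (sqrt_coeff k *\<^sub>R mat_power S k) ** A) sums (B ** A)"
    using bounded_linear.sums[OF bounded_bilinear.bounded_linear_left[OF bl, of A] sqrt_series_sums] .
  have "A ** (sqrt_coeff k *\<^sub>R mat_power S k) = (sqrt_coeff k *\<^sub>R mat_power S k) ** A" for k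
    using mat_power_commute[OF assms, of k]
    by (simp add: bounded_bilinear.scaleR_left[OF bl] bounded_bilinear.scaleR_right[OF bl])
  then show ?thesis using sums_unique2[OF 1] 2 by simp
qed

text \<open>The Cauchy product of the partial sums differs from \<open>1 - S\<close> by at most \<open>N\<^sup>2\<close> terms of
  size \<open>m\<^sup>N\<close>.\<close>

lemma sqrt_series_square: "B ** B = mat 1 - S"
proof -
  note bl = bounded_bilinear_matrix_matrix_mult[where 'b = complex]
  obtain C where C: "C > 0" "\<And>k. norm (mat_power S k) \<le> C * m ^ k" using mat_power_norm by blast
  define BN where "BN N = (\<Sum>k<N. sqrt_coeff k *\<^sub>R mat_power S k)" for N
  define t where "t = (\<lambda>(i, j). (sqrt_coeff i * sqrt_coeff j) *\<^sub>R mat_power S (i + j))"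
  have sq: "BN N ** BN N = sum t ({..<N} \<times> {..<N})" for N
    unfolding BN_def t_def
    by (simp add: bounded_bilinear.sum_left[OF bl] bounded_bilinear.sum_right[OF bl] scaleR_sum_right
        bounded_bilinear.scaleR_left[OF bl] bounded_bilinear.scaleR_right[OF bl] mat_power_add
        sum.cartesian_product[symmetric])
      (subst sum.swap, simp add: mult.commute)
  \<comment> \<open>In the triangle \<open>i + j < N\<close> all products of each degree
    \<open>k < N\<close> are present, so the convolution identity applies exactly there;
    \<open>N \<ge> 2\<close> ensures that the degrees 0 and 1 occur.\<close>
  have tri: "sum t {(i, j). i + j < N} = mat 1 - S" if "N \<ge> 2" for N
  proof -
    have "sum t {(i, j). i + j < N} = (\<Sum>k<N. \<Sum>i\<le>k. (sqrt_coeff i * sqrt_coeff (k - i)) *\<^sub>R mat_power S k)"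
      unfolding t_def by (subst sum.triangle_reindex) (auto intro!: sum.cong)
    also have "\<dots> = (\<Sum>k<N. (if k = 0 then 1 else if k = 1 then - 1 else 0 :: real) *\<^sub>R mat_power S k)"
      by (simp only: scaleR_left.sum[symmetric] sqrt_coeff_convolution)
    also have "\<dots> = (\<Sum>k\<in>{0,1}. (if k = 0 then 1 else if k = 1 then - 1 else 0 :: real) *\<^sub>R mat_power S k)"
      using that by (intro sum.mono_neutral_right) auto
    finally show ?thesis by simp
  qed
  have bound: "norm (BN N ** BN N - (mat 1 - S)) \<le> C * (real N * sqrt m ^ N)\<^sup>2" if N: "N \<ge> 2" for N
  proof -
    let ?R = "{..<N} \<times> {..<N} - {(i, j). i + j < N}"
    have sub: "{(i, j). i + j < N} \<subseteq> {..<N} \<times> {..<N}" by auto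
    have "BN N ** BN N - (mat 1 - S) = sum t ?R"
      using sum_diff[OF _ sub, of t] tri[OF N] by (simp add: sq)
    also have "norm \<dots> \<le> (\<Sum>z\<in>?R. C * m ^ N)"
    proof (rule sum_norm_le)
      fix z assume "z \<in> ?R"
      then obtain i j where z: "z = (i, j)" "i + j \<ge> N" by force
      have "norm (t z) \<le> 1 * norm (mat_power S (i + j))"
        unfolding z t_def using mult_mono[OF sqrt_coeff_abs_le[of i] sqrt_coeff_abs_le[of j]]
        by (simp add: abs_mult) (rule mult_left_le_one_le, simp_all)
      also have "\<dots> \<le> C * m ^ (i + j)" using C(2) by simp
      also have "\<dots> \<le> C * m ^ N" using C(1) m z by (intro mult_left_mono power_decreasing) auto
      finally show "norm (t z) \<le> C * m ^ N" .
    qed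
    also have "\<dots> = real (card ?R) * (C * m ^ N)" by simp
    also have "\<dots> \<le> real (N * N) * (C * m ^ N)"
    proof (intro mult_right_mono)
      have "card ?R \<le> N * N" using card_mono[of "{..<N} \<times> {..<N}" ?R] by auto
      then show "real (card ?R) \<le> real (N * N)" by (rule of_nat_mono)
    qed (use C(1) m in auto)
    \<comment> \<open>Written as a square so that the limit of \<open>N * sqrt m ^ N\<close> being 0
      can be used.\<close>
    also have "\<dots> = C * (real N * sqrt m ^ N)\<^sup>2"
      using m by (simp add: power_mult_distrib power2_eq_square power_mult_distrib[symmetric])
    finally show ?thesis .
  qed
  have "(\<lambda>N. C * (real N * sqrt m ^ N)\<^sup>2) \<longlonglongrightarrow> C * 0\<^sup>2"
    using m by (intro tendsto_intros powser_times_n_limit_0) (auto simp: real_sqrt_lt_1_iff)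
  then have z: "(\<lambda>N. C * (real N * sqrt m ^ N)\<^sup>2) \<longlonglongrightarrow> 0" by simp
  have "(\<lambda>N. BN N ** BN N - (mat 1 - S)) \<longlonglongrightarrow> 0"
    by (rule Lim_null_comparison[OF _ z]) (use bound in \<open>auto simp: eventually_sequentially intro!: exI[of _ 2]\<close>)
  moreover have "(\<lambda>N. BN N ** BN N - (mat 1 - S)) \<longlonglongrightarrow> B ** B - (mat 1 - S)"
    unfolding BN_def by (intro tendsto_intros bounded_bilinear.tendsto[OF bl] sqrt_series_limit)
  ultimately show ?thesis using LIMSEQ_unique by fastforce
qed

text \<open>Pairing the eigenvalue equation with \<open>v\<close> gives a positive real part.
  Pairing it with \<open>\<i> *s v\<close> gives a number that equals its own negative, by
  self-adjointness of \<open>B\<close> and skewness of i; so the imaginary part is 0.\<close>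

lemma sqrt_series_eigenvalues: "eigenvalues B \<subseteq> complex_of_real ` {0<..}"
proof
  fix k assume "k \<in> eigenvalues B"
  then obtain v where v: "v \<noteq> 0" "B *v v = k *s v" by (auto simp: eigenvalues_def)
  have g: "x \<bullet> (G *v (k *s v)) = Re k * (x \<bullet> (G *v v)) + Im k * (x \<bullet> (G *v (\<i> *s v)))" for x
    by (subst scaleC_eq) (simp add: matrix_vector_right_distrib mv_scaleR inner_add_right)
  have "v \<bullet> (G *v (B *v v)) = Re k * (v \<bullet> (G *v v))" unfolding v(2) g by (simp add: G_ii)
  then have re: "Re k > 0" using sqrt_series_pos[OF v(1)] Gpos[OF v(1)] by (simp add: zero_less_mult_iff)
  have ii: "(\<i> *s v) \<bullet> (G *v v) = 0" using G_ii[of v] by (metis Gsym inner_commute)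
  have vv: "(\<i> *s v) \<bullet> (G *v (\<i> *s v)) = v \<bullet> (G *v v)"
    unfolding matrix_vector_mult_scaleC by (rule inner_ii_ii)
  have "(\<i> *s v) \<bullet> (G *v (B *v v)) = Im k * (v \<bullet> (G *v v))"
    by (simp only: v(2) g ii vv)
  moreover have "(\<i> *s v) \<bullet> (G *v (B *v v)) = v \<bullet> (G *v (B *v (\<i> *s v)))"
    by (subst sqrt_series_sym) (rule inner_commute)
  moreover have "v \<bullet> (G *v (B *v (\<i> *s v))) = - ((\<i> *s v) \<bullet> (G *v (B *v v)))"
    by (simp add: matrix_vector_mult_scaleC inner_ii)
  ultimately have "Im k * (v \<bullet> (G *v v)) = 0" by linarith
  then have "Im k = 0" using Gpos[OF v(1)] by simp
  then have "k = complex_of_real (Re k)" by (simp add: complex_eq_iff)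
  then show "k \<in> complex_of_real ` {0<..}" using re by blast
qed

text \<open>\<open>B'\<close> is not assumed self-adjoint. As a root of \<open>mat 1 - S\<close> it
  commutes with \<open>S\<close>, hence with the series \<open>B\<close>, and
  \<open>(B' + B) ** (B' - B) = 0\<close>. If \<open>B' \<noteq> B\<close>, the kernel of
  \<open>B' + B\<close> is nonzero and invariant under \<open>S\<close>, so it contains an
  eigenvector of \<open>S\<close>. There \<open>B\<close> acts by some \<mu> > 0, and -\<mu> would
  be an eigenvalue of \<open>B'\<close>.\<close>

lemma sqrt_unique:
  assumes B': "B' ** B' = mat 1 - S" "eigenvalues B' \<subseteq> complex_of_real ` {0<..}"
  shows "B' = B"
proof (rule ccontr)
  assume ne: "B' \<noteq> B"
  have S: "S = mat 1 - B' ** B'" using B'(1) by simp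
  have c1: "B' ** S = S ** B'" unfolding S by (simp add: mm_diff matrix_mul_assoc)
  have c: "B' ** B = B ** B'" by (rule sqrt_series_commute[OF c1])
  have c2: "B ** S = S ** B" by (rule sqrt_series_commute[symmetric]) simp
  define N where "N = {w. B' *v w + B *v w = 0}"
  have N: "N = {w. (B' + B) *v w = 0}" by (simp add: N_def matrix_vector_mult_add_rdistrib)
  have "subspace N" by (auto simp: N subspace_def matrix_vector_right_distrib)
  moreover have "N \<noteq> {0}"
  proof -
    obtain x where x: "B' *v x \<noteq> B *v x" using ne matrix_eqI_vec by blast
    have "B' ** (B' - B) + B ** (B' - B) = 0"
      using c B'(1) sqrt_series_square by (simp add: mm_diff)
    then have "B' *v ((B' - B) *v x) + B *v ((B' - B) *v x) = 0"
      by (metis matrix_vector_mul_assoc matrix_vector_mult_add_rdistrib matrix_vector_mult_0)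
    moreover have "(B' - B) *v x \<noteq> 0" using x by (simp add: matrix_vector_mult_diff_rdistrib)
    ultimately show ?thesis unfolding N_def by blast
  qed
  moreover have "S *v x \<in> N" if "x \<in> N" for x
  proof -
    have "B' *v (S *v x) + B *v (S *v x) = S *v (B' *v x + B *v x)"
      by (simp add: matrix_vector_right_distrib matrix_vector_mul_assoc c1 c2)
    then show ?thesis using that by (simp add: N_def)
  qed
  ultimately obtain v k where v: "v \<in> N" "v \<noteq> 0" "S *v v = k *\<^sub>R v"
    using rayleigh[OF Ssym, of N] by metis
  have pk: "mat_power S j *v v = k ^ j *\<^sub>R v" for j
    by (induction j) (auto simp: matrix_vector_mul_assoc[symmetric] v(3) mv_scaleR)
  have s1: "(\<lambda>j. (sqrt_coeff j * k ^ j) *\<^sub>R v) sums (B *v v)" using sqrt_series_vec[of v] by (simp add: pk)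
  have "summable (\<lambda>j. sqrt_coeff j * k ^ j)"
  proof -
    have "summable (\<lambda>j. ((sqrt_coeff j * k ^ j) *\<^sub>R v) \<bullet> v)"
      using s1 bounded_linear.summable[OF bounded_linear_inner_left] sums_summable by blast
    then have "summable (\<lambda>j. (v \<bullet> v) * (sqrt_coeff j * k ^ j))" by (simp add: mult.commute)
    then show ?thesis by (rule summable_mult_D) (use v(2) in simp)
  qed
  then have "(\<lambda>j. (sqrt_coeff j * k ^ j) *\<^sub>R v) sums ((\<Sum>j. sqrt_coeff j * k ^ j) *\<^sub>R v)"
    using bounded_linear.sums[OF bounded_linear_scaleR_left summable_sums] by blast
  then obtain \<mu> where \<mu>: "B *v v = \<mu> *\<^sub>R v" using s1 sums_unique2 by blast
  have "\<mu> * (v \<bullet> (G *v v)) > 0" using sqrt_series_pos[OF v(2)] by (simp add: \<mu> mv_scaleR)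
  then have "\<mu> > 0" using Gpos[OF v(2)] by (simp add: zero_less_mult_iff)
  have "B' *v v = complex_of_real (- \<mu>) *s v"
    using v(1) \<mu> by (simp add: N_def eq_neg_iff_add_eq_0[symmetric] vec_eq_iff complex_eq_iff)
  then have "complex_of_real (- \<mu>) \<in> eigenvalues B'" using v(2) unfolding eigenvalues_def by blast
  then have "complex_of_real (- \<mu>) \<in> complex_of_real ` {0<..}" using B'(2) by blast
  then show False using \<open>\<mu> > 0\<close> by (auto simp del: of_real_minus)
qed

lemma matrix_sqrt_eq: "matrix_sqrt (mat 1 - S) = B"
  unfolding matrix_sqrt_def
  by (rule the_equality) (simp_all add: sqrt_series_square sqrt_series_eigenvalues sqrt_unique)

end

section \<open>Series of \<open>C\<^sup>k\<close> functions\<close>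

text \<open>Needed because the square root series is controlled only near each point, in a norm
  depending on that point.\<close>

lemma Ck_on_local:
  assumes "open S" "\<And>x. x \<in> S \<Longrightarrow> \<exists>U. open U \<and> x \<in> U \<and> Ck_on k U f"
  shows "Ck_on k S f"
  using assms(2)
proof (induction k arbitrary: f)
  case 0
  have "continuous (at x) f" if "x \<in> S" for x
  proof -
    obtain U where "open U" "x \<in> U" "continuous_on U f" using 0 \<open>x \<in> S\<close> by auto
    then show ?thesis by (simp add: continuous_on_eq_continuous_at)
  qed
  then show ?case by (simp add: continuous_at_imp_continuous_on)
next
  case (Suc k)
  have "f differentiable (at x)" if "x \<in> S" for x using Suc.prems[OF that] by auto
  moreover have "Ck_on k S (\<lambda>x. frechet_derivative f (at x) v)" for v
  proof (rule Suc.IH)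
    fix x assume "x \<in> S"
    then obtain U where "open U" "x \<in> U" "Ck_on (Suc k) U f" using Suc.prems by blast
    then show "\<exists>U. open U \<and> x \<in> U \<and> Ck_on k U (\<lambda>x. frechet_derivative f (at x) v)" by auto
  qed
  ultimately show ?case by simp
qed

lemma has_derivative_partial_sum:
  fixes f :: "real^'n \<Rightarrow> 'b::real_normed_vector"
  assumes "Ck_on (Suc k) S f" "x \<in> S"
  shows "(f has_derivative (\<lambda>h. \<Sum>i\<in>UNIV. (h $ i) *\<^sub>R partial i f x)) (at x)"
proof -
  let ?D = "frechet_derivative f (at x)"
  have d: "(f has_derivative ?D) (at x)" by (rule Ck_on_has_derivative[OF assms])
  then have lin: "linear ?D" by (rule has_derivative_linear)
  have "?D h = (\<Sum>i\<in>UNIV. (h $ i) *\<^sub>R partial i f x)" for h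
  proof -
    have "h = (\<Sum>i\<in>UNIV. (h $ i) *\<^sub>R axis i 1)" by (simp add: vec_eq_iff axis_def if_distrib cong: if_cong)
    then have "?D h = ?D (\<Sum>i\<in>UNIV. (h $ i) *\<^sub>R axis i 1)" by simp
    also have "\<dots> = (\<Sum>i\<in>UNIV. (h $ i) *\<^sub>R partial i f x)"
      by (simp add: linear_sum[OF lin] linear_scale[OF lin] partial_def)
    finally show ?thesis .
  qed
  then have "?D = (\<lambda>h. \<Sum>i\<in>UNIV. (h $ i) *\<^sub>R partial i f x)" by (rule ext)
  then show ?thesis using d by simp
qed

lemma Ck_on_SucI_partial:
  fixes f :: "real^'n \<Rightarrow> 'b::real_normed_vector"
  assumes "open S" "\<And>x. x \<in> S \<Longrightarrow> (f has_derivative (\<lambda>h. \<Sum>i\<in>UNIV. (h $ i) *\<^sub>R g i x)) (at x)"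
    and "\<And>i. Ck_on k S (g i)"
  shows "Ck_on (Suc k) S f"
  by (rule Ck_on_SucI[OF assms(1,2)])
    (auto intro!: Ck_on_sum Ck_on_linear[OF bounded_linear_scaleR_right] assms(1,3))

section \<open>Uniform geometric decay of derivatives\<close>

primrec bddD :: "nat \<Rightarrow> (real^'n) set \<Rightarrow> (real^'n \<Rightarrow> 'b::real_normed_vector) \<Rightarrow> bool" where
  "bddD 0 U f \<longleftrightarrow> (\<exists>C. \<forall>y\<in>U. norm (f y) \<le> C)"
| "bddD (Suc k) U f \<longleftrightarrow> (\<exists>C. \<forall>y\<in>U. norm (f y) \<le> C) \<and> (\<forall>i. bddD k U (partial i f))"

text \<open>Constant and ratio are chosen separately for every derivative: differentiating a matrix
  power produces factors growing with \<open>k\<close>, which are absorbed by a slightly larger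
  ratio.\<close>

primrec geoD :: "nat \<Rightarrow> (real^'n) set \<Rightarrow> (nat \<Rightarrow> real^'n \<Rightarrow> 'b::real_normed_vector) \<Rightarrow> bool" where
  "geoD 0 U g \<longleftrightarrow> (\<exists>C \<rho>. 0 \<le> \<rho> \<and> \<rho> < 1 \<and> (\<forall>k. \<forall>y\<in>U. norm (g k y) \<le> C * \<rho> ^ k))"
| "geoD (Suc j) U g \<longleftrightarrow> (\<exists>C \<rho>. 0 \<le> \<rho> \<and> \<rho> < 1 \<and> (\<forall>k. \<forall>y\<in>U. norm (g k y) \<le> C * \<rho> ^ k))
     \<and> (\<forall>i. geoD j U (\<lambda>k. partial i (g k)))"

lemma geoD_0: "geoD j U g \<Longrightarrow> geoD 0 U g" by (cases j) auto
lemma bddD_0: "bddD j U g \<Longrightarrow> bddD 0 U g" by (cases j) auto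

lemma geoD_0I:
  assumes "0 \<le> \<rho>" "\<rho> < 1" "\<And>k y. y \<in> U \<Longrightarrow> norm (g k y) \<le> C * \<rho> ^ k"
  shows "geoD 0 U g"
  using assms by auto

lemma geoD_pred: "geoD (Suc j) U g \<Longrightarrow> geoD j U g"
  by (induction j arbitrary: g) auto

lemma bddD_pred: "bddD (Suc j) U g \<Longrightarrow> bddD j U g"
  by (induction j arbitrary: g) auto

lemma geoD_cong:
  assumes "open U" "\<And>k y. y \<in> U \<Longrightarrow> g k y = h k y"
  shows "geoD j U g \<longleftrightarrow> geoD j U h"
  using assms(2)
proof (induction j arbitrary: g h)
  case 0
  then show ?case by simp
next
  case (Suc j)
  have "geoD j U (\<lambda>k. partial i (g k)) \<longleftrightarrow> geoD j U (\<lambda>k. partial i (h k))" for i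
    by (rule Suc.IH) (rule partial_cong_open[OF assms(1) _ Suc.prems])
  then show ?case using Suc.prems by simp
qed

lemma bddD_compact:
  assumes "open S" "compact K" "K \<subseteq> S" "U \<subseteq> K" "Ck_on j S f"
  shows "bddD j U f"
  using assms(5)
proof (induction j arbitrary: f)
  case 0
  have "bounded (f ` K)"
    by (rule compact_imp_bounded[OF compact_continuous_image[OF continuous_on_subset assms(2)]])
      (use 0 assms(3) in auto)
  then obtain C where "\<And>y. y \<in> K \<Longrightarrow> norm (f y) \<le> C" by (auto simp: bounded_iff)
  then show ?case using assms(4) by (auto intro!: exI[of _ C])
next
  case (Suc j)
  have "bounded (f ` K)"
    by (rule compact_imp_bounded[OF compact_continuous_image[OF continuous_on_subset assms(2)]])
      (use Ck_on_continuous[OF Suc.prems] assms(3) in auto)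
  then obtain C where C: "\<And>y. y \<in> K \<Longrightarrow> norm (f y) \<le> C" by (auto simp: bounded_iff)
  have "bddD j U (partial i f)" for i by (rule Suc.IH[OF Ck_on_partial[OF Suc.prems]])
  then show ?case using C assms(4) by (auto intro!: exI[of _ C])
qed

lemma geoD_0_add:
  assumes "geoD 0 U g" "geoD 0 U h"
  shows "geoD 0 U (\<lambda>k y. g k y + h k y)"
proof -
  obtain C \<rho> where 1: "0 \<le> \<rho>" "\<rho> < 1" "\<And>k y. y \<in> U \<Longrightarrow> norm (g k y) \<le> C * \<rho> ^ k" using assms(1) by auto
  obtain D \<sigma> where 2: "0 \<le> \<sigma>" "\<sigma> < 1" "\<And>k y. y \<in> U \<Longrightarrow> norm (h k y) \<le> D * \<sigma> ^ k" using assms(2) by auto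
  have "norm (g k y + h k y) \<le> (\<bar>C\<bar> + \<bar>D\<bar>) * (max \<rho> \<sigma>) ^ k" if "y \<in> U" for k y
  proof -
    have "norm (g k y) \<le> \<bar>C\<bar> * (max \<rho> \<sigma>) ^ k"
      using 1 that by (intro order_trans[OF 1(3)[OF that]] mult_mono power_mono) auto
    moreover have "norm (h k y) \<le> \<bar>D\<bar> * (max \<rho> \<sigma>) ^ k"
      using 2 that by (intro order_trans[OF 2(3)[OF that]] mult_mono power_mono) auto
    ultimately show ?thesis using norm_triangle_ineq[of "g k y" "h k y"] by (simp add: algebra_simps)
  qed
  then show ?thesis by (intro geoD_0I[of "max \<rho> \<sigma>"]) (use 1 2 in auto)
qed

lemma partial_add:
  fixes f g :: "real^'n \<Rightarrow> 'b::real_normed_vector"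
  assumes "Ck_on (Suc j) U f" "Ck_on (Suc j) U g" "y \<in> U"
  shows "partial i (\<lambda>y. f y + g y) y = partial i f y + partial i g y"
  using partial_eq[OF has_derivative_add[OF assms(1,2)[THEN Ck_on_has_derivative, OF assms(3)]]]
  by (simp add: partial_def)

lemma geoD_add:
  assumes "open U" "\<And>k. Ck_on j U (g k)" "\<And>k. Ck_on j U (h k)" "geoD j U g" "geoD j U h"
  shows "geoD j U (\<lambda>k y. g k y + h k y)"
  using assms(2-)
proof (induction j arbitrary: g h)
  case 0
  then show ?case using geoD_0_add by blast
next
  case (Suc j)
  have "geoD j U (\<lambda>k. partial i (\<lambda>y. g k y + h k y))" for i
  proof (subst geoD_cong[OF assms(1)])
    show "partial i (\<lambda>y. g k y + h k y) y = partial i (g k) y + partial i (h k) y" if "y \<in> U" for k y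
      by (rule partial_add[OF Suc.prems(1,2) that])
    show "geoD j U (\<lambda>k y. partial i (g k) y + partial i (h k) y)"
      using Suc.prems by (intro Suc.IH Ck_on_partial) auto
  qed
  moreover have "geoD 0 U (\<lambda>k y. g k y + h k y)"
    using Suc.prems by (intro geoD_0_add geoD_0[of "Suc j"]) auto
  ultimately show ?case by simp
qed

lemma partial_bilinear:
  fixes f :: "real^'n \<Rightarrow> 'a::real_normed_vector" and g :: "real^'n \<Rightarrow> 'b::real_normed_vector"
  assumes "bounded_bilinear b" "Ck_on (Suc j) U f" "Ck_on (Suc j) U g" "y \<in> U"
  shows "partial i (\<lambda>y. b (f y) (g y)) y = b (f y) (partial i g y) + b (partial i f y) (g y)"
  using partial_eq[OF bounded_bilinear.FDERIV[OF assms(1)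
    assms(2)[THEN Ck_on_has_derivative, OF assms(4)] assms(3)[THEN Ck_on_has_derivative, OF assms(4)]]]
  by (simp add: partial_def)

lemma geoD_0_bilinear:
  fixes f :: "real^'n \<Rightarrow> 'a::real_normed_vector" and g :: "nat \<Rightarrow> real^'n \<Rightarrow> 'b::real_normed_vector"
  assumes b: "bounded_bilinear b" and "bddD 0 U f" "geoD 0 U g"
  shows "geoD 0 U (\<lambda>k y. b (f y) (g k y))"
proof -
  obtain A where A: "\<And>y. y \<in> U \<Longrightarrow> norm (f y) \<le> A" using assms(2) by auto
  obtain C \<rho> where 1: "0 \<le> \<rho>" "\<rho> < 1" "\<And>k y. y \<in> U \<Longrightarrow> norm (g k y) \<le> C * \<rho> ^ k" using assms(3) by auto
  obtain K where K: "0 \<le> K" "\<And>x y. norm (b x y) \<le> norm x * norm y * K"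
    using bounded_bilinear.nonneg_bounded[OF b] by blast
  have "norm (b (f y) (g k y)) \<le> (A * C * K) * \<rho> ^ k" if "y \<in> U" for k y
  proof -
    have "norm (b (f y) (g k y)) \<le> norm (f y) * norm (g k y) * K" by (rule K(2))
    also have "\<dots> \<le> A * (C * \<rho> ^ k) * K"
      using A[OF that] 1(3)[OF that] K(1) by (intro mult_right_mono mult_mono) (auto intro: order_trans[OF norm_ge_zero])
    finally show ?thesis by (simp add: mult_ac)
  qed
  then show ?thesis using 1 by auto
qed

lemma geoD_bilinear:
  fixes f :: "real^'n \<Rightarrow> 'a::real_normed_vector" and g :: "nat \<Rightarrow> real^'n \<Rightarrow> 'b::real_normed_vector"
  assumes b: "bounded_bilinear b" and "open U"
    and "Ck_on j U f" "\<And>k. Ck_on j U (g k)" "bddD j U f" "geoD j U g"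
  shows "geoD j U (\<lambda>k y. b (f y) (g k y))"
  using assms(3-)
proof (induction j arbitrary: f g)
  case 0
  then show ?case using geoD_0_bilinear[OF b] by blast
next
  case (Suc j)
  have p: "Ck_on j U f" "\<And>k. Ck_on j U (g k)" "bddD j U f" "geoD j U g"
    using Suc.prems Ck_on_pred bddD_pred geoD_pred by blast+
  have "geoD j U (\<lambda>k. partial i (\<lambda>y. b (f y) (g k y)))" for i
  proof (subst geoD_cong[OF assms(2)])
    show "partial i (\<lambda>y. b (f y) (g k y)) y = b (f y) (partial i (g k) y) + b (partial i f y) (g k y)" if "y \<in> U" for k y
      by (rule partial_bilinear[OF b Suc.prems(1,2) that])
    have 1: "Ck_on j U (partial i f)" "\<And>k. Ck_on j U (partial i (g k))"
      using Suc.prems by (auto intro: Ck_on_partial)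
    have 2: "bddD j U (partial i f)" "geoD j U (\<lambda>k. partial i (g k))" using Suc.prems by auto
    show "geoD j U (\<lambda>k y. b (f y) (partial i (g k) y) + b (partial i f y) (g k y))"
      by (intro geoD_add Suc.IH Ck_on_bilinear[OF b] assms(2) p 1 2)
  qed
  moreover have "geoD 0 U (\<lambda>k y. b (f y) (g k y))"
    using Suc.prems by (intro geoD_0_bilinear[OF b] geoD_0[of "Suc j"] bddD_0[of "Suc j"]) auto
  ultimately show ?case by simp
qed

lemma summable_geoD:
  fixes g :: "nat \<Rightarrow> real^'n \<Rightarrow> 'b::banach"
  assumes "\<And>k y. y \<in> U \<Longrightarrow> norm (g k y) \<le> C * \<rho> ^ k" "0 \<le> \<rho>" "\<rho> < 1" "y \<in> U"
  shows "summable (\<lambda>k. g k y)"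
  by (rule summable_comparison_test'[where g = "\<lambda>k. C * \<rho> ^ k"])
    (use assms in \<open>auto intro!: summable_mult summable_geometric\<close>)

lemma suminf_geo_tail:
  fixes a :: "nat \<Rightarrow> 'b::banach"
  assumes a: "\<And>k. norm (a k) \<le> C * \<rho> ^ k" and "0 \<le> \<rho>" "\<rho> < 1"
  shows "norm ((\<Sum>i<n. a i) - (\<Sum>i. a i)) \<le> C * \<rho> ^ n / (1 - \<rho>)"
proof -
  have s: "summable a"
    by (rule summable_comparison_test'[OF _ a]) (use assms in \<open>auto intro!: summable_mult summable_geometric\<close>)
  have g: "(\<lambda>k. C * \<rho> ^ n * \<rho> ^ k) sums (C * \<rho> ^ n * (1 / (1 - \<rho>)))"
    using assms by (intro sums_mult geometric_sums) auto
  have "norm ((\<Sum>i<n. a i) - (\<Sum>i. a i)) = norm (\<Sum>i. a (i + n))"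
    unfolding suminf_split_initial_segment[OF s, of n] by (simp add: norm_minus_commute)
  also have "\<dots> \<le> (\<Sum>i. C * \<rho> ^ n * \<rho> ^ i)"
  proof (rule norm_suminf_le)
    show "norm (a (i + n)) \<le> C * \<rho> ^ n * \<rho> ^ i" for i using a[of "i + n"] by (simp add: power_add mult_ac)
    show "summable (\<lambda>i. C * \<rho> ^ n * \<rho> ^ i)" using g by (rule sums_summable)
  qed
  also have "\<dots> = C * \<rho> ^ n * (1 / (1 - \<rho>))" using g by (rule sums_unique[symmetric])
  finally show ?thesis by simp
qed

lemma geo_tail_eventually:
  assumes "0 \<le> \<rho>" "\<rho> < (1::real)" "e > 0"
  shows "\<forall>\<^sub>F n in sequentially. C * \<rho> ^ n / (1 - \<rho>) < e"
proof -
  have "(\<lambda>n. C * \<rho> ^ n / (1 - \<rho>)) \<longlonglongrightarrow> C * 0 / (1 - \<rho>)"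
    using assms by (intro tendsto_intros LIMSEQ_power_zero) auto
  then show ?thesis using assms(3) by (intro order_tendstoD(2)[where y = "C * 0 / (1 - \<rho>)"]) auto
qed

text \<open>Termwise differentiation. The geometric tails of the partial derivatives give the
  uniform convergence that \<open>has_derivative_series\<close> requires on the convex set
  \<open>U\<close>.\<close>

lemma Ck_on_series:
  fixes g :: "nat \<Rightarrow> real^'n \<Rightarrow> 'b::banach"
  assumes U: "open U" "convex U" and "\<And>k. Ck_on j U (g k)" "geoD j U g"
  shows "Ck_on j U (\<lambda>y. \<Sum>k. g k y)"
  using assms(3,4)
proof (induction j arbitrary: g)
  case 0
  obtain C \<rho> where 1: "0 \<le> \<rho>" "\<rho> < 1" "\<And>k y. y \<in> U \<Longrightarrow> norm (g k y) \<le> C * \<rho> ^ k" using 0(2) by auto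
  have "uniform_limit U (\<lambda>n y. \<Sum>k<n. g k y) (\<lambda>y. \<Sum>k. g k y) sequentially"
    by (rule Weierstrass_m_test[where M = "\<lambda>k. C * \<rho> ^ k"])
      (use 1 in \<open>auto intro!: summable_mult summable_geometric\<close>)
  moreover have "\<forall>\<^sub>F n in sequentially. continuous_on U (\<lambda>y. \<Sum>k<n. g k y)"
    using 0(1) by (intro always_eventually allI continuous_on_sum) auto
  ultimately have "continuous_on U (\<lambda>y. \<Sum>k. g k y)"
    by (intro uniform_limit_theorem[rotated]) auto
  then show ?case by simp
next
  case (Suc j)
  obtain C \<rho> where 1: "0 \<le> \<rho>" "\<rho> < 1" "\<And>k y. y \<in> U \<Longrightarrow> norm (g k y) \<le> C * \<rho> ^ k"
    using geoD_0[OF Suc.prems(2)] unfolding geoD.simps by blast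
  have geo: "geoD j U (\<lambda>k. partial i (g k))" for i using Suc.prems(2) by auto
  have "\<forall>i. \<exists>C \<rho>. 0 \<le> \<rho> \<and> \<rho> < 1 \<and> (\<forall>k. \<forall>y\<in>U. norm (partial i (g k) y) \<le> C * \<rho> ^ k)"
    using geoD_0[OF geo] by simp
  then obtain D \<sigma> where D: "\<And>i. 0 \<le> \<sigma> i" "\<And>i. \<sigma> i < 1" "\<And>i k y. y \<in> U \<Longrightarrow> norm (partial i (g k) y) \<le> D i * \<sigma> i ^ k"
    by metis
  show ?case
  proof (rule Ck_on_SucI_partial[OF U(1)])
    show "Ck_on j U (\<lambda>y. \<Sum>k. partial i (g k) y)" for i
      using Suc.prems by (intro Suc.IH Ck_on_partial geo)
    fix x assume x: "x \<in> U"
    let ?g' = "\<lambda>y h. \<Sum>i\<in>UNIV. (h $ i) *\<^sub>R (\<Sum>k. partial i (g k) y)"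
    have "\<exists>G. \<forall>y\<in>U. (\<lambda>n. g n y) sums (G y) \<and> (G has_derivative ?g' y) (at y within U)"
    proof (rule has_derivative_series[OF U(2), where f' = "\<lambda>k y h. \<Sum>i\<in>UNIV. (h $ i) *\<^sub>R partial i (g k) y"])
      show "(g n has_derivative (\<lambda>h. \<Sum>i\<in>UNIV. (h $ i) *\<^sub>R partial i (g n) y)) (at y within U)" if "y \<in> U" for n y
        by (rule has_derivative_at_withinI[OF has_derivative_partial_sum[OF Suc.prems(1) that]])
      show "x \<in> U" by (rule x)
      show "(\<lambda>n. g n x) sums (\<Sum>k. g k x)"
        by (rule summable_sums[OF summable_geoD[OF 1(3,1,2) x]])
      fix e :: real assume e: "e > 0"
      let ?N = "real CARD('n)"
      have "\<forall>\<^sub>F n in sequentially. \<forall>i. D i * \<sigma> i ^ n / (1 - \<sigma> i) < e / ?N"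
        using D e by (intro eventually_all_finite geo_tail_eventually) auto
      then show "\<forall>\<^sub>F n in sequentially. \<forall>y\<in>U. \<forall>h. norm ((\<Sum>k<n. \<Sum>i\<in>UNIV. (h $ i) *\<^sub>R partial i (g k) y) - ?g' y h) \<le> e * norm h"
      proof eventually_elim
        case (elim n)
        show ?case
        proof (intro ballI allI)
          fix y h assume y: "y \<in> U"
          have "(\<Sum>k<n. \<Sum>i\<in>UNIV. (h $ i) *\<^sub>R partial i (g k) y) - ?g' y h =
              (\<Sum>i\<in>UNIV. (h $ i) *\<^sub>R ((\<Sum>k<n. partial i (g k) y) - (\<Sum>k. partial i (g k) y)))"
            by (subst sum.swap) (simp add: scaleR_sum_right scaleR_diff_right sum_subtractf)
          also have "norm \<dots> \<le> (\<Sum>i\<in>(UNIV::'n set). norm h * (e / ?N))"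
          proof (rule sum_norm_le)
            fix i
            have "norm ((\<Sum>k<n. partial i (g k) y) - (\<Sum>k. partial i (g k) y)) \<le> D i * \<sigma> i ^ n / (1 - \<sigma> i)"
              by (rule suminf_geo_tail) (use D y in auto)
            then have "norm ((\<Sum>k<n. partial i (g k) y) - (\<Sum>k. partial i (g k) y)) \<le> e / ?N"
              using elim by (meson less_imp_le order_trans)
            moreover have "\<bar>h $ i\<bar> \<le> norm h" by (rule component_le_norm_cart)
            ultimately show "norm ((h $ i) *\<^sub>R ((\<Sum>k<n. partial i (g k) y) - (\<Sum>k. partial i (g k) y))) \<le> norm h * (e / ?N)"
              using e by (simp only: norm_scaleR real_norm_def) (intro mult_mono, auto)
          qed
          also have "\<dots> = e * norm h" by simp
          finally show "norm ((\<Sum>k<n. \<Sum>i\<in>UNIV. (h $ i) *\<^sub>R partial i (g k) y) - ?g' y h) \<le> e * norm h" .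
        qed
      qed
    qed
    then obtain G where G: "\<And>y. y \<in> U \<Longrightarrow> (\<lambda>n. g n y) sums (G y)" "(G has_derivative ?g' x) (at x within U)"
      using x by blast
    have "(G has_derivative ?g' x) (at x)" using G(2) at_within_open[OF x U(1)] by simp
    then show "((\<lambda>y. \<Sum>k. g k y) has_derivative ?g' x) (at x)"
      by (rule has_derivative_transform_within_open[OF _ U(1) x]) (use G(1) sums_unique in blast)
  qed
qed

text \<open>The first order part of the estimate absorbs a loss \<open>\<rho> < \<tau>\<close> in the ratio, so
  that the inhomogeneity \<open>e\<close> may decay at any geometric rate.\<close>

lemma geoD_recursion:
  fixes S :: "real^'n \<Rightarrow> complex^'m^'m" and g e :: "nat \<Rightarrow> real^'n \<Rightarrow> complex^'m"
  assumes U: "open U" and p: "\<And>x y. p (x + y) \<le> p x + p y" "\<alpha> > 0" "\<And>x. \<alpha> * norm x \<le> p x" "\<And>x. p x \<le> \<beta> * norm x"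
    and \<rho>: "0 \<le> \<rho>" "\<rho> < 1" "\<And>y x. y \<in> U \<Longrightarrow> p (S y *v x) \<le> \<rho> * p x"
    and "Ck_on j U S" "bddD j U S" "\<And>k. Ck_on j U (g k)" "bddD j U (g 0)" "\<And>k. Ck_on j U (e k)" "geoD j U e"
    and "\<And>k y. y \<in> U \<Longrightarrow> g (Suc k) y = S y *v g k y + e k y"
  shows "geoD j U g"
  using assms(9-)
proof (induction j arbitrary: g e)
  case 0
  obtain G where G: "\<And>y. y \<in> U \<Longrightarrow> norm (g 0 y) \<le> G" using 0(4) by auto
  obtain C \<sigma> where e: "0 \<le> \<sigma>" "\<sigma> < 1" "\<And>k y. y \<in> U \<Longrightarrow> norm (e k y) \<le> C * \<sigma> ^ k" using 0(6) by auto
  have \<beta>: "\<beta> \<ge> 0" using p(2) p(3,4)[of "axis undefined 1"] by (simp add: norm_eq_1 inner_axis)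
  define \<tau> where "\<tau> = (1 + max \<rho> \<sigma>) / 2"
  have \<tau>: "\<rho> < \<tau>" "\<sigma> \<le> \<tau>" "\<tau> < 1" "0 \<le> \<tau>" using \<rho> e by (auto simp: \<tau>_def)
  \<comment> \<open>Large enough for the start of the induction and for its step, which needs
    \<open>\<rho> * D + \<beta> * \<bar>C\<bar> \<le> D * \<tau>\<close>.\<close>
  define D where "D = max (\<beta> * \<bar>G\<bar>) (\<beta> * \<bar>C\<bar> / (\<tau> - \<rho>))"
  have D: "\<beta> * \<bar>G\<bar> \<le> D" "\<beta> * \<bar>C\<bar> \<le> D * (\<tau> - \<rho>)"
  proof -
    have "\<beta> * \<bar>C\<bar> / (\<tau> - \<rho>) \<le> D" by (simp add: D_def)
    then show "\<beta> * \<bar>C\<bar> \<le> D * (\<tau> - \<rho>)" using \<tau>(1) by (simp add: pos_divide_le_eq)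
  qed (simp add: D_def)
  have D0: "D \<ge> 0" using D(1) \<beta> by (meson abs_ge_zero mult_nonneg_nonneg order_trans)
  have "p (g k y) \<le> D * \<tau> ^ k" if y: "y \<in> U" for k y
  proof (induction k)
    case 0
    have "p (g 0 y) \<le> \<beta> * \<bar>G\<bar>" using p(4)[of "g 0 y"] mult_left_mono[OF _ \<beta>, of "norm (g 0 y)" "\<bar>G\<bar>"] G[OF y] by linarith
    then show ?case using D(1) by simp
  next
    case (Suc k)
    have "p (e k y) \<le> \<beta> * norm (e k y)" by (rule p(4))
    also have "\<dots> \<le> \<beta> * (\<bar>C\<bar> * \<tau> ^ k)"
      using \<tau> e(1) by (intro mult_left_mono \<beta> order_trans[OF e(3)[OF y]] mult_mono power_mono) auto
    also have "\<dots> \<le> (D * (\<tau> - \<rho>)) * \<tau> ^ k" using mult_right_mono[OF D(2), of "\<tau> ^ k"] \<tau>(4) by (simp add: mult_ac)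
    finally have 1: "p (e k y) \<le> (D * (\<tau> - \<rho>)) * \<tau> ^ k" .
    have 2: "p (S y *v g k y) \<le> \<rho> * (D * \<tau> ^ k)"
      using \<rho>(3)[OF y, of "g k y"] mult_left_mono[OF Suc \<rho>(1)] by linarith
    have "p (g (Suc k) y) \<le> \<rho> * (D * \<tau> ^ k) + (D * (\<tau> - \<rho>)) * \<tau> ^ k"
      using 1 2 p(1)[of "S y *v g k y" "e k y"] 0(7)[OF y, of k] by simp
    also have "\<dots> = D * \<tau> ^ Suc k" by (simp add: algebra_simps)
    finally show ?case .
  qed
  then have "norm (g k y) \<le> (D / \<alpha>) * \<tau> ^ k" if "y \<in> U" for k y
    using that p(3)[of "g k y"] p(2) by (simp add: pos_le_divide_eq mult.commute) (meson order_trans)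
  then show ?case by (rule geoD_0I[OF \<tau>(4,3)])
next
  case (Suc j)
  note bl = bounded_bilinear_matrix_vector_mult[where 'b = complex]
  have pr: "Ck_on j U S" "bddD j U S" "\<And>k. Ck_on j U (g k)" "bddD j U (g 0)" "\<And>k. Ck_on j U (e k)" "geoD j U e"
    using Suc.prems Ck_on_pred bddD_pred geoD_pred by blast+
  have gj: "geoD j U g" by (rule Suc.IH[OF pr Suc.prems(7)])
  \<comment> \<open>A derivative of \<open>g\<close> obeys the same recursion, with
    \<open>partial i S\<close> acting on \<open>g\<close> as an additional inhomogeneity; by
    \<open>gj\<close> this decays geometrically.\<close>
  have "geoD j U (\<lambda>k. partial i (g k))" for i
  proof (rule Suc.IH[where e = "\<lambda>k y. partial i S y *v g k y + partial i (e k) y"])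
    show "Ck_on j U S" "bddD j U S" by (rule pr)+
    show "Ck_on j U (partial i (g k))" for k by (rule Ck_on_partial[OF Suc.prems(3)])
    show "bddD j U (partial i (g 0))" using Suc.prems(4) by simp
    have 1: "Ck_on j U (partial i S)" by (rule Ck_on_partial[OF Suc.prems(1)])
    have 2: "Ck_on j U (partial i (e k))" for k by (rule Ck_on_partial[OF Suc.prems(5)])
    have 3: "bddD j U (partial i S)" "geoD j U (\<lambda>k. partial i (e k))" using Suc.prems by auto
    show "Ck_on j U (\<lambda>y. partial i S y *v g k y + partial i (e k) y)" for k
      by (intro Ck_on_add Ck_on_bilinear[OF bl] U pr 1 2)
    show "geoD j U (\<lambda>k y. partial i S y *v g k y + partial i (e k) y)"
      by (intro geoD_add geoD_bilinear[OF bl] Ck_on_bilinear[OF bl] U pr 1 2 3 gj)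
    fix k y assume y: "y \<in> U"
    have "partial i (g (Suc k)) y = partial i (\<lambda>y. S y *v g k y + e k y) y"
      by (rule partial_cong_open[OF U y Suc.prems(7)])
    also have "\<dots> = partial i (\<lambda>y. S y *v g k y) y + partial i (e k) y"
      by (rule partial_add[OF Ck_on_bilinear[OF bl U Suc.prems(1,3)] Suc.prems(5) y])
    also have "partial i (\<lambda>y. S y *v g k y) y = S y *v partial i (g k) y + partial i S y *v g k y"
      by (rule partial_bilinear[OF bl Suc.prems(1,3) y])
    finally show "partial i (g (Suc k)) y = S y *v partial i (g k) y + (partial i S y *v g k y + partial i (e k) y)"
      by (simp add: add.assoc)
  qed
  then show ?case using geoD_0[OF gj] by simp
qed

section \<open>The coefficient matrix of the second equation\<close>

definition re_vec :: "complex^'n \<Rightarrow> real^'n" where "re_vec x = (\<chi> i. Re (x $ i))"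
definition im_vec :: "complex^'n \<Rightarrow> real^'n" where "im_vec x = (\<chi> i. Im (x $ i))"
definition complex_vec :: "real^'n \<Rightarrow> complex^'n" where "complex_vec x = (\<chi> i. complex_of_real (x $ i))"

lemma inner_re_im: "x \<bullet> y = re_vec x \<bullet> re_vec y + im_vec x \<bullet> im_vec y"
  by (simp add: inner_vec_def inner_complex_def re_vec_def im_vec_def sum.distrib)

lemma re_vec_complex_matrix: "re_vec (complex_matrix G *v x) = G *v re_vec x"
  and im_vec_complex_matrix: "im_vec (complex_matrix G *v x) = G *v im_vec x"
  by (simp_all add: re_vec_def im_vec_def matrix_vector_mult_def map_matrix_def vec_eq_iff)

lemma complex_matrix_complex_vec: "complex_matrix G *v complex_vec x = complex_vec (G *v x)"
  by (simp add: complex_vec_def matrix_vector_mult_def map_matrix_def vec_eq_iff)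

lemma re_complex_vec [simp]: "re_vec (complex_vec x) = x" "im_vec (complex_vec x) = 0"
  by (simp_all add: re_vec_def im_vec_def complex_vec_def vec_eq_iff)

lemma re_im_eq_0: "re_vec x = 0 \<Longrightarrow> im_vec x = 0 \<Longrightarrow> x = 0"
  by (simp add: re_vec_def im_vec_def vec_eq_iff complex_eq_iff)

lemma positive_definite_sym: "positive_definite G \<Longrightarrow> x \<bullet> (G *v y) = (G *v x) \<bullet> y"
  by (metis dot_lmul_matrix positive_definite_def transpose_matrix_vector)

text \<open>A real matrix acts separately on real and imaginary parts, so both properties reduce to
  the real form.\<close>

lemma herm_form_complex_matrix:
  assumes "positive_definite G"
  shows "herm_form (complex_matrix G)"
proof
  show "x \<bullet> (complex_matrix G *v y) = (complex_matrix G *v x) \<bullet> y" for x y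
    by (simp add: inner_re_im re_vec_complex_matrix im_vec_complex_matrix positive_definite_sym[OF assms])
  fix x :: "complex^'a" assume "x \<noteq> 0"
  then consider "re_vec x \<noteq> 0" | "im_vec x \<noteq> 0" using re_im_eq_0 by blast
  moreover have "v \<bullet> (G *v v) \<ge> 0" "v \<noteq> 0 \<Longrightarrow> v \<bullet> (G *v v) > 0" for v
    using assms by (cases "v = 0"; auto simp: positive_definite_def less_imp_le)+
  ultimately show "x \<bullet> (complex_matrix G *v x) > 0"
    by (cases; simp add: inner_re_im re_vec_complex_matrix im_vec_complex_matrix add_pos_nonneg add_nonneg_pos)
qed

text \<open>For a symmetric matrix the entrywise conjugate is the adjoint.\<close>

lemma inner_cnj_symmetric:
  fixes X :: "complex^'n^'n"
  assumes "transpose X = X"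
  shows "x \<bullet> (X *v y) = (map_matrix cnj X *v x) \<bullet> y"
proof -
  have s: "X $ i $ j = X $ j $ i" for i j using arg_cong[OF assms, of "\<lambda>A. A $ j $ i"] by (simp add: transpose_def)
  have c: "a \<bullet> (b * d) = (cnj b * a) \<bullet> d" for a b d :: complex
    by (simp add: inner_complex_def algebra_simps)
  have "x \<bullet> (X *v y) = (\<Sum>i\<in>UNIV. \<Sum>j\<in>UNIV. (cnj (X $ i $ j) * x $ i) \<bullet> (y $ j))"
    by (simp add: inner_vec_def matrix_vector_mult_def inner_sum_right c)
  also have "\<dots> = (\<Sum>j\<in>UNIV. \<Sum>i\<in>UNIV. (cnj (X $ i $ j) * x $ i) \<bullet> (y $ j))" by (rule sum.swap)
  also have "\<dots> = (\<Sum>j\<in>UNIV. (map_matrix cnj X *v x) $ j \<bullet> y $ j)"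
  proof (rule sum.cong[OF refl])
    fix j
    have "(map_matrix cnj X *v x) $ j = (\<Sum>i\<in>UNIV. cnj (X $ i $ j) * x $ i)"
      unfolding matrix_vector_mult_def map_matrix_def vec_lambda_beta
      by (rule sum.cong[OF refl]) (simp only: s[of j])
    then show "(\<Sum>i\<in>UNIV. (cnj (X $ i $ j) * x $ i) \<bullet> (y $ j)) = (map_matrix cnj X *v x) $ j \<bullet> y $ j"
      by (simp only: inner_sum_left)
  qed
  also have "\<dots> = (map_matrix cnj X *v x) \<bullet> y" by (simp only: inner_vec_def)
  finally show ?thesis .
qed

text \<open>Eigenvalues are the roots of \<open>q\<close>, the characteristic polynomial built as a
  determinant over the polynomial ring; \<open>q\<close> is nonzero because \<open>K + 1\<close>
  exceeds the operator bound and is no eigenvalue. Finiteness matters since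
  \<open>spectral_radius\<close> is a \<open>Max\<close>.\<close>

lemma finite_eigenvalues: "finite (eigenvalues (M :: complex^'n^'n))"
proof -
  define D where "D = (\<chi> i j. [:M $ i $ j:] - (if i = j then [:0, 1:] else 0))"
  define q where "q = det (D :: complex poly^'n^'n)"
  have ev: "poly q k = det (M - mat k)" for k
  proof -
    have e: "poly (D $ i $ j) k = (M - mat k) $ i $ j" for i j
      by (simp add: D_def mat_def)
    show ?thesis by (simp add: q_def det_def poly_sum poly_prod e)
  qed
  have eig: "k \<in> eigenvalues M \<longleftrightarrow> poly q k = 0" for k
  proof -
    have "(M - mat k) *v v = M *v v - k *s v" for v
    proof -
      have "mat k *v v = k *s v" by (simp add: matrix_vector_mult_def mat_def vec_eq_iff if_distrib if_distribR cong: if_cong)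
      then show ?thesis by (simp add: matrix_vector_mult_diff_rdistrib)
    qed
    then have "k \<in> eigenvalues M \<longleftrightarrow> (\<exists>v. v \<noteq> 0 \<and> (M - mat k) *v v = 0)"
      by (simp add: eigenvalues_def)
    also have "\<dots> \<longleftrightarrow> \<not> invertible (M - mat k)"
      unfolding invertible_left_inverse matrix_left_invertible_ker by blast
    also have "\<dots> \<longleftrightarrow> poly q k = 0" by (simp add: ev invertible_det_nz)
    finally show ?thesis .
  qed
  obtain K where K: "0 \<le> K" "\<And>x. norm (M *v x) \<le> norm x * K"
    using bounded_linear.nonneg_bounded[OF bounded_bilinear.bounded_linear_right[OF bounded_bilinear_matrix_vector_mult]] by blast
  have "complex_of_real (K + 1) \<notin> eigenvalues M"
  proof
    assume "complex_of_real (K + 1) \<in> eigenvalues M"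
    then obtain v where v: "v \<noteq> 0" "M *v v = complex_of_real (K + 1) *s v" by (auto simp: eigenvalues_def)
    have "complex_of_real (K + 1) *s v = (K + 1) *\<^sub>R v"
      by (simp add: vec_eq_iff complex_eq_iff algebra_simps)
    then have "norm (M *v v) = (K + 1) * norm v" using K(1) v(2) by simp
    then show False using K(2)[of v] v(1) by (simp add: algebra_simps)
  qed
  then have "poly q (complex_of_real (K + 1)) \<noteq> 0" using eig[of "complex_of_real (K + 1)"] by blast
  then have "q \<noteq> 0" by (metis poly_0)
  then have "finite {k. poly q k = 0}" by (rule poly_roots_finite)
  moreover have "eigenvalues M = {k. poly q k = 0}" using eig by blast
  ultimately show ?thesis by simp
qed

lemma eigenvalue_le_spectral_radius: "k \<in> eigenvalues M \<Longrightarrow> cmod k \<le> spectral_radius M"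
  unfolding spectral_radius_def by (intro Max_ge finite_imageI finite_eigenvalues) auto

text \<open>The form \<open>\<langle>x, G S y\<rangle>\<close> equals \<open>\<langle>X\<^sup>* G x, G (X\<^sup>* G y)\<rangle>\<close>, as \<open>X\<^sup>*\<close> is the conjugate of \<open>X\<close>.\<close>

lemma higgs_form:
  fixes G :: "real^'n^'n" and X :: "complex^'n^'n"
  assumes G: "positive_definite G" and X: "transpose X = X"
  defines "S \<equiv> X ** complex_matrix G ** map_matrix cnj X ** complex_matrix G"
  shows "x \<bullet> (complex_matrix G *v (S *v y)) =
    (map_matrix cnj X *v (complex_matrix G *v x)) \<bullet> (complex_matrix G *v (map_matrix cnj X *v (complex_matrix G *v y)))"
proof -
  interpret herm_form "complex_matrix G" by (rule herm_form_complex_matrix[OF G])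
  have S: "S *v y = X *v (complex_matrix G *v (map_matrix cnj X *v (complex_matrix G *v y)))"
    by (simp add: S_def matrix_vector_mul_assoc matrix_mul_assoc)
  show ?thesis unfolding S Gsym[of x "X *v _"] by (rule inner_cnj_symmetric[OF X])
qed

text \<open>The maximal Rayleigh quotient is an eigenvalue of \<open>S\<close>. It is nonnegative by
  \<open>higgs_form\<close> and below 1 by the spectral bound, so it can serve as the contraction
  constant.\<close>

lemma higgs_contraction:
  fixes G :: "real^'n^'n" and X :: "complex^'n^'n"
  assumes G: "positive_definite G" and X: "transpose X = X"
  defines "S \<equiv> X ** complex_matrix G ** map_matrix cnj X ** complex_matrix G"
  assumes r: "spectral_radius S < 1"
  obtains m where "contraction_form (complex_matrix G) S m"
proof -
  interpret herm_form "complex_matrix G" by (rule herm_form_complex_matrix[OF G])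
  note hf = higgs_form[OF G X, folded S_def]
  have sym: "x \<bullet> (complex_matrix G *v (S *v y)) = (complex_matrix G *v (S *v x)) \<bullet> y" for x y
  proof -
    have "x \<bullet> (complex_matrix G *v (S *v y)) = y \<bullet> (complex_matrix G *v (S *v x))"
      unfolding hf by (subst Gsym) (rule inner_commute)
    then show ?thesis by (simp only: inner_commute[of y])
  qed
  have S0: "0 \<le> x \<bullet> (complex_matrix G *v (S *v x))" for x unfolding hf by (rule G0)
  have ne: "(UNIV :: (complex^'n) set) \<noteq> {0}"
  proof
    assume "(UNIV :: (complex^'n) set) = {0}"
    then have "(axis undefined 1 :: complex^'n) = 0" by blast
    then show False by simp
  qed
  obtain v k where v: "v \<noteq> 0" "S *v v = k *\<^sub>R v" "\<And>x. x \<bullet> (complex_matrix G *v (S *v x)) \<le> k * (x \<bullet> (complex_matrix G *v x))"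
    by (rule rayleigh[OF sym subspace_UNIV ne UNIV_I]) simp
  have "0 \<le> k * (v \<bullet> (complex_matrix G *v v))" using S0[of v] v(2) by simp
  then have k0: "0 \<le> k" using Gpos[OF v(1)] by (simp add: zero_le_mult_iff)
  have "S *v v = complex_of_real k *s v" using v(2) by (simp add: vec_eq_iff complex_eq_iff)
  then have "complex_of_real k \<in> eigenvalues S" using v(1) unfolding eigenvalues_def by blast
  from eigenvalue_le_spectral_radius[OF this] have "k < 1" using r k0 by simp
  have "contraction_form (complex_matrix G) S k"
    by (unfold_locales) (rule sym S0 v(3) k0 \<open>k < 1\<close>)+
  then show ?thesis by (rule that)
qed

definition re_matrix :: "complex^'n^'n \<Rightarrow> real^'n^'n" where "re_matrix V = (\<chi> a b. Re (V $ a $ b))"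

lemma bounded_linear_re_matrix: "bounded_linear re_matrix"
  by (intro linear_conv_bounded_linear[THEN iffD1]) (auto intro!: linearI simp: re_matrix_def vec_eq_iff)

lemma inner_re_matrix: "x \<bullet> (re_matrix V *v y) = complex_vec x \<bullet> (V *v complex_vec y)"
  by (simp add: inner_vec_def inner_complex_def matrix_vector_mult_def re_matrix_def complex_vec_def)

text \<open>With \<open>w x\<close> the inverse of \<open>G\<close> applied to \<open>x\<close>, the
  form of \<open>R\<close> at \<open>x\<close> is the form of the square root at \<open>w x\<close>,
  and the properties of \<open>sqrt_series\<close> carry over. In the last bound
  \<open>higgs_form\<close> rewrites the defect so that no inverse of \<open>G\<close> is left in
  it; this makes it computable near the boundary.\<close>

lemma higgs_coefficient:
  fixes G :: "real^'n^'n" and X :: "complex^'n^'n"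
  assumes G: "positive_definite G" and X: "transpose X = X"
  defines "S \<equiv> X ** complex_matrix G ** map_matrix cnj X ** complex_matrix G"
  assumes r: "spectral_radius S < 1"
  defines "R \<equiv> re_matrix (matrix_sqrt (mat 1 - S) ** complex_matrix (matrix_inv G))"
  shows "matrix_sqrt (mat 1 - S) = sqrt_series S"
    and "x \<bullet> (R *v y) = (R *v x) \<bullet> y"
    and "x \<noteq> 0 \<Longrightarrow> x \<bullet> (R *v x) > 0"
    and "x \<bullet> (R *v x) \<le> x \<bullet> (matrix_inv G *v x)"
    and "x \<bullet> (matrix_inv G *v x) - (map_matrix cnj X *v complex_vec x) \<bullet> (complex_matrix G *v (map_matrix cnj X *v complex_vec x)) \<le> x \<bullet> (R *v x)"
proof -
  obtain m where m: "contraction_form (complex_matrix G) S m"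
    using higgs_contraction[OF G X r[unfolded S_def], folded S_def] by blast
  interpret contraction_form "complex_matrix G" S m by (rule m)
  show ms: "matrix_sqrt (mat 1 - S) = sqrt_series S" by (rule matrix_sqrt_eq)
  have inv: "invertible G"
  proof -
    have "G *v x = 0 \<Longrightarrow> x = 0" for x using G by (auto simp: positive_definite_def)
    then show ?thesis by (simp add: invertible_left_inverse matrix_left_invertible_ker)
  qed
  define w where "w x = complex_vec (matrix_inv G *v x)" for x
  have Gw: "complex_vec x = complex_matrix G *v w x" for x
    using matrix_inv_right[OF inv] by (simp add: w_def complex_matrix_complex_vec matrix_vector_mul_assoc)
  have R: "x \<bullet> (R *v y) = w x \<bullet> (complex_matrix G *v (sqrt_series S *v w y))" for x y
  proof -
    have "x \<bullet> (R *v y) = complex_vec x \<bullet> (sqrt_series S *v w y)"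
      unfolding R_def inner_re_matrix ms w_def
      by (simp add: complex_matrix_complex_vec[symmetric] matrix_vector_mul_assoc)
    also have "\<dots> = w x \<bullet> (complex_matrix G *v (sqrt_series S *v w y))"
      unfolding Gw[of x] by (rule Gsym[symmetric])
    finally show ?thesis .
  qed
  have "x \<bullet> (R *v y) = y \<bullet> (R *v x)" unfolding R by (subst sqrt_series_sym) (rule inner_commute)
  then show "x \<bullet> (R *v y) = (R *v x) \<bullet> y" by (simp only: inner_commute[of y])
  have i: "x \<bullet> (matrix_inv G *v x) = w x \<bullet> (complex_matrix G *v w x)"
  proof -
    have "w x \<bullet> complex_vec x = (matrix_inv G *v x) \<bullet> x" by (simp add: inner_re_im w_def)
    then show ?thesis by (simp add: Gw[symmetric] inner_commute)
  qed
  show "x \<bullet> (R *v x) \<le> x \<bullet> (matrix_inv G *v x)" unfolding R i by (rule sqrt_series_bounds(1))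
  show "x \<bullet> (matrix_inv G *v x) - (map_matrix cnj X *v complex_vec x) \<bullet> (complex_matrix G *v (map_matrix cnj X *v complex_vec x)) \<le> x \<bullet> (R *v x)"
    using sqrt_series_bounds(2)[of "w x"] unfolding R i higgs_form[OF G X, folded S_def] Gw[symmetric] .
  show "x \<bullet> (R *v x) > 0" if "x \<noteq> 0"
  proof -
    have "w x \<noteq> 0"
    proof
      assume "w x = 0"
      then have "complex_vec x = 0" using Gw[of x] by simp
      then have "re_vec (complex_vec x) = re_vec 0" by (rule arg_cong)
      also have "re_vec 0 = (0 :: real^'n)" by (simp add: re_vec_def vec_eq_iff)
      finally show False using that by simp
    qed
    then show ?thesis unfolding R by (rule sqrt_series_pos)
  qed
qed

section \<open>Smoothness of the square root\<close>

text \<open>Provides the fixed norm in which \<open>geoD_recursion\<close> measures the powers of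
  \<open>S\<close>.\<close>

lemma herm_form_norm:
  assumes "herm_form G"
  defines "p \<equiv> \<lambda>x. sqrt (x \<bullet> (G *v x))"
  obtains \<alpha> \<beta> where "\<alpha> > 0" "\<beta> > 0" "\<And>x. \<alpha> * norm x \<le> p x" "\<And>x. p x \<le> \<beta> * norm x" "\<And>x y. p (x + y) \<le> p x + p y"
proof -
  interpret herm_form G by (rule assms)
  obtain \<alpha> \<beta> where ab: "\<alpha> > 0" "\<beta> > 0" "\<And>x. \<alpha> * (norm x)\<^sup>2 \<le> x \<bullet> (G *v x)" "\<And>x. x \<bullet> (G *v x) \<le> \<beta> * (norm x)\<^sup>2"
    using form_bounds by metis
  have p2: "(p x)\<^sup>2 = x \<bullet> (G *v x)" "p x \<ge> 0" for x using G0[of x] by (simp_all add: p_def)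
  show ?thesis
  proof (rule that[of "sqrt \<alpha>" "sqrt \<beta>"])
    show "sqrt \<alpha> * norm x \<le> p x" for x
      by (rule power2_le_imp_le) (use ab(1) ab(3)[of x] in \<open>simp_all add: power_mult_distrib p2\<close>)
    show "p x \<le> sqrt \<beta> * norm x" for x
      by (rule power2_le_imp_le) (use ab(2) ab(4)[of x] in \<open>simp_all add: power_mult_distrib p2\<close>)
    show "p (x + y) \<le> p x + p y" for x y
    proof (rule power2_le_imp_le)
      have s: "y \<bullet> (G *v x) = x \<bullet> (G *v y)" by (subst Gsym) (rule inner_commute)
      have "(x \<bullet> (G *v y))\<^sup>2 \<le> (x \<bullet> (G *v x)) * (y \<bullet> (G *v y))"
      proof (rule psd_Cauchy_Schwarz[where N = UNIV and \<beta> = "\<lambda>x y. x \<bullet> (G *v y)"])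
        show "x \<bullet> (G *v y) = y \<bullet> (G *v x)" for x y by (subst Gsym) (rule inner_commute)
        show "x \<bullet> (G *v (y + z)) = x \<bullet> (G *v y) + x \<bullet> (G *v z)" for x y z
          by (simp only: matrix_vector_right_distrib inner_add_right)
        show "x \<bullet> (G *v (r *\<^sub>R y)) = r * (x \<bullet> (G *v y))" for x y r
          by (simp only: mv_scaleR inner_scaleR_right)
      qed (rule G0 subspace_UNIV UNIV_I)+
      then have "\<bar>x \<bullet> (G *v y)\<bar> \<le> p x * p y"
        by - (rule power2_le_imp_le, simp_all add: power_mult_distrib p2)
      then show "(p (x + y))\<^sup>2 \<le> (p x + p y)\<^sup>2"
        by (simp add: p2(1) power2_sum matrix_vector_right_distrib inner_add_left inner_add_right s)
    qed (use p2(2) in simp)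
  qed (use ab(1,2) in simp_all)
qed

text \<open>The form for which \<open>S y\<close> is a contraction varies with \<open>y\<close>, so
  it is frozen at \<open>y0\<close>. By continuity \<open>S y\<close> still contracts the norm of
  this one form for \<open>y\<close> near \<open>y0\<close>, with ratio \<open>(1 + m) / 2\<close>,
  and the powers then decay geometrically together with their derivatives.\<close>

lemma Ck_on_sqrt_series:
  fixes S :: "real^'n \<Rightarrow> complex^'m^'m" and f :: "real^'n \<Rightarrow> complex^'m"
  assumes "open O'" and y0: "y0 \<in> O'" and S: "Ck_on j O' S" and f: "Ck_on j O' f"
    and con: "\<And>y. y \<in> O' \<Longrightarrow> \<exists>G m. contraction_form G (S y) m"
  shows "\<exists>U. open U \<and> y0 \<in> U \<and> Ck_on j U (\<lambda>y. sqrt_series (S y) *v f y)"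
proof -
  note bl = bounded_bilinear_matrix_vector_mult[where 'b = complex]
  obtain G m where c0: "contraction_form G (S y0) m" using con[OF y0] by blast
  then interpret c0: contraction_form G "S y0" m .
  define p where "p x = sqrt (x \<bullet> (G *v x))" for x
  obtain \<alpha> \<beta> where ab: "\<alpha> > 0" "\<beta> > 0" "\<And>x. \<alpha> * norm x \<le> p x" "\<And>x. p x \<le> \<beta> * norm x" "\<And>x y. p (x + y) \<le> p x + p y"
    using herm_form_norm[OF c0.herm_form_axioms] unfolding p_def by metis
  obtain K where K: "K > 0" "\<And>(A :: complex^'m^'m) x. norm (A *v x) \<le> norm A * norm x * K"
    using bounded_bilinear.pos_bounded[OF bl] by blast
  define \<rho> where "\<rho> = (1 + m) / 2"
  have \<rho>: "0 \<le> \<rho>" "\<rho> < 1" "m < \<rho>" using c0.m by (auto simp: \<rho>_def)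
  \<comment> \<open>A perturbation of \<open>S y0\<close> by less than \<open>\<epsilon>\<close>
    raises its ratio in the norm \<open>p\<close> from \<open>m\<close> to at most
    \<open>\<rho>\<close>; the other factors compare \<open>p\<close> with the Euclidean
    norm.\<close>
  define \<epsilon> where "\<epsilon> = (\<rho> - m) * \<alpha> / (\<beta> * K)"
  have \<epsilon>: "\<epsilon> > 0" using \<rho> ab K by (simp add: \<epsilon>_def)
  have "continuous (at y0) S"
    using Ck_on_continuous[OF S] assms(1) y0 continuous_on_eq_continuous_at by blast
  then obtain d1 where d1: "d1 > 0" "\<And>y. dist y y0 < d1 \<Longrightarrow> dist (S y) (S y0) < \<epsilon>"
    using \<epsilon> unfolding continuous_at_eps_delta by metis
  obtain d2 where d2: "d2 > 0" "cball y0 d2 \<subseteq> O'" using assms(1) y0 open_contains_cball by metis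
  define U where "U = ball y0 (min d1 d2)"
  have U: "open U" "convex U" "y0 \<in> U" "U \<subseteq> cball y0 d2" "U \<subseteq> O'" using d1(1) d2 by (auto simp: U_def)
  have pS: "p (S y *v x) \<le> \<rho> * p x" if "y \<in> U" for y x
  proof -
    have "dist (S y) (S y0) < \<epsilon>" using that d1(2)[of y] by (simp add: U_def dist_commute)
    then have "norm (S y - S y0) \<le> \<epsilon>" by (simp add: dist_norm)
    then have "norm (S y - S y0) * norm x * K \<le> \<epsilon> * norm x * K"
      using K(1) by (intro mult_right_mono) auto
    then have "norm ((S y - S y0) *v x) \<le> \<epsilon> * norm x * K" by (rule order_trans[OF K(2)])
    then have "\<beta> * norm ((S y - S y0) *v x) \<le> \<beta> * (\<epsilon> * norm x * K)"
      using ab(2) by (intro mult_left_mono) auto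
    then have "p ((S y - S y0) *v x) \<le> \<beta> * (\<epsilon> * norm x * K)" by (rule order_trans[OF ab(4)])
    also have "\<dots> = (\<rho> - m) * (\<alpha> * norm x)" using ab(2) K(1) by (simp add: \<epsilon>_def)
    also have "\<dots> \<le> (\<rho> - m) * p x" using \<rho> by (intro mult_left_mono ab(3)) auto
    finally have 1: "p ((S y - S y0) *v x) \<le> (\<rho> - m) * p x" .
    have "p (S y0 *v x) \<le> sqrt (m\<^sup>2 * (x \<bullet> (G *v x)))" unfolding p_def by (rule real_sqrt_le_mono[OF c0.S_norm])
    also have "\<dots> = m * p x" using c0.m by (simp add: real_sqrt_mult p_def)
    finally have 2: "p (S y0 *v x) \<le> m * p x" .
    have "S y *v x = S y0 *v x + (S y - S y0) *v x" by (simp add: matrix_vector_mult_diff_rdistrib)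
    then have "p (S y *v x) \<le> m * p x + (\<rho> - m) * p x"
      using ab(5)[of "S y0 *v x" "(S y - S y0) *v x"] 1 2 by simp
    then show ?thesis by (simp add: algebra_simps)
  qed
  define g where "g k y = mat_power (S y) k *v f y" for k y
  have gS: "g (Suc k) y = S y *v g k y + 0" for k y by (simp add: g_def matrix_vector_mul_assoc)
  have Sj: "Ck_on j U S" "Ck_on j U f" using S f U(5) Ck_on_subset by blast+
  have gC: "Ck_on j U (g k)" for k
  proof (induction k)
    case 0
    then show ?case using Sj(2) by (simp add: g_def[abs_def])
  next
    case (Suc k)
    have "g (Suc k) = (\<lambda>y. S y *v g k y)" using gS by auto
    then show ?case using Ck_on_bilinear[OF bl U(1) Sj(1) Suc] by simp
  qed
  have z: "geoD i U (\<lambda>k y. 0 :: complex^'m)" for i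
  proof (induction i)
    case (Suc i)
    have "partial a (\<lambda>y. 0 :: complex^'m) = (\<lambda>y. 0)" for a :: 'n
      using partial_eq[OF has_derivative_const] by auto
    then show ?case using Suc by (auto intro!: exI[of _ 0])
  qed (auto intro!: exI[of _ 0])
  have "geoD j U g"
  proof (rule geoD_recursion[OF U(1) ab(5,1,3,4) \<rho>(1,2) pS Sj(1)])
    show "bddD j U S" by (rule bddD_compact[OF assms(1) compact_cball d2(2) U(4) S])
    show "bddD j U (g 0)" unfolding g_def using bddD_compact[OF assms(1) compact_cball d2(2) U(4) f] by simp
  qed (use gC gS z U(1) in auto)
  then have geo: "geoD j U (\<lambda>k y. sqrt_coeff k *\<^sub>R g k y)"
    using gC
  proof (induction j arbitrary: g)
    case 0
    obtain C \<rho> where 1: "0 \<le> \<rho>" "\<rho> < 1" "\<And>k y. y \<in> U \<Longrightarrow> norm (g k y) \<le> C * \<rho> ^ k"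
      using 0(1) unfolding geoD.simps by blast
    show ?case
    proof (rule geoD_0I[OF 1(1,2)])
      fix k y assume y: "y \<in> U"
      have "norm (sqrt_coeff k *\<^sub>R g k y) \<le> norm (g k y)"
        using sqrt_coeff_abs_le[of k] by (simp add: mult_left_le_one_le)
      then show "norm (sqrt_coeff k *\<^sub>R g k y) \<le> C * \<rho> ^ k" using 1(3)[OF y, of k] by linarith
    qed
  next
    case (Suc j)
    have "geoD 0 U (\<lambda>k y. sqrt_coeff k *\<^sub>R g k y)"
    proof -
      obtain C \<rho> where 1: "0 \<le> \<rho>" "\<rho> < 1" "\<And>k y. y \<in> U \<Longrightarrow> norm (g k y) \<le> C * \<rho> ^ k"
        using geoD_0[OF Suc.prems(1)] unfolding geoD.simps by blast
      show ?thesis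
      proof (rule geoD_0I[OF 1(1,2)])
        fix k y assume y: "y \<in> U"
        have "norm (sqrt_coeff k *\<^sub>R g k y) \<le> norm (g k y)"
          using sqrt_coeff_abs_le[of k] by (simp add: mult_left_le_one_le)
        then show "norm (sqrt_coeff k *\<^sub>R g k y) \<le> C * \<rho> ^ k" using 1(3)[OF y, of k] by linarith
      qed
    qed
    moreover have "geoD j U (\<lambda>k. partial i (\<lambda>y. sqrt_coeff k *\<^sub>R g k y))" for i
    proof (subst geoD_cong[OF U(1)])
      show "partial i (\<lambda>y. sqrt_coeff k *\<^sub>R g k y) y = sqrt_coeff k *\<^sub>R partial i (g k) y" if "y \<in> U" for k y
        using partial_eq[OF has_derivative_scaleR_right[OF Suc.prems(2)[THEN Ck_on_has_derivative, OF that]]]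
        by (simp add: partial_def)
      show "geoD j U (\<lambda>k y. sqrt_coeff k *\<^sub>R partial i (g k) y)"
        by (rule Suc.IH) (use Suc.prems in \<open>auto intro: Ck_on_partial\<close>)
    qed
    ultimately show ?case by simp
  qed
  have C: "Ck_on j U (\<lambda>y. \<Sum>k. sqrt_coeff k *\<^sub>R g k y)"
    by (rule Ck_on_series[OF U(1,2) _ geo]) (intro Ck_on_linear[OF bounded_linear_scaleR_right] gC U(1))
  have "(\<Sum>k. sqrt_coeff k *\<^sub>R g k y) = sqrt_series (S y) *v f y" if yU: "y \<in> U" for y
  proof -
    obtain G m where "contraction_form G (S y) m" using con[of y] U(5) yU by blast
    then interpret contraction_form G "S y" m .
    show ?thesis unfolding g_def using sums_unique[OF sqrt_series_vec] by simp
  qed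
  then have "Ck_on j U (\<lambda>y. sqrt_series (S y) *v f y)"
    using C Ck_on_cong[OF U(1)] by (metis (no_types, lifting))
  then show ?thesis using U by blast
qed

section \<open>Integration by parts\<close>

lemma integral_lborel_translate:
  fixes g :: "'a::euclidean_space \<Rightarrow> real"
  assumes "g \<in> borel_measurable borel"
  shows "(LINT y|lborel. g (y + v)) = (LINT y|lborel. g y)"
proof -
  have "(LINT y|lborel. g y) = (LINT y|distr lborel borel (\<lambda>x. x + v). g y)"
    by (simp add: lborel_distr_plus')
  also have "\<dots> = (LINT y|lborel. g (y + v))" using assms by (subst integral_distr) auto
  finally show ?thesis by simp
qed

lemma has_real_derivative_line:
  fixes g :: "real^'n \<Rightarrow> real"
  assumes "Ck_on (Suc k) S g" "y + t *\<^sub>R v \<in> S"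
  shows "((\<lambda>t. g (y + t *\<^sub>R v)) has_real_derivative frechet_derivative g (at (y + t *\<^sub>R v)) v) (at t)"
proof -
  let ?D = "frechet_derivative g (at (y + t *\<^sub>R v))"
  have d: "(g has_derivative ?D) (at (y + t *\<^sub>R v))" by (rule Ck_on_has_derivative[OF assms])
  have "((\<lambda>t. y + t *\<^sub>R v) has_derivative (\<lambda>h. h *\<^sub>R v)) (at t)"
    by (auto intro!: derivative_eq_intros)
  from has_derivative_compose[OF this d] have "((\<lambda>t. g (y + t *\<^sub>R v)) has_derivative (\<lambda>h. ?D (h *\<^sub>R v))) (at t)" .
  moreover have "?D (h *\<^sub>R v) = ?D v * h" for h
    using linear_scale[OF has_derivative_linear[OF d]] by simp
  ultimately show ?thesis by (simp add: has_field_derivative_def)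
qed

text \<open>Translation invariance gives the difference quotients integral 0, and they converge
  dominatedly to the partial derivative; the mean value theorem bounds them by the supremum of that
  derivative.\<close>

lemma integral_partial_eq_0:
  fixes g :: "real^'n \<Rightarrow> real"
  assumes g: "Ck_on 1 UNIV g" and supp: "\<And>y. norm y > \<rho> \<Longrightarrow> g y = 0"
  shows "(LINT y|lborel. partial i g y) = 0"
proof -
  have g1: "Ck_on (Suc 0) UNIV g" using g by simp
  have cont: "continuous_on UNIV g" "continuous_on UNIV (partial i g)"
    using Ck_on_continuous[OF g] Ck_on_partial[OF g1, of i] by auto
  have [measurable]: "g \<in> borel_measurable borel" "partial i g \<in> borel_measurable borel"
    using cont by (auto intro: borel_measurable_continuous_onI)
  have zero: "partial i g y = 0" if "norm y > \<rho>" for y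
  proof -
    have "open (- cball (0::real^'n) \<rho>)" "y \<in> - cball 0 \<rho>" using that by auto
    then have "partial i g y = partial i (\<lambda>_. 0) y" by (rule partial_cong_open) (use supp in auto)
    also have "\<dots> = 0" by (rule partial_eq[OF has_derivative_const])
    finally show ?thesis .
  qed
  obtain B where B: "\<And>y. \<bar>partial i g y\<bar> \<le> B"
  proof -
    have "bounded (partial i g ` cball 0 \<rho>)"
      by (rule compact_imp_bounded[OF compact_continuous_image[OF continuous_on_subset[OF cont(2)]]]) auto
    then obtain B where "\<forall>z\<in>partial i g ` cball 0 \<rho>. norm z \<le> B" unfolding bounded_iff by blast
    then have B: "\<bar>partial i g y\<bar> \<le> B" if "norm y \<le> \<rho>" for y using that by auto
    have "\<bar>partial i g y\<bar> \<le> \<bar>B\<bar>" for y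
      using B[of y] zero[of y] by (cases "norm y \<le> \<rho>") auto
    then show ?thesis by (rule that)
  qed
  define e where "e = (axis i 1 :: real^'n)"
  have ne: "norm e = 1" by (simp add: e_def)
  define h where "h k = inverse (real (Suc k))" for k
  have h: "0 < h k" "h k \<le> 1" for k by (auto simp: h_def inverse_le_1_iff)
  have h0: "h \<longlonglongrightarrow> 0" unfolding h_def by (rule LIMSEQ_inverse_real_of_nat)
  have der: "((\<lambda>t. g (y + t *\<^sub>R e)) has_real_derivative partial i g (y + t *\<^sub>R e)) (at t)" for y t
    using has_real_derivative_line[OF g1, of y t e] by (simp add: partial_def e_def)
  define q where "q k y = (g (y + h k *\<^sub>R e) - g y) / h k" for k y
  have [measurable]: "q k \<in> borel_measurable borel" for k unfolding q_def by measurable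
  have qB: "\<bar>q k y\<bar> \<le> B" for k y
  proof -
    obtain z where "g (y + h k *\<^sub>R e) - g (y + 0 *\<^sub>R e) = (h k - 0) * partial i g (y + z *\<^sub>R e)"
      using MVT2[of 0 "h k" "\<lambda>t. g (y + t *\<^sub>R e)" "\<lambda>t. partial i g (y + t *\<^sub>R e)"] der h[of k] by blast
    then have "q k y = partial i g (y + z *\<^sub>R e)" using h[of k] by (simp add: q_def)
    then show ?thesis using B by simp
  qed
  have gi: "integrable lborel g"
  proof -
    have "bounded (g ` cball 0 \<rho>)"
      by (rule compact_imp_bounded[OF compact_continuous_image[OF continuous_on_subset[OF cont(1)]]]) auto
    then obtain B where "\<forall>z\<in>g ` cball 0 \<rho>. norm z \<le> B" unfolding bounded_iff by blast
    then have B: "\<bar>g y\<bar> \<le> B" if "norm y \<le> \<rho>" for y using that by auto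
    have "\<bar>g y\<bar> \<le> \<bar>B\<bar>" for y using B[of y] supp[of y] by (cases "norm y \<le> \<rho>") auto
    then show ?thesis by (rule integrable_bounded_support[rotated, where \<rho> = \<rho>]) (use supp in \<open>force simp: not_le[symmetric]\<close>)+
  qed
  have qi: "(LINT y|lborel. q k y) = 0" for k
  proof -
    have "integrable lborel (\<lambda>y. g (y + h k *\<^sub>R e))"
    proof -
      have "integrable (distr lborel borel (\<lambda>x. x + h k *\<^sub>R e)) g" using gi by (simp add: lborel_distr_plus')
      then show ?thesis by (subst (asm) integrable_distr_eq) auto
    qed
    then have "(LINT y|lborel. q k y) = ((LINT y|lborel. g (y + h k *\<^sub>R e)) - (LINT y|lborel. g y)) / h k"
      using gi by (simp add: q_def)
    then show ?thesis by (simp add: integral_lborel_translate)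
  qed
  have "(\<lambda>k. LINT y|lborel. q k y) \<longlonglongrightarrow> (LINT y|lborel. partial i g y)"
  proof (rule integral_dominated_convergence[where w = "\<lambda>y. B * indicator (cball (0::real^'n) (\<bar>\<rho>\<bar> + 1)) y"])
    show "integrable lborel (\<lambda>y. B * indicator (cball (0::real^'n) (\<bar>\<rho>\<bar> + 1)) y)"
      using emeasure_lborel_cball_finite[of "0::real^'n" "\<bar>\<rho>\<bar> + 1"] by (auto simp: less_top)
    show "AE y in lborel. norm (q k y) \<le> B * indicator (cball (0::real^'n) (\<bar>\<rho>\<bar> + 1)) y" for k
    proof (intro AE_I2)
      fix y
      show "norm (q k y) \<le> B * indicator (cball (0::real^'n) (\<bar>\<rho>\<bar> + 1)) y"
      proof (cases "norm y \<le> \<bar>\<rho>\<bar> + 1")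
        case False
        have "norm y \<le> norm (y + h k *\<^sub>R e) + norm (h k *\<^sub>R e)"
          using norm_triangle_ineq4[of "y + h k *\<^sub>R e" "h k *\<^sub>R e"] by simp
        then have "norm (y + h k *\<^sub>R e) > \<rho>" using h[of k] ne False by simp
        then have "q k y = 0" using supp False by (simp add: q_def)
        then show ?thesis using False by simp
      qed (use qB in simp)
    qed
    show "AE y in lborel. (\<lambda>k. q k y) \<longlonglongrightarrow> partial i g y"
    proof (intro AE_I2)
      fix y
      have "(\<lambda>t. (g (y + (0 + t) *\<^sub>R e) - g (y + 0 *\<^sub>R e)) / t) \<midarrow>0\<rightarrow> partial i g (y + 0 *\<^sub>R e)"
        using der[of y 0] unfolding DERIV_def .
      then have l: "(\<lambda>t. (g (y + t *\<^sub>R e) - g y) / t) \<midarrow>0\<rightarrow> partial i g y" by simp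
      have "filterlim h (at 0) sequentially"
        unfolding filterlim_at using h h0 by (auto intro!: always_eventually dest: less_imp_neq[symmetric] simp: less_le)
      from filterlim_compose[OF l this] show "(\<lambda>k. q k y) \<longlonglongrightarrow> partial i g y" by (simp add: q_def)
    qed
  qed simp_all
  then have "(\<lambda>k. 0) \<longlonglongrightarrow> (LINT y|lborel. partial i g y)" by (simp add: qi)
  then show ?thesis by (simp add: LIMSEQ_const_iff)
qed

lemma set_integrable_compact:
  fixes h :: "real^'n \<Rightarrow> real"
  assumes "compact K" "continuous_on K h"
  shows "set_integrable lborel K h"
  unfolding set_integrable_def using borel_integrable_compact[OF assms] by simp

lemma partial_zero_off:
  assumes "closed K" "\<And>y. y \<notin> K \<Longrightarrow> \<eta> y = (0::real)" "y \<notin> K"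
  shows "partial i \<eta> y = 0"
proof -
  have "partial i \<eta> y = partial i (\<lambda>_. 0) y"
    by (rule partial_cong_open[of "- K"]) (use assms in auto)
  also have "\<dots> = 0" by (rule partial_eq[OF has_derivative_const])
  finally show ?thesis .
qed

text \<open>\<open>w\<close> is controlled only on \<open>O'\<close>. Since \<open>\<eta>\<close>
  vanishes off the compact \<open>K\<close>, the product is of class C1 on \<open>O'\<close> and
  zero on the complement of \<open>K\<close>, and these two open sets cover the space.\<close>

lemma integral_by_parts:
  fixes \<eta> w :: "real^'n \<Rightarrow> real"
  assumes \<eta>: "Ck_on 1 UNIV \<eta>" and K: "compact K" "K \<subseteq> O'" and O': "open O'"
    and off: "\<And>y. y \<notin> K \<Longrightarrow> \<eta> y = 0" and w: "Ck_on 1 O' w"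
  shows "(LINT y:K|lborel. partial i \<eta> y * w y + \<eta> y * partial i w y) = 0"
proof -
  define g where "g y = (if y \<in> K then \<eta> y * w y else 0)" for y
  have gO: "g y = \<eta> y * w y" for y using off by (simp add: g_def)
  have c: "Ck_on (Suc 0) O' \<eta>" "Ck_on (Suc 0) O' w"
    using Ck_on_subset[of "Suc 0" UNIV \<eta> O'] \<eta> w by simp_all
  have cl: "closed K" using K(1) by (rule compact_imp_closed)
  have "Ck_on 1 UNIV g"
  proof (rule Ck_on_local[OF open_UNIV])
    fix x :: "real^'n"
    show "\<exists>U. open U \<and> x \<in> U \<and> Ck_on 1 U g"
    proof (cases "x \<in> O'")
      case True
      have "Ck_on 1 O' g" unfolding gO[abs_def] using Ck_on_mult[OF O' c] by simp
      then show ?thesis using True O' by blast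
    next
      case False
      have "Ck_on 1 (- K) g"
        using Ck_on_cong[of "- K" g "\<lambda>_. 0" 1] cl by (auto simp: g_def open_Compl)
      then show ?thesis using False K(2) cl by (intro exI[of _ "- K"]) auto
    qed
  qed
  moreover obtain \<rho> where \<rho>: "\<And>y. y \<in> K \<Longrightarrow> norm y \<le> \<rho>"
    using compact_imp_bounded[OF K(1)] by (auto simp: bounded_iff)
  ultimately have 0: "(LINT y|lborel. partial i g y) = 0"
    by (intro integral_partial_eq_0[of g \<rho>]) (auto simp: g_def dest: \<rho>)
  have "partial i g y = indicator K y *\<^sub>R (partial i \<eta> y * w y + \<eta> y * partial i w y)" for y
  proof (cases "y \<in> K")
    case True
    have "partial i g y = partial i (\<lambda>y. \<eta> y * w y) y" by (simp add: gO[abs_def])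
    also have "\<dots> = \<eta> y * partial i w y + partial i \<eta> y * w y"
      using partial_bilinear[OF bounded_bilinear_mult c] True K(2) by blast
    finally show ?thesis using True by simp
  next
    case False
    then show ?thesis using partial_zero_off[OF cl, of g y i] by (simp add: g_def)
  qed
  then show ?thesis using 0 by (simp add: set_lebesgue_integral_def)
qed

lemma sum_swap_sym: "(\<Sum>a\<in>UNIV. \<Sum>b\<in>UNIV. F a b) = (\<Sum>a\<in>(UNIV::'n::finite set). \<Sum>b\<in>UNIV. F b a)"
  by (rule sum.swap)

text \<open>Of the three families of exact divergences, \<open>TA\<close> differentiates
  \<open>\<eta> R \<partial>f\<close>, \<open>TB\<close> differentiates
  \<open>\<eta> f \<partial>R\<close>, and \<open>TC\<close> differentiates
  \<open>f R \<partial>\<eta>\<close>. In the combination \<open>TA - TB + TC\<close> all terms with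
  first derivatives of \<open>R\<close> cancel and the mixed terms in
  \<open>\<partial>\<eta>\<close> and \<open>\<partial>f\<close> add up to the factor 2.\<close>

lemma hessian_integral_identity:
  fixes \<eta> f :: "real^'n \<Rightarrow> real" and R :: "real^'n \<Rightarrow> real^'n^'n"
  assumes \<eta>: "Ck_on 2 UNIV \<eta>" and K: "compact K" "K \<subseteq> O'" and O': "open O'"
    and off: "\<And>y. y \<notin> K \<Longrightarrow> \<eta> y = 0"
    and R: "Ck_on 2 O' R" and sym: "\<And>y a b. y \<in> O' \<Longrightarrow> R y $ a $ b = R y $ b $ a" and f: "Ck_on 2 O' f"
    and dd: "\<And>y. y \<in> O' \<Longrightarrow> (\<Sum>a\<in>UNIV. \<Sum>b\<in>UNIV. partial b (partial a (\<lambda>y. R y $ a $ b)) y) = - C"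
  shows "(LINT y:K|lborel. \<eta> y * (\<Sum>a\<in>UNIV. \<Sum>b\<in>UNIV. R y $ a $ b * hess f y $ a $ b)) =
      - (LINT y:K|lborel. C * (\<eta> y * f y))
      - (LINT y:K|lborel. f y * (\<Sum>a\<in>UNIV. \<Sum>b\<in>UNIV. R y $ a $ b * hess \<eta> y $ a $ b))
      - (LINT y:K|lborel. 2 * (\<Sum>a\<in>UNIV. \<Sum>b\<in>UNIV. R y $ a $ b * (partial a \<eta> y * partial b f y)))"
proof -
  have e2: "2 = Suc (Suc 0)" by simp
  define r where "r a b y = R y $ a $ b" for a b y
  have r2: "Ck_on (Suc (Suc 0)) O' (r a b)" for a b
    unfolding r_def using R by (intro Ck_on_component O') (simp add: e2)
  have f2: "Ck_on (Suc (Suc 0)) O' f" using f by (simp add: e2)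
  have x2: "Ck_on (Suc (Suc 0)) UNIV \<eta>" using \<eta> by (simp add: e2)
  have x2': "Ck_on (Suc (Suc 0)) O' \<eta>" using x2 Ck_on_subset by blast
  have r1: "Ck_on (Suc 0) O' (r a b)" "Ck_on (Suc 0) O' (partial c (r a b))" for a b c
    using r2 Ck_on_pred Ck_on_partial by blast+
  have f1: "Ck_on (Suc 0) O' f" "Ck_on (Suc 0) O' (partial c f)" for c
    using f2 Ck_on_pred Ck_on_partial by blast+
  have x1: "Ck_on 1 UNIV \<eta>" "Ck_on 1 UNIV (partial c \<eta>)" for c
    using x2 Ck_on_pred Ck_on_partial by (metis One_nat_def)+
  have x1': "Ck_on (Suc 0) O' \<eta>" "Ck_on (Suc 0) O' (partial c \<eta>)" for c
    using x2' Ck_on_pred Ck_on_partial by blast+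
  have cl: "closed K" using K(1) by (rule compact_imp_closed)
  have off1: "partial c \<eta> y = 0" if "y \<notin> K" for c y by (rule partial_zero_off[OF cl off that])
  define TA where "TA a b y = partial a \<eta> y * (r a b y * partial b f y) + \<eta> y * partial a (\<lambda>y. r a b y * partial b f y) y" for a b y
  define TB where "TB a b y = partial a \<eta> y * (partial b (r a b) y * f y) + \<eta> y * partial a (\<lambda>y. partial b (r a b) y * f y) y" for a b y
  define TC where "TC a b y = partial a (partial b \<eta>) y * (r a b y * f y) + partial b \<eta> y * partial a (\<lambda>y. r a b y * f y) y" for a b y
  have w1: "Ck_on (Suc 0) O' (\<lambda>y. r a b y * partial b f y)" "Ck_on (Suc 0) O' (\<lambda>y. partial b (r a b) y * f y)"
    "Ck_on (Suc 0) O' (\<lambda>y. r a b y * f y)" for a b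
    by (intro Ck_on_mult O' r1 f1)+
  have iA: "(LINT y:K|lborel. TA a b y) = 0" for a b
    unfolding TA_def by (rule integral_by_parts[OF x1(1) K O' off]) (use w1 in auto)
  have iB: "(LINT y:K|lborel. TB a b y) = 0" for a b
    unfolding TB_def by (rule integral_by_parts[OF x1(1) K O' off]) (use w1 in auto)
  have iC: "(LINT y:K|lborel. TC a b y) = 0" for a b
    unfolding TC_def by (rule integral_by_parts[OF x1(2) K O' off1]) (use w1 in auto)
  have Kc: "Ck_on k O' w \<Longrightarrow> continuous_on K w" for k and w :: "real^'n \<Rightarrow> real"
    using Ck_on_continuous continuous_on_subset K(2) by blast
  note cc = Kc[OF x1'(1)] Kc[OF x1'(2)] Kc[OF Ck_on_partial[OF x1'(2)]] Kc[OF r1(1)] Kc[OF r1(2)]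
    Kc[OF f1(1)] Kc[OF f1(2)] Kc[OF Ck_on_partial[OF f1(2)]]
  note cw = Kc[OF Ck_on_partial[OF w1(1)]] Kc[OF Ck_on_partial[OF w1(2)]] Kc[OF Ck_on_partial[OF w1(3)]]
  have si: "set_integrable lborel K (TA a b)" "set_integrable lborel K (TB a b)" "set_integrable lborel K (TC a b)" for a b
    unfolding TA_def TB_def TC_def by (intro set_integrable_compact K(1) continuous_intros cc cw)+
  define T where "T y = (\<Sum>a\<in>UNIV. \<Sum>b\<in>UNIV. TA a b y - TB a b y + TC a b y)" for y
  have T0: "(LINT y:K|lborel. T y) = 0"
  proof -
    have i: "set_integrable lborel K (\<lambda>y. TA a b y - TB a b y + TC a b y)" for a b by (intro set_integral_add set_integral_diff si)
    have z: "(LINT y:K|lborel. TA a b y - TB a b y + TC a b y) = 0" for a b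
      by (simp add: set_integral_add set_integral_diff si iA iB iC)
    have "(LINT y:K|lborel. T y) = (\<Sum>a\<in>UNIV. \<Sum>b\<in>UNIV. (LINT y:K|lborel. TA a b y - TB a b y + TC a b y))"
      unfolding set_lebesgue_integral_def T_def scaleR_sum_right using i[unfolded set_integrable_def]
      by (simp only: Bochner_Integration.integral_sum Bochner_Integration.integrable_sum)
    then show ?thesis by (simp add: z)
  qed
  define Q1 where "Q1 y = \<eta> y * (\<Sum>a\<in>UNIV. \<Sum>b\<in>UNIV. R y $ a $ b * hess f y $ a $ b)" for y
  define Q2 where "Q2 y = C * (\<eta> y * f y)" for y
  define Q3 where "Q3 y = f y * (\<Sum>a\<in>UNIV. \<Sum>b\<in>UNIV. R y $ a $ b * hess \<eta> y $ a $ b)" for y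
  define Q4 where "Q4 y = 2 * (\<Sum>a\<in>UNIV. \<Sum>b\<in>UNIV. R y $ a $ b * (partial a \<eta> y * partial b f y))" for y
  have TQ: "T y = Q1 y + Q2 y + Q3 y + Q4 y" if "y \<in> K" for y
  proof -
    have y: "y \<in> O'" using that K(2) by blast
    note pb = partial_bilinear[OF bounded_bilinear_mult _ _ y]
    have A: "TA a b y = partial a \<eta> y * r a b y * partial b f y + \<eta> y * r a b y * partial a (partial b f) y
        + \<eta> y * partial a (r a b) y * partial b f y" for a b
      unfolding TA_def pb[OF r1(1) f1(2)] by (simp add: algebra_simps)
    have B: "TB a b y = partial a \<eta> y * partial b (r a b) y * f y + \<eta> y * partial b (r a b) y * partial a f y
        + \<eta> y * f y * partial a (partial b (r a b)) y" for a b
      unfolding TB_def pb[OF r1(2) f1(1)] by (simp add: algebra_simps)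
    have C: "TC a b y = f y * (r a b y * partial a (partial b \<eta>) y) + partial b \<eta> y * r a b y * partial a f y
        + partial b \<eta> y * partial a (r a b) y * f y" for a b
      unfolding TC_def pb[OF r1(1) f1(1)] by (simp add: algebra_simps)
    have rs: "r b a z = r a b z" if "z \<in> O'" for a b z using sym[OF that] by (simp add: r_def)
    have rp: "partial c (r b a) z = partial c (r a b) z" if "z \<in> O'" for a b c z
      by (rule partial_cong_open[OF O' that rs])
    have rpp: "partial d (partial c (r b a)) y = partial d (partial c (r a b)) y" for a b c d
      by (rule partial_cong_open[OF O' y rp])
    let ?s = "\<lambda>F. \<Sum>a\<in>UNIV. \<Sum>b\<in>UNIV. F a b"
    \<comment> \<open>Exchanging the summation indices and using the symmetry of \<open>R\<close>
      takes the place of the symmetry of second derivatives, here and in the next four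
      identities.\<close>
    have 1: "?s (\<lambda>a b. r a b y * partial a (partial b w) y) = ?s (\<lambda>a b. r a b y * partial b (partial a w) y)" for w
      by (subst sum_swap_sym) (simp add: rs[OF y])
    have 2: "?s (\<lambda>a b. partial a (partial b (r a b)) y) = ?s (\<lambda>a b. partial b (partial a (r a b)) y)"
      by (subst sum_swap_sym) (simp add: rpp)
    have 3: "?s (\<lambda>a b. \<eta> y * partial a (r a b) y * partial b f y) = ?s (\<lambda>a b. \<eta> y * partial b (r a b) y * partial a f y)"
      by (subst sum_swap_sym) (simp add: rp[OF y])
    have 4: "?s (\<lambda>a b. partial b \<eta> y * partial a (r a b) y * f y) = ?s (\<lambda>a b. partial a \<eta> y * partial b (r a b) y * f y)"
      by (subst sum_swap_sym) (simp add: rp[OF y])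
    have 5: "?s (\<lambda>a b. partial b \<eta> y * r a b y * partial a f y) = ?s (\<lambda>a b. partial a \<eta> y * r a b y * partial b f y)"
      by (subst sum_swap_sym) (simp add: rs[OF y])
    have "T y = 2 * ?s (\<lambda>a b. partial a \<eta> y * r a b y * partial b f y)
        + ?s (\<lambda>a b. \<eta> y * r a b y * partial a (partial b f) y)
        - ?s (\<lambda>a b. \<eta> y * f y * partial a (partial b (r a b)) y)
        + ?s (\<lambda>a b. f y * (r a b y * partial a (partial b \<eta>) y))"
      unfolding T_def A B C using 3 4 5 by (simp add: sum.distrib sum_subtractf)
    also have "\<dots> = Q4 y + \<eta> y * ?s (\<lambda>a b. r a b y * partial a (partial b f) y)
        - \<eta> y * f y * ?s (\<lambda>a b. partial a (partial b (r a b)) y)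
        + f y * ?s (\<lambda>a b. r a b y * partial a (partial b \<eta>) y)"
      by (simp add: Q4_def r_def sum_distrib_left mult_ac)
    also have "\<dots> = Q1 y + Q2 y + Q3 y + Q4 y"
      unfolding 1 2 using dd[OF y] by (simp add: Q1_def Q2_def Q3_def hess_def r_def[abs_def])
    finally show ?thesis .
  qed
  have Rc: "continuous_on K (\<lambda>y. R y $ a $ b)" for a b using cc(4)[of a b] by (simp add: r_def[abs_def])
  have hc: "continuous_on K (\<lambda>y. hess f y $ a $ b)" "continuous_on K (\<lambda>y. hess \<eta> y $ a $ b)" for a b
    using cc(3,8) by (simp_all add: hess_def)
  have Qi: "set_integrable lborel K Q1" "set_integrable lborel K Q2" "set_integrable lborel K Q3" "set_integrable lborel K Q4"
    unfolding Q1_def Q2_def Q3_def Q4_def by (intro set_integrable_compact K(1) continuous_intros cc Rc hc)+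
  have "0 = (LINT y:K|lborel. Q1 y + Q2 y + Q3 y + Q4 y)"
    unfolding T0[symmetric] by (rule set_lebesgue_integral_cong) (use TQ cl in auto)
  also have "\<dots> = (LINT y:K|lborel. Q1 y) + (LINT y:K|lborel. Q2 y) + (LINT y:K|lborel. Q3 y) + (LINT y:K|lborel. Q4 y)"
    by (simp add: set_integral_add Qi)
  finally show ?thesis unfolding Q1_def Q2_def Q3_def Q4_def by linarith
qed

section \<open>Delzant polytopes\<close>

text \<open>Multilinearity in the rows. For sums of multiples of normals only injective choices
  \<open>f\<close> will survive.\<close>

lemma det_sum_rows:
  fixes a :: "'n::finite \<Rightarrow> 'r::finite \<Rightarrow> real^'n"
  shows "det (\<chi> i. \<Sum>s\<in>UNIV. a i s) = (\<Sum>f\<in>UNIV. det (\<chi> i. a i (f i)))"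
proof -
  have "(\<Prod>i\<in>UNIV. \<Sum>s\<in>UNIV. a i s $ p i) = (\<Sum>f\<in>UNIV. \<Prod>i\<in>UNIV. a i (f i) $ p i)" for p :: "'n \<Rightarrow> 'n"
    using prod_sum_PiE[of "UNIV :: 'n set" "\<lambda>_. UNIV :: 'r set" "\<lambda>i s. a i s $ p i"] by (simp add: PiE_UNIV_domain)
  then have "det (\<chi> i. \<Sum>s\<in>UNIV. a i s) =
      (\<Sum>p | p permutes (UNIV :: 'n set). \<Sum>f\<in>UNIV. of_int (sign p) * (\<Prod>i\<in>UNIV. a i (f i) $ p i))"
    by (simp add: det_def sum_distrib_left)
  also have "\<dots> = (\<Sum>f\<in>UNIV. det (\<chi> i. a i (f i)))"
    unfolding det_def by (subst sum.swap) simp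
  finally show ?thesis .
qed

locale delzant_polytope =
  fixes \<nu> :: "'r::finite \<Rightarrow> int^'n" and c :: "'r \<Rightarrow> real"
  assumes delz: "delzant \<nu> c"
begin

abbreviation "P \<equiv> moment_polytope \<nu> c"
abbreviation "L \<equiv> ell \<nu> c"
abbreviation "nv \<equiv> \<lambda>r. real_vec (\<nu> r)"

lemma nv_nonzero: "nv r \<noteq> 0"
proof
  assume "nv r = 0"
  then have "range (\<lambda>i. \<nu> r $ i) = {0}" by (auto simp: real_vec_def vec_eq_iff)
  moreover have "primitive (\<nu> r)" using delz by (simp add: delzant_def)
  ultimately show False by (simp add: primitive_def)
qed

lemma L_add: "L r (y + v) = L r y + nv r \<bullet> v" by (simp add: ell_def inner_add_right)

lemma continuous_L [continuous_intros]: "continuous_on S (L r)"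
  unfolding ell_def[abs_def] by (intro continuous_intros)

lemma P_closed: "closed P"
proof -
  have "P = (\<Inter>r. {y. L r y \<ge> 0})" by (auto simp: moment_polytope_def)
  then show ?thesis by (simp add: ell_def closed_INT closed_Collect_le continuous_intros)
qed

lemma P_compact: "compact P"
  using delz P_closed by (simp add: delzant_def compact_eq_bounded_closed)

lemma P_convex: "convex P"
proof -
  have "P = (\<Inter>r. {y. nv r \<bullet> y \<ge> - c r})" 
  proof -
    have "L r y \<ge> 0 \<longleftrightarrow> nv r \<bullet> y \<ge> - c r" for r y by (auto simp: ell_def)
    then show ?thesis by (auto simp: moment_polytope_def)
  qed
  then show ?thesis by (simp add: convex_INT convex_halfspace_ge)
qed

lemma interior_P: "interior P = {y. \<forall>r. L r y > 0}"
proof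
  show "interior P \<subseteq> {y. \<forall>r. L r y > 0}"
  proof (intro subsetI CollectI allI)
    fix y r assume y: "y \<in> interior P"
    then obtain e where e: "e > 0" "ball y e \<subseteq> P" by (meson mem_interior)
    define v where "v = - (e / (2 * norm (nv r))) *\<^sub>R nv r"
    have n: "norm (nv r) > 0" using nv_nonzero by simp
    have "norm v = e / 2" using n e by (simp add: v_def)
    then have "y + v \<in> P" using e by (intro subsetD[OF e(2)]) (simp add: dist_norm)
    then have "L r y + nv r \<bullet> v \<ge> 0" by (simp add: moment_polytope_def L_add[symmetric])
    moreover have "nv r \<bullet> v < 0" using n e by (simp add: v_def)
    ultimately show "L r y > 0" by simp
  qed
  have "{y. \<forall>r. L r y > 0} = (\<Inter>r. {y. L r y > 0})" by auto
  then have "open {y. \<forall>r. L r y > 0}"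
    by (simp add: ell_def open_INT open_Collect_less continuous_intros)
  then show "{y. \<forall>r. L r y > 0} \<subseteq> interior P"
    by (intro interior_maximal) (auto simp: moment_polytope_def less_imp_le)
qed

lemma L_bounded: obtains M where "M > 0" "\<And>r y. y \<in> P \<Longrightarrow> L r y \<le> M"
proof -
  have "\<exists>M. \<forall>y\<in>P. L r y \<le> M" for r
  proof -
    have "bounded (L r ` P)" by (intro compact_imp_bounded compact_continuous_image P_compact continuous_L)
    then obtain M where "\<forall>z\<in>L r ` P. norm z \<le> M" unfolding bounded_iff by blast
    then show ?thesis by (intro exI[of _ M]) (auto simp: abs_le_iff)
  qed
  then obtain M where M: "\<And>r y. y \<in> P \<Longrightarrow> L r y \<le> M r" by metis
  show ?thesis
  proof (rule that[of "(\<Sum>r\<in>UNIV. \<bar>M r\<bar>) + 1"])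
    show "(\<Sum>r\<in>UNIV. \<bar>M r\<bar>) + 1 > 0" by (simp add: add_nonneg_pos sum_nonneg)
    fix r y assume "y \<in> P"
    have "\<bar>M r\<bar> \<le> (\<Sum>r\<in>UNIV. \<bar>M r\<bar>)" by (rule member_le_sum) auto
    then show "L r y \<le> (\<Sum>r\<in>UNIV. \<bar>M r\<bar>) + 1" using M[OF \<open>y \<in> P\<close>, of r] by linarith
  qed
qed

text \<open>The coordinate of a lattice vector belonging to \<open>\<nu> r\<close> is a linear form
  on the lattice; the vector representing it is dual to the basis.\<close>

lemma lattice_dual_vector:
  assumes A: "lattice_basis A \<nu>" and r: "r \<in> A"
  shows "\<exists>e. nv r \<bullet> e = 1 \<and> (\<forall>s\<in>A. s \<noteq> r \<longrightarrow> nv s \<bullet> e = 0)"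
proof -
  let ?Q = "\<lambda>w k. (\<forall>r. r \<notin> A \<longrightarrow> k r = 0) \<and> w = (\<Sum>r\<in>A. k r *s \<nu> r)"
  have ex: "\<exists>!k. ?Q w k" for w using A by (simp add: lattice_basis_def)
  have uniq: "k1 = k2" if "?Q w k1" "?Q w k2" for w k1 k2 using ex[of w] that by blast
  obtain k where k: "\<And>w. ?Q w (k w)" using ex by metis
  \<comment> \<open>The linear extension of the coordinates of the unit vectors; uniqueness of the
    expansion identifies it with \<open>k\<close>.\<close>
  define j where "j w s = (\<Sum>i\<in>UNIV. w $ i * k (axis i 1) s)" for w s
  have "k w = j w" for w
  proof -
    have "w = (\<Sum>i\<in>UNIV. (w $ i) *s axis i 1)"
      by (simp add: vec_eq_iff axis_def if_distrib cong: if_cong)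
    also have "\<dots> = (\<Sum>i\<in>UNIV. (w $ i) *s (\<Sum>s\<in>A. k (axis i 1) s *s \<nu> s))" using k by metis
    also have "\<dots> = (\<Sum>i\<in>UNIV. \<Sum>s\<in>A. (w $ i * k (axis i 1) s) *s \<nu> s)"
      by (simp add: vec_eq_iff sum_distrib_left mult.assoc)
    also have "\<dots> = (\<Sum>s\<in>A. \<Sum>i\<in>UNIV. (w $ i * k (axis i 1) s) *s \<nu> s)" by (rule sum.swap)
    also have "\<dots> = (\<Sum>s\<in>A. j w s *s \<nu> s)"
      by (simp add: vec_eq_iff j_def sum_distrib_right)
    finally have "?Q w (j w)" using k by (simp add: j_def)
    then show ?thesis by (rule uniq[OF k])
  qed
  moreover have "k (\<nu> s) = (\<lambda>t. if t = s then 1 else 0)" if s: "s \<in> A" for s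
  proof -
    have "(\<Sum>t\<in>A. (if t = s then 1 else 0) *s \<nu> t) = (\<Sum>t\<in>A. if t = s then \<nu> t else 0)"
      by (rule sum.cong) auto
    then have "?Q (\<nu> s) (\<lambda>t. if t = s then 1 else 0)" using s by simp
    then show ?thesis by (rule uniq[OF k])
  qed
  ultimately have js: "j (\<nu> s) r = (if r = s then 1 else 0)" if "s \<in> A" for s using that by metis
  define e where "e = (\<chi> i. real_of_int (k (axis i 1) r))"
  have "nv s \<bullet> e = real_of_int (j (\<nu> s) r)" for s
    by (simp add: inner_vec_def real_vec_def e_def j_def)
  then show ?thesis using js r by (intro exI[of _ e]) auto
qed

text \<open>The Delzant condition speaks of vertices only. The face cut out by \<open>A\<close> has
  an extreme point, which is extreme in \<open>P\<close> as well, and the normals at this vertex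
  include those of \<open>A\<close>.\<close>

lemma face_dual_vector:
  assumes y: "y \<in> P" "\<And>s. s \<in> A \<Longrightarrow> L s y = 0" and r: "r \<in> A"
  shows "\<exists>e. nv r \<bullet> e = 1 \<and> (\<forall>s\<in>A. s \<noteq> r \<longrightarrow> nv s \<bullet> e = 0)"
proof -
  define F where "F = P \<inter> (\<Inter>s\<in>A. {y. L s y = 0})"
  have cF: "closed (\<Inter>s\<in>A. {y. L s y = 0})"
    by (auto simp: ell_def intro!: closed_INT closed_Collect_eq continuous_intros)
  have "{y. L s y = 0} = {y. nv s \<bullet> y = - c s}" for s by (auto simp: ell_def)
  then have "convex (\<Inter>s\<in>A. {y. L s y = 0})" by (auto intro!: convex_INT convex_hyperplane)
  then have "convex F" unfolding F_def by (intro convex_Int P_convex)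
  moreover have "compact F" unfolding F_def by (intro compact_Int_closed P_compact cF)
  moreover have "F \<noteq> {}" using y by (auto simp: F_def)
  ultimately obtain v where v: "v extreme_point_of F" using extreme_point_exists_convex by blast
  have vF: "v \<in> F" using v by (simp add: extreme_point_of_def)
  have "v extreme_point_of P"
    unfolding extreme_point_of_def
  proof (intro conjI ballI notI)
    show "v \<in> P" using vF by (simp add: F_def)
    fix a b assume ab: "a \<in> P" "b \<in> P" "v \<in> open_segment a b"
    then obtain t where t: "0 < t" "t < 1" "v = (1 - t) *\<^sub>R a + t *\<^sub>R b" "a \<noteq> b"
      by (auto simp: in_segment)
    have "L s a = 0 \<and> L s b = 0" if "s \<in> A" for s
    proof -
      have "L s v = (1 - t) * L s a + t * L s b" by (simp add: t(3) ell_def inner_add_right algebra_simps)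
      moreover have "L s v = 0" using vF that by (simp add: F_def)
      moreover have "L s a \<ge> 0" "L s b \<ge> 0" using ab by (auto simp: moment_polytope_def)
      ultimately show ?thesis using t(1,2)
        by (smt (verit) mult_nonneg_nonneg mult_pos_pos)
    qed
    then have "a \<in> F" "b \<in> F" using ab by (auto simp: F_def)
    then show False using v ab(3) by (simp add: extreme_point_of_def)
  qed
  then have lb: "lattice_basis {r. L r v = 0} \<nu>" using delz by (simp add: delzant_def)
  have sub: "A \<subseteq> {r. L r v = 0}" using vF by (auto simp: F_def)
  show ?thesis using lattice_dual_vector[OF lb, of r] r sub by blast
qed

text \<open>A compactness version of \<open>face_dual_vector\<close>: for small \<epsilon>, facets
  that are simultaneously \<epsilon>-close to a point of \<open>P\<close> have a common point. There
  are finitely many index sets, so \<epsilon> and the bound on the dual vectors are uniform.\<close>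

lemma dual_vectors:
  obtains \<epsilon> C where "\<epsilon> > 0" "C \<ge> 0"
    "\<And>y r. \<lbrakk>y \<in> P; L r y < \<epsilon>\<rbrakk> \<Longrightarrow> \<exists>e. norm e \<le> C \<and> nv r \<bullet> e = 1 \<and> (\<forall>s. s \<noteq> r \<longrightarrow> L s y < \<epsilon> \<longrightarrow> nv s \<bullet> e = 0)"
proof -
  define good where "good A \<longleftrightarrow> (\<exists>y\<in>P. \<forall>s\<in>A. L s y = 0)" for A
  \<comment> \<open>For facets without a common point the sum of their \<open>L s\<close> has a
    positive minimum on \<open>P\<close>; everywhere some \<open>L s\<close> is at least that
    minimum divided by the number of facets.\<close>
  have "\<exists>\<epsilon>>0. good A \<or> (\<forall>y\<in>P. \<exists>s\<in>A. L s y \<ge> \<epsilon>)" for A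
  proof (cases "good A")
    case False
    have ne: "P \<noteq> {}" using delz by (auto simp: delzant_def)
    have "continuous_on P (\<lambda>y. \<Sum>s\<in>A. L s y)" by (intro continuous_intros)
    then obtain y0 where y0: "y0 \<in> P" "\<And>y. y \<in> P \<Longrightarrow> (\<Sum>s\<in>A. L s y0) \<le> (\<Sum>s\<in>A. L s y)"
      using continuous_attains_inf[OF P_compact ne] by blast
    have nn: "L s y \<ge> 0" if "y \<in> P" for s y using that by (simp add: moment_polytope_def)
    define m where "m = (\<Sum>s\<in>A. L s y0)"
    have "m \<noteq> 0"
    proof
      assume "m = 0"
      then have "\<forall>s\<in>A. L s y0 = 0" using nn[OF y0(1)] by (simp add: m_def sum_nonneg_eq_0_iff)
      then show False using False y0(1) by (auto simp: good_def)
    qed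
    then have m: "m > 0" using sum_nonneg[of A "\<lambda>s. L s y0"] nn[OF y0(1)] by (simp add: m_def)
    have A: "card A > 0" using m by (cases "A = {}") (auto simp: m_def card_gt_0_iff)
    have "\<exists>s\<in>A. L s y \<ge> m / card A" if "y \<in> P" for y
    proof (rule ccontr)
      assume "\<not> ?thesis"
      then have "(\<Sum>s\<in>A. L s y) < (\<Sum>s\<in>A. m / card A)"
        using A by (intro sum_strict_mono) (auto simp: not_le card_gt_0_iff)
      also have "\<dots> = m" using A by (cases "A = {}") auto
      finally show False using y0(2)[OF that] by (simp add: m_def)
    qed
    then show ?thesis using m A by (intro exI[of _ "m / card A"]) auto
  qed (auto intro: exI[of _ 1])
  then obtain \<epsilon>' where \<epsilon>': "\<And>A. \<epsilon>' A > 0" "\<And>A. good A \<or> (\<forall>y\<in>P. \<exists>s\<in>A. L s y \<ge> \<epsilon>' A)" by metis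
  define \<epsilon> where "\<epsilon> = Min (range \<epsilon>')"
  have \<epsilon>: "\<epsilon> > 0" "\<epsilon> \<le> \<epsilon>' A" for A using \<epsilon>'(1) by (auto simp: \<epsilon>_def)
  have "\<forall>A r. \<exists>e. good A \<and> r \<in> A \<longrightarrow> nv r \<bullet> e = 1 \<and> (\<forall>s\<in>A. s \<noteq> r \<longrightarrow> nv s \<bullet> e = 0)"
    using face_dual_vector unfolding good_def by meson
  then obtain e where e: "\<And>A r. good A \<Longrightarrow> r \<in> A \<Longrightarrow> nv r \<bullet> e A r = 1 \<and> (\<forall>s\<in>A. s \<noteq> r \<longrightarrow> nv s \<bullet> e A r = 0)"
    by metis
  define C where "C = (\<Sum>A\<in>UNIV. \<Sum>r\<in>UNIV. norm (e A r))"
  have C: "norm (e A r) \<le> C" for A r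
  proof -
    have "norm (e A r) \<le> (\<Sum>r\<in>UNIV. norm (e A r))" by (rule member_le_sum) auto
    also have "\<dots> \<le> C" unfolding C_def by (rule member_le_sum[where f = "\<lambda>A. \<Sum>r\<in>UNIV. norm (e A r)"]) (auto intro: sum_nonneg)
    finally show ?thesis .
  qed
  show ?thesis
  proof (rule that[OF \<epsilon>(1)])
    show "C \<ge> 0" by (simp add: C_def sum_nonneg)
    fix y r assume y: "y \<in> P" "L r y < \<epsilon>"
    let ?A = "{s. L s y < \<epsilon>}"
    have "good ?A"
    proof (rule ccontr)
      assume "\<not> good ?A"
      then obtain s where "s \<in> ?A" "L s y \<ge> \<epsilon>' ?A" using \<epsilon>'(2) y(1) by blast
      then show False using \<epsilon>(2)[of ?A] by simp
    qed
    then show "\<exists>e. norm e \<le> C \<and> nv r \<bullet> e = 1 \<and> (\<forall>s. s \<noteq> r \<longrightarrow> L s y < \<epsilon> \<longrightarrow> nv s \<bullet> e = 0)"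
      using e[of ?A r] C[of ?A r] y(2) by (intro exI[of _ "e ?A r"]) auto
  qed
qed

text \<open>The Hessian of Guillemin's potential \<open>u_P\<close>, with simple poles along the
  facets; the identification is \<open>hess_u_P\<close>.\<close>

definition guillemin_hess :: "real^'n \<Rightarrow> real^'n^'n" where
  "guillemin_hess y = (\<chi> a b. \<Sum>r\<in>UNIV. nv r $ a * nv r $ b / L r y)"

lemma guillemin_hess_form: "x \<bullet> (guillemin_hess y *v z) = (\<Sum>s\<in>UNIV. (nv s \<bullet> x) * (nv s \<bullet> z) / L s y)"
proof -
  have "x \<bullet> (guillemin_hess y *v z) = (\<Sum>a\<in>UNIV. \<Sum>b\<in>UNIV. \<Sum>s\<in>UNIV. (nv s $ a * x $ a) * (nv s $ b * z $ b) / L s y)"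
    by (simp add: inner_vec_def matrix_vector_mult_def guillemin_hess_def sum_distrib_left sum_distrib_right mult_ac)
  also have "\<dots> = (\<Sum>a\<in>UNIV. \<Sum>s\<in>UNIV. \<Sum>b\<in>UNIV. (nv s $ a * x $ a) * (nv s $ b * z $ b) / L s y)"
    by (rule sum.cong[OF refl]) (rule sum.swap)
  also have "\<dots> = (\<Sum>s\<in>UNIV. \<Sum>a\<in>UNIV. \<Sum>b\<in>UNIV. (nv s $ a * x $ a) * (nv s $ b * z $ b) / L s y)"
    by (rule sum.swap)
  also have "\<dots> = (\<Sum>s\<in>UNIV. (nv s \<bullet> x) * (nv s \<bullet> z) / L s y)"
    by (simp add: inner_vec_def sum_product sum_divide_distrib[symmetric])
  finally show ?thesis .
qed

text \<open>On the bounded polytope all \<open>1 / L s y\<close> are bounded below, and the normals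
  span: a vector orthogonal to all of them would be a direction in which \<open>P\<close> is
  unbounded.\<close>

lemma guillemin_hess_coercive: obtains \<kappa> where "\<kappa> > 0" "\<And>y x. y \<in> interior P \<Longrightarrow> \<kappa> * (norm x)\<^sup>2 \<le> x \<bullet> (guillemin_hess y *v x)"
proof -
  obtain M where M: "M > 0" "\<And>r y. y \<in> P \<Longrightarrow> L r y \<le> M" using L_bounded by blast
  let ?q = "\<lambda>x. \<Sum>s\<in>UNIV. (nv s \<bullet> x)\<^sup>2"
  have ne: "sphere (0::real^'n) 1 \<noteq> {}" by simp
  have c: "continuous_on (sphere (0::real^'n) 1) ?q" by (intro continuous_intros)
  obtain v where v: "v \<in> sphere 0 1" "\<And>x. x \<in> sphere 0 1 \<Longrightarrow> ?q v \<le> ?q x"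
    using continuous_attains_inf[OF compact_sphere ne c] by blast
  have "?q v \<noteq> 0"
  proof
    assume "?q v = 0"
    then have z: "nv s \<bullet> v = 0" for s by (simp add: sum_nonneg_eq_0_iff)
    obtain y where y: "y \<in> P" using delz interior_subset[of P] by (auto simp: delzant_def)
    obtain B where B: "\<And>y. y \<in> P \<Longrightarrow> norm y \<le> B" using compact_imp_bounded[OF P_compact] by (auto simp: bounded_iff)
    define t where "t = B + norm y + 1"
    have "y + t *\<^sub>R v \<in> P" using y z by (simp add: moment_polytope_def L_add)
    then have "norm (y + t *\<^sub>R v) \<le> B" by (rule B)
    moreover have "norm (t *\<^sub>R v) \<le> norm (y + t *\<^sub>R v) + norm y"
      using norm_triangle_ineq4[of "y + t *\<^sub>R v" y] by simp
    moreover have "norm (t *\<^sub>R v) = \<bar>t\<bar>" using v(1) by simp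
    moreover have "t \<ge> B + norm y + 1" by (simp add: t_def)
    ultimately show False by linarith
  qed
  then have m: "?q v > 0" using sum_nonneg[of UNIV "\<lambda>s. (nv s \<bullet> v)\<^sup>2"] by simp
  have q: "?q v * (norm x)\<^sup>2 \<le> ?q x" for x
  proof (cases "x = 0")
    case False
    have "?q v \<le> ?q (x /\<^sub>R norm x)" using False by (intro v(2)) simp
    also have "\<dots> = ?q x / (norm x)\<^sup>2"
      by (simp add: sum_divide_distrib power_mult_distrib divide_inverse power_inverse sum_distrib_left mult_ac)
    finally show ?thesis using False by (simp add: pos_le_divide_eq)
  qed (simp add: sum_nonneg)
  show ?thesis
  proof (rule that[of "?q v / M"])
    show "?q v / M > 0" using m M by simp
    fix y x assume y: "y \<in> interior P"
    have yP: "y \<in> P" using y interior_subset by blast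
    have "?q v / M * (norm x)\<^sup>2 \<le> ?q x / M" using q[of x] M(1) by (simp add: divide_right_mono)
    also have "\<dots> = (\<Sum>s\<in>UNIV. (nv s \<bullet> x)\<^sup>2 / M)" by (simp add: sum_divide_distrib)
    also have "\<dots> \<le> (\<Sum>s\<in>UNIV. (nv s \<bullet> x) * (nv s \<bullet> x) / L s y)"
    proof (rule sum_mono)
      fix s
      have "L s y > 0" using y interior_P by auto
      then show "(nv s \<bullet> x)\<^sup>2 / M \<le> (nv s \<bullet> x) * (nv s \<bullet> x) / L s y"
        using M(2)[OF yP, of s] by (simp add: power2_eq_square divide_left_mono M(1))
    qed
    finally show "?q v / M * (norm x)\<^sup>2 \<le> x \<bullet> (guillemin_hess y *v x)" by (simp add: guillemin_hess_form)
  qed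
qed

lemma guillemin_hess_posdef: "y \<in> interior P \<Longrightarrow> positive_definite (guillemin_hess y)"
proof -
  assume y: "y \<in> interior P"
  obtain \<kappa> where \<kappa>: "\<kappa> > 0" "\<And>y x. y \<in> interior P \<Longrightarrow> \<kappa> * (norm x)\<^sup>2 \<le> x \<bullet> (guillemin_hess y *v x)"
    using guillemin_hess_coercive by blast
  have "v \<bullet> (guillemin_hess y *v v) > 0" if "v \<noteq> 0" for v
    using \<kappa>(2)[OF y, of v] mult_pos_pos[OF \<kappa>(1), of "(norm v)\<^sup>2"] that by auto
  then show ?thesis by (simp add: positive_definite_def guillemin_hess_def transpose_def vec_eq_iff mult.commute)
qed

text \<open>Testing \<open>G\<^sub>P w = \<nu>\<^sub>r\<close> with a vector dual to the nearby facets shows that \<open>w\<close> vanishes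
  to first order on the facet.\<close>

lemma guillemin_hess_inverse_normal:
  obtains C where "C \<ge> 0" "\<And>y r w. \<lbrakk>y \<in> interior P; guillemin_hess y *v w = nv r\<rbrakk> \<Longrightarrow>
    norm w \<le> C * L r y \<and> \<bar>nv r \<bullet> w - L r y\<bar> \<le> C * (L r y)\<^sup>2"
proof -
  obtain \<kappa> where \<kappa>: "\<kappa> > 0" "\<And>y x. y \<in> interior P \<Longrightarrow> \<kappa> * (norm x)\<^sup>2 \<le> x \<bullet> (guillemin_hess y *v x)"
    using guillemin_hess_coercive by blast
  obtain \<epsilon> Ce where \<epsilon>: "\<epsilon> > 0" "Ce \<ge> 0"
    and dual: "\<And>y r. \<lbrakk>y \<in> P; L r y < \<epsilon>\<rbrakk> \<Longrightarrow> \<exists>e. norm e \<le> Ce \<and> nv r \<bullet> e = 1 \<and> (\<forall>s. s \<noteq> r \<longrightarrow> L s y < \<epsilon> \<longrightarrow> nv s \<bullet> e = 0)"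
    using dual_vectors by blast
  define N where "N = (\<Sum>s\<in>(UNIV::'r set). norm (nv s) * norm (nv s) * Ce / \<epsilon>)"
  have N0: "N \<ge> 0" unfolding N_def using \<epsilon> by (intro sum_nonneg) auto
  \<comment> \<open>The first two summands serve points with \<open>l \<ge> \<epsilon>\<close>, the
    last two points with \<open>l < \<epsilon>\<close>.\<close>
  define C where "C = 1 / \<epsilon> + sqrt (1 / (\<kappa> * \<epsilon>)) + (N / \<kappa> + Ce) + N * (N / \<kappa> + Ce)"
  have C: "1 / \<epsilon> \<le> C" "sqrt (1 / (\<kappa> * \<epsilon>)) \<le> C" "N / \<kappa> + Ce \<le> C" "N * (N / \<kappa> + Ce) \<le> C"
    using \<epsilon> \<kappa>(1) N0 by (auto simp: C_def intro!: add_nonneg_nonneg)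
  have C0: "C \<ge> 0" using C(1) \<epsilon>(1) by (meson divide_nonneg_pos order_trans zero_le_one)
  show ?thesis
  proof (rule that[OF C0])
    fix y r w assume y: "y \<in> interior P" and w: "guillemin_hess y *v w = nv r"
    define l where "l = L r y"
    have pos: "L s y > 0" for s using y interior_P by auto
    have yP: "y \<in> P" using y interior_subset by blast
    define a where "a = nv r \<bullet> w"
    have ww: "w \<bullet> (guillemin_hess y *v w) = a" by (simp add: w a_def inner_commute)
    have l0: "l > 0" by (simp add: l_def pos)
    \<comment> \<open>The \<open>r\<close>-th term of the form at \<open>w\<close> is already
      \<open>a * a / l\<close>, and the whole form equals \<open>a\<close>; this yields
      \<open>a \<le> l\<close>.\<close>
    have "a * a / l \<le> a"
    proof -
      have "a * a / l \<le> (\<Sum>s\<in>UNIV. (nv s \<bullet> w) * (nv s \<bullet> w) / L s y)"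
        unfolding a_def l_def
        by (rule member_le_sum[where f = "\<lambda>s. (nv s \<bullet> w) * (nv s \<bullet> w) / L s y"]) (auto simp: pos less_imp_le)
      then show ?thesis using ww by (simp add: guillemin_hess_form)
    qed
    moreover have a0: "a \<ge> 0"
      using ww \<kappa>(2)[OF y, of w] \<kappa>(1) by (smt (verit) mult_nonneg_nonneg zero_le_power2)
    ultimately have al: "a \<le> l" using l0
      by (cases "a = 0") (auto simp: pos_divide_le_eq mult_le_cancel_left)
    have kw: "\<kappa> * (norm w)\<^sup>2 \<le> a" using \<kappa>(2)[OF y, of w] ww by simp
    have "norm w \<le> C * l \<and> \<bar>a - l\<bar> \<le> C * l\<^sup>2"
    proof (cases "l < \<epsilon>")
      case False
      \<comment> \<open>Away from the facet crude bounds suffice, since powers of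
        \<open>l / \<epsilon> \<ge> 1\<close> may be inserted freely.\<close>
      have "(norm w)\<^sup>2 \<le> l / \<kappa>" using kw al \<kappa>(1) by (simp add: pos_le_divide_eq mult.commute)
      also have "\<dots> \<le> l * (l / \<epsilon>) / \<kappa>" using False l0 \<epsilon> \<kappa>(1) by (intro divide_right_mono) (auto simp: pos_le_divide_eq)
      also have "\<dots> = (sqrt (1 / (\<kappa> * \<epsilon>)) * l)\<^sup>2"
        using \<epsilon>(1) \<kappa>(1) by (simp add: power_mult_distrib power2_eq_square[of l] mult.commute)
      finally have "norm w \<le> sqrt (1 / (\<kappa> * \<epsilon>)) * l" by (rule power2_le_imp_le) (use l0 \<epsilon> \<kappa>(1) in auto)
      also have "\<dots> \<le> C * l" using C(2) l0 by (intro mult_right_mono) auto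
      finally have 1: "norm w \<le> C * l" .
      have "\<bar>a - l\<bar> \<le> l" using a0 al by simp
      also have "\<dots> \<le> (1 / \<epsilon>) * l\<^sup>2" using False l0 \<epsilon>(1) by (simp add: power2_eq_square pos_le_divide_eq)
      also have "\<dots> \<le> C * l\<^sup>2" using C(1) by (intro mult_right_mono) auto
      finally show ?thesis using 1 by simp
    next
      case True
      then obtain e where e: "norm e \<le> Ce" "nv r \<bullet> e = 1" "\<And>s. s \<noteq> r \<Longrightarrow> L s y < \<epsilon> \<Longrightarrow> nv s \<bullet> e = 0"
        using dual[OF yP] unfolding l_def by blast
      \<comment> \<open>\<open>e\<close> annihilates every other normal of a facet closer than
        \<open>\<epsilon>\<close>, so the remaining terms have denominators at least
        \<open>\<epsilon>\<close> and the poles disappear.\<close>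
      have far: "\<bar>\<Sum>s\<in>UNIV - {r}. (nv s \<bullet> x) * (nv s \<bullet> e) / L s y\<bar> \<le> N * norm x" for x
      proof -
        have "\<bar>\<Sum>s\<in>UNIV - {r}. (nv s \<bullet> x) * (nv s \<bullet> e) / L s y\<bar>
            \<le> (\<Sum>s\<in>UNIV - {r}. norm (nv s) * norm (nv s) * Ce / \<epsilon> * norm x)"
        proof (rule order_trans[OF sum_abs sum_mono])
          fix s assume s: "s \<in> UNIV - {r}"
          show "\<bar>(nv s \<bullet> x) * (nv s \<bullet> e) / L s y\<bar> \<le> norm (nv s) * norm (nv s) * Ce / \<epsilon> * norm x"
          proof (cases "L s y < \<epsilon>")
            case True
            then show ?thesis using e(3)[of s] s \<epsilon> by simp
          next
            case False
            have "\<bar>nv s \<bullet> x\<bar> \<le> norm (nv s) * norm x" by (rule Cauchy_Schwarz_ineq2)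
            moreover have "\<bar>nv s \<bullet> e\<bar> \<le> norm (nv s) * Ce"
              using Cauchy_Schwarz_ineq2[of "nv s" e] mult_left_mono[OF e(1), of "norm (nv s)"] by simp
            ultimately have "\<bar>(nv s \<bullet> x) * (nv s \<bullet> e)\<bar> \<le> (norm (nv s) * norm x) * (norm (nv s) * Ce)"
              unfolding abs_mult by (intro mult_mono) auto
            then have "\<bar>(nv s \<bullet> x) * (nv s \<bullet> e)\<bar> / L s y \<le> (norm (nv s) * norm x) * (norm (nv s) * Ce) / \<epsilon>"
              using False \<epsilon> by (intro frac_le) auto
            then show ?thesis using pos[of s] by (simp add: abs_divide mult_ac)
          qed
        qed
        also have "\<dots> \<le> (\<Sum>s\<in>UNIV. norm (nv s) * norm (nv s) * Ce / \<epsilon> * norm x)"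
          using \<epsilon> by (intro sum_mono2) auto
        also have "\<dots> = N * norm x" by (simp add: N_def sum_distrib_right)
        finally show ?thesis .
      qed
      have split: "x \<bullet> (guillemin_hess y *v e) = (nv r \<bullet> x) / l + (\<Sum>s\<in>UNIV - {r}. (nv s \<bullet> x) * (nv s \<bullet> e) / L s y)" for x
        unfolding guillemin_hess_form by (subst sum.remove[of UNIV r]) (auto simp: e(2) l_def)
      have sy: "x \<bullet> (guillemin_hess y *v x') = x' \<bullet> (guillemin_hess y *v x)" for x x' by (simp add: guillemin_hess_form mult.commute)
      \<comment> \<open>Subtracting the multiple of \<open>e\<close> makes
        \<open>nv r \<bullet> z = 0\<close>. The singular \<open>r\<close>-th term then drops out
        and coercivity bounds \<open>z\<close> by \<open>a\<close>, hence by
        \<open>l\<close>.\<close>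
      define z where "z = w - a *\<^sub>R e"
      have rz: "nv r \<bullet> z = 0" by (simp add: z_def inner_diff_right a_def[symmetric] e(2))
      have "z \<bullet> (guillemin_hess y *v z) = z \<bullet> (guillemin_hess y *v w) - a * (z \<bullet> (guillemin_hess y *v e))"
        by (simp add: z_def matrix_vector_mult_diff_distrib matrix_vector_mult_scaleR inner_diff_right)
      also have "z \<bullet> (guillemin_hess y *v w) = 0" using rz by (simp add: w inner_commute)
      also have "0 - a * (z \<bullet> (guillemin_hess y *v e)) \<le> a * (N * norm z)"
      proof -
        have "\<bar>z \<bullet> (guillemin_hess y *v e)\<bar> \<le> N * norm z" using far[of z] by (simp add: split rz)
        then have "- (z \<bullet> (guillemin_hess y *v e)) \<le> N * norm z" by linarith
        from mult_left_mono[OF this a0] show ?thesis by simp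
      qed
      finally have "\<kappa> * (norm z)\<^sup>2 \<le> a * (N * norm z)" using \<kappa>(2)[OF y, of z] by linarith
      then have "(\<kappa> * norm z) * norm z \<le> (a * N) * norm z" by (simp add: power2_eq_square mult_ac)
      then have "\<kappa> * norm z \<le> a * N"
        using a0 N0 by (cases "norm z = 0") (auto simp: mult_le_cancel_right)
      then have "norm z \<le> a * (N / \<kappa>)" using \<kappa>(1) by (simp add: pos_le_divide_eq mult.commute)
      also have "\<dots> \<le> l * (N / \<kappa>)" using al N0 \<kappa>(1) by (intro mult_right_mono) auto
      finally have nz: "norm z \<le> l * (N / \<kappa>)" .
      have "norm w \<le> norm z + norm (a *\<^sub>R e)" using norm_triangle_ineq[of z "a *\<^sub>R e"] by (simp add: z_def)
      also have "\<dots> \<le> l * (N / \<kappa>) + l * Ce"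
        using nz mult_mono[OF al e(1)] a0 l0 by simp
      finally have w1: "norm w \<le> (N / \<kappa> + Ce) * l" by (simp add: algebra_simps)
      \<comment> \<open>Testing the equation for \<open>w\<close> with \<open>e\<close> gives
        \<open>1 = a / l\<close> up to \<open>N * norm w\<close>, a term of order \<open>l\<close>;
        multiplication by \<open>l\<close> makes the error quadratic.\<close>
      have "1 = w \<bullet> (guillemin_hess y *v e)" using sy[of w e] e(2) by (simp add: w inner_commute)
      then have "1 - a / l = (\<Sum>s\<in>UNIV - {r}. (nv s \<bullet> w) * (nv s \<bullet> e) / L s y)" by (simp add: split a_def)
      then have "\<bar>1 - a / l\<bar> \<le> N * norm w" using far[of w] by simp
      also have "\<dots> \<le> N * ((N / \<kappa> + Ce) * l)" by (intro mult_left_mono w1 N0)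
      finally have "\<bar>1 - a / l\<bar> * l \<le> N * ((N / \<kappa> + Ce) * l) * l" using l0 by (intro mult_right_mono) auto
      moreover have "\<bar>1 - a / l\<bar> * l = \<bar>a - l\<bar>"
      proof -
        have "\<bar>1 - a / l\<bar> * l = \<bar>(1 - a / l) * l\<bar>" using l0 by (simp add: abs_mult)
        also have "(1 - a / l) * l = l - a" using l0 by (simp add: algebra_simps)
        finally show ?thesis by simp
      qed
      ultimately have "\<bar>a - l\<bar> \<le> (N * (N / \<kappa> + Ce)) * l\<^sup>2" by (simp add: power2_eq_square mult_ac)
      also have "\<dots> \<le> C * l\<^sup>2" by (intro mult_right_mono C(4)) simp
      finally have "\<bar>a - l\<bar> \<le> C * l\<^sup>2" .
      moreover have "norm w \<le> C * l" using w1 mult_right_mono[OF C(3), of l] l0 by linarith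
      ultimately show ?thesis by simp
    qed
    then show "norm w \<le> C * L r y \<and> \<bar>nv r \<bullet> w - L r y\<bar> \<le> C * (L r y)\<^sup>2" by (simp add: a_def l_def)
  qed
qed

text \<open>In the expansion by rows, terms with a repeated normal vanish. In the others each pole
  occurs at most once and is cancelled by the product of all \<open>L r\<close>.\<close>

lemma guillemin_hess_det_bound: obtains D where "D > 0" "\<And>y. y \<in> interior P \<Longrightarrow> \<bar>det (guillemin_hess y) * (\<Prod>r\<in>UNIV. L r y)\<bar> \<le> D"
proof -
  obtain M where M: "M > 0" "\<And>r y. y \<in> P \<Longrightarrow> L r y \<le> M" using L_bounded by blast
  define K where "K = max 1 M ^ CARD('r)"
  define d where "d f = (\<Prod>i\<in>UNIV. nv (f i) $ i) * det (\<chi> i. nv (f i))" for f :: "'n \<Rightarrow> 'r"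
  define D where "D = (\<Sum>f\<in>UNIV. \<bar>d f\<bar> * K) + 1"
  have K0: "K \<ge> 0" by (simp add: K_def)
  show ?thesis
  proof (rule that[of D])
    show "D > 0" unfolding D_def using K0 by (intro add_nonneg_pos sum_nonneg) auto
    fix y assume y: "y \<in> interior P"
    have pos: "L s y > 0" for s using y interior_P by auto
    have yP: "y \<in> P" using y interior_subset by blast
    have "guillemin_hess y = (\<chi> i. \<Sum>s\<in>UNIV. (nv s $ i / L s y) *s nv s)"
      by (simp add: guillemin_hess_def vec_eq_iff)
    then have "det (guillemin_hess y) = (\<Sum>f\<in>UNIV. det (\<chi> i. (nv (f i) $ i / L (f i) y) *s nv (f i)))"
      by (simp only: det_sum_rows)
    also have "\<dots> = (\<Sum>f\<in>UNIV. d f * (\<Prod>i\<in>UNIV. inverse (L (f i) y)))"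
      by (simp add: det_rows_mul d_def divide_inverse prod.distrib mult_ac)
    finally have "det (guillemin_hess y) * (\<Prod>r\<in>UNIV. L r y) = (\<Sum>f\<in>UNIV. d f * ((\<Prod>i\<in>UNIV. inverse (L (f i) y)) * (\<Prod>r\<in>UNIV. L r y)))"
      by (simp add: sum_distrib_right mult.assoc)
    also have "\<bar>\<dots>\<bar> \<le> (\<Sum>f\<in>UNIV. \<bar>d f\<bar> * K)"
    proof (rule order_trans[OF sum_abs sum_mono])
      fix f :: "'n \<Rightarrow> 'r"
      show "\<bar>d f * ((\<Prod>i\<in>UNIV. inverse (L (f i) y)) * (\<Prod>r\<in>UNIV. L r y))\<bar> \<le> \<bar>d f\<bar> * K"
      proof (cases "inj f")
        case False
        then obtain i j where ij: "i \<noteq> j" "f i = f j" by (auto simp: inj_def)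
        have "det (\<chi> i. nv (f i)) = 0"
          by (rule det_identical_rows[OF ij(1)]) (simp add: row_def ij(2))
        then show ?thesis using K0 by (simp add: d_def)
      next
        case True
        have "(\<Prod>i\<in>UNIV. inverse (L (f i) y)) = (\<Prod>r\<in>range f. inverse (L r y))"
          using prod.reindex[OF True, of "\<lambda>r. inverse (L r y)"] by simp
        moreover have "(\<Prod>r\<in>UNIV. L r y) = (\<Prod>r\<in>range f. L r y) * (\<Prod>r\<in>UNIV - range f. L r y)"
          using prod.subset_diff[of "range f" UNIV "\<lambda>r. L r y"] by (simp add: mult.commute)
        moreover have "(\<Prod>r\<in>range f. inverse (L r y)) * (\<Prod>r\<in>range f. L r y) = 1"
          using pos by (simp add: prod.distrib[symmetric] less_imp_neq[symmetric] less_imp_neq[THEN not_sym])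
        ultimately have e: "(\<Prod>i\<in>UNIV. inverse (L (f i) y)) * (\<Prod>r\<in>UNIV. L r y) = (\<Prod>r\<in>UNIV - range f. L r y)"
          by (simp add: mult.assoc[symmetric])
        have "(\<Prod>r\<in>UNIV - range f. L r y) \<le> (\<Prod>r\<in>UNIV - range f. max 1 M)"
          using M(2)[OF yP] pos by (intro prod_mono) (auto simp: less_imp_le max.coboundedI2)
        also have "\<dots> = max 1 M ^ card (UNIV - range f)" by simp
        also have "\<dots> \<le> K" unfolding K_def by (intro power_increasing card_mono) auto
        finally have "(\<Prod>r\<in>UNIV - range f. L r y) \<le> K" .
        moreover have "(\<Prod>r\<in>UNIV - range f. L r y) \<ge> 0" using pos by (intro prod_nonneg) (auto simp: less_imp_le)
        ultimately show ?thesis unfolding e by (simp add: abs_mult mult_left_mono)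
      qed
    qed
    finally show "\<bar>det (guillemin_hess y) * (\<Prod>r\<in>UNIV. L r y)\<bar> \<le> D" by (simp add: D_def)
  qed
qed

end

section \<open>Boundary behaviour of a solution\<close>

text \<open>A uniform bound \<open>1 / m\<close> for inverses, by compactness: matrices of bounded
  norm with determinant bounded away from 0 form a compact set of invertible matrices.\<close>

lemma matrix_lower_bound:
  fixes c K :: real
  assumes "c > 0"
  shows "\<exists>m>0. \<forall>N :: real^'n^'n. norm N \<le> K \<longrightarrow> \<bar>det N\<bar> \<ge> c \<longrightarrow> (\<forall>x. m * norm x \<le> norm (N *v x))"
proof -
  let ?X = "cball 0 K \<inter> {N :: real^'n^'n. \<bar>det N\<bar> \<ge> c}"
  have "Ck_on 0 UNIV (\<lambda>N :: real^'n^'n. det N)"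
    by (rule Ck_on_det) (auto intro!: continuous_intros)
  then have cd: "continuous_on UNIV (\<lambda>N :: real^'n^'n. det N)" by simp
  then have "closed {N :: real^'n^'n. \<bar>det N\<bar> \<ge> c}"
    by (intro closed_Collect_le continuous_intros)
  then have X: "compact ?X" by (intro compact_Int_closed compact_cball)
  let ?Y = "?X \<times> sphere (0::real^'n) 1"
  have Y: "compact ?Y" by (intro compact_Times X compact_sphere)
  show ?thesis
  proof (cases "?X = {}")
    case True
    then show ?thesis by (intro exI[of _ 1]) auto
  next
    case False
    have ne: "?Y \<noteq> {}" using False by (simp add: Times_empty)
    have "continuous_on ?Y (\<lambda>z. norm (fst z *v snd z))"
      by (intro continuous_intros bounded_bilinear.continuous_on[OF bounded_bilinear_matrix_vector_mult])
    then obtain z where z: "z \<in> ?Y" "\<And>w. w \<in> ?Y \<Longrightarrow> norm (fst z *v snd z) \<le> norm (fst w *v snd w)"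
      using continuous_attains_inf[OF Y ne] by blast
    define m where "m = norm (fst z *v snd z)"
    have "m \<noteq> 0"
    proof
      assume "m = 0"
      then have 0: "fst z *v snd z = 0" by (simp add: m_def)
      have "det (fst z) \<noteq> 0" using z(1) assms by auto
      then have "invertible (fst z)" by (simp add: invertible_det_nz)
      then have "snd z = 0" using 0 by (simp add: invertible_left_inverse matrix_left_invertible_ker)
      then show False using z(1) by (auto simp: mem_Times_iff)
    qed
    then have m: "m > 0" by (simp add: m_def)
    have "m * norm x \<le> norm (N *v x)" if N: "norm N \<le> K" "\<bar>det N\<bar> \<ge> c" for N :: "real^'n^'n" and x
    proof (cases "x = 0")
      case False
      have "(N, x /\<^sub>R norm x) \<in> ?Y" using N False by simp
      from z(2)[OF this] have "m \<le> norm (N *v x) / norm x"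
        by (simp add: m_def matrix_vector_mult_scaleR divide_inverse mult.commute)
      then show ?thesis using False by (simp add: pos_le_divide_eq)
    qed simp
    then show ?thesis using m by blast
  qed
qed

lemma bounded_matrix_action:
  obtains K where "K \<ge> 0" "\<And>(A :: 'b::{real_normed_algebra_1,euclidean_space}^'m^'n) x. norm (A *v x) \<le> norm A * norm x * K"
  using bounded_bilinear.nonneg_bounded[OF bounded_bilinear_matrix_vector_mult] by blast

lemma smooth_up_to_boundary_bounded:
  assumes "compact P" "smooth_up_to_boundary P f"
  obtains B where "B \<ge> 0" "\<And>y. y \<in> P \<Longrightarrow> norm (f y) \<le> B"
proof -
  obtain U g where g: "open U" "P \<subseteq> U" "smooth_on U g" "\<And>x. x \<in> P \<Longrightarrow> g x = f x"
    using assms(2) unfolding smooth_up_to_boundary_def by blast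
  have "Ck_on 0 U g" using g(3) unfolding smooth_on_def by blast
  then have "continuous_on P g" using g(2) continuous_on_subset by auto
  then have "bounded (g ` P)" by (intro compact_imp_bounded compact_continuous_image assms(1))
  then obtain B where "\<forall>z\<in>g ` P. norm z \<le> B" unfolding bounded_iff by blast
  then have "norm (f y) \<le> \<bar>B\<bar>" if "y \<in> P" for y using g(4)[OF that] that by force
  then show ?thesis by (intro that[of "\<bar>B\<bar>"]) auto
qed

locale toric_solution = delzant_polytope \<nu> c for \<nu> :: "'r::finite \<Rightarrow> int^'n" and c :: "'r \<Rightarrow> real" +
  fixes u :: "real^'n \<Rightarrow> real" and \<xi> :: "real^'n \<Rightarrow> complex^'n^'n"
  assumes sp: "symplectic_potential \<nu> c u" and hg: "higgs_tensor \<nu> c \<xi>"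
    and hb: "higgs_bound P u \<xi>" and sol: "toric_HcscK \<nu> c u \<xi>"
begin

lemma Ck_on_L: "open S \<Longrightarrow> Ck_on k S (L r)"
  unfolding ell_def[abs_def] by (rule Ck_on_affine)

lemma L_pos: "y \<in> interior P \<Longrightarrow> L r y > 0" using interior_P by auto

lemma Ck_on_u_P: "Ck_on k (interior P) (u_P \<nu> c)"
  unfolding u_P_def[abs_def]
  by (intro Ck_on_sum Ck_on_mult Ck_on_ln Ck_on_L open_interior L_pos)

lemma hess_u_P: "y \<in> interior P \<Longrightarrow> hess (u_P \<nu> c) y = guillemin_hess y"
proof -
  assume y: "y \<in> interior P"
  have dL: "(L r has_derivative (\<lambda>v. nv r \<bullet> v)) (at x)" for r x
    unfolding ell_def[abs_def] by (auto intro!: derivative_eq_intros)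
  have p1: "partial a (u_P \<nu> c) x = (\<Sum>r\<in>UNIV. nv r $ a * (ln (L r x) + 1))" if x: "x \<in> interior P" for a x
  proof -
    have "(u_P \<nu> c has_derivative (\<lambda>v. \<Sum>r\<in>UNIV. (nv r \<bullet> v) * (ln (L r x) + 1))) (at x)"
      unfolding u_P_def[abs_def]
    proof (rule has_derivative_sum)
      fix r
      have "((\<lambda>y. L r y * ln (L r y)) has_derivative
          (\<lambda>v. L r x * ((nv r \<bullet> v) * inverse (L r x)) + (nv r \<bullet> v) * ln (L r x))) (at x)"
        by (rule has_derivative_mult[OF dL has_derivative_ln[OF L_pos[OF x] dL]])
      moreover have "L r x * ((nv r \<bullet> v) * inverse (L r x)) + (nv r \<bullet> v) * ln (L r x) = (nv r \<bullet> v) * (ln (L r x) + 1)" for v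
        using L_pos[OF x, of r] by (simp add: algebra_simps)
      ultimately show "((\<lambda>y. L r y * ln (L r y)) has_derivative (\<lambda>v. (nv r \<bullet> v) * (ln (L r x) + 1))) (at x)"
        by simp
    qed
    from partial_eq[OF this, of a] show ?thesis by (simp add: inner_axis)
  qed
  have "partial b (partial a (u_P \<nu> c)) y = (\<Sum>r\<in>UNIV. nv r $ a * nv r $ b / L r y)" for a b
  proof -
    have "partial b (partial a (u_P \<nu> c)) y = partial b (\<lambda>x. \<Sum>r\<in>UNIV. nv r $ a * (ln (L r x) + 1)) y"
      by (rule partial_cong_open[OF open_interior y p1])
    also have "\<dots> = (\<Sum>r\<in>UNIV. nv r $ a * ((nv r \<bullet> axis b 1) * inverse (L r y) + 0))"
      by (rule partial_eq) (intro has_derivative_sum has_derivative_mult_right has_derivative_add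
          has_derivative_ln[OF L_pos[OF y] dL] has_derivative_const)
    finally show ?thesis by (simp add: inner_axis divide_inverse mult.assoc)
  qed
  then show ?thesis by (simp add: hess_def guillemin_hess_def vec_eq_iff)
qed

text \<open>The singular part of the Hessian is explicit; the remainder comes from a function smooth
  up to the boundary and is therefore bounded on the compact \<open>P\<close>.\<close>

lemma potential_decomp:
  obtains H B where "B \<ge> 0" "\<And>y. y \<in> interior P \<Longrightarrow> hess u y = guillemin_hess y + H y" "\<And>y. y \<in> P \<Longrightarrow> norm (H y) \<le> B"
    "\<And>k. Ck_on k (interior P) u"
proof -
  obtain h where h: "smooth_up_to_boundary P h" "\<And>y. y \<in> P \<Longrightarrow> u y = u_P \<nu> c y + h y"
    using sp unfolding symplectic_potential_def Let_def by blast
  obtain W g where g: "open W" "P \<subseteq> W" "smooth_on W g" "\<And>x. x \<in> P \<Longrightarrow> g x = h x"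
    using h(1) unfolding smooth_up_to_boundary_def by blast
  have iP: "interior P \<subseteq> P" by (rule interior_subset)
  have gk: "Ck_on k W g" for k using g(3) unfolding smooth_on_def by blast
  have gO: "Ck_on k (interior P) g" for k using Ck_on_subset[OF gk] g(2) iP by blast
  have ug: "u y = u_P \<nu> c y + g y" if "y \<in> interior P" for y using h(2) g(4) that iP by auto
  have uk: "Ck_on k (interior P) u" for k
  proof -
    have "Ck_on k (interior P) (\<lambda>y. u_P \<nu> c y + g y)" by (rule Ck_on_add[OF open_interior Ck_on_u_P gO])
    then show ?thesis by (subst Ck_on_cong[OF open_interior ug])
  qed
  have hu: "hess u y = guillemin_hess y + hess g y" if y: "y \<in> interior P" for y
  proof -
    have "hess u y = hess (\<lambda>y. u_P \<nu> c y + g y) y" by (rule hess_cong_open[OF open_interior y ug])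
    also have "\<dots> = hess (u_P \<nu> c) y + hess g y" by (rule hess_add[OF open_interior y Ck_on_u_P gO])
    finally show ?thesis by (simp add: hess_u_P[OF y])
  qed
  have "Ck_on 0 W (hess g)" by (rule Ck_on_hess[OF g(1) gk])
  then have "continuous_on P (hess g)" using g(2) continuous_on_subset by auto
  then have "bounded (hess g ` P)" by (intro compact_imp_bounded compact_continuous_image P_compact)
  then obtain B where "\<forall>z\<in>hess g ` P. norm z \<le> B" unfolding bounded_iff by blast
  then have "norm (hess g y) \<le> \<bar>B\<bar>" if "y \<in> P" for y using that by force
  then show ?thesis using that[of "\<bar>B\<bar>" "hess g"] hu uk by auto
qed

section \<open>Regularity of the coefficient matrix\<close>

lemma Ck_on_u: "Ck_on k (interior P) u" using potential_decomp by metis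

lemma G_posdef: "y \<in> interior P \<Longrightarrow> positive_definite (hess u y)"
  using sp unfolding symplectic_potential_def Let_def by blast

lemma posdef_det: "positive_definite (A :: real^'n^'n) \<Longrightarrow> det A \<noteq> 0"
proof -
  assume A: "positive_definite A"
  have "A *v x = 0 \<Longrightarrow> x = 0" for x using A by (auto simp: positive_definite_def)
  then have "invertible A" by (simp add: invertible_left_inverse matrix_left_invertible_ker)
  then show ?thesis by (simp add: invertible_det_nz)
qed

lemma Ck_on_G: "Ck_on k (interior P) (hess u)" by (rule Ck_on_hess[OF open_interior Ck_on_u])

lemma Ck_on_Ginv: "Ck_on k (interior P) (\<lambda>y. matrix_inv (hess u y))"
  by (rule Ck_on_matrix_inv[OF open_interior posdef_det[OF G_posdef] Ck_on_G])

lemma Ck_on_xi: "Ck_on k (interior P) \<xi>"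
  using hg unfolding higgs_tensor_def Let_def smooth_on_def by blast

lemma xi_sym: "y \<in> interior P \<Longrightarrow> transpose (\<xi> y) = \<xi> y"
  using hg unfolding higgs_tensor_def Let_def by blast

lemma Ck_on_S: "Ck_on k (interior P) (higgs_endo u \<xi>)"
  unfolding higgs_endo_def[abs_def]
  by (intro Ck_on_matrix_mult open_interior Ck_on_xi Ck_on_linear[OF bounded_linear_complex_matrix]
      Ck_on_linear[OF bounded_linear_cnj_matrix] Ck_on_G)

text \<open>At interior points the limit in \<open>higgs_bound\<close> is the value itself, by
  continuity.\<close>

lemma S_spectral: "y \<in> interior P \<Longrightarrow> spectral_radius (higgs_endo u \<xi> y) < 1"
proof -
  assume y: "y \<in> interior P"
  have w: "at y within interior P = at y" by (rule at_within_open[OF y open_interior])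
  have "continuous (at y) (higgs_endo u \<xi>)"
    using Ck_on_continuous[OF Ck_on_S] y continuous_on_eq_continuous_at[OF open_interior] by blast
  then have "(higgs_endo u \<xi> \<longlongrightarrow> higgs_endo u \<xi> y) (at y)" by (simp add: continuous_at)
  then have "Lim (at y within interior P) (higgs_endo u \<xi>) = higgs_endo u \<xi> y"
    unfolding w by (intro tendsto_Lim) auto
  moreover have "y \<in> P" using y interior_subset by blast
  ultimately show ?thesis using hb unfolding higgs_bound_def by metis
qed

definition complex_coeff :: "real^'n \<Rightarrow> complex^'n^'n" where
  "complex_coeff y = matrix_sqrt (mat 1 - higgs_endo u \<xi> y) ** complex_matrix (matrix_inv (hess u y))"

text \<open>Test functions are real, so only the real part of the coefficients pairs with their
  Hessians; its double divergence is still the prescribed constant because that constant is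
  real.\<close>

definition real_coeff :: "real^'n \<Rightarrow> real^'n^'n" where "real_coeff y = re_matrix (complex_coeff y)"

lemmas coefficient = higgs_coefficient[OF G_posdef xi_sym S_spectral[unfolded higgs_endo_def],
    folded higgs_endo_def, folded complex_coeff_def, folded real_coeff_def]

lemma S_contraction: "y \<in> interior P \<Longrightarrow> \<exists>G m. contraction_form G (higgs_endo u \<xi> y) m"
  using higgs_contraction[OF G_posdef xi_sym S_spectral[unfolded higgs_endo_def]]
  unfolding higgs_endo_def by metis

lemma Ck_on_complex_coeff: "Ck_on k (interior P) complex_coeff"
proof (intro Ck_on_vec[OF open_interior])
  fix a b
  define f where "f y = complex_matrix (matrix_inv (hess u y)) *v axis b 1" for y
  have f: "Ck_on k (interior P) f" unfolding f_def
    by (intro Ck_on_matrix_vector_mult open_interior Ck_on_linear[OF bounded_linear_complex_matrix] Ck_on_Ginv Ck_on_const)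
  have "Ck_on k (interior P) (\<lambda>y. sqrt_series (higgs_endo u \<xi> y) *v f y)"
    by (rule Ck_on_local[OF open_interior])
      (rule Ck_on_sqrt_series[OF open_interior _ Ck_on_S f S_contraction])
  then have "Ck_on k (interior P) (\<lambda>y. (sqrt_series (higgs_endo u \<xi> y) *v f y) $ a)"
    by (rule Ck_on_component[OF open_interior])
  moreover have "complex_coeff y $ a $ b = (sqrt_series (higgs_endo u \<xi> y) *v f y) $ a" if "y \<in> interior P" for y
  proof -
    have "complex_coeff y $ a $ b = (complex_coeff y *v axis b 1) $ a"
      by (simp add: matrix_vector_mult_def axis_def if_distrib cong: if_cong)
    also have "complex_coeff y *v axis b 1 = sqrt_series (higgs_endo u \<xi> y) *v f y"
      unfolding complex_coeff_def f_def coefficient(1)[OF that that that] by (simp only: matrix_vector_mul_assoc)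
    finally show ?thesis .
  qed
  ultimately show "Ck_on k (interior P) (\<lambda>y. complex_coeff y $ a $ b)"
    by (subst Ck_on_cong[OF open_interior])
qed

lemma Ck_on_real_coeff: "Ck_on k (interior P) real_coeff"
  unfolding real_coeff_def[abs_def] by (rule Ck_on_linear[OF bounded_linear_re_matrix open_interior Ck_on_complex_coeff])

lemma partial_Re:
  fixes f :: "real^'n \<Rightarrow> complex"
  assumes "Ck_on (Suc k) S f" "y \<in> S"
  shows "partial a (\<lambda>y. Re (f y)) y = Re (partial a f y)"
  using partial_eq[OF has_derivative_Re[OF Ck_on_has_derivative[OF assms]]] by (simp add: partial_def)

lemma real_coeff_double_div:
  assumes y: "y \<in> interior P"
  shows "(\<Sum>a\<in>UNIV. \<Sum>b\<in>UNIV. partial b (partial a (\<lambda>y. real_coeff y $ a $ b)) y) = - const_C \<nu> c"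
proof -
  have v: "Ck_on (Suc (Suc 0)) (interior P) (\<lambda>y. complex_coeff y $ a $ b)" for a b
    by (intro Ck_on_component open_interior Ck_on_complex_coeff)
  have "partial b (partial a (\<lambda>y. real_coeff y $ a $ b)) y = Re (partial b (partial a (\<lambda>y. complex_coeff y $ a $ b)) y)" for a b
  proof -
    have "partial b (partial a (\<lambda>y. real_coeff y $ a $ b)) y = partial b (\<lambda>y. Re (partial a (\<lambda>y. complex_coeff y $ a $ b) y)) y"
      by (rule partial_cong_open[OF open_interior y]) (simp add: real_coeff_def re_matrix_def partial_Re[OF v])
    also have "\<dots> = Re (partial b (partial a (\<lambda>y. complex_coeff y $ a $ b)) y)"
      by (rule partial_Re[OF Ck_on_partial[OF v] y])
    finally show ?thesis .
  qed
  then have "(\<Sum>a\<in>UNIV. \<Sum>b\<in>UNIV. partial b (partial a (\<lambda>y. real_coeff y $ a $ b)) y) = Re (double_div complex_coeff y)"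
    by (simp add: double_div_def)
  also have "double_div complex_coeff y = - complex_of_real (const_C \<nu> c)"
    using sol y unfolding toric_HcscK_def complex_coeff_def[abs_def] by blast
  finally show ?thesis by simp
qed

lemma real_coeff_sym: "y \<in> interior P \<Longrightarrow> real_coeff y $ a $ b = real_coeff y $ b $ a"
proof -
  assume y: "y \<in> interior P"
  have "axis a 1 \<bullet> (real_coeff y *v axis b 1) = (real_coeff y *v axis a 1) \<bullet> axis b 1" by (rule coefficient(2)[OF y y y])
  then show ?thesis
    by (simp add: inner_axis inner_axis' matrix_vector_mult_basis column_def)
qed

text \<open>Donaldson's boundary conditions for the coefficient matrix.\<close>

lemma boundary_estimate:
  obtains C where "C \<ge> 0" "\<And>y r. y \<in> interior P \<Longrightarrow> norm (real_coeff y *v nv r) \<le> C * L r y"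
    "\<And>y r. y \<in> interior P \<Longrightarrow> \<bar>nv r \<bullet> (real_coeff y *v nv r) - L r y\<bar> \<le> C * (L r y)\<^sup>2"
proof -
  obtain \<kappa> where \<kappa>: "\<kappa> > 0" "\<And>y x. y \<in> interior P \<Longrightarrow> \<kappa> * (norm x)\<^sup>2 \<le> x \<bullet> (guillemin_hess y *v x)"
    using guillemin_hess_coercive by blast
  obtain D where D: "D > 0" "\<And>y. y \<in> interior P \<Longrightarrow> \<bar>det (guillemin_hess y) * (\<Prod>r\<in>UNIV. L r y)\<bar> \<le> D"
    using guillemin_hess_det_bound by blast
  obtain H BH where H: "BH \<ge> 0" "\<And>y. y \<in> interior P \<Longrightarrow> hess u y = guillemin_hess y + H y" "\<And>y. y \<in> P \<Longrightarrow> norm (H y) \<le> BH"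
    using potential_decomp by metis
  obtain C1 where C1: "C1 \<ge> 0" "\<And>y r w. \<lbrakk>y \<in> interior P; guillemin_hess y *v w = nv r\<rbrakk> \<Longrightarrow>
      norm w \<le> C1 * L r y \<and> \<bar>nv r \<bullet> w - L r y\<bar> \<le> C1 * (L r y)\<^sup>2"
    using guillemin_hess_inverse_normal by blast
  obtain K where K: "K \<ge> 0" "\<And>(A :: real^'n^'n) x. norm (A *v x) \<le> norm A * norm x * K"
    using bounded_matrix_action by blast
  obtain Kc where Kc: "Kc \<ge> 0" "\<And>(A :: complex^'n^'n) x. norm (A *v x) \<le> norm A * norm x * Kc"
    using bounded_matrix_action by blast
  have iP: "y \<in> P" if "y \<in> interior P" for y using that interior_subset by blast
  have Hx: "norm (H y *v x) \<le> (BH * K) * norm x" if "y \<in> interior P" for y x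
  proof -
    have "norm (H y *v x) \<le> norm (H y) * norm x * K" by (rule K(2))
    also have "\<dots> \<le> BH * norm x * K" by (intro mult_right_mono H(3) iP that K(1)) auto
    finally show ?thesis by (simp add: mult_ac)
  qed
  define h where "h = BH * K"
  have h0: "h \<ge> 0" using H(1) K(1) by (simp add: h_def)
  have gp: "norm v \<le> norm (guillemin_hess y *v v) / \<kappa>" if y: "y \<in> interior P" for y v
  proof -
    have "\<kappa> * (norm v)\<^sup>2 \<le> norm v * norm (guillemin_hess y *v v)"
      using \<kappa>(2)[OF y, of v] norm_cauchy_schwarz[of v "guillemin_hess y *v v"] by linarith
    then have "(\<kappa> * norm v) * norm v \<le> norm (guillemin_hess y *v v) * norm v" by (simp add: power2_eq_square mult_ac)
    then have "\<kappa> * norm v \<le> norm (guillemin_hess y *v v)" by (cases "norm v = 0") (auto simp: mult_le_cancel_right)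
    then show ?thesis using \<kappa>(1) by (simp add: pos_le_divide_eq mult.commute)
  qed
  obtain \<delta> where \<delta>: "continuous_on P \<delta>" "\<And>y. y \<in> P \<Longrightarrow> \<delta> y > 0"
    "\<And>y. y \<in> interior P \<Longrightarrow> det (hess u y) = inverse (\<delta> y * (\<Prod>r\<in>UNIV. L r y))"
    using sp unfolding symplectic_potential_def Let_def by blast
  obtain \<Delta> where \<Delta>: "\<Delta> > 0" "\<And>y. y \<in> P \<Longrightarrow> \<delta> y \<le> \<Delta>"
  proof -
    have "bounded (\<delta> ` P)" by (intro compact_imp_bounded compact_continuous_image P_compact \<delta>(1))
    then obtain B where "\<forall>z\<in>\<delta> ` P. norm z \<le> B" unfolding bounded_iff by blast
    then have "\<delta> y \<le> \<bar>B\<bar> + 1" if "y \<in> P" for y using that by force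
    then show ?thesis by (intro that[of "\<bar>B\<bar> + 1"]) auto
  qed
  \<comment> \<open>Measures \<open>hess u\<close> against \<open>guillemin_hess\<close>.
    \<open>N\<close> is the identity plus a bounded matrix by coercivity, and the determinant
    condition together with \<open>guillemin_hess_det_bound\<close> keeps \<open>det (N y)\<close>
    away from 0. So the inverse of \<open>N\<close> is bounded, and \<open>Ginv\<close>
    follows.\<close>
  define N where "N y = matrix_inv (guillemin_hess y) ** hess u y" for y
  have gpi: "invertible (guillemin_hess y)" if "y \<in> interior P" for y
    using posdef_det[OF guillemin_hess_posdef[OF that]] by (simp add: invertible_det_nz)
  have gpr: "guillemin_hess y *v (matrix_inv (guillemin_hess y) *v x) = x" if "y \<in> interior P" for y x
    using matrix_inv_right[OF gpi[OF that]] by (simp add: matrix_vector_mul_assoc)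
  have gpl: "matrix_inv (guillemin_hess y) *v (guillemin_hess y *v x) = x" if "y \<in> interior P" for y x
    using matrix_inv_left[OF gpi[OF that]] by (simp add: matrix_vector_mul_assoc)
  have detN: "\<bar>det (N y)\<bar> \<ge> 1 / (\<Delta> * D)" if y: "y \<in> interior P" for y
  proof -
    let ?p = "\<Prod>r\<in>UNIV. L r y"
    have Ln: "L r y \<noteq> 0" for r using L_pos[OF y, of r] by simp
    have p: "?p > 0" by (intro prod_pos) (auto simp: L_pos[OF y])
    have g0: "det (guillemin_hess y) \<noteq> 0" by (rule posdef_det[OF guillemin_hess_posdef[OF y]])
    have "det (matrix_inv (guillemin_hess y)) * det (guillemin_hess y) = 1"
      using matrix_inv_left[OF gpi[OF y]] by (metis det_I det_mul)
    then have "det (matrix_inv (guillemin_hess y)) = inverse (det (guillemin_hess y))" using g0 by (simp add: field_simps)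
    then have "\<bar>det (N y)\<bar> = 1 / (\<delta> y * \<bar>det (guillemin_hess y) * ?p\<bar>)"
      using \<delta>(2)[OF iP[OF y]] p by (simp add: N_def det_mul \<delta>(3)[OF y] abs_mult divide_inverse mult_ac)
    also have "1 / (\<delta> y * \<bar>det (guillemin_hess y) * ?p\<bar>) \<ge> 1 / (\<Delta> * D)"
      using \<delta>(2)[OF iP[OF y]] \<Delta>(2)[OF iP[OF y]] \<Delta>(1) D(1) D(2)[OF y] g0 p
      by (intro divide_left_mono mult_mono mult_pos_pos) (auto simp: Ln)
    finally show ?thesis .
  qed
  have Nv: "N y *v x = x + matrix_inv (guillemin_hess y) *v (H y *v x)" if "y \<in> interior P" for y x
    using gpl[OF that, of x]
    by (simp add: N_def H(2)[OF that] matrix_vector_mul_assoc[symmetric] matrix_vector_mult_add_rdistrib matrix_vector_right_distrib)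
  define KN where "KN = (\<Sum>i\<in>(UNIV::'n set). \<Sum>j\<in>(UNIV::'n set). 1 + h / \<kappa>)"
  have normN: "norm (N y) \<le> KN" if y: "y \<in> interior P" for y
  proof -
    have "norm (N y *v axis j 1) \<le> 1 + h / \<kappa>" for j
    proof -
      let ?x = "axis j 1 :: real^'n"
      have "norm (matrix_inv (guillemin_hess y) *v (H y *v ?x)) \<le> norm (H y *v ?x) / \<kappa>"
        using gp[OF y, of "matrix_inv (guillemin_hess y) *v (H y *v ?x)"] by (simp add: gpr[OF y])
      also have "\<dots> \<le> h / \<kappa>" using Hx[OF y, of ?x] \<kappa>(1) by (simp add: h_def divide_right_mono)
      finally show ?thesis unfolding Nv[OF y]
        using norm_triangle_ineq[of ?x "matrix_inv (guillemin_hess y) *v (H y *v ?x)"] by simp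
    qed
    then show ?thesis unfolding KN_def by (intro order_trans[OF norm_matrix_le_axis] sum_mono) auto
  qed
  obtain m where m: "m > 0" "\<And>(N :: real^'n^'n) x. norm N \<le> KN \<Longrightarrow> \<bar>det N\<bar> \<ge> 1 / (\<Delta> * D) \<Longrightarrow> m * norm x \<le> norm (N *v x)"
    using matrix_lower_bound[of "1 / (\<Delta> * D)" KN] \<Delta>(1) D(1) by (metis divide_pos_pos mult_pos_pos zero_less_one)
  have Gi: "invertible (hess u y)" if "y \<in> interior P" for y
    using posdef_det[OF G_posdef[OF that]] by (simp add: invertible_det_nz)
  have Gr: "hess u y *v (matrix_inv (hess u y) *v x) = x" if "y \<in> interior P" for y x
    using matrix_inv_right[OF Gi[OF that]] by (simp add: matrix_vector_mul_assoc)
  have Ginv: "norm (matrix_inv (hess u y) *v x) \<le> norm (matrix_inv (guillemin_hess y) *v x) / m" if y: "y \<in> interior P" for y x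
  proof -
    have "N y *v (matrix_inv (hess u y) *v x) = matrix_inv (guillemin_hess y) *v x"
      by (simp add: N_def matrix_vector_mul_assoc[symmetric] Gr[OF y])
    then have "m * norm (matrix_inv (hess u y) *v x) \<le> norm (matrix_inv (guillemin_hess y) *v x)"
      using m(2)[OF normN[OF y] detN[OF y], of "matrix_inv (hess u y) *v x"] by simp
    then show ?thesis using m(1) by (simp add: pos_le_divide_eq mult.commute)
  qed
  have GPinv: "norm (matrix_inv (guillemin_hess y) *v x) \<le> norm x / \<kappa>" if y: "y \<in> interior P" for y x
    using gp[OF y, of "matrix_inv (guillemin_hess y) *v x"] by (simp add: gpr[OF y])
  obtain F where F: "smooth_up_to_boundary P F"
    "\<And>y. y \<in> interior P \<Longrightarrow> F y = complex_matrix (hess (u_P \<nu> c) y) ** \<xi> y ** complex_matrix (hess (u_P \<nu> c) y)"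
    using hg unfolding higgs_tensor_def Let_def extends_smoothly_def by blast
  obtain BF0 where BF0: "BF0 \<ge> 0" "\<And>y. y \<in> P \<Longrightarrow> norm (F y) \<le> BF0"
    using smooth_up_to_boundary_bounded[OF P_compact F(1)] by blast
  obtain Kb where Kb: "Kb \<ge> 0" "\<And>A :: complex^'n^'n. norm (map_matrix cnj A) \<le> norm A * Kb"
    using bounded_linear.nonneg_bounded[OF bounded_linear_cnj_matrix] by blast
  have Fc: "norm (map_matrix cnj (F y) *v x) \<le> (BF0 * Kb * Kc) * norm x" if y: "y \<in> interior P" for y x
  proof -
    have "norm (map_matrix cnj (F y)) \<le> BF0 * Kb"
      by (rule order_trans[OF Kb(2)]) (intro mult_right_mono BF0(2) iP y Kb(1))
    then have "norm (map_matrix cnj (F y)) * norm x * Kc \<le> BF0 * Kb * norm x * Kc"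
      by (intro mult_right_mono Kc(1)) auto
    then show ?thesis using Kc(2)[of "map_matrix cnj (F y)" x] by (simp add: mult_ac)
  qed
  \<comment> \<open>The form of \<open>hess u\<close> is not bounded by \<open>norm p\<close> near
    the boundary, but it is by the norm of \<open>guillemin_hess y *v p\<close>, which dominates
    \<open>norm p\<close> by coercivity. The summands of \<open>q\<close> belong to the two parts of
    \<open>hess u\<close>.\<close>
  define q where "q = 1 / \<kappa> + h / \<kappa>\<^sup>2"
  have q0: "q \<ge> 0" using \<kappa>(1) h0 by (simp add: q_def)
  have pq: "p \<bullet> (hess u y *v p) \<le> q * (norm (guillemin_hess y *v p))\<^sup>2" if y: "y \<in> interior P" for y p
  proof -
    let ?g = "norm (guillemin_hess y *v p)"
    have np: "norm p \<le> ?g / \<kappa>" by (rule gp[OF y])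
    have "p \<bullet> (hess u y *v p) = p \<bullet> (guillemin_hess y *v p) + p \<bullet> (H y *v p)"
      by (simp add: H(2)[OF y] matrix_vector_mult_add_rdistrib inner_add_right)
    also have "\<dots> \<le> norm p * ?g + norm p * (h * norm p)"
    proof (intro add_mono)
      show "p \<bullet> (guillemin_hess y *v p) \<le> norm p * ?g" by (rule norm_cauchy_schwarz)
      show "p \<bullet> (H y *v p) \<le> norm p * (h * norm p)"
        using norm_cauchy_schwarz[of p "H y *v p"] mult_left_mono[OF Hx[OF y, of p], of "norm p"] by (simp add: h_def)
    qed
    also have "\<dots> \<le> (?g / \<kappa>) * ?g + (?g / \<kappa>) * (h * (?g / \<kappa>))"
      using np h0 \<kappa>(1) by (intro add_mono mult_mono mult_nonneg_nonneg) auto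
    also have "\<dots> = q * ?g\<^sup>2" by (simp add: q_def power2_eq_square algebra_simps)
    finally show ?thesis .
  qed
  define t where "t = q * (BF0 * Kb * Kc * C1)\<^sup>2"
  have t0: "t \<ge> 0" using q0 by (simp add: t_def)
  define bG where "bG = 1 / \<kappa> / m"
  have bG0: "bG \<ge> 0" using \<kappa>(1) m(1) by (simp add: bG_def)
  define C where "C = (C1 / m + sqrt (bG * t)) + (C1 + C1 * (h * (C1 / m)) + t)"
  have C0: "C1 / m + sqrt (bG * t) \<le> C" "C1 + C1 * (h * (C1 / m)) + t \<le> C" "C \<ge> 0"
    using C1(1) m(1) h0 t0 bG0 by (auto simp: C_def intro!: add_nonneg_nonneg)
  have main: "norm (real_coeff y *v nv r) \<le> C * L r y \<and> \<bar>nv r \<bullet> (real_coeff y *v nv r) - L r y\<bar> \<le> C * (L r y)\<^sup>2"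
    if y: "y \<in> interior P" for y r
  proof -
    define l where "l = L r y"
    have l0: "l > 0" by (simp add: l_def L_pos[OF y])
    define w where "w = matrix_inv (guillemin_hess y) *v nv r"
    define z where "z = matrix_inv (hess u y) *v nv r"
    have gw: "guillemin_hess y *v w = nv r" by (simp add: w_def gpr[OF y])
    have w1: "norm w \<le> C1 * l" "\<bar>nv r \<bullet> w - l\<bar> \<le> C1 * l\<^sup>2" using C1(2)[OF y gw] by (auto simp: l_def)
    have z1: "norm z \<le> C1 / m * l"
    proof -
      have "norm z \<le> norm w / m" unfolding z_def w_def by (rule Ginv[OF y])
      also have "\<dots> \<le> C1 * l / m" using w1(1) m(1) by (intro divide_right_mono) auto
      finally show ?thesis by simp
    qed
    have gsym: "x \<bullet> (guillemin_hess y *v x') = (guillemin_hess y *v x) \<bullet> x'" for x x' by (rule positive_definite_sym[OF guillemin_hess_posdef[OF y]])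
    \<comment> \<open>The two inverses applied to \<open>nv r\<close> differ through the bounded
      \<open>H\<close>: the difference of the pairings is \<open>w \<bullet> (H y *v z)\<close> up
      to sign, and both \<open>w\<close> and \<open>z\<close> are of order \<open>l\<close>.\<close>
    have zw: "\<bar>nv r \<bullet> z - nv r \<bullet> w\<bar> \<le> C1 * (h * (C1 / m)) * l\<^sup>2"
    proof -
      have "guillemin_hess y *v z + H y *v z = guillemin_hess y *v w"
        using Gr[OF y, of "nv r"] by (simp add: gw z_def H(2)[OF y] matrix_vector_mult_add_rdistrib)
      then have "w \<bullet> (guillemin_hess y *v z) + w \<bullet> (H y *v z) = w \<bullet> (guillemin_hess y *v w)" by (metis inner_add_right)
      moreover have "w \<bullet> (guillemin_hess y *v z) = nv r \<bullet> z" using gsym[of w z] by (simp only: gw)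
      moreover have "w \<bullet> (guillemin_hess y *v w) = nv r \<bullet> w" using gsym[of w w] by (simp only: gw)
      ultimately have "nv r \<bullet> z + w \<bullet> (H y *v z) = nv r \<bullet> w" by simp
      then have "\<bar>nv r \<bullet> z - nv r \<bullet> w\<bar> = \<bar>w \<bullet> (H y *v z)\<bar>" by linarith
      also have "\<dots> \<le> norm w * norm (H y *v z)" by (rule Cauchy_Schwarz_ineq2)
      also have "\<dots> \<le> (C1 * l) * (h * (C1 / m * l))"
      proof (rule mult_mono[OF w1(1)])
        have "norm (H y *v z) \<le> h * norm z" using Hx[OF y, of z] by (simp add: h_def)
        also have "\<dots> \<le> h * (C1 / m * l)" by (intro mult_left_mono z1 h0)
        finally show "norm (H y *v z) \<le> h * (C1 / m * l)" .
      qed (use C1(1) l0 in auto)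
      finally show ?thesis by (simp add: power2_eq_square mult_ac)
    qed
    \<comment> \<open>The defect between the inverse Hessian and \<open>real_coeff\<close>: positive
      semidefinite, uniformly bounded, and to be shown small at \<open>nv r\<close>.\<close>
    define E where "E x = matrix_inv (hess u y) *v x - real_coeff y *v x" for x
    have co: "x \<bullet> (real_coeff y *v x) \<le> x \<bullet> (matrix_inv (hess u y) *v x)"
      "x \<bullet> (matrix_inv (hess u y) *v x) - (map_matrix cnj (\<xi> y) *v complex_vec x) \<bullet> (complex_matrix (hess u y) *v (map_matrix cnj (\<xi> y) *v complex_vec x)) \<le> x \<bullet> (real_coeff y *v x)" for x
      using coefficient(4,5)[OF y y y] by blast+
    have R0: "x \<bullet> (real_coeff y *v x) \<ge> 0" for x using coefficient(3)[OF y y y, of x] by (cases "x = 0") auto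
    have E0: "x \<bullet> E x \<ge> 0" for x using co(1)[of x] by (simp add: E_def inner_diff_right)
    have EG: "x \<bullet> E x \<le> bG * (norm x)\<^sup>2" for x
    proof -
      have "x \<bullet> E x \<le> x \<bullet> (matrix_inv (hess u y) *v x)" using R0[of x] by (simp add: E_def inner_diff_right)
      also have "\<dots> \<le> norm x * norm (matrix_inv (hess u y) *v x)" by (rule norm_cauchy_schwarz)
      also have "\<dots> \<le> norm x * (norm x / \<kappa> / m)"
        using GPinv[OF y, of x] m(1) by (intro mult_left_mono order_trans[OF Ginv[OF y]] divide_right_mono) auto
      finally show ?thesis by (simp add: bG_def power2_eq_square mult_ac)
    qed
    have Esym: "x \<bullet> E x' = x' \<bullet> E x" for x x'
    proof -
      have "x \<bullet> (matrix_inv (hess u y) *v x') = x' \<bullet> (matrix_inv (hess u y) *v x)"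
        using positive_definite_sym[OF G_posdef[OF y], of "matrix_inv (hess u y) *v x" "matrix_inv (hess u y) *v x'"]
        by (simp add: Gr[OF y] inner_commute)
      moreover have "x \<bullet> (real_coeff y *v x') = x' \<bullet> (real_coeff y *v x)"
        using coefficient(2)[OF y y y, of x x'] by (simp only: inner_commute)
      ultimately show ?thesis by (simp add: E_def inner_diff_right)
    qed
    \<comment> \<open>The defect form at \<open>nv r\<close> is at most the
      \<open>hess u\<close>-form of \<open>\<tau>\<close>. The regularity of the Higgs tensor
      concerns \<open>F\<close>, bounded up to the boundary; its conjugate applied to
      \<open>w\<close> is \<open>guillemin_hess\<close> applied to \<open>\<tau>\<close>, so the
      latter is of order \<open>l\<close> and \<open>pq\<close> gives a quadratic bound.\<close>
    have Er: "nv r \<bullet> E (nv r) \<le> t * l\<^sup>2"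
    proof -
      define \<tau> where "\<tau> = map_matrix cnj (\<xi> y) *v complex_vec (nv r)"
      have cm: "map_matrix cnj (A ** B) = map_matrix cnj A ** map_matrix cnj B" for A B :: "complex^'n^'n"
        by (simp add: map_matrix_def matrix_matrix_mult_def vec_eq_iff)
      have cc: "map_matrix cnj (complex_matrix A) = complex_matrix A" for A :: "real^'n^'n"
        by (simp add: map_matrix_def vec_eq_iff)
      have "map_matrix cnj (F y) *v complex_vec w = complex_matrix (guillemin_hess y) *v (map_matrix cnj (\<xi> y) *v (complex_matrix (guillemin_hess y) *v complex_vec w))"
        by (simp add: F(2)[OF y] hess_u_P[OF y] cm cc matrix_vector_mul_assoc matrix_mul_assoc)
      then have ft: "map_matrix cnj (F y) *v complex_vec w = complex_matrix (guillemin_hess y) *v \<tau>"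
        by (simp add: \<tau>_def complex_matrix_complex_vec gw)
      have nw: "norm (complex_vec w) = norm w" by (simp add: norm_eq_sqrt_inner inner_re_im)
      have "norm (complex_matrix (guillemin_hess y) *v \<tau>) \<le> (BF0 * Kb * Kc) * norm w"
        using Fc[OF y, of "complex_vec w"] by (simp add: ft nw)
      also have "\<dots> \<le> (BF0 * Kb * Kc) * (C1 * l)"
        by (intro mult_left_mono w1(1) mult_nonneg_nonneg BF0(1) Kb(1) Kc(1))
      finally have nt: "norm (complex_matrix (guillemin_hess y) *v \<tau>) \<le> (BF0 * Kb * Kc * C1) * l" by (simp add: mult_ac)
      have "nv r \<bullet> E (nv r) \<le> \<tau> \<bullet> (complex_matrix (hess u y) *v \<tau>)"
        using co(2)[of "nv r"] by (simp add: E_def inner_diff_right \<tau>_def)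
      also have "\<dots> = re_vec \<tau> \<bullet> (hess u y *v re_vec \<tau>) + im_vec \<tau> \<bullet> (hess u y *v im_vec \<tau>)"
        by (simp add: inner_re_im re_vec_complex_matrix im_vec_complex_matrix)
      also have "\<dots> \<le> q * (norm (guillemin_hess y *v re_vec \<tau>))\<^sup>2 + q * (norm (guillemin_hess y *v im_vec \<tau>))\<^sup>2"
        by (intro add_mono pq y)
      also have "\<dots> = q * (norm (complex_matrix (guillemin_hess y) *v \<tau>))\<^sup>2"
        by (simp add: power2_norm_eq_inner inner_re_im re_vec_complex_matrix im_vec_complex_matrix distrib_left)
      also have "\<dots> \<le> q * ((BF0 * Kb * Kc * C1) * l)\<^sup>2"
        by (intro mult_left_mono power_mono nt q0) auto
      finally show ?thesis by (simp add: t_def power_mult_distrib mult_ac)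
    qed
    \<comment> \<open>Cauchy-Schwarz for the form of \<open>E\<close>, at \<open>E (nv r)\<close>
      and \<open>nv r\<close>: the quadratic bound of the form at \<open>nv r\<close> becomes a
      linear bound of the vector \<open>E (nv r)\<close>.\<close>
    have nE: "norm (E (nv r)) \<le> sqrt (bG * t) * l"
    proof -
      let ?e = "E (nv r)"
      have "(?e \<bullet> E (nv r))\<^sup>2 \<le> (?e \<bullet> E ?e) * (nv r \<bullet> E (nv r))"
      proof (rule psd_Cauchy_Schwarz[where N = UNIV and \<beta> = "\<lambda>x y. x \<bullet> E y"])
        show "x \<bullet> E (x' + z) = x \<bullet> E x' + x \<bullet> E z" for x x' z
          by (simp add: E_def matrix_vector_right_distrib inner_add_right inner_diff_right)
        show "x \<bullet> E (r *\<^sub>R x') = r * (x \<bullet> E x')" for x x' r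
          by (simp add: E_def matrix_vector_mult_scaleR inner_diff_right right_diff_distrib)
      qed (rule Esym E0 subspace_UNIV UNIV_I)+
      also have "\<dots> \<le> (bG * (norm ?e)\<^sup>2) * (t * l\<^sup>2)"
        by (intro mult_mono EG Er E0 mult_nonneg_nonneg bG0) auto
      finally have "(norm ?e)\<^sup>2 * (norm ?e)\<^sup>2 \<le> (bG * t * l\<^sup>2) * (norm ?e)\<^sup>2"
        by (simp add: power2_norm_eq_inner[symmetric] power2_eq_square[of "(norm ?e)\<^sup>2"] mult_ac)
      then have "(norm ?e)\<^sup>2 \<le> bG * t * l\<^sup>2"
        using bG0 t0 by (cases "norm ?e = 0") (simp, rule mult_right_le_imp_le, assumption, simp)
      also have "\<dots> = (sqrt (bG * t) * l)\<^sup>2" using bG0 t0 by (simp add: power_mult_distrib)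
      finally show ?thesis by (rule power2_le_imp_le) (use bG0 t0 l0 in auto)
    qed
    have Re: "real_coeff y *v nv r = z - E (nv r)" by (simp add: E_def z_def)
    have "norm (real_coeff y *v nv r) \<le> (C1 / m + sqrt (bG * t)) * l"
      unfolding Re using norm_triangle_ineq4[of z "E (nv r)"] z1 nE by (simp add: distrib_right)
    also have "\<dots> \<le> C * l" using C0(1) l0 by (intro mult_right_mono) auto
    finally have 1: "norm (real_coeff y *v nv r) \<le> C * l" .
    have "nv r \<bullet> (real_coeff y *v nv r) - l = (nv r \<bullet> z - nv r \<bullet> w) + (nv r \<bullet> w - l) - nv r \<bullet> E (nv r)"
      by (simp add: Re inner_diff_right)
    then have "\<bar>nv r \<bullet> (real_coeff y *v nv r) - l\<bar> \<le> C1 * (h * (C1 / m)) * l\<^sup>2 + C1 * l\<^sup>2 + t * l\<^sup>2"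
      using zw w1(2) Er E0[of "nv r"] by linarith
    also have "\<dots> = (C1 + C1 * (h * (C1 / m)) + t) * l\<^sup>2" by (simp add: algebra_simps)
    also have "\<dots> \<le> C * l\<^sup>2" by (intro mult_right_mono C0(2)) simp
    finally show ?thesis using 1 by (simp add: l_def)
  qed
  show ?thesis using that[OF C0(3)] main by blast
qed

lemma real_coeff_pos: "y \<in> interior P \<Longrightarrow> x \<noteq> 0 \<Longrightarrow> x \<bullet> (real_coeff y *v x) > 0"
  using coefficient(3) by blast

lemma real_coeff_coercive:
  assumes K: "compact K" "K \<subseteq> interior P"
  obtains \<alpha> where "\<alpha> > 0" "\<And>y x. y \<in> K \<Longrightarrow> \<alpha> * (norm x)\<^sup>2 \<le> x \<bullet> (real_coeff y *v x)"
proof (cases "K = {}")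
  case True
  then show ?thesis using that[of 1] by simp
next
  case False
  let ?Y = "K \<times> sphere (0::real^'n) 1"
  have Y: "compact ?Y" by (intro compact_Times K(1) compact_sphere)
  have ne: "?Y \<noteq> {}" using False by (simp add: Times_empty)
  have Rc: "continuous_on K real_coeff" using Ck_on_continuous[OF Ck_on_real_coeff] continuous_on_subset K(2) by blast
  have "continuous_on ?Y (\<lambda>z. snd z \<bullet> (real_coeff (fst z) *v snd z))"
    by (intro continuous_intros bounded_bilinear.continuous_on[OF bounded_bilinear_matrix_vector_mult]
        continuous_on_compose2[OF Rc]) auto
  then obtain z where z: "z \<in> ?Y" "\<And>w. w \<in> ?Y \<Longrightarrow> snd z \<bullet> (real_coeff (fst z) *v snd z) \<le> snd w \<bullet> (real_coeff (fst w) *v snd w)"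
    using continuous_attains_inf[OF Y ne] by blast
  define \<alpha> where "\<alpha> = snd z \<bullet> (real_coeff (fst z) *v snd z)"
  have "snd z \<noteq> 0" "fst z \<in> interior P" using z(1) K(2) by (auto simp: mem_Times_iff)
  then have a: "\<alpha> > 0" unfolding \<alpha>_def by (intro real_coeff_pos)
  show ?thesis
  proof (rule that[OF a])
    fix y x assume y: "y \<in> K"
    show "\<alpha> * (norm x)\<^sup>2 \<le> x \<bullet> (real_coeff y *v x)"
    proof (cases "x = 0")
      case False
      have "(y, x /\<^sub>R norm x) \<in> ?Y" using y False by simp
      from z(2)[OF this] have "\<alpha> \<le> (x \<bullet> (real_coeff y *v x)) / (norm x)\<^sup>2"
        by (simp add: \<alpha>_def matrix_vector_mult_scaleR divide_inverse power2_eq_square mult_ac)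
      then show ?thesis using False by (simp add: pos_le_divide_eq)
    qed simp
  qed
qed

end

section \<open>Cutoff functions\<close>

text \<open>The cutoffs only have to be \<open>C\<^sup>2\<close>, so cubes of the positive part suffice.\<close>

definition pos_part :: "real \<Rightarrow> real" where "pos_part t = max 0 t"

lemma continuous_pos_part [continuous_intros]: "continuous_on S f \<Longrightarrow> continuous_on S (\<lambda>x. pos_part (f x))"
  unfolding pos_part_def by (intro continuous_intros)

lemma pos_part_simps [simp]: "t \<le> 0 \<Longrightarrow> pos_part t = 0" "t \<ge> 0 \<Longrightarrow> pos_part t = t" "pos_part t \<ge> 0"
  by (auto simp: pos_part_def)

lemma DERIV_pos_part_power:
  assumes "n \<ge> 1"
  shows "((\<lambda>t. pos_part t ^ Suc n) has_real_derivative real (Suc n) * pos_part t ^ n) (at t)"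
proof -
  consider "t > 0" | "t < 0" | "t = 0" by linarith
  then show ?thesis
  proof cases
    case 1
    have "((\<lambda>t. t ^ Suc n) has_real_derivative real (Suc n) * t ^ n) (at t)"
      by (rule derivative_eq_intros refl | simp)+
    then have "((\<lambda>t. pos_part t ^ Suc n) has_real_derivative real (Suc n) * t ^ n) (at t)"
      by (rule DERIV_cong_ev[THEN iffD1, rotated -1, OF _ refl _ refl])
        (use 1 in \<open>auto simp: eventually_nhds intro!: exI[of _ "{0<..}"]\<close>)
    then show ?thesis using 1 by simp
  next
    case 2
    have "((\<lambda>t. 0) has_real_derivative 0) (at t)" by simp
    then have "((\<lambda>t. pos_part t ^ Suc n) has_real_derivative 0) (at t)"
      by (rule DERIV_cong_ev[THEN iffD1, rotated -1, OF _ refl _ refl])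
        (use 2 in \<open>auto simp: eventually_nhds intro!: exI[of _ "{..<0}"]\<close>)
    then show ?thesis using 2 assms by (simp add: power_0_left)
  next
    case 3
    have "(\<lambda>h. (pos_part (0 + h) ^ Suc n - pos_part 0 ^ Suc n) / h) \<midarrow>0\<rightarrow> 0"
    proof (rule Lim_null_comparison)
      show "\<forall>\<^sub>F h in at 0. norm ((pos_part (0 + h) ^ Suc n - pos_part 0 ^ Suc n) / h) \<le> \<bar>h\<bar> ^ n"
      proof (intro always_eventually allI)
        fix h :: real
        show "norm ((pos_part (0 + h) ^ Suc n - pos_part 0 ^ Suc n) / h) \<le> \<bar>h\<bar> ^ n"
          by (cases "h \<le> 0") (auto simp: abs_mult)
      qed
      have "(\<lambda>h. \<bar>h\<bar> ^ n) \<midarrow>0\<rightarrow> \<bar>0::real\<bar> ^ n" by (intro tendsto_intros)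
      moreover have "\<bar>0::real\<bar> ^ n = 0" using assms by (simp add: power_0_left)
      ultimately show "(\<lambda>h. \<bar>h\<bar> ^ n) \<midarrow>(0::real)\<rightarrow> 0" by (simp only:)
    qed
    then show ?thesis using 3 assms by (simp add: DERIV_def power_0_left)
  qed
qed

lemma DERIV_pos_part_3: "((\<lambda>t. pos_part t ^ 3) has_real_derivative 3 * pos_part t ^ 2) (at t)"
  using DERIV_pos_part_power[of 2 t] by (simp add: eval_nat_numeral)

lemma DERIV_pos_part_2: "((\<lambda>t. pos_part t ^ 2) has_real_derivative 2 * pos_part t) (at t)"
  using DERIV_pos_part_power[of 1 t] by (simp add: eval_nat_numeral)

lemma Ck_on_compose_real:
  fixes f :: "'a::euclidean_space \<Rightarrow> real"
  assumes "open S" "Ck_on (Suc k) S f" "\<And>t. (\<phi> has_real_derivative \<phi>' t) (at t)" "Ck_on k S (\<lambda>x. \<phi>' (f x))"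
  shows "Ck_on (Suc k) S (\<lambda>x. \<phi> (f x))"
proof (rule Ck_on_SucI[OF assms(1)])
  show "((\<lambda>x. \<phi> (f x)) has_derivative (\<lambda>v. \<phi>' (f x) * frechet_derivative f (at x) v)) (at x)" if "x \<in> S" for x
    using has_derivative_compose[OF Ck_on_has_derivative[OF assms(2) that] assms(3)[THEN has_field_derivative_imp_has_derivative]]
    by simp
  show "Ck_on k S (\<lambda>x. \<phi>' (f x) * frechet_derivative f (at x) v)" for v
    using assms by (intro Ck_on_mult) auto
qed

lemma partial_compose_real:
  fixes f :: "real^'n \<Rightarrow> real"
  assumes "Ck_on (Suc k) S f" "y \<in> S" "(\<phi> has_real_derivative d) (at (f y))"
  shows "partial a (\<lambda>x. \<phi> (f x)) y = d * partial a f y"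
  using partial_eq[OF has_derivative_compose[OF Ck_on_has_derivative[OF assms(1,2)]
    assms(3)[THEN has_field_derivative_imp_has_derivative]]] by (simp add: partial_def)

lemma partial_cmult:
  fixes f :: "real^'n \<Rightarrow> real"
  assumes "Ck_on (Suc k) S f" "y \<in> S"
  shows "partial a (\<lambda>x. d * f x) y = d * partial a f y"
  using partial_eq[OF has_derivative_mult_right[OF Ck_on_has_derivative[OF assms], of d], of a]
  by (simp only: partial_def)

lemma Ck_on_pos_part:
  fixes f :: "'a::euclidean_space \<Rightarrow> real"
  assumes S: "open S" and f: "Ck_on 2 S f"
  shows "Ck_on 1 S (\<lambda>x. pos_part (f x) ^ 2)" "Ck_on 2 S (\<lambda>x. pos_part (f x) ^ 3)"
proof -
  have f': "Ck_on (Suc (Suc 0)) S f" using f by (simp add: numeral_2_eq_2)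
  have 0: "Ck_on 0 S (\<lambda>x. 2 * pos_part (f x))" using Ck_on_continuous[OF f] by (auto intro!: continuous_intros)
  have 1: "Ck_on (Suc 0) S (\<lambda>x. pos_part (f x) ^ 2)"
    by (rule Ck_on_compose_real[OF S Ck_on_pred[OF f'] DERIV_pos_part_2 0])
  then show "Ck_on 1 S (\<lambda>x. pos_part (f x) ^ 2)" by simp
  have "Ck_on (Suc 0) S (\<lambda>x. 3 * pos_part (f x) ^ 2)" by (intro Ck_on_mult S Ck_on_const 1)
  from Ck_on_compose_real[OF S f' DERIV_pos_part_3 this] show "Ck_on 2 S (\<lambda>x. pos_part (f x) ^ 3)"
    by (simp add: numeral_2_eq_2)
qed

context delzant_polytope
begin

text \<open>Vanishes where all \<open>L r y\<close> are at least \<open>2 * \<delta>\<close> and is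
  at least 1 once some \<open>L r y\<close> is at most \<open>\<delta>\<close>, so that
  \<open>cut\<close> rises from 0 to 1 in between. Over the relative interior of a facet only one
  summand remains for small \<open>\<delta>\<close>.\<close>

definition cutF :: "real \<Rightarrow> real^'n \<Rightarrow> real" where
  "cutF \<delta> y = (\<Sum>r\<in>UNIV. pos_part (2 - L r y / \<delta>) ^ 3)"

definition cut :: "real \<Rightarrow> real^'n \<Rightarrow> real" where "cut \<delta> y = pos_part (1 - cutF \<delta> y) ^ 3"

definition inner_part :: "real \<Rightarrow> (real^'n) set" where "inner_part \<delta> = {y. \<forall>r. L r y \<ge> \<delta>}"

lemma Ck_on_arg: "Ck_on k UNIV (\<lambda>y. 2 - L r y / \<delta>)"
proof -
  have "(\<lambda>y. 2 - L r y / \<delta>) = (\<lambda>y. (- (1 / \<delta>) *\<^sub>R nv r) \<bullet> y + (2 - c r / \<delta>))"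
    by (auto simp: ell_def add_divide_distrib)
  then show ?thesis using Ck_on_affine[OF open_UNIV] by metis
qed

lemma Ck_on_cutF: "Ck_on 2 UNIV (cutF \<delta>)"
  unfolding cutF_def[abs_def] by (intro Ck_on_sum open_UNIV Ck_on_pos_part(2) Ck_on_arg)

lemma Ck_on_1_minus_cutF: "Ck_on 2 UNIV (\<lambda>y. 1 - cutF \<delta> y)"
  by (intro Ck_on_diff open_UNIV Ck_on_const Ck_on_cutF)

lemma Ck_on_cut: "Ck_on 2 UNIV (cut \<delta>)"
  unfolding cut_def[abs_def] by (intro Ck_on_pos_part(2) open_UNIV Ck_on_1_minus_cutF)

lemma partial_arg: "partial a (\<lambda>y. 2 - L r y / \<delta>) y = - (nv r $ a / \<delta>)"
proof -
  have "((\<lambda>y. 2 - L r y / \<delta>) has_derivative (\<lambda>v. - ((nv r \<bullet> v) / \<delta>))) (at y)"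
    unfolding ell_def[abs_def] by (auto intro!: derivative_eq_intros simp: divide_inverse)
  from partial_eq[OF this] show ?thesis by (simp add: inner_axis)
qed

lemma partial_sum_fun:
  fixes f :: "'i \<Rightarrow> real^'n \<Rightarrow> real"
  assumes "\<And>i. i \<in> I \<Longrightarrow> Ck_on (Suc k) UNIV (f i)"
  shows "partial a (\<lambda>y. \<Sum>i\<in>I. f i y) y = (\<Sum>i\<in>I. partial a (f i) y)"
proof -
  have "((\<lambda>y. \<Sum>i\<in>I. f i y) has_derivative (\<lambda>v. \<Sum>i\<in>I. frechet_derivative (f i) (at y) v)) (at y)"
    by (intro has_derivative_sum Ck_on_has_derivative[OF assms] UNIV_I)
  from partial_eq[OF this] show ?thesis by (simp add: partial_def)
qed

lemma partial_cutF: "partial a (cutF \<delta>) y = (\<Sum>r\<in>UNIV. - (3 * pos_part (2 - L r y / \<delta>) ^ 2) * (nv r $ a / \<delta>))"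
proof -
  have "partial a (cutF \<delta>) y = (\<Sum>r\<in>UNIV. partial a (\<lambda>y. pos_part (2 - L r y / \<delta>) ^ 3) y)"
    unfolding cutF_def[abs_def]
    by (rule partial_sum_fun[where k = 1]) (use Ck_on_pos_part(2)[OF open_UNIV Ck_on_arg] in \<open>simp add: numeral_2_eq_2\<close>)
  also have "\<dots> = (\<Sum>r\<in>UNIV. - (3 * pos_part (2 - L r y / \<delta>) ^ 2) * (nv r $ a / \<delta>))"
  proof (rule sum.cong[OF refl])
    fix r
    show "partial a (\<lambda>y. pos_part (2 - L r y / \<delta>) ^ 3) y = - (3 * pos_part (2 - L r y / \<delta>) ^ 2) * (nv r $ a / \<delta>)"
      using partial_compose_real[OF Ck_on_arg[of "Suc 0" r \<delta>] UNIV_I DERIV_pos_part_3, of a y]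
      by (simp only: partial_arg)
  qed
  finally show ?thesis .
qed

lemma partial2_cutF:
  "partial b (partial a (cutF \<delta>)) y = (\<Sum>r\<in>UNIV. 6 * pos_part (2 - L r y / \<delta>) * (nv r $ a * nv r $ b / \<delta>\<^sup>2))"
proof -
  define g where "g r y = - (3 * (nv r $ a / \<delta>)) * pos_part (2 - L r y / \<delta>) ^ 2" for r y
  have p1: "Ck_on (Suc 0) UNIV (\<lambda>y. pos_part (2 - L r y / \<delta>) ^ 2)" for r
    using Ck_on_pos_part(1)[OF open_UNIV Ck_on_arg[of 2 r \<delta>]] by simp
  have "partial a (cutF \<delta>) = (\<lambda>y. \<Sum>r\<in>UNIV. g r y)"
    by (rule ext) (simp add: partial_cutF g_def mult_ac)
  then have "partial b (partial a (cutF \<delta>)) y = (\<Sum>r\<in>UNIV. partial b (g r) y)"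
    by (simp only:) (rule partial_sum_fun[where k = 0], unfold g_def, intro Ck_on_mult open_UNIV Ck_on_const p1)
  also have "\<dots> = (\<Sum>r\<in>UNIV. 6 * pos_part (2 - L r y / \<delta>) * (nv r $ a * nv r $ b / \<delta>\<^sup>2))"
  proof (rule sum.cong[OF refl])
    fix r
    have "partial b (\<lambda>y. pos_part (2 - L r y / \<delta>) ^ 2) y = 2 * pos_part (2 - L r y / \<delta>) * - (nv r $ b / \<delta>)"
      using partial_compose_real[OF Ck_on_arg[of "Suc 0" r \<delta>] UNIV_I DERIV_pos_part_2, of b y]
      by (simp only: partial_arg)
    moreover have "partial b (g r) y = - (3 * (nv r $ a / \<delta>)) * partial b (\<lambda>y. pos_part (2 - L r y / \<delta>) ^ 2) y"
      unfolding g_def by (rule partial_cmult[OF p1 UNIV_I])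
    ultimately show "partial b (g r) y = 6 * pos_part (2 - L r y / \<delta>) * (nv r $ a * nv r $ b / \<delta>\<^sup>2)"
      by (simp add: power2_eq_square)
  qed
  finally show ?thesis .
qed

lemma partial_cut: "partial a (cut \<delta>) y = - (3 * pos_part (1 - cutF \<delta> y) ^ 2) * partial a (cutF \<delta>) y"
proof -
  have c: "Ck_on (Suc 0) UNIV (\<lambda>y. 1 - cutF \<delta> y)" by (rule Ck_on_le[OF Ck_on_1_minus_cutF]) simp
  have c': "Ck_on (Suc 0) UNIV (cutF \<delta>)" by (rule Ck_on_le[OF Ck_on_cutF]) simp
  have "partial a (\<lambda>y. 1 - cutF \<delta> y) y = - partial a (cutF \<delta>) y"
    using partial_eq[OF has_derivative_diff[OF has_derivative_const Ck_on_has_derivative[OF c' UNIV_I]]]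
    by (simp add: partial_def)
  then show ?thesis
    unfolding cut_def[abs_def] using partial_compose_real[OF c UNIV_I DERIV_pos_part_3, of a y] by simp
qed

lemma partial2_cut:
  "partial b (partial a (cut \<delta>)) y = 6 * pos_part (1 - cutF \<delta> y) * (partial a (cutF \<delta>) y * partial b (cutF \<delta>) y)
     - 3 * pos_part (1 - cutF \<delta> y) ^ 2 * partial b (partial a (cutF \<delta>)) y"
proof -
  have c: "Ck_on (Suc 0) UNIV (\<lambda>y. 1 - cutF \<delta> y)" by (rule Ck_on_le[OF Ck_on_1_minus_cutF]) simp
  have c': "Ck_on (Suc 0) UNIV (cutF \<delta>)" by (rule Ck_on_le[OF Ck_on_cutF]) simp
  have c2: "Ck_on (Suc 0) UNIV (partial a (cutF \<delta>))"
    using Ck_on_partial[of "Suc 0" UNIV "cutF \<delta>"] Ck_on_cutF by (simp add: numeral_2_eq_2)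
  have p1: "Ck_on (Suc 0) UNIV (\<lambda>y. pos_part (1 - cutF \<delta> y) ^ 2)"
    using Ck_on_pos_part(1)[OF open_UNIV Ck_on_1_minus_cutF] by simp
  have m1: "Ck_on (Suc 0) UNIV (\<lambda>y. - (3 * pos_part (1 - cutF \<delta> y) ^ 2))"
    by (intro Ck_on_uminus Ck_on_mult open_UNIV Ck_on_const p1)
  have d1: "partial b (\<lambda>y. 1 - cutF \<delta> y) y = - partial b (cutF \<delta>) y"
    using partial_eq[OF has_derivative_diff[OF has_derivative_const Ck_on_has_derivative[OF c' UNIV_I]]]
    by (simp add: partial_def)
  have d2: "partial b (\<lambda>y. - (3 * pos_part (1 - cutF \<delta> y) ^ 2)) y = 6 * pos_part (1 - cutF \<delta> y) * partial b (cutF \<delta>) y"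
  proof -
    have "((\<lambda>t. - (3 * pos_part t ^ 2)) has_real_derivative - (6 * pos_part t)) (at t)" for t
      using DERIV_minus[OF DERIV_cmult[OF DERIV_pos_part_2[of t], of 3]] by simp
    from partial_compose_real[OF c UNIV_I this, of b y] show ?thesis by (simp add: d1)
  qed
  have "partial a (cut \<delta>) = (\<lambda>y. - (3 * pos_part (1 - cutF \<delta> y) ^ 2) * partial a (cutF \<delta>) y)"
    by (rule ext) (rule partial_cut)
  then show ?thesis
    using partial_bilinear[OF bounded_bilinear_mult m1 c2 UNIV_I, of b y] by (simp add: d2)
qed

lemma cut_off: "\<delta> > 0 \<Longrightarrow> y \<notin> inner_part \<delta> \<Longrightarrow> cut \<delta> y = 0"
proof -
  assume d: "\<delta> > 0" and "y \<notin> inner_part \<delta>"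
  then obtain r where r: "L r y < \<delta>" by (auto simp: inner_part_def not_le)
  then have "2 - L r y / \<delta> \<ge> 1" using d by (simp add: pos_divide_le_eq)
  then have "1 \<le> pos_part (2 - L r y / \<delta>) ^ 3" by (simp add: one_le_power)
  also have "\<dots> \<le> cutF \<delta> y" unfolding cutF_def by (rule member_le_sum) auto
  finally show ?thesis by (simp add: cut_def)
qed

lemma cutF_nonneg: "cutF \<delta> y \<ge> 0" by (simp add: cutF_def sum_nonneg)

lemma cut_bounds: "0 \<le> cut \<delta> y" "cut \<delta> y \<le> 1"
proof -
  have "pos_part (1 - cutF \<delta> y) \<le> 1" using cutF_nonneg[of \<delta> y] by (simp add: pos_part_def)
  then show "cut \<delta> y \<le> 1" unfolding cut_def by (simp add: power_le_one)
  show "0 \<le> cut \<delta> y" by (simp add: cut_def)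
qed

lemma cut_eq_1: "\<delta> > 0 \<Longrightarrow> y \<in> inner_part (2 * \<delta>) \<Longrightarrow> cut \<delta> y = 1"
proof -
  assume d: "\<delta> > 0" and y: "y \<in> inner_part (2 * \<delta>)"
  have "pos_part (2 - L r y / \<delta>) = 0" for r
    using y d by (simp add: inner_part_def pos_le_divide_eq)
  then show ?thesis by (simp add: cut_def cutF_def)
qed

lemma inner_part_subset: "\<delta> > 0 \<Longrightarrow> inner_part \<delta> \<subseteq> interior P"
  unfolding interior_P inner_part_def by (auto intro: less_le_trans)

lemma inner_part_compact: "\<delta> > 0 \<Longrightarrow> compact (inner_part \<delta>)"
proof -
  assume d: "\<delta> > 0"
  have "inner_part \<delta> = (\<Inter>r. {y. L r y \<ge> \<delta>})" by (auto simp: inner_part_def)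
  then have "closed (inner_part \<delta>)" by (simp add: ell_def closed_INT closed_Collect_le continuous_intros)
  moreover have "inner_part \<delta> = P \<inter> inner_part \<delta>" using inner_part_subset[OF d] interior_subset by blast
  ultimately show ?thesis by (metis P_compact compact_Int_closed)
qed

text \<open>Supplies the hypothesis \<open>npar\<close> of \<open>layer_limit\<close>. An interior
  point shows \<open>k > 0\<close>, so both facets would be the same set, against injectivity of the
  facet map.\<close>

lemma facet_parallel:
  assumes "s \<noteq> r" "nv s = k *\<^sub>R nv r" "c s = k * c r"
  shows False
proof -
  have Lk: "L s y = k * L r y" for y by (simp add: ell_def assms(2,3) algebra_simps)
  obtain y where y: "y \<in> interior P" using delz by (auto simp: delzant_def)
  have "L s y > 0" "L r y > 0" using y interior_P by auto
  then have k: "k > 0" using Lk[of y] by (simp add: zero_less_mult_iff)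
  have "facet \<nu> c s = facet \<nu> c r" using k by (auto simp: facet_def Lk)
  then show False using assms(1) delz by (auto simp: delzant_def inj_def)
qed

text \<open>The layer of width \<open>\<delta>\<close> along the facet is rescaled to unit width, where \<open>W\<close> tends to the profile \<open>\<kappa>\<close>;
  the part of the layer close to another facet is of lower order.\<close>

lemma facet_limit:
  fixes W :: "nat \<Rightarrow> real^'n \<Rightarrow> real" and \<kappa> :: "real \<Rightarrow> real"
  assumes \<delta>: "\<And>k. \<delta> k > 0" "\<delta> \<longlonglongrightarrow> 0" and f: "continuous_on P f"
    and Wc: "\<And>k. continuous_on (inner_part (\<delta> k)) (W k)"
    and WM: "\<And>k y. y \<in> inner_part (\<delta> k) \<Longrightarrow> \<bar>W k y\<bar> \<le> M"
    and Ws: "\<And>k y. y \<in> inner_part (\<delta> k) \<Longrightarrow> L r y > 2 * \<delta> k \<Longrightarrow> W k y = 0"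
    and \<kappa>: "continuous_on {0..2} \<kappa>" "\<And>\<tau>. \<tau> < 1 \<Longrightarrow> \<kappa> \<tau> = 0"
    and conv: "\<And>y \<tau>. \<lbrakk>1 \<le> \<tau>; \<tau> \<le> 2; \<forall>\<^sub>F k in sequentially. y k \<in> inner_part (\<delta> k) \<and> L r (y k) = \<tau> * \<delta> k \<and> cutF (\<delta> k) (y k) = pos_part (2 - \<tau>) ^ 3
          \<and> (\<forall>s. s \<noteq> r \<longrightarrow> L s (y k) \<ge> 2 * \<delta> k)\<rbrakk> \<Longrightarrow> (\<lambda>k. W k (y k)) \<longlonglongrightarrow> \<kappa> \<tau>"
  shows "(\<lambda>k. (1 / \<delta> k) * (LINT y:inner_part (\<delta> k)|lborel. W k y * f y)) \<longlonglongrightarrow>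
     (LBINT \<tau>:{0..2}. \<kappa> \<tau>) * ((LINT y:facet \<nu> c r|hyperplane_lborel (nv r) (c r). f y) / norm (nv r))"
proof -
  have PI: "P = {y. nv r \<bullet> y + c r \<ge> 0 \<and> (\<forall>s\<in>UNIV - {r}. nv s \<bullet> y + c s \<ge> 0)}"
    by (auto simp: moment_polytope_def ell_def)
  have KP: "inner_part (\<delta> k) \<subseteq> P" for k using inner_part_subset[OF \<delta>(1)] interior_subset by blast
  define g where "g k y = indicator (inner_part (\<delta> k)) y *\<^sub>R (W k y * f y)" for k y
  have "bounded (f ` P)" by (intro compact_imp_bounded compact_continuous_image P_compact f)
  then obtain Bf0 where "\<forall>z\<in>f ` P. norm z \<le> Bf0" unfolding bounded_iff by blast
  then have Bf: "\<bar>f y\<bar> \<le> \<bar>Bf0\<bar>" if "y \<in> P" for y using that by force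
  have bP: "bounded P" by (rule compact_imp_bounded[OF P_compact])
  have facet: "{y \<in> P. nv r \<bullet> y + c r = 0} = facet \<nu> c r" by (simp add: facet_def ell_def)
  have "(\<lambda>k. (1 / \<delta> k) * (LINT y|lborel. g k y)) \<longlonglongrightarrow>
    (LBINT \<tau>:{0..2}. \<kappa> \<tau>) * (LINT y:{y \<in> P. nv r \<bullet> y + c r = 0}|hyperplane_lborel (nv r) (c r). f y) / norm (nv r)"
    unfolding PI
  proof (rule layer_limit[where M = "\<bar>M\<bar> * \<bar>Bf0\<bar>"], unfold PI[symmetric])
    show "nv r \<noteq> 0" by (rule nv_nonzero)
    show "finite (UNIV - {r})" by simp
    show False if "s \<in> UNIV - {r}" "nv s = k *\<^sub>R nv r" "c s = k * c r" for s k
      using facet_parallel[of s r k] that by blast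
    show "g k \<in> borel_measurable borel" for k
      unfolding g_def using KP f inner_part_compact[OF \<delta>(1)]
      by (intro borel_measurable_continuous_on_indicator continuous_intros Wc)
        (auto intro: continuous_on_subset borel_compact)
    show "\<bar>g k y\<bar> \<le> \<bar>M\<bar> * \<bar>Bf0\<bar>" for k y
    proof (cases "y \<in> inner_part (\<delta> k)")
      case True
      then have "\<bar>W k y\<bar> * \<bar>f y\<bar> \<le> \<bar>M\<bar> * \<bar>Bf0\<bar>"
        using WM[OF True] Bf[of y] KP by (intro mult_mono) auto
      then show ?thesis using True by (simp add: g_def abs_mult)
    qed (simp add: g_def)
    show "y \<in> P \<and> nv r \<bullet> y + c r \<le> 2 * \<delta> k" if "g k y \<noteq> 0" for k y
    proof -
      have y: "y \<in> inner_part (\<delta> k)" "W k y \<noteq> 0" using that by (auto simp: g_def indicator_def split: if_splits)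
      then show ?thesis using Ws[OF y(1)] KP by (force simp: ell_def not_le[symmetric])
    qed
    fix z :: "real^'n" and \<tau> :: real assume z: "nv r \<bullet> z + c r = 0" "\<And>s. s \<in> UNIV - {r} \<Longrightarrow> 0 < nv s \<bullet> z + c s" and \<tau>: "0 \<le> \<tau>" "\<tau> \<le> 2"
    define y where "y k = z + (\<tau> * \<delta> k / (norm (nv r))\<^sup>2) *\<^sub>R nv r" for k
    have n0: "norm (nv r) \<noteq> 0" using nv_nonzero by simp
    have Lr: "L r (y k) = \<tau> * \<delta> k" for k
      using z(1) n0 by (simp add: y_def ell_def inner_add_right power2_norm_eq_inner)
    have zP: "z \<in> P" using z unfolding PI by (auto simp: less_imp_le)
    have ylim: "y \<longlonglongrightarrow> z"
    proof -
      have "y \<longlonglongrightarrow> z + (\<tau> * 0 / (norm (nv r))\<^sup>2) *\<^sub>R nv r" unfolding y_def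
        by (intro tendsto_intros \<delta>(2)) (use n0 in simp)
      then show ?thesis by simp
    qed
    \<comment> \<open>\<open>z\<close> is in the relative interior of the facet, so the other
      \<open>L s\<close> stay away from 0 and their contributions to \<open>cutF\<close> vanish
      eventually.\<close>
    have far: "\<forall>\<^sub>F k in sequentially. \<forall>s. s \<noteq> r \<longrightarrow> L s (y k) \<ge> 2 * \<delta> k"
    proof (rule eventually_all_finite)
      fix s
      show "\<forall>\<^sub>F k in sequentially. s \<noteq> r \<longrightarrow> L s (y k) \<ge> 2 * \<delta> k"
      proof (cases "s = r")
        case False
        have "(\<lambda>k. L s (y k) - 2 * \<delta> k) \<longlonglongrightarrow> L s z - 2 * 0"
          unfolding ell_def by (intro tendsto_intros ylim \<delta>(2))
        moreover have "L s z - 2 * 0 > 0" using z(2)[of s] False by (simp add: ell_def)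
        ultimately have "\<forall>\<^sub>F k in sequentially. L s (y k) - 2 * \<delta> k > 0" by (rule order_tendstoD(1))
        then show ?thesis by eventually_elim simp
      qed simp
    qed
    show "(\<lambda>k. g k (z + (\<tau> * \<delta> k / (norm (nv r))\<^sup>2) *\<^sub>R nv r)) \<longlonglongrightarrow> \<kappa> \<tau> * f z"
      unfolding y_def[symmetric]
    proof (cases "\<tau> < 1")
      case True
      have "y k \<notin> inner_part (\<delta> k)" for k
      proof
        assume "y k \<in> inner_part (\<delta> k)"
        then have "\<delta> k \<le> L r (y k)" unfolding inner_part_def by blast
        then have "\<delta> k \<le> \<tau> * \<delta> k" using Lr[of k] by simp
        then show False using True \<delta>(1)[of k] by (simp add: mult_le_cancel_right1)
      qed
      then show "(\<lambda>k. g k (y k)) \<longlonglongrightarrow> \<kappa> \<tau> * f z" using \<kappa>(2)[OF True] by (simp add: g_def)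
    next
      case False
      have ev: "\<forall>\<^sub>F k in sequentially. y k \<in> inner_part (\<delta> k) \<and> L r (y k) = \<tau> * \<delta> k \<and> cutF (\<delta> k) (y k) = pos_part (2 - \<tau>) ^ 3
          \<and> (\<forall>s. s \<noteq> r \<longrightarrow> L s (y k) \<ge> 2 * \<delta> k)"
        using far
      proof eventually_elim
        case (elim k)
        have d: "\<delta> k > 0" by (rule \<delta>(1))
        have "L s (y k) \<ge> \<delta> k" for s
          using elim[rule_format, of s] d Lr[of k] False
          by (cases "s = r") (auto simp: mult_le_cancel_right1)
        then have 1: "y k \<in> inner_part (\<delta> k)" by (simp add: inner_part_def)
        have "pos_part (2 - L s (y k) / \<delta> k) = 0" if "s \<noteq> r" for s
          using elim that d by (simp add: pos_le_divide_eq)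
        then have "(\<Sum>s\<in>UNIV - {r}. pos_part (2 - L s (y k) / \<delta> k) ^ 3) = 0" by simp
        then have "cutF (\<delta> k) (y k) = pos_part (2 - L r (y k) / \<delta> k) ^ 3"
          unfolding cutF_def by (subst sum.remove[of UNIV r]) auto
        then show ?case using 1 Lr[of k] elim d by simp
      qed
      have "(\<lambda>k. W k (y k)) \<longlonglongrightarrow> \<kappa> \<tau>" by (rule conv[OF _ _ ev]) (use False \<tau> in auto)
      moreover have "(\<lambda>k. f (y k)) \<longlonglongrightarrow> f z"
      proof (rule continuous_on_tendsto_compose[OF f ylim zP])
        show "\<forall>\<^sub>F k in sequentially. y k \<in> P" using ev by eventually_elim (use KP in blast)
      qed
      ultimately have lim: "(\<lambda>k. W k (y k) * f (y k)) \<longlonglongrightarrow> \<kappa> \<tau> * f z" by (rule tendsto_mult)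
      have "\<forall>\<^sub>F k in sequentially. W k (y k) * f (y k) = g k (y k)"
        using ev by eventually_elim (simp add: g_def)
      then show "(\<lambda>k. g k (y k)) \<longlonglongrightarrow> \<kappa> \<tau> * f z" by (rule Lim_transform_eventually[OF lim])
    qed
  qed (use \<delta> \<kappa>(1) f bP in auto)
  then show ?thesis unfolding facet by (simp add: set_lebesgue_integral_def g_def)
qed

text \<open>In the variable \<tau> = L / \<delta> the cutoff near a single facet is a function of
  \<tau> that increases from 0 to 1 on \<open>{0..2}\<close>; \<open>\<theta>1\<close> and
  \<open>\<theta>2\<close> are its first and second derivative. The first integral is its increment,
  the second follows from one integration by parts, since \<open>\<theta>1\<close> vanishes at
  2.\<close>

lemma profile_integrals:
  "(LBINT \<tau>:{0..2}. - (3 * pos_part (1 - pos_part (2 - \<tau>) ^ 3) ^ 2) * (- (3 * pos_part (2 - \<tau>) ^ 2))) = 1"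
  "(LBINT \<tau>:{0..2}. \<tau> * (6 * pos_part (1 - pos_part (2 - \<tau>) ^ 3) * (3 * pos_part (2 - \<tau>) ^ 2)\<^sup>2
      - 3 * pos_part (1 - pos_part (2 - \<tau>) ^ 3) ^ 2 * (6 * pos_part (2 - \<tau>)))) = - 1"
proof -
  define \<theta>1 where "\<theta>1 \<tau> = 9 * (pos_part (1 - pos_part (2 - \<tau>) ^ 3) ^ 2 * pos_part (2 - \<tau>) ^ 2)" for \<tau>
  define \<theta>2 where "\<theta>2 \<tau> = 6 * pos_part (1 - pos_part (2 - \<tau>) ^ 3) * (3 * pos_part (2 - \<tau>) ^ 2)\<^sup>2
      - 3 * pos_part (1 - pos_part (2 - \<tau>) ^ 3) ^ 2 * (6 * pos_part (2 - \<tau>))" for \<tau>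
  have a: "((\<lambda>\<tau>. 2 - \<tau>) has_real_derivative - 1) (at \<tau>)" for \<tau> :: real
    by (rule derivative_eq_intros refl | simp)+
  have q3: "((\<lambda>\<tau>. 1 - pos_part (2 - \<tau>) ^ 3) has_real_derivative 3 * pos_part (2 - \<tau>) ^ 2) (at \<tau>)" for \<tau>
    using DERIV_diff[OF DERIV_const DERIV_chain2[OF DERIV_pos_part_3 a]] by simp
  have q2: "((\<lambda>\<tau>. pos_part (2 - \<tau>) ^ 2) has_real_derivative - (2 * pos_part (2 - \<tau>))) (at \<tau>)" for \<tau>
    using DERIV_chain2[OF DERIV_pos_part_2 a] by simp
  have d0: "((\<lambda>\<tau>. pos_part (1 - pos_part (2 - \<tau>) ^ 3) ^ 3) has_real_derivative \<theta>1 \<tau>) (at \<tau>)" for \<tau>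
    using DERIV_chain2[OF DERIV_pos_part_3 q3] by (simp add: \<theta>1_def mult_ac)
  have d1: "(\<theta>1 has_real_derivative \<theta>2 \<tau>) (at \<tau>)" for \<tau>
  proof -
    have "(\<theta>1 has_real_derivative 9 * ((2 * pos_part (1 - pos_part (2 - \<tau>) ^ 3) * (3 * pos_part (2 - \<tau>) ^ 2)) * pos_part (2 - \<tau>) ^ 2
        + - (2 * pos_part (2 - \<tau>)) * pos_part (1 - pos_part (2 - \<tau>) ^ 3) ^ 2)) (at \<tau>)"
      unfolding \<theta>1_def[abs_def]
      by (intro DERIV_cmult DERIV_mult DERIV_chain2[OF DERIV_pos_part_2 q3] q2)
    then show ?thesis by (rule DERIV_cong) (simp add: \<theta>2_def power2_eq_square algebra_simps)
  qed
  have d2: "((\<lambda>\<tau>. \<tau> * \<theta>1 \<tau> - pos_part (1 - pos_part (2 - \<tau>) ^ 3) ^ 3) has_real_derivative \<tau> * \<theta>2 \<tau>) (at \<tau>)" for \<tau>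
    using DERIV_diff[OF DERIV_mult[OF DERIV_ident d1[of \<tau>]] d0[of \<tau>]] by (rule DERIV_cong) simp
  have c1: "continuous_on {0..2} \<theta>1" "continuous_on {0..2} (\<lambda>\<tau>. \<tau> * \<theta>2 \<tau>)"
    unfolding \<theta>1_def \<theta>2_def by (intro continuous_intros)+
  have "(LBINT \<tau>:{0..2}. \<theta>1 \<tau>) = pos_part (1 - pos_part (2 - 2) ^ 3) ^ 3 - pos_part (1 - pos_part (2 - 0) ^ 3) ^ 3"
    unfolding set_lebesgue_integral_def
    by (rule integral_FTC_Icc)
      (use d0 c1 in \<open>auto intro: has_field_derivative_at_within simp: has_real_derivative_iff_has_vector_derivative[symmetric]\<close>)
  also have "\<dots> = 1" by simp
  finally have 1: "(LBINT \<tau>:{0..2}. \<theta>1 \<tau>) = 1" .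
  have "(LBINT \<tau>:{0..2}. \<tau> * \<theta>2 \<tau>) = (2 * \<theta>1 2 - pos_part (1 - pos_part (2 - 2) ^ 3) ^ 3) - (0 * \<theta>1 0 - pos_part (1 - pos_part (2 - 0) ^ 3) ^ 3)"
    unfolding set_lebesgue_integral_def
    by (rule integral_FTC_Icc[where F = "\<lambda>\<tau>. \<tau> * \<theta>1 \<tau> - pos_part (1 - pos_part (2 - \<tau>) ^ 3) ^ 3"])
      (use d2 c1 in \<open>auto intro: has_field_derivative_at_within simp: has_real_derivative_iff_has_vector_derivative[symmetric]\<close>)
  also have "\<dots> = - 1" by (simp add: \<theta>1_def)
  finally have 2: "(LBINT \<tau>:{0..2}. \<tau> * \<theta>2 \<tau>) = - 1" .
  show "(LBINT \<tau>:{0..2}. - (3 * pos_part (1 - pos_part (2 - \<tau>) ^ 3) ^ 2) * (- (3 * pos_part (2 - \<tau>) ^ 2))) = 1"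
    using 1 by (simp add: \<theta>1_def mult_ac)
  show "(LBINT \<tau>:{0..2}. \<tau> * (6 * pos_part (1 - pos_part (2 - \<tau>) ^ 3) * (3 * pos_part (2 - \<tau>) ^ 2)\<^sup>2
      - 3 * pos_part (1 - pos_part (2 - \<tau>) ^ 3) ^ 2 * (6 * pos_part (2 - \<tau>)))) = - 1"
    using 2 by (simp add: \<theta>2_def)
qed

end

section \<open>The functional as an interior integral\<close>

lemma set_integral_sum:
  fixes f :: "'i \<Rightarrow> 'a \<Rightarrow> 'b::{banach, second_countable_topology}"
  assumes "\<And>i. i \<in> I \<Longrightarrow> set_integrable M A (f i)"
  shows "(LINT x:A|M. \<Sum>i\<in>I. f i x) = (\<Sum>i\<in>I. LINT x:A|M. f i x)"
  using assms unfolding set_lebesgue_integral_def set_integrable_def scaleR_sum_right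
  by (rule Bochner_Integration.integral_sum)

definition grad :: "(real^'n \<Rightarrow> real) \<Rightarrow> real^'n \<Rightarrow> real^'n" where
  "grad f y = (\<chi> a. partial a f y)"

lemma frechet_grad:
  fixes f :: "real^'n \<Rightarrow> real"
  assumes "Ck_on (Suc k) S f" "y \<in> S"
  shows "frechet_derivative f (at y) v = grad f y \<bullet> v"
  using frechet_derivative_at[OF has_derivative_partial_sum[OF assms]]
  by (simp add: grad_def inner_vec_def mult.commute fun_eq_iff)

text \<open>Difference quotients along the segment are bounded by convexity. Only the base point
  \<open>y\<close> has to be interior; \<open>x\<close> may lie on the boundary, where
  \<open>f\<close> has no gradient.\<close>

lemma convex_gradient_ineq:
  fixes f :: "real^'n \<Rightarrow> real"
  assumes f: "convex_on P f" and c: "Ck_on (Suc k) (interior P) f" and y: "y \<in> interior P" and x: "x \<in> P"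
  shows "f y + grad f y \<bullet> (x - y) \<le> f x"
proof -
  define v where "v = x - y"
  have yP: "y \<in> P" using y interior_subset by blast
  have "((\<lambda>t. f (y + t *\<^sub>R v)) has_real_derivative grad f y \<bullet> v) (at 0)"
    using has_real_derivative_line[OF c, of y 0 v] y frechet_grad[OF c y, of v] by simp
  then have "(\<lambda>t. (f (y + (0 + t) *\<^sub>R v) - f (y + 0 *\<^sub>R v)) / t) \<midarrow>0\<rightarrow> grad f y \<bullet> v"
    unfolding DERIV_def .
  then have l: "((\<lambda>t. (f (y + t *\<^sub>R v) - f y) / t) \<longlongrightarrow> grad f y \<bullet> v) (at_right 0)"
    by (simp add: filterlim_at_split)
  have "\<forall>\<^sub>F t in at_right (0::real). (f (y + t *\<^sub>R v) - f y) / t \<le> f x - f y"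
    unfolding eventually_at_right_field
  proof (intro exI[of _ 1] conjI allI impI)
    fix t :: real assume t: "0 < t" "t < 1"
    have "y + t *\<^sub>R v = (1 - t) *\<^sub>R y + t *\<^sub>R x" by (simp add: v_def algebra_simps)
    then have "f (y + t *\<^sub>R v) \<le> (1 - t) * f y + t * f x"
      using convex_onD[OF f, of t y x] t yP x by simp
    then have "f (y + t *\<^sub>R v) - f y \<le> (f x - f y) * t" by (simp add: algebra_simps)
    then show "(f (y + t *\<^sub>R v) - f y) / t \<le> f x - f y" by (subst pos_divide_le_eq[OF t(1)])
  qed simp
  then have "grad f y \<bullet> v \<le> f x - f y" by (rule tendsto_upperbound[OF l]) simp
  then show ?thesis by (simp add: v_def)
qed

lemma inner_matrix_sum: "x \<bullet> (R *v y) = (\<Sum>a\<in>UNIV. \<Sum>b\<in>UNIV. R $ a $ b * (x $ a * y $ b :: real))"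
  by (simp add: inner_vec_def matrix_vector_mult_def sum_distrib_left mult_ac)

context delzant_polytope
begin

section \<open>Gradients and cutoffs near the boundary\<close>

definition depth :: "nat \<Rightarrow> real" where "depth k = inverse (real (Suc k))"

lemma depth: "depth k > 0" "depth \<longlonglongrightarrow> 0"
  unfolding depth_def[abs_def] using LIMSEQ_inverse_real_of_nat by auto

definition normal_bound :: real where "normal_bound = (\<Sum>r\<in>UNIV. norm (nv r))"

lemma normal_bound: "norm (nv r) \<le> normal_bound" "normal_bound > 0"
proof -
  show 1: "norm (nv r) \<le> normal_bound" for r unfolding normal_bound_def by (rule member_le_sum) auto
  show "normal_bound > 0" using 1[of undefined] nv_nonzero[of undefined] by (meson less_le_trans zero_less_norm_iff)
qed

lemma inner_part_ball: "\<delta> > 0 \<Longrightarrow> y \<in> inner_part \<delta> \<Longrightarrow> norm v \<le> \<delta> / normal_bound \<Longrightarrow> y + v \<in> P"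
proof -
  assume a: "\<delta> > 0" "y \<in> inner_part \<delta>" "norm v \<le> \<delta> / normal_bound"
  have "L r (y + v) \<ge> 0" for r
  proof -
    have "\<bar>nv r \<bullet> v\<bar> \<le> norm (nv r) * norm v" by (rule Cauchy_Schwarz_ineq2)
    also have "\<dots> \<le> normal_bound * (\<delta> / normal_bound)" using normal_bound a(3) by (intro mult_mono) auto
    finally have "\<bar>nv r \<bullet> v\<bar> \<le> \<delta>" using normal_bound(2) by simp
    moreover have "L r y \<ge> \<delta>" using a(2) by (simp add: inner_part_def)
    ultimately show ?thesis by (simp add: L_add)
  qed
  then show ?thesis by (simp add: moment_polytope_def)
qed

text \<open>A step of length \<open>\<delta> / normal_bound\<close> along the gradient stays inside
  \<open>P\<close>, and \<open>f\<close> rises there by at least the increment of its tangent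
  plane.\<close>

lemma gradient_osc:
  assumes f: "convex_on P f" and c: "Ck_on (Suc j) (interior P) f" and d: "\<delta> > 0" and y: "y \<in> inner_part \<delta>"
    and osc: "\<And>x. x \<in> P \<Longrightarrow> norm (x - y) \<le> \<delta> / normal_bound \<Longrightarrow> f x - f y \<le> B" and B: "B \<ge> 0"
  shows "\<delta> * norm (grad f y) \<le> normal_bound * B"
proof (cases "grad f y = 0")
  case False
  define v where "v = (\<delta> / normal_bound / norm (grad f y)) *\<^sub>R grad f y"
  have nv: "norm v = \<delta> / normal_bound" using False d normal_bound(2) by (simp add: v_def)
  have x: "y + v \<in> P" by (rule inner_part_ball[OF d y]) (simp add: nv)
  have yi: "y \<in> interior P" using y inner_part_subset[OF d] by blast
  have "f y + grad f y \<bullet> (y + v - y) \<le> f (y + v)" by (rule convex_gradient_ineq[OF f c yi x])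
  moreover have "grad f y \<bullet> v = \<delta> / normal_bound * norm (grad f y)"
    using False by (simp add: v_def dot_square_norm power2_eq_square)
  moreover have "f (y + v) - f y \<le> B" by (rule osc[OF x]) (simp add: nv)
  ultimately have "\<delta> / normal_bound * norm (grad f y) \<le> B" by simp
  then show ?thesis using normal_bound(2) by (simp add: pos_divide_le_eq mult.commute)
qed (use normal_bound(2) B in simp)

text \<open>The gradient may be unbounded near the boundary; uniform continuity of \<open>f\<close>
  makes its oscillation on the scale of the depth tend to 0, and \<open>gradient_osc\<close>
  transfers this to depth times gradient. This decay removes the mixed term in
  \<open>L_C_limit\<close>.\<close>

lemma gradient_layer:
  assumes f: "convex_on P f" "continuous_on P f" and c: "Ck_on (Suc j) (interior P) f"
  shows "\<exists>G. \<forall>k. \<forall>y\<in>inner_part (depth k). depth k * norm (grad f y) \<le> G"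
    and "e > 0 \<Longrightarrow> \<forall>\<^sub>F k in sequentially. \<forall>y\<in>inner_part (depth k). depth k * norm (grad f y) \<le> e"
proof -
  have KP: "inner_part (depth k) \<subseteq> P" for k using inner_part_subset[OF depth(1)] interior_subset by blast
  have "bounded (f ` P)" by (intro compact_imp_bounded compact_continuous_image P_compact f)
  then obtain B where "\<forall>z\<in>f ` P. norm z \<le> B" unfolding bounded_iff by blast
  then have B: "\<bar>f y\<bar> \<le> \<bar>B\<bar>" if "y \<in> P" for y using that by force
  have "depth k * norm (grad f y) \<le> normal_bound * (2 * \<bar>B\<bar>)" if y: "y \<in> inner_part (depth k)" for k y
  proof (rule gradient_osc[OF f(1) c depth(1) y])
    fix x assume "x \<in> P"
    then show "f x - f y \<le> 2 * \<bar>B\<bar>" using B[of x] B[of y] y KP by fastforce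
  qed simp
  then show "\<exists>G. \<forall>k. \<forall>y\<in>inner_part (depth k). depth k * norm (grad f y) \<le> G" by blast
  assume e: "e > 0"
  have uc: "uniformly_continuous_on P f" by (rule compact_uniformly_continuous[OF f(2) P_compact])
  have en: "e / normal_bound > 0" using e normal_bound(2) by simp
  obtain d where d: "d > 0" "\<And>x y. x \<in> P \<Longrightarrow> y \<in> P \<Longrightarrow> dist x y < d \<Longrightarrow> dist (f x) (f y) < e / normal_bound"
    using uc en unfolding uniformly_continuous_on_def by metis
  have "(\<lambda>k. depth k / normal_bound) \<longlonglongrightarrow> 0 / normal_bound" by (intro tendsto_intros depth) (use normal_bound(2) in simp)
  then have "\<forall>\<^sub>F k in sequentially. depth k / normal_bound < d" using d(1) by (intro order_tendstoD(2)) auto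
  then show "\<forall>\<^sub>F k in sequentially. \<forall>y\<in>inner_part (depth k). depth k * norm (grad f y) \<le> e"
  proof eventually_elim
    case (elim k)
    show ?case
    proof
      fix y assume y: "y \<in> inner_part (depth k)"
      have "depth k * norm (grad f y) \<le> normal_bound * (e / normal_bound)"
      proof (rule gradient_osc[OF f(1) c depth(1) y])
        fix x assume x: "x \<in> P" "norm (x - y) \<le> depth k / normal_bound"
        then have "dist (f x) (f y) < e / normal_bound" using elim y KP by (intro d(2)) (auto simp: dist_norm)
        then show "f x - f y \<le> e / normal_bound" by (simp add: dist_real_def)
      qed (use en in simp)
      then show "depth k * norm (grad f y) \<le> e" using normal_bound(2) by simp
    qed
  qed
qed

lemma AE_not_frontier: "AE y in lborel. y \<notin> frontier P"
proof -
  have "frontier P \<in> null_sets lebesgue"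
    using negligible_convex_frontier[OF P_convex] by (simp add: negligible_iff_null_sets)
  then show ?thesis using AE_not_in by (subst AE_completion_iff[symmetric]) blast
qed

text \<open>Every interior point is eventually in the region where the cutoff is 1, and the frontier
  of a convex set is null.\<close>

lemma cut_limit:
  assumes w: "continuous_on P w"
  shows "(\<lambda>k. LINT y:inner_part (depth k)|lborel. cut (depth k) y * w y) \<longlonglongrightarrow> (LINT y:P|lborel. w y)"
proof -
  have KP: "inner_part (depth k) \<subseteq> P" for k using inner_part_subset[OF depth(1)] interior_subset by blast
  have "bounded (w ` P)" by (intro compact_imp_bounded compact_continuous_image P_compact w)
  then obtain B where "\<forall>z\<in>w ` P. norm z \<le> B" unfolding bounded_iff by blast
  then have B: "\<bar>w y\<bar> \<le> \<bar>B\<bar>" if "y \<in> P" for y using that by force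
  have cutc: "continuous_on S (cut \<delta>)" for S \<delta> using Ck_on_continuous[OF Ck_on_cut] continuous_on_subset by blast
  show ?thesis unfolding set_lebesgue_integral_def
  proof (rule integral_dominated_convergence[where w = "\<lambda>y. \<bar>B\<bar> * indicator P y"])
    show "(\<lambda>y. indicator P y *\<^sub>R w y) \<in> borel_measurable lborel"
      using borel_measurable_continuous_on_indicator[OF _ w] P_closed by simp
    show "(\<lambda>y. indicator (inner_part (depth k)) y *\<^sub>R (cut (depth k) y * w y)) \<in> borel_measurable lborel" for k
      using borel_measurable_continuous_on_indicator[of "inner_part (depth k)" "\<lambda>y. cut (depth k) y * w y"]
        inner_part_compact[OF depth(1)] continuous_on_subset[OF w KP] by (simp add: continuous_on_mult cutc borel_compact)
    show "integrable lborel (\<lambda>y. \<bar>B\<bar> * indicator P y)"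
      using emeasure_compact_finite[OF P_compact] P_closed by (auto simp: less_top)
    show "AE y in lborel. norm (indicator (inner_part (depth k)) y *\<^sub>R (cut (depth k) y * w y)) \<le> \<bar>B\<bar> * indicator P y" for k
    proof (intro AE_I2)
      fix y
      show "norm (indicator (inner_part (depth k)) y *\<^sub>R (cut (depth k) y * w y)) \<le> \<bar>B\<bar> * indicator P y"
      proof (cases "y \<in> inner_part (depth k)")
        case True
        have "\<bar>cut (depth k) y\<bar> * \<bar>w y\<bar> \<le> 1 * \<bar>B\<bar>"
          using cut_bounds[of "depth k" y] B[of y] True KP by (intro mult_mono) auto
        moreover have "y \<in> P" using True KP by blast
        ultimately show ?thesis using True by (simp add: abs_mult)
      qed simp
    qed
    show "AE y in lborel. (\<lambda>k. indicator (inner_part (depth k)) y *\<^sub>R (cut (depth k) y * w y)) \<longlonglongrightarrow> indicator P y *\<^sub>R w y"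
      using AE_not_frontier
    proof (rule AE_mp, intro AE_I2 impI)
      fix y assume nf: "y \<notin> frontier P"
      show "(\<lambda>k. indicator (inner_part (depth k)) y *\<^sub>R (cut (depth k) y * w y)) \<longlonglongrightarrow> indicator P y *\<^sub>R w y"
      proof (cases "y \<in> P")
        case True
        then have yi: "y \<in> interior P" using nf P_closed by (simp add: frontier_def)
        have "\<forall>\<^sub>F k in sequentially. \<forall>r. 2 * depth k < L r y"
        proof (rule eventually_all_finite)
          fix r
          have "(\<lambda>k. 2 * depth k) \<longlonglongrightarrow> 2 * 0" by (intro tendsto_intros depth)
          moreover have "2 * 0 < L r y" using yi interior_P by auto
          ultimately show "\<forall>\<^sub>F k in sequentially. 2 * depth k < L r y" by (rule order_tendstoD(2))
        qed
        then have "\<forall>\<^sub>F k in sequentially. indicator (inner_part (depth k)) y *\<^sub>R (cut (depth k) y * w y) = indicator P y *\<^sub>R w y"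
        proof eventually_elim
          case (elim k)
          have 1: "y \<in> inner_part (2 * depth k)" using elim by (simp add: inner_part_def less_imp_le)
          have "y \<in> inner_part (depth k)" unfolding inner_part_def
          proof (intro CollectI allI)
            fix r show "depth k \<le> L r y" using elim[rule_format, of r] depth(1)[of k] by linarith
          qed
          then show ?case using cut_eq_1[OF depth(1) 1] True by simp
        qed
        then show ?thesis by (rule tendsto_eventually)
      next
        case False
        then have "y \<notin> inner_part (depth k)" for k using KP by blast
        then show ?thesis using False by simp
      qed
    qed
  qed
qed

definition facet_integral :: "'r \<Rightarrow> (real^'n \<Rightarrow> real) \<Rightarrow> real" where
  "facet_integral r f = (LINT y:facet \<nu> c r|hyperplane_lborel (nv r) (c r). f y) / norm (nv r)"

lemma boundary_integral_facet_integral: "boundary_integral \<nu> c f = (\<Sum>r\<in>UNIV. facet_integral r f)"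
  by (simp add: boundary_integral_def facet_integral_def)

lemma pos_part_r_bounds: "\<delta> > 0 \<Longrightarrow> y \<in> inner_part \<delta> \<Longrightarrow> 0 \<le> pos_part (2 - L r y / \<delta>) \<and> pos_part (2 - L r y / \<delta>) \<le> 2"
proof -
  assume d: "\<delta> > 0" "y \<in> inner_part \<delta>"
  from d(2) have "L r y \<ge> \<delta>" by (simp add: inner_part_def)
  then have "L r y / \<delta> \<ge> 0" using d(1) by simp
  then show ?thesis by (simp add: pos_part_def)
qed

lemma pos_part_F_bounds: "0 \<le> pos_part (1 - cutF \<delta> y) \<and> pos_part (1 - cutF \<delta> y) \<le> 1"
  using cutF_nonneg[of \<delta> y] by (simp add: pos_part_def)

lemma pos_part_r_zero: "\<delta> > 0 \<Longrightarrow> L r y > 2 * \<delta> \<Longrightarrow> pos_part (2 - L r y / \<delta>) = 0"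
  by (simp add: pos_le_divide_eq)

lemma continuous_cutF: "continuous_on S (cutF \<delta>)"
  using Ck_on_continuous[OF Ck_on_cutF] continuous_on_subset by blast

lemma grad_cut: "grad (cut \<delta>) y = (\<Sum>r\<in>UNIV. (3 * pos_part (1 - cutF \<delta> y) ^ 2 * (3 * pos_part (2 - L r y / \<delta>) ^ 2) / \<delta>) *\<^sub>R nv r)"
  unfolding grad_def vec_eq_iff
  by (intro allI, simp only: partial_cut partial_cutF vec_lambda_beta sum_component sum_distrib_left)
    (intro sum.cong refl, simp)

text \<open>Integration of the divergence of \<open>(y - p\<^sub>0) f\<close> against the cutoff.\<close>

lemma radial_limit:
  assumes f: "convex_on P f" "continuous_on P f" and c: "Ck_on 1 (interior P) f"
  shows "(\<lambda>k. LINT y:inner_part (depth k)|lborel. cut (depth k) y * (grad f y \<bullet> (y - p0) + real CARD('n) * f y))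
     \<longlonglongrightarrow> (\<Sum>r\<in>UNIV. L r p0 * facet_integral r f)"
proof -
  have c1: "Ck_on (Suc 0) (interior P) f" using c by simp
  have KP: "inner_part (depth k) \<subseteq> P" for k using inner_part_subset[OF depth(1)] interior_subset by blast
  \<comment> \<open>Up to sign and the factor \<open>1 / depth k\<close>, the contribution of the
    facet \<open>r\<close> to the gradient of the cutoff paired with \<open>y - p0\<close>. On the
    facet its last factor tends to \<open>- L r p0\<close>, the coefficient in the limit.\<close>
  define W where "W r k y = - (3 * pos_part (1 - cutF (depth k) y) ^ 2) * (3 * pos_part (2 - L r y / depth k) ^ 2) * (L r y - L r p0)" for r k y
  obtain M where M: "M > 0" "\<And>r y. y \<in> P \<Longrightarrow> L r y \<le> M" using L_bounded by blast
  have "(\<lambda>k. (1 / depth k) * (LINT y:inner_part (depth k)|lborel. W r k y * f y)) \<longlonglongrightarrow>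
     (LBINT \<tau>:{0..2}. L r p0 * (- (3 * pos_part (1 - pos_part (2 - \<tau>) ^ 3) ^ 2) * (- (3 * pos_part (2 - \<tau>) ^ 2)))) * facet_integral r f" for r
    unfolding facet_integral_def
  proof (rule facet_limit[OF depth f(2), where M = "36 * (M + \<bar>L r p0\<bar>)"])
    show "continuous_on (inner_part (depth k)) (W r k)" for k
      unfolding W_def using depth(1)[of k] by (intro continuous_intros continuous_L continuous_cutF) auto
    show "\<bar>W r k y\<bar> \<le> 36 * (M + \<bar>L r p0\<bar>)" if y: "y \<in> inner_part (depth k)" for k y
    proof -
      have b: "0 \<le> pos_part (2 - L r y / depth k)" "pos_part (2 - L r y / depth k) \<le> 2" using pos_part_r_bounds[OF depth(1) y] by auto
      have a: "0 \<le> pos_part (1 - cutF (depth k) y)" "pos_part (1 - cutF (depth k) y) \<le> 1" using pos_part_F_bounds by auto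
      \<comment> \<open>The positive parts are at most 1 and 2, which is the origin of the constant
        \<open>36 = 3 * (3 * 4)\<close>.\<close>
      have "(3 * pos_part (1 - cutF (depth k) y) ^ 2) * (3 * pos_part (2 - L r y / depth k) ^ 2) \<le> (3 * 1 ^ 2) * (3 * 2 ^ 2)"
        using a b by (intro mult_mono power_mono) auto
      moreover have "\<bar>L r y - L r p0\<bar> \<le> M + \<bar>L r p0\<bar>"
      proof -
        have "L r y \<ge> 0" using y KP by (auto simp: moment_polytope_def)
        then show ?thesis using M(2)[of y r] y KP by fastforce
      qed
      ultimately have "\<bar>(3 * pos_part (1 - cutF (depth k) y) ^ 2) * (3 * pos_part (2 - L r y / depth k) ^ 2)\<bar> * \<bar>L r y - L r p0\<bar> \<le> 36 * (M + \<bar>L r p0\<bar>)"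
        by (intro mult_mono) auto
      then show ?thesis by (simp add: W_def abs_mult)
    qed
    show "W r k y = 0" if "y \<in> inner_part (depth k)" "L r y > 2 * depth k" for k y
      using pos_part_r_zero[OF depth(1) that(2)] by (simp add: W_def)
    show "continuous_on {0..2} (\<lambda>\<tau>. L r p0 * (- (3 * pos_part (1 - pos_part (2 - \<tau>) ^ 3) ^ 2) * (- (3 * pos_part (2 - \<tau>) ^ 2))))"
      by (intro continuous_intros)
    show "L r p0 * (- (3 * pos_part (1 - pos_part (2 - \<tau>) ^ 3) ^ 2) * (- (3 * pos_part (2 - \<tau>) ^ 2))) = 0" if "\<tau> < 1" for \<tau>
    proof -
      have "1 \<le> pos_part (2 - \<tau>) ^ 3" using that by (simp add: one_le_power)
      then show ?thesis by simp
    qed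
    fix y \<tau> assume \<tau>: "1 \<le> \<tau>" "\<tau> \<le> 2"
      and ev: "\<forall>\<^sub>F k in sequentially. y k \<in> inner_part (depth k) \<and> L r (y k) = \<tau> * depth k \<and> cutF (depth k) (y k) = pos_part (2 - \<tau>) ^ 3
          \<and> (\<forall>s. s \<noteq> r \<longrightarrow> L s (y k) \<ge> 2 * depth k)"
    let ?X = "- (3 * pos_part (1 - pos_part (2 - \<tau>) ^ 3) ^ 2) * (3 * pos_part (2 - \<tau>) ^ 2)"
    have "(\<lambda>k. ?X * (\<tau> * depth k - L r p0)) \<longlonglongrightarrow> ?X * (\<tau> * 0 - L r p0)" by (intro tendsto_intros depth)
    moreover have "\<forall>\<^sub>F k in sequentially. ?X * (\<tau> * depth k - L r p0) = W r k (y k)"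
      using ev
    proof eventually_elim
      case (elim k)
      then show ?case using depth(1)[of k] by (simp add: W_def)
    qed
    ultimately have "(\<lambda>k. W r k (y k)) \<longlonglongrightarrow> ?X * (\<tau> * 0 - L r p0)" by (rule Lim_transform_eventually)
    then show "(\<lambda>k. W r k (y k)) \<longlonglongrightarrow> L r p0 * (- (3 * pos_part (1 - pos_part (2 - \<tau>) ^ 3) ^ 2) * (- (3 * pos_part (2 - \<tau>) ^ 2)))"
      by (simp add: mult_ac)
  qed
  moreover have "(LBINT \<tau>:{0..2}. L r p0 * (- (3 * pos_part (1 - pos_part (2 - \<tau>) ^ 3) ^ 2) * (- (3 * pos_part (2 - \<tau>) ^ 2)))) = L r p0" for r
    using profile_integrals(1) by (simp only: set_integral_mult_right)
  ultimately have lim: "(\<lambda>k. (1 / depth k) * (LINT y:inner_part (depth k)|lborel. W r k y * f y)) \<longlonglongrightarrow> L r p0 * facet_integral r f" for r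
    by (simp only:)
  have eq: "(LINT y:inner_part (depth k)|lborel. cut (depth k) y * (grad f y \<bullet> (y - p0) + real CARD('n) * f y))
      = (\<Sum>r\<in>UNIV. (1 / depth k) * (LINT y:inner_part (depth k)|lborel. W r k y * f y))" for k
  proof -
    let ?K = "inner_part (depth k)"
    have K: "compact ?K" "?K \<subseteq> interior P" using inner_part_compact[OF depth(1)] inner_part_subset[OF depth(1)] by auto
    define w where "w a y = f y * (y $ a - p0 $ a)" for a and y :: "real^'n"
    have la: "Ck_on j S (\<lambda>y. y $ a - p0 $ a)" if "open S" for j S and a :: 'n
    proof -
      have "(\<lambda>y. y $ a - p0 $ a) = (\<lambda>y. axis a 1 \<bullet> y + - (p0 $ a))" by (simp add: fun_eq_iff inner_axis')
      then show ?thesis using Ck_on_affine[OF that] by metis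
    qed
    have wC: "Ck_on 1 (interior P) (w a)" for a
      unfolding w_def using c by (intro Ck_on_mult open_interior la) auto
    have x1: "Ck_on 1 UNIV (cut (depth k))" by (rule Ck_on_le[OF Ck_on_cut]) simp
    have off: "y \<notin> ?K \<Longrightarrow> cut (depth k) y = 0" for y by (rule cut_off[OF depth(1)])
    have i0: "(LINT y:?K|lborel. partial a (cut (depth k)) y * w a y + cut (depth k) y * partial a (w a) y) = 0" for a
      by (rule integral_by_parts[OF x1 K open_interior off wC])
    have cf: "continuous_on ?K f" using f(2) KP continuous_on_subset by blast
    have cp: "continuous_on ?K (partial a f)" for a
      using Ck_on_continuous[OF Ck_on_partial[OF c1]] K(2) continuous_on_subset by blast
    have cg: "continuous_on ?K (grad f)" unfolding grad_def[abs_def] by (intro continuous_intros cp)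
    have cw: "continuous_on ?K (w a)" "continuous_on ?K (partial a (w a))" for a
    proof -
      show "continuous_on ?K (w a)" using Ck_on_continuous[OF wC] K(2) continuous_on_subset by blast
      have "continuous_on (interior P) (partial a (w a))"
        using Ck_on_partial[of 0 "interior P" "w a"] wC by simp
      then show "continuous_on ?K (partial a (w a))" using K(2) continuous_on_subset by blast
    qed
    have x2: "Ck_on (Suc 0) UNIV (cut (depth k))" using x1 by simp
    have cc: "continuous_on ?K (cut (depth k))" "continuous_on ?K (partial a (cut (depth k)))" for a
      using Ck_on_continuous[OF x1] Ck_on_continuous[OF Ck_on_partial[OF x2]] continuous_on_subset by blast+
    have cW: "continuous_on ?K (W r k)" for r
      unfolding W_def using depth(1)[of k] by (intro continuous_intros continuous_L continuous_cutF) auto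
    have e1: "(\<Sum>a\<in>UNIV. (LINT y:?K|lborel. partial a (cut (depth k)) y * w a y + cut (depth k) y * partial a (w a) y)) = 0"
      by (simp add: i0)
    have e2: "(\<Sum>a\<in>UNIV. (LINT y:?K|lborel. partial a (cut (depth k)) y * w a y + cut (depth k) y * partial a (w a) y))
        = (LINT y:?K|lborel. \<Sum>a\<in>UNIV. partial a (cut (depth k)) y * w a y + cut (depth k) y * partial a (w a) y)"
      by (rule set_integral_sum[symmetric]) (auto intro!: set_integrable_compact K(1) continuous_intros cc cw)
    have e3: "(LINT y:?K|lborel. \<Sum>a\<in>UNIV. partial a (cut (depth k)) y * w a y + cut (depth k) y * partial a (w a) y)
        = (LINT y:?K|lborel. cut (depth k) y * (grad f y \<bullet> (y - p0) + real CARD('n) * f y) - (\<Sum>r\<in>UNIV. (1 / depth k) * (W r k y * f y)))"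
    proof (rule set_lebesgue_integral_cong)
      show "?K \<in> sets lborel" using K(1) by (simp add: borel_compact)
      show "\<forall>y. y \<in> ?K \<longrightarrow> (\<Sum>a\<in>UNIV. partial a (cut (depth k)) y * w a y + cut (depth k) y * partial a (w a) y)
        = cut (depth k) y * (grad f y \<bullet> (y - p0) + real CARD('n) * f y) - (\<Sum>r\<in>UNIV. (1 / depth k) * (W r k y * f y))"
      proof (intro allI impI)
        fix y assume y: "y \<in> ?K"
        then have yi: "y \<in> interior P" using K(2) by blast
        have pw: "partial a (w a) y = f y + partial a f y * (y $ a - p0 $ a)" for a
        proof -
          have "partial a (\<lambda>y. y $ a - p0 $ a) y = 1"
          proof -
            have "((\<lambda>y::real^'n. y $ a - p0 $ a) has_derivative (\<lambda>h. h $ a)) (at y)"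
              using has_derivative_diff[OF bounded_linear_imp_has_derivative[OF bounded_linear_vec_nth] has_derivative_const] by simp
            from partial_eq[OF this] show ?thesis by simp
          qed
          then show ?thesis unfolding w_def
            using partial_bilinear[OF bounded_bilinear_mult c1 la[OF open_interior] yi, of a] by simp
        qed
        have "(\<Sum>a\<in>UNIV. partial a (cut (depth k)) y * w a y) = f y * (grad (cut (depth k)) y \<bullet> (y - p0))"
          unfolding grad_def inner_vec_def sum_distrib_left by (intro sum.cong refl) (simp add: w_def)
        also have "\<dots> = - (\<Sum>r\<in>UNIV. (1 / depth k) * (W r k y * f y))"
        proof -
          have "nv r \<bullet> (y - p0) = L r y - L r p0" for r by (simp add: ell_def inner_diff_right)
          then have "f y * (grad (cut (depth k)) y \<bullet> (y - p0)) = (\<Sum>r\<in>UNIV. - ((1 / depth k) * (W r k y * f y)))"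
            unfolding grad_cut inner_sum_left sum_distrib_left by (intro sum.cong refl) (simp add: W_def)
          then show ?thesis by (simp only: sum_negf)
        qed
        finally have 1: "(\<Sum>a\<in>UNIV. partial a (cut (depth k)) y * w a y) = - (\<Sum>r\<in>UNIV. (1 / depth k) * (W r k y * f y))" .
        have 2: "(\<Sum>a\<in>UNIV. cut (depth k) y * partial a (w a) y) = cut (depth k) y * (grad f y \<bullet> (y - p0) + real CARD('n) * f y)"
          unfolding pw by (simp add: sum_distrib_left[symmetric] sum.distrib grad_def inner_vec_def)
        show "(\<Sum>a\<in>UNIV. partial a (cut (depth k)) y * w a y + cut (depth k) y * partial a (w a) y)
          = cut (depth k) y * (grad f y \<bullet> (y - p0) + real CARD('n) * f y) - (\<Sum>r\<in>UNIV. (1 / depth k) * (W r k y * f y))"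
          unfolding sum.distrib 1 2 by simp
      qed
    qed
    have e4: "(LINT y:?K|lborel. cut (depth k) y * (grad f y \<bullet> (y - p0) + real CARD('n) * f y) - (\<Sum>r\<in>UNIV. (1 / depth k) * (W r k y * f y))) = (LINT y:?K|lborel. cut (depth k) y * (grad f y \<bullet> (y - p0) + real CARD('n) * f y))
        - (LINT y:?K|lborel. \<Sum>r\<in>UNIV. (1 / depth k) * (W r k y * f y))"
    proof (rule set_integral_diff)
      show "set_integrable lborel ?K (\<lambda>y. cut (depth k) y * (grad f y \<bullet> (y - p0) + real CARD('n) * f y))"
        by (rule set_integrable_compact[OF K(1)]) (intro continuous_intros cc cf cg)
      show "set_integrable lborel ?K (\<lambda>y. \<Sum>r\<in>UNIV. (1 / depth k) * (W r k y * f y))"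
        by (rule set_integrable_compact[OF K(1)]) (rule continuous_on_sum, rule continuous_on_mult[OF continuous_on_const continuous_on_mult[OF cW cf]])
    qed
    have e5: "(LINT y:?K|lborel. \<Sum>r\<in>UNIV. (1 / depth k) * (W r k y * f y)) = (\<Sum>r\<in>UNIV. (LINT y:?K|lborel. (1 / depth k) * (W r k y * f y)))"
      by (rule set_integral_sum, rule set_integrable_compact[OF K(1)], rule continuous_on_mult[OF continuous_on_const continuous_on_mult[OF cW cf]])
    have e6: "(\<Sum>r\<in>UNIV. (LINT y:?K|lborel. (1 / depth k) * (W r k y * f y))) = (\<Sum>r\<in>UNIV. (1 / depth k) * (LINT y:?K|lborel. W r k y * f y))"
      by (intro sum.cong refl set_integral_mult_right)
    show ?thesis using trans[OF trans[OF trans[OF e4[symmetric] e3[symmetric]] e2[symmetric]] e1] trans[OF e5 e6]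
      by (simp only: right_minus_eq)
  qed
  show ?thesis unfolding eq by (intro tendsto_sum lim)
qed

end

context toric_solution
begin

text \<open>The limit of the integral identity is \<open>\<L>\<^sub>C(f)\<close>: the diagonal terms of the cutoff
  Hessian produce the boundary integral, everything else disappears.\<close>

lemma L_C_limit:
  assumes f: "convex_on P f" "continuous_on P f" and c: "Ck_on 2 (interior P) f"
  shows "(\<lambda>k. LINT y:inner_part (depth k)|lborel. cut (depth k) y * (\<Sum>a\<in>UNIV. \<Sum>b\<in>UNIV. real_coeff y $ a $ b * hess f y $ a $ b))
     \<longlonglongrightarrow> L_C \<nu> c f"
proof -
  have c2: "Ck_on (Suc 1) (interior P) f" using c by (simp add: numeral_2_eq_2)
  have KP: "inner_part (depth k) \<subseteq> P" for k using inner_part_subset[OF depth(1)] interior_subset by blast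
  have Ki: "inner_part (depth k) \<subseteq> interior P" for k by (rule inner_part_subset[OF depth(1)])
  obtain C where C: "C \<ge> 0" "\<And>y r. y \<in> interior P \<Longrightarrow> norm (real_coeff y *v nv r) \<le> C * L r y"
    "\<And>y r. y \<in> interior P \<Longrightarrow> \<bar>nv r \<bullet> (real_coeff y *v nv r) - L r y\<bar> \<le> C * (L r y)\<^sup>2"
    using boundary_estimate by blast
  obtain G where G: "\<And>k y. y \<in> inner_part (depth k) \<Longrightarrow> depth k * norm (grad f y) \<le> G"
    using gradient_layer(1)[OF f c2] by blast
  have Rsym: "x \<bullet> (real_coeff y *v x') = (real_coeff y *v x) \<bullet> x'" if "y \<in> interior P" for x x' y by (rule coefficient(2)[OF that that that])
  have cR: "continuous_on (inner_part (depth k)) (\<lambda>y. real_coeff y *v g y)" if "continuous_on (inner_part (depth k)) g" for k g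
  proof -
    have "continuous_on (inner_part (depth k)) real_coeff" using Ck_on_continuous[OF Ck_on_real_coeff] Ki continuous_on_subset by blast
    then show ?thesis by (intro bounded_bilinear.continuous_on[OF bounded_bilinear_matrix_vector_mult] that)
  qed
  have cpar: "continuous_on (inner_part (depth k)) (partial a f)" for a k
    using Ck_on_continuous[OF Ck_on_partial[OF c2]] Ki continuous_on_subset by blast
  have cgr: "continuous_on (inner_part (depth k)) (grad f)" for k unfolding grad_def[abs_def] by (intro continuous_intros cpar)
  have RL: "norm (real_coeff y *v nv r) \<le> 2 * C * depth k" if "y \<in> inner_part (depth k)" "L r y \<le> 2 * depth k" for y r k
  proof -
    have "y \<in> interior P" using that(1) Ki by blast
    from C(2)[OF this, of r] mult_left_mono[OF that(2) C(1)] show ?thesis by simp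
  qed
  let ?A = "\<lambda>k y. pos_part (1 - cutF (depth k) y)" and ?b = "\<lambda>r k y. pos_part (2 - L r y / depth k)"
  \<comment> \<open>The layer terms, each with one factor \<open>1 / depth k\<close> taken out for
    \<open>facet_limit\<close>: \<open>Wd\<close> and \<open>Wo\<close> come from the Hessian of the
    cutoff, with equal and with distinct facets, and \<open>Wg\<close> from its gradient paired with
    that of \<open>f\<close>. The remaining division by the depth in \<open>Wd\<close> and
    \<open>Wo\<close> is compensated by \<open>R nv r\<close>, which is of that order.\<close>
  define Wd where "Wd r k y = (6 * ?A k y * (3 * ?b r k y ^ 2)\<^sup>2 - 3 * ?A k y ^ 2 * (6 * ?b r k y)) * ((nv r \<bullet> (real_coeff y *v nv r)) / depth k)" for r k y
  define Wo where "Wo r s k y = 6 * ?A k y * (3 * ?b r k y ^ 2 * (3 * ?b s k y ^ 2)) * ((nv r \<bullet> (real_coeff y *v nv s)) / depth k)" for r s k y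
  define Wg where "Wg r k y = 2 * (3 * ?A k y ^ 2 * (3 * ?b r k y ^ 2)) * (nv r \<bullet> (real_coeff y *v grad f y))" for r k y
  have cWd: "continuous_on (inner_part (depth k)) (Wd r k)" for r k
    unfolding Wd_def using depth(1)[of k] by (intro continuous_intros continuous_L continuous_cutF cR) auto
  have cWo: "continuous_on (inner_part (depth k)) (Wo r s k)" for r s k
    unfolding Wo_def using depth(1)[of k] by (intro continuous_intros continuous_L continuous_cutF cR) auto
  have cWg: "continuous_on (inner_part (depth k)) (Wg r k)" for r k
    unfolding Wg_def using depth(1)[of k] by (intro continuous_intros continuous_L continuous_cutF cR cgr) auto
  have Ab: "0 \<le> ?A k y" "?A k y \<le> 1" for k y using pos_part_F_bounds by auto
  have bb: "0 \<le> ?b r k y" "?b r k y \<le> 2" if "y \<in> inner_part (depth k)" for r k y using pos_part_r_bounds[OF depth(1) that] by auto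
  have z0: "(LBINT \<tau>:{0..2::real}. (0::real)) = 0" by (simp add: set_lebesgue_integral_def)
  have limd: "(\<lambda>k. (1 / depth k) * (LINT y:inner_part (depth k)|lborel. Wd r k y * f y)) \<longlonglongrightarrow> - facet_integral r f" for r
  proof -
    have "(\<lambda>k. (1 / depth k) * (LINT y:inner_part (depth k)|lborel. Wd r k y * f y)) \<longlonglongrightarrow>
      (LBINT \<tau>:{0..2}. \<tau> * (6 * pos_part (1 - pos_part (2 - \<tau>) ^ 3) * (3 * pos_part (2 - \<tau>) ^ 2)\<^sup>2
        - 3 * pos_part (1 - pos_part (2 - \<tau>) ^ 3) ^ 2 * (6 * pos_part (2 - \<tau>)))) * facet_integral r f"
      unfolding facet_integral_def
    proof (rule facet_limit[OF depth f(2) cWd, where M = "900 * (normal_bound * (2 * C))"])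
      show "Wd r k y = 0" if "y \<in> inner_part (depth k)" "L r y > 2 * depth k" for k y
        using pos_part_r_zero[OF depth(1) that(2)] by (simp add: Wd_def)
      show "\<bar>Wd r k y\<bar> \<le> 900 * (normal_bound * (2 * C))" if y: "y \<in> inner_part (depth k)" for k y
      proof (cases "L r y > 2 * depth k")
        case True
        then show ?thesis using pos_part_r_zero[OF depth(1) True] normal_bound(2) C(1) by (simp add: Wd_def)
      next
        case False
        have "\<bar>nv r \<bullet> (real_coeff y *v nv r)\<bar> \<le> norm (nv r) * norm (real_coeff y *v nv r)" by (rule Cauchy_Schwarz_ineq2)
        also have "\<dots> \<le> normal_bound * (2 * C * depth k)" using normal_bound RL[OF y, of r] False by (intro mult_mono) auto
        finally have 1: "\<bar>(nv r \<bullet> (real_coeff y *v nv r)) / depth k\<bar> \<le> normal_bound * (2 * C)"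
          using depth(1)[of k] by (simp add: abs_divide pos_divide_le_eq mult_ac)
        \<comment> \<open>The two bounds are 864 and 36; the constant 900 is their sum.\<close>
        have b1: "6 * ?A k y * (3 * ?b r k y ^ 2)\<^sup>2 \<le> 6 * 1 * (3 * 2 ^ 2)\<^sup>2"
          using Ab bb[OF y] by (intro mult_mono power_mono) auto
        have b2: "3 * ?A k y ^ 2 * (6 * ?b r k y) \<le> 3 * 1 ^ 2 * (6 * 2)"
          using Ab bb[OF y] by (intro mult_mono power_mono) auto
        have b3: "0 \<le> 6 * ?A k y * (3 * ?b r k y ^ 2)\<^sup>2" "0 \<le> 3 * ?A k y ^ 2 * (6 * ?b r k y)"
          using Ab[of k y] bb[OF y, of r] by auto
        have bb9: "\<bar>X - Y\<bar> \<le> 900" if "X \<le> 6 * 1 * (3 * 2 ^ 2)\<^sup>2" "Y \<le> 3 * 1 ^ 2 * (6 * 2)" "0 \<le> X" "0 \<le> Y" for X Y :: real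
          using that by (simp add: abs_le_iff)
        have "\<bar>6 * ?A k y * (3 * ?b r k y ^ 2)\<^sup>2 - 3 * ?A k y ^ 2 * (6 * ?b r k y)\<bar> \<le> 900" by (rule bb9[OF b1 b2 b3])
        then show ?thesis unfolding Wd_def abs_mult by (intro mult_mono 1) auto
      qed
      show "continuous_on {0..2} (\<lambda>\<tau>. \<tau> * (6 * pos_part (1 - pos_part (2 - \<tau>) ^ 3) * (3 * pos_part (2 - \<tau>) ^ 2)\<^sup>2
        - 3 * pos_part (1 - pos_part (2 - \<tau>) ^ 3) ^ 2 * (6 * pos_part (2 - \<tau>))))" by (intro continuous_intros)
      show "\<tau> * (6 * pos_part (1 - pos_part (2 - \<tau>) ^ 3) * (3 * pos_part (2 - \<tau>) ^ 2)\<^sup>2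
        - 3 * pos_part (1 - pos_part (2 - \<tau>) ^ 3) ^ 2 * (6 * pos_part (2 - \<tau>))) = 0" if "\<tau> < 1" for \<tau>
      proof -
        have "1 \<le> pos_part (2 - \<tau>) ^ 3" using that by (simp add: one_le_power)
        then show ?thesis by simp
      qed
      fix y \<tau> assume \<tau>: "1 \<le> \<tau>" "\<tau> \<le> 2"
        and ev: "\<forall>\<^sub>F k in sequentially. y k \<in> inner_part (depth k) \<and> L r (y k) = \<tau> * depth k \<and> cutF (depth k) (y k) = pos_part (2 - \<tau>) ^ 3
            \<and> (\<forall>s. s \<noteq> r \<longrightarrow> L s (y k) \<ge> 2 * depth k)"
      let ?X = "6 * pos_part (1 - pos_part (2 - \<tau>) ^ 3) * (3 * pos_part (2 - \<tau>) ^ 2)\<^sup>2 - 3 * pos_part (1 - pos_part (2 - \<tau>) ^ 3) ^ 2 * (6 * pos_part (2 - \<tau>))"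
      let ?q = "\<lambda>k. (nv r \<bullet> (real_coeff (y k) *v nv r)) / depth k"
      \<comment> \<open>The second boundary estimate gives
        \<open>L r (y k) = \<tau> * depth k\<close> as leading term, with a quadratic error. This
        explains the factor \<tau> in the profile, whose integral is -1.\<close>
      have "(\<lambda>k. ?q k - \<tau>) \<longlonglongrightarrow> 0"
      proof (rule Lim_null_comparison)
        show "\<forall>\<^sub>F k in sequentially. norm (?q k - \<tau>) \<le> C * \<tau>\<^sup>2 * depth k"
          using ev
        proof eventually_elim
          case (elim k)
          have yi: "y k \<in> interior P" using elim Ki by blast
          have d: "depth k > 0" by (rule depth(1))
          have "\<bar>nv r \<bullet> (real_coeff (y k) *v nv r) - \<tau> * depth k\<bar> \<le> (C * \<tau>\<^sup>2 * depth k) * depth k"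
            using C(3)[OF yi, of r] elim by (simp add: power2_eq_square mult_ac)
          then have "\<bar>nv r \<bullet> (real_coeff (y k) *v nv r) - \<tau> * depth k\<bar> / depth k \<le> C * \<tau>\<^sup>2 * depth k"
            using d by (simp add: pos_divide_le_eq)
          moreover have "?q k - \<tau> = (nv r \<bullet> (real_coeff (y k) *v nv r) - \<tau> * depth k) / depth k" using d by (simp add: diff_divide_distrib)
          ultimately show ?case using d by (simp add: abs_divide)
        qed
        have "(\<lambda>k. C * \<tau>\<^sup>2 * depth k) \<longlonglongrightarrow> C * \<tau>\<^sup>2 * 0" by (intro tendsto_intros depth)
        then show "(\<lambda>k. C * \<tau>\<^sup>2 * depth k) \<longlonglongrightarrow> 0" by simp
      qed
      then have "?q \<longlonglongrightarrow> \<tau>" by (simp add: LIM_zero_iff)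
      then have "(\<lambda>k. ?X * ?q k) \<longlonglongrightarrow> ?X * \<tau>" by (intro tendsto_intros)
      moreover have "\<forall>\<^sub>F k in sequentially. ?X * ?q k = Wd r k (y k)"
        using ev
      proof eventually_elim
        case (elim k)
        then show ?case using depth(1)[of k] by (simp add: Wd_def)
      qed
      ultimately have "(\<lambda>k. Wd r k (y k)) \<longlonglongrightarrow> ?X * \<tau>" by (rule Lim_transform_eventually)
      then show "(\<lambda>k. Wd r k (y k)) \<longlonglongrightarrow> \<tau> * ?X" by (simp only: mult.commute)
    qed
    then show ?thesis unfolding profile_integrals(2) by simp
  qed
  \<comment> \<open>\<open>Wo\<close> contains the cutoff factors of two different facets. Over the
    relative interior of the facet \<open>r\<close> the factor of \<open>s\<close> vanishes
    eventually, so the profile is 0 although the terms are merely bounded.\<close>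
  have limo: "(\<lambda>k. (1 / depth k) * (LINT y:inner_part (depth k)|lborel. Wo r s k y * f y)) \<longlonglongrightarrow> 0" if rs: "s \<noteq> r" for r s
  proof -
    have "(\<lambda>k. (1 / depth k) * (LINT y:inner_part (depth k)|lborel. Wo r s k y * f y)) \<longlonglongrightarrow>
      (LBINT \<tau>:{0..2::real}. 0) * ((LINT y:facet \<nu> c r|hyperplane_lborel (nv r) (c r). f y) / norm (nv r))"
    proof (rule facet_limit[OF depth f(2) cWo, where M = "864 * (2 * C * normal_bound)"])
      show "Wo r s k y = 0" if "y \<in> inner_part (depth k)" "L r y > 2 * depth k" for k y
        using pos_part_r_zero[OF depth(1) that(2)] by (simp add: Wo_def)
      show "\<bar>Wo r s k y\<bar> \<le> 864 * (2 * C * normal_bound)" if y: "y \<in> inner_part (depth k)" for k y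
      proof (cases "L r y > 2 * depth k")
        case True
        then show ?thesis using pos_part_r_zero[OF depth(1) True] normal_bound(2) C(1) by (simp add: Wo_def)
      next
        case False
        have yi: "y \<in> interior P" using y Ki by blast
        have "\<bar>nv r \<bullet> (real_coeff y *v nv s)\<bar> \<le> norm (real_coeff y *v nv r) * norm (nv s)"
          unfolding Rsym[OF yi] by (rule Cauchy_Schwarz_ineq2)
        also have "\<dots> \<le> (2 * C * depth k) * normal_bound" using normal_bound RL[OF y, of r] False C(1) depth(1)[of k] by (intro mult_mono) auto
        finally have 1: "\<bar>(nv r \<bullet> (real_coeff y *v nv s)) / depth k\<bar> \<le> 2 * C * normal_bound"
          using depth(1)[of k] by (simp add: abs_divide pos_divide_le_eq mult_ac)
        have "6 * ?A k y * (3 * ?b r k y ^ 2 * (3 * ?b s k y ^ 2)) \<le> 6 * 1 * (3 * 2 ^ 2 * (3 * 2 ^ 2))"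
          using Ab bb[OF y] by (intro mult_mono power_mono) auto
        moreover have "0 \<le> 6 * ?A k y * (3 * ?b r k y ^ 2 * (3 * ?b s k y ^ 2))"
          using Ab[of k y] bb[OF y] by auto
        ultimately have "\<bar>6 * ?A k y * (3 * ?b r k y ^ 2 * (3 * ?b s k y ^ 2))\<bar> \<le> 864" by (simp add: abs_le_iff)
        then show ?thesis unfolding Wo_def abs_mult[of "6 * ?A k y * (3 * ?b r k y ^ 2 * (3 * ?b s k y ^ 2))"]
          by (intro mult_mono 1) auto
      qed
      fix y and \<tau> :: real assume ev: "\<forall>\<^sub>F k in sequentially. y k \<in> inner_part (depth k) \<and> L r (y k) = \<tau> * depth k \<and> cutF (depth k) (y k) = pos_part (2 - \<tau>) ^ 3
            \<and> (\<forall>s. s \<noteq> r \<longrightarrow> L s (y k) \<ge> 2 * depth k)"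
      have "\<forall>\<^sub>F k in sequentially. Wo r s k (y k) = 0"
        using ev
      proof eventually_elim
        case (elim k)
        have "L s (y k) \<ge> 2 * depth k" using elim rs by blast
        then have "pos_part (2 - L s (y k) / depth k) = 0" using depth(1)[of k] by (simp add: pos_le_divide_eq)
        then show ?case by (simp add: Wo_def)
      qed
      then show "(\<lambda>k. Wo r s k (y k)) \<longlonglongrightarrow> 0" by (rule tendsto_eventually)
    qed auto
    then show ?thesis by (simp add: z0)
  qed
  \<comment> \<open>\<open>R nv r\<close> is of order \<open>depth k\<close>, hence
    \<open>Wg\<close> is bounded by depth times the gradient of \<open>f\<close>, which tends to 0.
    As \<open>f\<close> already sits inside \<open>Wg\<close>, the continuous test function is the
    constant 1.\<close>
  have limg: "(\<lambda>k. (1 / depth k) * (LINT y:inner_part (depth k)|lborel. Wg r k y * 1)) \<longlonglongrightarrow> 0" for r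
  proof -
    have Wgb: "\<bar>Wg r k y\<bar> \<le> 72 * (2 * C * g)" if y: "y \<in> inner_part (depth k)" and g: "depth k * norm (grad f y) \<le> g" for k y g
    proof (cases "L r y > 2 * depth k")
      case True
      have "0 \<le> g" using g depth(1)[of k] by (meson less_imp_le mult_nonneg_nonneg norm_ge_zero order_trans)
      then show ?thesis using pos_part_r_zero[OF depth(1) True] C(1) by (simp add: Wg_def)
    next
      case False
      have yi: "y \<in> interior P" using y Ki by blast
      have "\<bar>nv r \<bullet> (real_coeff y *v grad f y)\<bar> \<le> norm (real_coeff y *v nv r) * norm (grad f y)"
        unfolding Rsym[OF yi] by (rule Cauchy_Schwarz_ineq2)
      also have "\<dots> \<le> (2 * C * depth k) * norm (grad f y)" using RL[OF y, of r] False by (intro mult_right_mono) auto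
      also have "\<dots> = (2 * C) * (depth k * norm (grad f y))" by simp
      also have "\<dots> \<le> (2 * C) * g" using C(1) by (intro mult_left_mono g) auto
      finally have 1: "\<bar>nv r \<bullet> (real_coeff y *v grad f y)\<bar> \<le> 2 * C * g" .
      have "2 * (3 * ?A k y ^ 2 * (3 * ?b r k y ^ 2)) \<le> 2 * (3 * 1 ^ 2 * (3 * 2 ^ 2))"
        using Ab bb[OF y] by (intro mult_mono power_mono) auto
      moreover have "0 \<le> 2 * (3 * ?A k y ^ 2 * (3 * ?b r k y ^ 2))" using Ab[of k y] bb[OF y] by auto
      ultimately have "\<bar>2 * (3 * ?A k y ^ 2 * (3 * ?b r k y ^ 2))\<bar> \<le> 72" by (simp add: abs_le_iff)
      then show ?thesis unfolding Wg_def abs_mult[of "2 * (3 * ?A k y ^ 2 * (3 * ?b r k y ^ 2))"]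
        by (intro mult_mono 1) auto
    qed
    have "(\<lambda>k. (1 / depth k) * (LINT y:inner_part (depth k)|lborel. Wg r k y * 1)) \<longlonglongrightarrow>
      (LBINT \<tau>:{0..2::real}. 0) * ((LINT y:facet \<nu> c r|hyperplane_lborel (nv r) (c r). 1) / norm (nv r))"
    proof (rule facet_limit[OF depth continuous_on_const cWg, where M = "72 * (2 * C * G)"])
      show "Wg r k y = 0" if "y \<in> inner_part (depth k)" "L r y > 2 * depth k" for k y
        using pos_part_r_zero[OF depth(1) that(2)] by (simp add: Wg_def)
      show "\<bar>Wg r k y\<bar> \<le> 72 * (2 * C * G)" if "y \<in> inner_part (depth k)" for k y by (rule Wgb[OF that G[OF that]])
      fix y and \<tau> :: real assume ev: "\<forall>\<^sub>F k in sequentially. y k \<in> inner_part (depth k) \<and> L r (y k) = \<tau> * depth k \<and> cutF (depth k) (y k) = pos_part (2 - \<tau>) ^ 3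
            \<and> (\<forall>s. s \<noteq> r \<longrightarrow> L s (y k) \<ge> 2 * depth k)"
      show "(\<lambda>k. Wg r k (y k)) \<longlonglongrightarrow> 0"
      proof (rule LIMSEQ_I)
        fix e :: real assume e: "e > 0"
        \<comment> \<open>Makes \<open>72 * (2 * C * e')\<close> at most \<open>e / 2\<close>; the
          \<open>+ 1\<close> covers \<open>C = 0\<close>.\<close>
        define e' where "e' = e / (144 * C + 1) / 2"
        have e': "e' > 0" using e C(1) by (simp add: e'_def)
        have "\<forall>\<^sub>F k in sequentially. norm (Wg r k (y k) - 0) < e"
          using ev gradient_layer(2)[OF f c2 e']
        proof eventually_elim
          case (elim k)
          then have "\<bar>Wg r k (y k)\<bar> \<le> 72 * (2 * C * e')" by (intro Wgb) auto
          also have "\<dots> \<le> (144 * C + 1) * e'" using e' by (simp add: algebra_simps)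
          also have "\<dots> = e / 2"
          proof -
            have "144 * C + 1 > 0" using C(1) by linarith
            then show ?thesis unfolding e'_def by (metis nonzero_mult_div_cancel_left times_divide_eq_right less_irrefl divide_divide_eq_left)
          qed
          also have "\<dots> < e" using e by simp
          finally show ?case by simp
        qed
        then show "\<exists>no. \<forall>k\<ge>no. norm (Wg r k (y k) - 0) < e" by (simp add: eventually_sequentially)
      qed
    qed auto
    then show ?thesis by (simp add: z0)
  qed
  have cut_lim: "(\<lambda>k. LINT y:inner_part (depth k)|lborel. const_C \<nu> c * (cut (depth k) y * f y)) \<longlonglongrightarrow> (LINT y:P|lborel. const_C \<nu> c * f y)"
    using cut_limit[OF continuous_on_mult_left[OF f(2)], of "const_C \<nu> c"] by (simp add: mult_ac)
  have eq: "(LINT y:inner_part (depth k)|lborel. cut (depth k) y * (\<Sum>a\<in>UNIV. \<Sum>b\<in>UNIV. real_coeff y $ a $ b * hess f y $ a $ b))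
    = - (LINT y:inner_part (depth k)|lborel. const_C \<nu> c * (cut (depth k) y * f y))
      - (\<Sum>r\<in>UNIV. (1 / depth k) * (LINT y:inner_part (depth k)|lborel. Wd r k y * f y) + (\<Sum>s\<in>UNIV - {r}. (1 / depth k) * (LINT y:inner_part (depth k)|lborel. Wo r s k y * f y)))
      - (\<Sum>r\<in>UNIV. (1 / depth k) * (LINT y:inner_part (depth k)|lborel. Wg r k y * 1))" for k
  proof -
    let ?K = "inner_part (depth k)"
    have K: "compact ?K" by (rule inner_part_compact[OF depth(1)])
    have Ks: "?K \<in> sets lborel" using K by (simp add: borel_compact)
    have cf: "continuous_on ?K f" using f(2) KP continuous_on_subset by blast
    have d: "depth k > 0" by (rule depth(1))
    have hid: "(LINT y:?K|lborel. cut (depth k) y * (\<Sum>a\<in>UNIV. \<Sum>b\<in>UNIV. real_coeff y $ a $ b * hess f y $ a $ b)) =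
      - (LINT y:?K|lborel. const_C \<nu> c * (cut (depth k) y * f y))
      - (LINT y:?K|lborel. f y * (\<Sum>a\<in>UNIV. \<Sum>b\<in>UNIV. real_coeff y $ a $ b * hess (cut (depth k)) y $ a $ b))
      - (LINT y:?K|lborel. 2 * (\<Sum>a\<in>UNIV. \<Sum>b\<in>UNIV. real_coeff y $ a $ b * (partial a (cut (depth k)) y * partial b f y)))"
      by (rule hessian_integral_identity[OF Ck_on_cut K Ki open_interior cut_off[OF depth(1)] Ck_on_real_coeff real_coeff_sym c real_coeff_double_div])
    have gF: "(\<chi> a. partial a (cutF (depth k)) y) = (\<Sum>r\<in>UNIV. (- (3 * ?b r k y ^ 2) / depth k) *\<^sub>R nv r)" for y
      by (simp add: vec_eq_iff partial_cutF)
    have h: "f y * (\<Sum>a\<in>UNIV. \<Sum>b\<in>UNIV. real_coeff y $ a $ b * hess (cut (depth k)) y $ a $ b)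
        = (\<Sum>r\<in>UNIV. (1 / depth k) * (Wd r k y * f y) + (\<Sum>s\<in>UNIV - {r}. (1 / depth k) * (Wo r s k y * f y)))" for y
    proof -
      let ?g = "\<chi> a. partial a (cutF (depth k)) y"
      let ?R = "\<lambda>r s. nv r \<bullet> (real_coeff y *v nv s)"
      have 1: "(\<Sum>a\<in>UNIV. \<Sum>b\<in>UNIV. real_coeff y $ a $ b * (partial a (cutF (depth k)) y * partial b (cutF (depth k)) y))
          = (\<Sum>r\<in>UNIV. \<Sum>s\<in>UNIV. (3 * ?b r k y ^ 2) * (3 * ?b s k y ^ 2) / (depth k)\<^sup>2 * ?R r s)"
      proof -
        have "(\<Sum>a\<in>UNIV. \<Sum>b\<in>UNIV. real_coeff y $ a $ b * (partial a (cutF (depth k)) y * partial b (cutF (depth k)) y)) = ?g \<bullet> (real_coeff y *v ?g)"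
          by (simp add: inner_matrix_sum)
        also have "\<dots> = (\<Sum>r\<in>UNIV. \<Sum>s\<in>UNIV. (- (3 * ?b s k y ^ 2) / depth k) * ((- (3 * ?b r k y ^ 2) / depth k) * ?R r s))"
          unfolding gF inner_sum_left
          by (simp only: linear_sum[OF matrix_vector_mul_linear] matrix_vector_mult_scaleR inner_sum_right
              inner_scaleR_left inner_scaleR_right sum_distrib_left)
        also have "\<dots> = (\<Sum>r\<in>UNIV. \<Sum>s\<in>UNIV. (3 * ?b r k y ^ 2) * (3 * ?b s k y ^ 2) / (depth k)\<^sup>2 * ?R r s)"
          by (intro sum.cong refl) (simp add: power2_eq_square)
        finally show ?thesis .
      qed
      have 2: "(\<Sum>a\<in>UNIV. \<Sum>b\<in>UNIV. real_coeff y $ a $ b * partial b (partial a (cutF (depth k))) y)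
          = (\<Sum>r\<in>UNIV. 6 * ?b r k y / (depth k)\<^sup>2 * ?R r r)"
      proof -
        have "(\<Sum>a\<in>UNIV. \<Sum>b\<in>UNIV. real_coeff y $ a $ b * partial b (partial a (cutF (depth k))) y)
            = (\<Sum>a\<in>UNIV. \<Sum>b\<in>UNIV. \<Sum>r\<in>UNIV. 6 * ?b r k y / (depth k)\<^sup>2 * (real_coeff y $ a $ b * (nv r $ a * nv r $ b)))"
          by (simp add: partial2_cutF sum_distrib_left mult_ac)
        also have "\<dots> = (\<Sum>a\<in>UNIV. \<Sum>r\<in>UNIV. \<Sum>b\<in>UNIV. 6 * ?b r k y / (depth k)\<^sup>2 * (real_coeff y $ a $ b * (nv r $ a * nv r $ b)))"
          by (rule sum.cong[OF refl]) (rule sum.swap)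
        also have "\<dots> = (\<Sum>r\<in>UNIV. \<Sum>a\<in>UNIV. \<Sum>b\<in>UNIV. 6 * ?b r k y / (depth k)\<^sup>2 * (real_coeff y $ a $ b * (nv r $ a * nv r $ b)))"
          by (rule sum.swap)
        also have "\<dots> = (\<Sum>r\<in>UNIV. 6 * ?b r k y / (depth k)\<^sup>2 * ?R r r)"
          by (simp only: inner_matrix_sum sum_distrib_left)
        finally show ?thesis .
      qed
      have "(\<Sum>a\<in>UNIV. \<Sum>b\<in>UNIV. real_coeff y $ a $ b * hess (cut (depth k)) y $ a $ b)
          = 6 * ?A k y * (\<Sum>a\<in>UNIV. \<Sum>b\<in>UNIV. real_coeff y $ a $ b * (partial a (cutF (depth k)) y * partial b (cutF (depth k)) y))
          - 3 * ?A k y ^ 2 * (\<Sum>a\<in>UNIV. \<Sum>b\<in>UNIV. real_coeff y $ a $ b * partial b (partial a (cutF (depth k))) y)"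
        by (simp add: hess_def partial2_cut right_diff_distrib sum_subtractf sum_distrib_left mult_ac)
      also have "\<dots> = (\<Sum>r\<in>UNIV. (1 / depth k) * Wd r k y + (\<Sum>s\<in>UNIV - {r}. (1 / depth k) * Wo r s k y))"
      proof -
        have "6 * ?A k y * (\<Sum>s\<in>UNIV. (3 * ?b r k y ^ 2) * (3 * ?b s k y ^ 2) / (depth k)\<^sup>2 * ?R r s)
            - 3 * ?A k y ^ 2 * (6 * ?b r k y / (depth k)\<^sup>2 * ?R r r)
            = (1 / depth k) * Wd r k y + (\<Sum>s\<in>UNIV - {r}. (1 / depth k) * Wo r s k y)" for r
          by (subst sum.remove[of UNIV r])
            (simp_all add: Wd_def Wo_def distrib_left left_diff_distrib right_diff_distrib sum_distrib_left power2_eq_square mult_ac)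
        then show ?thesis unfolding 1 2 sum_distrib_left sum_subtractf[symmetric] by (simp add: sum_distrib_left)
      qed
      finally show ?thesis by (simp add: sum_distrib_left distrib_left mult_ac)
    qed
    have hg: "2 * (\<Sum>a\<in>UNIV. \<Sum>b\<in>UNIV. real_coeff y $ a $ b * (partial a (cut (depth k)) y * partial b f y))
        = (\<Sum>r\<in>UNIV. (1 / depth k) * (Wg r k y * 1))" for y
    proof -
      have "(\<Sum>a\<in>UNIV. \<Sum>b\<in>UNIV. real_coeff y $ a $ b * (partial a (cut (depth k)) y * partial b f y)) = grad (cut (depth k)) y \<bullet> (real_coeff y *v grad f y)"
        by (simp add: inner_matrix_sum grad_def)
      then show ?thesis by (simp add: grad_cut inner_sum_left sum_distrib_left Wg_def mult_ac)
    qed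
    have i1: "(LINT y:?K|lborel. f y * (\<Sum>a\<in>UNIV. \<Sum>b\<in>UNIV. real_coeff y $ a $ b * hess (cut (depth k)) y $ a $ b))
        = (\<Sum>r\<in>UNIV. (1 / depth k) * (LINT y:?K|lborel. Wd r k y * f y) + (\<Sum>s\<in>UNIV - {r}. (1 / depth k) * (LINT y:?K|lborel. Wo r s k y * f y)))"
    proof -
      have iD: "set_integrable lborel ?K (\<lambda>y. (1 / depth k) * (Wd r k y * f y))" for r
        by (rule set_integrable_compact[OF K continuous_on_mult[OF continuous_on_const continuous_on_mult[OF cWd cf]]])
      have iO: "set_integrable lborel ?K (\<lambda>y. (1 / depth k) * (Wo r s k y * f y))" for r s
        by (rule set_integrable_compact[OF K continuous_on_mult[OF continuous_on_const continuous_on_mult[OF cWo cf]]])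
      have iS: "set_integrable lborel ?K (\<lambda>y. \<Sum>s\<in>UNIV - {r}. (1 / depth k) * (Wo r s k y * f y))" for r
        by (rule set_integrable_compact[OF K continuous_on_sum[OF continuous_on_mult[OF continuous_on_const continuous_on_mult[OF cWo cf]]]])
      have "(LINT y:?K|lborel. \<Sum>r\<in>UNIV. (1 / depth k) * (Wd r k y * f y) + (\<Sum>s\<in>UNIV - {r}. (1 / depth k) * (Wo r s k y * f y)))
          = (\<Sum>r\<in>UNIV. (LINT y:?K|lborel. (1 / depth k) * (Wd r k y * f y) + (\<Sum>s\<in>UNIV - {r}. (1 / depth k) * (Wo r s k y * f y))))"
        by (rule set_integral_sum, rule set_integral_add(1)[OF iD iS])
      also have "\<dots> = (\<Sum>r\<in>UNIV. (1 / depth k) * (LINT y:?K|lborel. Wd r k y * f y) + (\<Sum>s\<in>UNIV - {r}. (1 / depth k) * (LINT y:?K|lborel. Wo r s k y * f y)))"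
      proof (rule sum.cong[OF refl])
        fix r
        have "(LINT y:?K|lborel. (1 / depth k) * (Wd r k y * f y) + (\<Sum>s\<in>UNIV - {r}. (1 / depth k) * (Wo r s k y * f y)))
            = (LINT y:?K|lborel. (1 / depth k) * (Wd r k y * f y)) + (LINT y:?K|lborel. \<Sum>s\<in>UNIV - {r}. (1 / depth k) * (Wo r s k y * f y))"
          by (rule set_integral_add(2)[OF iD iS])
        also have "(LINT y:?K|lborel. \<Sum>s\<in>UNIV - {r}. (1 / depth k) * (Wo r s k y * f y)) = (\<Sum>s\<in>UNIV - {r}. (LINT y:?K|lborel. (1 / depth k) * (Wo r s k y * f y)))"
          by (rule set_integral_sum, rule iO)
        finally show "(LINT y:?K|lborel. (1 / depth k) * (Wd r k y * f y) + (\<Sum>s\<in>UNIV - {r}. (1 / depth k) * (Wo r s k y * f y)))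
            = (1 / depth k) * (LINT y:?K|lborel. Wd r k y * f y) + (\<Sum>s\<in>UNIV - {r}. (1 / depth k) * (LINT y:?K|lborel. Wo r s k y * f y))"
          by (simp only: set_integral_mult_right)
      qed
      finally show ?thesis by (simp only: h)
    qed
    have i2: "(LINT y:?K|lborel. 2 * (\<Sum>a\<in>UNIV. \<Sum>b\<in>UNIV. real_coeff y $ a $ b * (partial a (cut (depth k)) y * partial b f y)))
        = (\<Sum>r\<in>UNIV. (1 / depth k) * (LINT y:?K|lborel. Wg r k y * 1))"
    proof -
      have "(LINT y:?K|lborel. \<Sum>r\<in>UNIV. (1 / depth k) * (Wg r k y * 1)) = (\<Sum>r\<in>UNIV. (LINT y:?K|lborel. (1 / depth k) * (Wg r k y * 1)))"
        by (rule set_integral_sum, rule set_integrable_compact[OF K continuous_on_mult[OF continuous_on_const continuous_on_mult[OF cWg continuous_on_const]]])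
      then show ?thesis by (simp only: hg set_integral_mult_right)
    qed
    show ?thesis unfolding hid i1 i2 ..
  qed
  have "(\<lambda>k. - (LINT y:inner_part (depth k)|lborel. const_C \<nu> c * (cut (depth k) y * f y))
      - (\<Sum>r\<in>UNIV. (1 / depth k) * (LINT y:inner_part (depth k)|lborel. Wd r k y * f y) + (\<Sum>s\<in>UNIV - {r}. (1 / depth k) * (LINT y:inner_part (depth k)|lborel. Wo r s k y * f y)))
      - (\<Sum>r\<in>UNIV. (1 / depth k) * (LINT y:inner_part (depth k)|lborel. Wg r k y * 1)))
    \<longlonglongrightarrow> - (LINT y:P|lborel. const_C \<nu> c * f y) - (\<Sum>r\<in>UNIV. - facet_integral r f + (\<Sum>s\<in>UNIV - {r}. 0)) - (\<Sum>r\<in>(UNIV::'r set). 0)"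
    by (intro tendsto_diff tendsto_minus tendsto_sum tendsto_add cut_lim limd limg) (rule limo, blast)
  moreover have "- (LINT y:P|lborel. const_C \<nu> c * f y) - (\<Sum>r\<in>UNIV. - facet_integral r f + (\<Sum>s\<in>UNIV - {r}. 0)) - (\<Sum>r\<in>(UNIV::'r set). 0) = L_C \<nu> c f"
    by (simp add: L_C_def boundary_integral_facet_integral sum_negf)
  ultimately show ?thesis unfolding eq by simp
qed

end

section \<open>Lower bounds by the Laplacian\<close>

text \<open>One step of Gaussian elimination for a semidefinite matrix: a zero pivot has a zero
  column, and for a positive pivot the Schur complement remains semidefinite.\<close>

lemma psd_column:
  fixes A :: "real^'n^'n"
  assumes A: "\<And>a b. A $ a $ b = A $ b $ a" "\<And>x. x \<bullet> (A *v x) \<ge> 0"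
  shows "A $ p $ p \<ge> 0" "A $ p $ p = 0 \<Longrightarrow> A $ a $ p = 0"
    "A $ p $ p > 0 \<Longrightarrow> x \<bullet> (A *v x) \<ge> (x \<bullet> (A *v axis p 1))\<^sup>2 / A $ p $ p"
proof -
  let ?e = "axis p 1 :: real^'n"
  have sym: "?e \<bullet> (A *v x) = x \<bullet> (A *v ?e)" for x
    unfolding inner_matrix_sum by (subst sum.swap) (intro sum.cong refl, subst A(1), simp)
  have diag: "?e \<bullet> (A *v ?e) = A $ p $ p" by (simp add: inner_axis' matrix_vector_mul_component inner_axis)
  have ap: "axis a 1 \<bullet> (A *v ?e) = A $ a $ p" for a by (simp add: inner_axis' matrix_vector_mul_component inner_axis)
  show p0: "A $ p $ p \<ge> 0" using A(2)[of ?e] by (simp add: diag)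
  have q: "(x + s *\<^sub>R ?e) \<bullet> (A *v (x + s *\<^sub>R ?e)) = x \<bullet> (A *v x) + 2 * s * (x \<bullet> (A *v ?e)) + s\<^sup>2 * A $ p $ p" for x s
    by (simp add: inner_add_left inner_add_right matrix_vector_right_distrib matrix_vector_mult_scaleR sym[of x] diag power2_eq_square distrib_left)
  show "A $ a $ p = 0" if z: "A $ p $ p = 0"
  proof (rule ccontr)
    assume n: "A $ a $ p \<noteq> 0"
    \<comment> \<open>This multiple of \<open>?e\<close>, added to the unit vector at
      \<open>a\<close>, would give the form the value -1.\<close>
    let ?s = "- (A $ a $ a + 1) / (2 * A $ a $ p)"
    have "0 \<le> A $ a $ a + 2 * ?s * A $ a $ p"
      using A(2)[of "axis a 1 + ?s *\<^sub>R ?e"] unfolding q z ap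
      by (simp add: inner_axis' matrix_vector_mul_component inner_axis)
    moreover have "2 * ?s * A $ a $ p = - (A $ a $ a + 1)" using n by (simp add: field_simps)
    ultimately show False by linarith
  qed
  show "x \<bullet> (A *v x) \<ge> (x \<bullet> (A *v ?e))\<^sup>2 / A $ p $ p" if "A $ p $ p > 0"
  proof -
    let ?s = "- (x \<bullet> (A *v ?e)) / A $ p $ p"
    have "0 \<le> x \<bullet> (A *v x) + 2 * ?s * (x \<bullet> (A *v ?e)) + ?s\<^sup>2 * A $ p $ p"
      using A(2)[of "x + ?s *\<^sub>R ?e"] unfolding q .
    then show ?thesis using that by (simp add: power2_eq_square)
  qed
qed

lemma psd_trace_nonneg:
  fixes A F :: "real^'n^'n"
  assumes "\<And>a b. A $ a $ b = A $ b $ a" "\<And>x. x \<bullet> (A *v x) \<ge> 0" and F: "\<And>x. x \<bullet> (F *v x) \<ge> 0"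
  shows "0 \<le> (\<Sum>a\<in>UNIV. \<Sum>b\<in>UNIV. A $ a $ b * F $ a $ b)"
  using assms(1,2)
proof (induction "card {i. A $ i $ i \<noteq> 0}" arbitrary: A rule: less_induct)
  case less
  note A = less.prems
  show ?case
  proof (cases "\<exists>p. A $ p $ p \<noteq> 0")
    case False
    then have "A $ a $ b = 0" for a b using psd_column(2)[OF A, of b a] by blast
    then show ?thesis by simp
  next
    case True
    then obtain p where p: "A $ p $ p > 0" using psd_column(1)[OF A] by (metis order_le_less)
    define v where "v = A *v axis p 1"
    have va: "v $ a = A $ a $ p" for a by (simp add: v_def matrix_vector_mul_component inner_axis)
    define A' where "A' = (\<chi> a b. A $ a $ b - v $ a * v $ b / A $ p $ p)"
    have A'x: "x \<bullet> (A' *v x) = x \<bullet> (A *v x) - (x \<bullet> v)\<^sup>2 / A $ p $ p" for x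
    proof -
      have "(x \<bullet> v)\<^sup>2 = (\<Sum>a\<in>UNIV. \<Sum>b\<in>UNIV. v $ a * v $ b * (x $ a * x $ b))"
        unfolding power2_eq_square inner_vec_def sum_product by (intro sum.cong refl) simp
      then show ?thesis
        unfolding inner_matrix_sum A'_def by (simp add: left_diff_distrib sum_subtractf sum_divide_distrib)
    qed
    have s': "A' $ a $ b = A' $ b $ a" for a b unfolding A'_def using A(1)[of a b] by simp
    have p': "0 \<le> x \<bullet> (A' *v x)" for x using psd_column(3)[OF A p, of x] by (simp add: A'x v_def)
    have "card {i. A' $ i $ i \<noteq> 0} < card {i. A $ i $ i \<noteq> 0}"
    proof (rule psubset_card_mono)
      have "A' $ i $ i = 0" if "A $ i $ i = 0" for i
      proof -
        have "A' $ i $ i = - (v $ i * v $ i / A $ p $ p)" using that by (simp add: A'_def)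
        moreover have "v $ i * v $ i / A $ p $ p \<ge> 0" using p by simp
        ultimately show ?thesis using psd_column(1)[OF s' p', of i] by linarith
      qed
      moreover have "A' $ p $ p = 0" using p by (simp add: A'_def va)
      moreover have "A $ p $ p \<noteq> 0" using p by simp
      ultimately show "{i. A' $ i $ i \<noteq> 0} \<subset> {i. A $ i $ i \<noteq> 0}" by blast
    qed simp
    then have "0 \<le> (\<Sum>a\<in>UNIV. \<Sum>b\<in>UNIV. A' $ a $ b * F $ a $ b)" by (rule less.hyps[OF _ s' p'])
    moreover have "(\<Sum>a\<in>UNIV. \<Sum>b\<in>UNIV. A' $ a $ b * F $ a $ b)
        = (\<Sum>a\<in>UNIV. \<Sum>b\<in>UNIV. A $ a $ b * F $ a $ b) - v \<bullet> (F *v v) / A $ p $ p"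
    proof -
      have "v \<bullet> (F *v v) / A $ p $ p = (\<Sum>a\<in>UNIV. \<Sum>b\<in>UNIV. v $ a * v $ b / A $ p $ p * F $ a $ b)"
        unfolding inner_matrix_sum sum_divide_distrib by (intro sum.cong refl) simp
      then show ?thesis unfolding A'_def by (simp add: left_diff_distrib sum_subtractf)
    qed
    ultimately show ?thesis using F[of v] p by (smt (verit) divide_nonneg_pos)
  qed
qed

lemma sum_sum_diag: "(\<Sum>a\<in>UNIV. \<Sum>b\<in>(UNIV::'n::finite set). (if a = b then k else 0) * G a b) = k * (\<Sum>a\<in>UNIV. G a a :: real)"
  by (simp add: if_distrib[of "\<lambda>z. z * _"] sum_distrib_left cong: if_cong)

text \<open>The previous inequality for \<open>R\<close> minus \<open>\<alpha>\<close> times the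
  identity.\<close>

lemma trace_lower_bound:
  fixes R F :: "real^'n^'n"
  assumes R: "\<And>a b. R $ a $ b = R $ b $ a" "\<And>x. x \<bullet> (R *v x) \<ge> \<alpha> * (norm x)\<^sup>2" and F: "\<And>x. x \<bullet> (F *v x) \<ge> 0"
  shows "\<alpha> * (\<Sum>a\<in>UNIV. F $ a $ a) \<le> (\<Sum>a\<in>UNIV. \<Sum>b\<in>UNIV. R $ a $ b * F $ a $ b)"
proof -
  define A where "A = (\<chi> a b. R $ a $ b - (if a = b then \<alpha> else 0))"
  have n: "(\<Sum>a\<in>UNIV. x $ a * x $ a) = (norm x)\<^sup>2" for x :: "real^'n"
    by (simp add: power2_norm_eq_inner inner_vec_def)
  have "x \<bullet> (A *v x) = x \<bullet> (R *v x) - \<alpha> * (norm x)\<^sup>2" for x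
    unfolding inner_matrix_sum A_def by (simp add: left_diff_distrib sum_subtractf sum_sum_diag n)
  then have "0 \<le> (\<Sum>a\<in>UNIV. \<Sum>b\<in>UNIV. A $ a $ b * F $ a $ b)"
    using R by (intro psd_trace_nonneg F) (auto simp: A_def)
  then show ?thesis unfolding A_def by (simp add: left_diff_distrib sum_subtractf sum_sum_diag)
qed

text \<open>The squared norm of \<open>v\<close> times the identity, minus the rank-one matrix of
  \<open>v\<close>, is semidefinite by Cauchy-Schwarz; its pairing with \<open>F\<close> is the
  difference of the two sides.\<close>

lemma form_le_trace:
  fixes F :: "real^'n^'n"
  assumes F: "\<And>x. x \<bullet> (F *v x) \<ge> 0"
  shows "v \<bullet> (F *v v) \<le> (norm v)\<^sup>2 * (\<Sum>a\<in>UNIV. F $ a $ a)"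
proof -
  define A where "A = (\<chi> a b. (if a = b then (norm v)\<^sup>2 else 0) - v $ a * v $ b)"
  have n: "(\<Sum>a\<in>UNIV. x $ a * x $ a) = (norm x)\<^sup>2" for x :: "real^'n"
    by (simp add: power2_norm_eq_inner inner_vec_def)
  have "x \<bullet> (A *v x) = (norm v)\<^sup>2 * (norm x)\<^sup>2 - (v \<bullet> x)\<^sup>2" for x
  proof -
    have "(v \<bullet> x)\<^sup>2 = (\<Sum>a\<in>UNIV. \<Sum>b\<in>UNIV. v $ a * v $ b * (x $ a * x $ b))"
      unfolding power2_eq_square inner_vec_def sum_product by (intro sum.cong refl) simp
    then show ?thesis
      unfolding inner_matrix_sum A_def by (simp add: left_diff_distrib sum_subtractf sum_sum_diag n)
  qed
  moreover have "(v \<bullet> x)\<^sup>2 \<le> (norm v)\<^sup>2 * (norm x)\<^sup>2" for x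
    using Cauchy_Schwarz_ineq[of v x] by (simp add: power2_norm_eq_inner)
  ultimately have "0 \<le> (\<Sum>a\<in>UNIV. \<Sum>b\<in>UNIV. A $ a $ b * F $ a $ b)"
    by (intro psd_trace_nonneg F) (auto simp: A_def)
  moreover have "v \<bullet> (F *v v) = (\<Sum>a\<in>UNIV. \<Sum>b\<in>UNIV. v $ a * v $ b * F $ a $ b)"
    unfolding inner_matrix_sum by (intro sum.cong refl) simp
  ultimately show ?thesis unfolding A_def by (simp add: left_diff_distrib sum_subtractf sum_sum_diag)
qed

section \<open>Convex functions along segments\<close>

lemma gradient_line_derivative:
  fixes f :: "real^'n \<Rightarrow> real"
  assumes f: "Ck_on 2 S f" "y + t *\<^sub>R v \<in> S"
  shows "((\<lambda>t. grad f (y + t *\<^sub>R v) \<bullet> v) has_real_derivative v \<bullet> (hess f (y + t *\<^sub>R v) *v v)) (at t)"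
proof -
  have p: "Ck_on (Suc 0) S (partial a f)" for a by (rule Ck_on_partial) (use f(1) in \<open>simp add: numeral_2_eq_2\<close>)
  have "((\<lambda>t. \<Sum>a\<in>UNIV. partial a f (y + t *\<^sub>R v) * v $ a) has_real_derivative
      (\<Sum>a\<in>UNIV. (grad (partial a f) (y + t *\<^sub>R v) \<bullet> v) * v $ a)) (at t)"
    using has_real_derivative_line[OF p f(2)] unfolding frechet_grad[OF p f(2)]
    by (intro DERIV_sum DERIV_cmult_right)
  moreover have "(\<Sum>a\<in>UNIV. (grad (partial a f) (y + t *\<^sub>R v) \<bullet> v) * v $ a) = v \<bullet> (hess f (y + t *\<^sub>R v) *v v)"
    unfolding inner_matrix_sum by (simp add: grad_def hess_def inner_vec_def sum_distrib_left sum_distrib_right mult_ac)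
  moreover have "(\<lambda>t. grad f (y + t *\<^sub>R v) \<bullet> v) = (\<lambda>t. \<Sum>a\<in>UNIV. partial a f (y + t *\<^sub>R v) * v $ a)"
    by (simp add: grad_def inner_vec_def)
  ultimately show ?thesis by simp
qed

text \<open>Adding the gradient inequalities at two points of a line shows that the gradient is
  monotone along it; the Hessian form is the limit of the corresponding difference
  quotients.\<close>

lemma convex_hessian_nonneg:
  fixes f :: "real^'n \<Rightarrow> real"
  assumes f: "convex_on P f" "Ck_on 2 (interior P) f" and y: "y \<in> interior P"
  shows "v \<bullet> (hess f y *v v) \<ge> 0"
proof -
  have c: "Ck_on (Suc 1) (interior P) f" using f(2) by (simp add: numeral_2_eq_2)
  have "((\<lambda>t. grad f (y + t *\<^sub>R v) \<bullet> v) has_real_derivative v \<bullet> (hess f y *v v)) (at 0)"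
    using gradient_line_derivative[OF f(2), of y 0 v] y by simp
  then have "(\<lambda>t. (grad f (y + t *\<^sub>R v) \<bullet> v - grad f y \<bullet> v) / t) \<midarrow>0\<rightarrow> v \<bullet> (hess f y *v v)"
    unfolding DERIV_def by simp
  then have lim: "((\<lambda>t. (grad f (y + t *\<^sub>R v) \<bullet> v - grad f y \<bullet> v) / t) \<longlongrightarrow> v \<bullet> (hess f y *v v)) (at_right 0)"
    by (simp add: filterlim_at_split)
  have "((\<lambda>t::real. y + t *\<^sub>R v) \<longlongrightarrow> y + 0 *\<^sub>R v) (at_right 0)" by (intro tendsto_intros)
  then have "\<forall>\<^sub>F t in at_right (0::real). y + t *\<^sub>R v \<in> interior P"
    using y by (intro topological_tendstoD[OF _ open_interior]) auto
  then have "\<forall>\<^sub>F t in at_right (0::real). 0 \<le> (grad f (y + t *\<^sub>R v) \<bullet> v - grad f y \<bullet> v) / t"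
    using eventually_at_right_less[of "0::real"]
  proof eventually_elim
    case (elim t)
    have P: "y \<in> P" "y + t *\<^sub>R v \<in> P" using y elim interior_subset by auto
    have "f y + grad f y \<bullet> (y + t *\<^sub>R v - y) \<le> f (y + t *\<^sub>R v)"
      by (rule convex_gradient_ineq[OF f(1) c y P(2)])
    moreover have "f (y + t *\<^sub>R v) + grad f (y + t *\<^sub>R v) \<bullet> (y - (y + t *\<^sub>R v)) \<le> f y"
      by (rule convex_gradient_ineq[OF f(1) c elim(1) P(1)])
    ultimately have "t * (grad f (y + t *\<^sub>R v) \<bullet> v - grad f y \<bullet> v) \<ge> 0" by (simp add: algebra_simps)
    then show ?case using elim(2) by (simp add: zero_le_mult_iff)
  qed
  then show ?thesis by (rule tendsto_lowerbound[OF lim]) simp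
qed

lemma nn_integral_lborel_affine:
  fixes g :: "'a::euclidean_space \<Rightarrow> ennreal"
  assumes g: "g \<in> borel_measurable borel" and k: "k \<noteq> 0"
  shows "(\<integral>\<^sup>+x. g (q + k *\<^sub>R x) \<partial>lborel) = ennreal (1 / \<bar>k\<bar> ^ DIM('a)) * (\<integral>\<^sup>+x. g x \<partial>lborel)"
proof -
  let ?I = "\<integral>\<^sup>+x. g (q + k *\<^sub>R x) \<partial>lborel"
  have "(\<integral>\<^sup>+x. g x \<partial>lborel) = ennreal (\<bar>k\<bar> ^ DIM('a)) * ?I"
    by (subst lborel_affine[OF k, of q]) (use g in \<open>simp add: nn_integral_density nn_integral_distr nn_integral_cmult\<close>)
  moreover have "ennreal (1 / \<bar>k\<bar> ^ DIM('a)) * ennreal (\<bar>k\<bar> ^ DIM('a)) = 1"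
    using k by (simp add: ennreal_mult'[symmetric])
  ultimately show ?thesis by (simp add: mult.assoc[symmetric])
qed

lemma integral_lborel_affine:
  fixes g :: "'a::euclidean_space \<Rightarrow> real"
  assumes g: "g \<in> borel_measurable borel" and k: "k \<noteq> 0"
  shows "(LINT x|lborel. g x) = \<bar>k\<bar> ^ DIM('a) * (LINT x|lborel. g (q + k *\<^sub>R x))"
  by (subst lborel_affine[OF k, of q]) (use g in \<open>simp add: integral_density integral_distr\<close>)

text \<open>One of the two segment parameters \<open>t\<close>, \<open>1 - t\<close> is at least \<open>1/2\<close>, so
  the substitution is carried out in the variable at that end of the segment.\<close>

lemma segment_average_bound:
  fixes w :: "'a::euclidean_space \<Rightarrow> ennreal"
  assumes w[measurable]: "w \<in> borel_measurable borel" and K[measurable]: "K \<in> sets borel"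
    and k: "k \<noteq> 0" "\<bar>k\<bar> \<le> 1"
  shows "(\<integral>\<^sup>+b. \<integral>\<^sup>+x. (\<integral>\<^sup>+t. w (b + t *\<^sub>R (q + k *\<^sub>R x - b)) * indicator {0..1} t \<partial>lborel)
      * indicator K x * indicator K b \<partial>lborel \<partial>lborel)
    \<le> ennreal ((2 / \<bar>k\<bar>) ^ DIM('a)) * emeasure lborel K * (\<integral>\<^sup>+x. w x \<partial>lborel)"
proof -
  let ?W = "\<integral>\<^sup>+x. w x \<partial>lborel"
  let ?A = "ennreal ((2 / \<bar>k\<bar>) ^ DIM('a))"
  \<comment> \<open>The Jacobian of \<open>p + s *R x\<close> costs \<open>1 / \<bar>s\<bar>\<close>
    to the dimension, which is controlled once \<open>\<bar>s\<bar> \<ge> \<bar>k\<bar> / 2\<close>.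
    Below \<open>s\<close> is \<open>t * k\<close> with \<open>t \<ge> 1/2\<close>, or
    \<open>1 - t \<ge> 1/2\<close>.\<close>
  have scale: "(\<integral>\<^sup>+x. w (p + s *\<^sub>R x) \<partial>lborel) \<le> ?A * ?W" if s: "\<bar>k\<bar> / 2 \<le> \<bar>s\<bar>" for s :: real and p
  proof -
    have s0: "s \<noteq> 0" using s k(1) by auto
    have "1 / \<bar>s\<bar> \<le> 2 / \<bar>k\<bar>" using s k(1) s0 by (simp add: field_simps)
    then have "(1 / \<bar>s\<bar>) ^ DIM('a) \<le> (2 / \<bar>k\<bar>) ^ DIM('a)" by (rule power_mono) simp
    then have "ennreal (1 / \<bar>s\<bar> ^ DIM('a)) \<le> ?A" by (intro ennreal_leI) (simp add: power_divide)
    then show ?thesis unfolding nn_integral_lborel_affine[OF w s0] by (rule mult_right_mono) simp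
  qed
  have fixed_t: "(\<integral>\<^sup>+b. \<integral>\<^sup>+x. w (b + t *\<^sub>R (q + k *\<^sub>R x - b)) * indicator K x * indicator K b \<partial>lborel \<partial>lborel)
      \<le> ?A * emeasure lborel K * ?W" if t: "t \<in> {0..1}" for t
  proof (cases "t \<ge> 1/2")
    case True
    have "(\<integral>\<^sup>+x. w (b + t *\<^sub>R (q + k *\<^sub>R x - b)) * indicator K x * indicator K b \<partial>lborel) \<le> ?A * ?W * indicator K b" for b
    proof -
      have "(\<integral>\<^sup>+x. w (b + t *\<^sub>R (q + k *\<^sub>R x - b)) * indicator K x * indicator K b \<partial>lborel)
          \<le> (\<integral>\<^sup>+x. w ((b + t *\<^sub>R (q - b)) + (t * k) *\<^sub>R x) * indicator K b \<partial>lborel)"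
        by (intro nn_integral_mono) (auto simp: indicator_def algebra_simps)
      also have "\<dots> = (\<integral>\<^sup>+x. w ((b + t *\<^sub>R (q - b)) + (t * k) *\<^sub>R x) \<partial>lborel) * indicator K b"
        by (rule nn_integral_multc) measurable
      also have "\<dots> \<le> ?A * ?W * indicator K b"
        using True k by (intro mult_right_mono scale) (auto simp: abs_mult intro: order_trans[OF _ mult_right_mono[of "1/2" t]])
      finally show ?thesis .
    qed
    then have "(\<integral>\<^sup>+b. \<integral>\<^sup>+x. w (b + t *\<^sub>R (q + k *\<^sub>R x - b)) * indicator K x * indicator K b \<partial>lborel \<partial>lborel)
        \<le> (\<integral>\<^sup>+b. ?A * ?W * indicator K b \<partial>lborel)" by (intro nn_integral_mono)
    also have "\<dots> = ?A * ?W * emeasure lborel K" using K by (intro nn_integral_cmult_indicator) simp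
    finally show ?thesis by (simp add: mult_ac)
  next
    case False
    have "(\<integral>\<^sup>+b. \<integral>\<^sup>+x. w (b + t *\<^sub>R (q + k *\<^sub>R x - b)) * indicator K x * indicator K b \<partial>lborel \<partial>lborel)
        = (\<integral>\<^sup>+x. \<integral>\<^sup>+b. w (b + t *\<^sub>R (q + k *\<^sub>R x - b)) * indicator K x * indicator K b \<partial>lborel \<partial>lborel)"
      by (rule lborel_pair.Fubini'[symmetric]) measurable
    also have "\<dots> \<le> (\<integral>\<^sup>+x. ?A * ?W * indicator K x \<partial>lborel)"
    proof (intro nn_integral_mono)
      fix x
      have "(\<integral>\<^sup>+b. w (b + t *\<^sub>R (q + k *\<^sub>R x - b)) * indicator K x * indicator K b \<partial>lborel)
          \<le> (\<integral>\<^sup>+b. w (t *\<^sub>R (q + k *\<^sub>R x) + (1 - t) *\<^sub>R b) * indicator K x \<partial>lborel)"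
        by (intro nn_integral_mono) (auto simp: indicator_def algebra_simps)
      also have "\<dots> = (\<integral>\<^sup>+b. w (t *\<^sub>R (q + k *\<^sub>R x) + (1 - t) *\<^sub>R b) \<partial>lborel) * indicator K x"
        by (rule nn_integral_multc) measurable
      also have "\<dots> \<le> ?A * ?W * indicator K x"
        using False k by (intro mult_right_mono scale) auto
      finally show "(\<integral>\<^sup>+b. w (b + t *\<^sub>R (q + k *\<^sub>R x - b)) * indicator K x * indicator K b \<partial>lborel) \<le> ?A * ?W * indicator K x" .
    qed
    also have "\<dots> = ?A * ?W * emeasure lborel K" using K by (intro nn_integral_cmult_indicator) simp
    finally show ?thesis by (simp add: mult_ac)
  qed
  have "(\<integral>\<^sup>+b. \<integral>\<^sup>+x. (\<integral>\<^sup>+t. w (b + t *\<^sub>R (q + k *\<^sub>R x - b)) * indicator {0..1} t \<partial>lborel)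
      * indicator K x * indicator K b \<partial>lborel \<partial>lborel)
    = (\<integral>\<^sup>+b. \<integral>\<^sup>+x. \<integral>\<^sup>+t. w (b + t *\<^sub>R (q + k *\<^sub>R x - b)) * indicator {0..1::real} t * (indicator K x * indicator K b) \<partial>lborel \<partial>lborel \<partial>lborel)"
    by (subst nn_integral_multc, measurable) (simp add: mult.assoc)
  also have "\<dots> = (\<integral>\<^sup>+b. \<integral>\<^sup>+t. \<integral>\<^sup>+x. w (b + t *\<^sub>R (q + k *\<^sub>R x - b)) * indicator {0..1::real} t * (indicator K x * indicator K b) \<partial>lborel \<partial>lborel \<partial>lborel)"
    by (intro nn_integral_cong lborel_pair.Fubini') measurable
  also have "\<dots> = (\<integral>\<^sup>+t. \<integral>\<^sup>+b. \<integral>\<^sup>+x. w (b + t *\<^sub>R (q + k *\<^sub>R x - b)) * indicator {0..1::real} t * (indicator K x * indicator K b) \<partial>lborel \<partial>lborel \<partial>lborel)"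
    by (rule lborel_pair.Fubini') measurable
  also have "\<dots> \<le> (\<integral>\<^sup>+t. ?A * emeasure lborel K * ?W * indicator {0..1::real} t \<partial>lborel)"
  proof (intro nn_integral_mono)
    fix t :: real
    show "(\<integral>\<^sup>+b. \<integral>\<^sup>+x. w (b + t *\<^sub>R (q + k *\<^sub>R x - b)) * indicator {0..1::real} t * (indicator K x * indicator K b) \<partial>lborel \<partial>lborel)
        \<le> ?A * emeasure lborel K * ?W * indicator {0..1::real} t"
      using fixed_t[of t] by (cases "t \<in> {0..1}") (auto simp: mult.assoc)
  qed
  also have "\<dots> = ?A * emeasure lborel K * ?W" by (subst nn_integral_cmult_indicator) auto
  finally show ?thesis .
qed

text \<open>The gradient inequality based at \<open>x\<close> bounds the error of the tangent plane
  at \<open>b\<close> by the difference of the gradients paired with \<open>x - b\<close>. This is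
  an integral of Hessian forms over the segment, each at most \<open>d * d\<close> times the
  Laplacian. The indicator of \<open>K\<close> is 1 on the segment; together with values in
  \<open>ennreal\<close> it prepares the exchange of integrals.\<close>

lemma gradient_difference_integral:
  fixes f :: "real^'n \<Rightarrow> real"
  assumes f: "convex_on P f" "Ck_on 2 (interior P) f" and K: "convex K" "compact K" "K \<subseteq> interior P"
    and xb: "x \<in> K" "b \<in> K" and d: "norm (x - b) \<le> d"
  shows "ennreal (f x - (f b + grad f b \<bullet> (x - b))) \<le> ennreal (d\<^sup>2) *
    (\<integral>\<^sup>+t. (ennreal (\<Sum>a\<in>UNIV. hess f (b + t *\<^sub>R (x - b)) $ a $ a) * indicator K (b + t *\<^sub>R (x - b))) * indicator {0..1} t \<partial>lborel)"
proof -
  define v where "v = x - b"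
  have c: "Ck_on (Suc 1) (interior P) f" using f(2) by (simp add: numeral_2_eq_2)
  have seg: "b + t *\<^sub>R v \<in> K" if "t \<in> {0..1}" for t
    using convexD_alt[OF K(1) xb(2,1), of t] that by (simp add: v_def algebra_simps)
  have segi: "b + t *\<^sub>R v \<in> interior P" if "t \<in> {0..1}" for t using seg[OF that] K(3) by blast
  let ?q = "\<lambda>t. v \<bullet> (hess f (b + t *\<^sub>R v) *v v)"
  have ch: "continuous_on (interior P) (hess f)"
    using Ck_on_hess[OF open_interior, of 0 P f] f(2) by (simp add: numeral_2_eq_2)
  have psd: "y \<bullet> (hess f (b + t *\<^sub>R v) *v y) \<ge> 0" if "t \<in> {0..1}" for t y
    by (rule convex_hessian_nonneg[OF f segi[OF that]])
  have "(\<integral>\<^sup>+t. ennreal (?q t) * indicator {0..1} t \<partial>lborel) = ennreal (grad f (b + 1 *\<^sub>R v) \<bullet> v - grad f (b + 0 *\<^sub>R v) \<bullet> v)"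
  proof (rule nn_integral_has_integral_lebesgue')
    show "(?q has_integral (grad f (b + 1 *\<^sub>R v) \<bullet> v - grad f (b + 0 *\<^sub>R v) \<bullet> v)) {0..1}"
    proof (rule fundamental_theorem_of_calculus)
      show "((\<lambda>t. grad f (b + t *\<^sub>R v) \<bullet> v) has_vector_derivative ?q t) (at t within {0..1})" if "t \<in> {0..1}" for t
        using gradient_line_derivative[OF f(2) segi[OF that]]
        by (simp add: has_real_derivative_iff_has_vector_derivative has_vector_derivative_at_within)
    qed simp
  qed (rule psd)
  moreover have "f x - (f b + grad f b \<bullet> (x - b)) \<le> grad f (b + 1 *\<^sub>R v) \<bullet> v - grad f (b + 0 *\<^sub>R v) \<bullet> v"
    using convex_gradient_ineq[OF f(1) c, of x b] xb K(3) interior_subset by (force simp: v_def inner_diff_right)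
  ultimately have "ennreal (f x - (f b + grad f b \<bullet> (x - b))) \<le> (\<integral>\<^sup>+t. ennreal (?q t) * indicator {0..1} t \<partial>lborel)"
    by (simp add: ennreal_leI)
  also have "\<dots> \<le> (\<integral>\<^sup>+t. ennreal (d\<^sup>2) * ((ennreal (\<Sum>a\<in>UNIV. hess f (b + t *\<^sub>R v) $ a $ a) * indicator K (b + t *\<^sub>R v)) * indicator {0..1} t) \<partial>lborel)"
  proof (intro nn_integral_mono)
    fix t :: real
    show "ennreal (?q t) * indicator {0..1} t
      \<le> ennreal (d\<^sup>2) * ((ennreal (\<Sum>a\<in>UNIV. hess f (b + t *\<^sub>R v) $ a $ a) * indicator K (b + t *\<^sub>R v)) * indicator {0..1} t)"
    proof (cases "t \<in> {0..1}")
      case True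
      have "hess f (b + t *\<^sub>R v) $ a $ a \<ge> 0" for a
        using psd[OF True, of "axis a 1"] by (simp add: inner_axis' matrix_vector_mul_component inner_axis)
      then have T: "(\<Sum>a\<in>UNIV. hess f (b + t *\<^sub>R v) $ a $ a) \<ge> 0" by (rule sum_nonneg)
      have "?q t \<le> (norm v)\<^sup>2 * (\<Sum>a\<in>UNIV. hess f (b + t *\<^sub>R v) $ a $ a)" by (rule form_le_trace[OF psd[OF True]])
      also have "\<dots> \<le> d\<^sup>2 * (\<Sum>a\<in>UNIV. hess f (b + t *\<^sub>R v) $ a $ a)"
        using d by (intro mult_right_mono power_mono T) (auto simp: v_def)
      finally show ?thesis using True seg[OF True] T by (simp add: ennreal_mult[symmetric] ennreal_leI)
    qed simp
  qed
  also have "\<dots> = ennreal (d\<^sup>2) * (\<integral>\<^sup>+t. (ennreal (\<Sum>a\<in>UNIV. hess f (b + t *\<^sub>R v) $ a $ a) * indicator K (b + t *\<^sub>R v)) * indicator {0..1} t \<partial>lborel)"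
  proof (rule nn_integral_cmult)
    have "(\<lambda>t. indicator {0..1} t *\<^sub>R (\<Sum>a\<in>UNIV. hess f (b + t *\<^sub>R v) $ a $ a)) \<in> borel_measurable borel"
      by (intro borel_measurable_continuous_on_indicator continuous_intros continuous_on_compose2[OF ch]) (use segi in auto)
    then have "(\<lambda>t. ennreal (indicator {0..1} t *\<^sub>R (\<Sum>a\<in>UNIV. hess f (b + t *\<^sub>R v) $ a $ a))) \<in> borel_measurable borel"
      by (rule measurable_compose) measurable
    moreover have "(\<lambda>t. ennreal (indicator {0..1} t *\<^sub>R (\<Sum>a\<in>UNIV. hess f (b + t *\<^sub>R v) $ a $ a)))
      = (\<lambda>t. (ennreal (\<Sum>a\<in>UNIV. hess f (b + t *\<^sub>R v) $ a $ a) * indicator K (b + t *\<^sub>R v)) * indicator {0..1} t)"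
      using seg by (auto simp: fun_eq_iff indicator_def)
    ultimately show "(\<lambda>t. (ennreal (\<Sum>a\<in>UNIV. hess f (b + t *\<^sub>R v) $ a $ a) * indicator K (b + t *\<^sub>R v)) * indicator {0..1} t) \<in> borel_measurable lborel"
      by simp
  qed
  finally show ?thesis unfolding v_def .
qed

lemma nn_integral_compact:
  fixes h :: "real^'n \<Rightarrow> real"
  assumes K: "compact K" "continuous_on K h" and h: "\<And>x. x \<in> K \<Longrightarrow> h x \<ge> 0"
  shows "(\<integral>\<^sup>+x. ennreal (h x) * indicator K x \<partial>lborel) = ennreal (LINT x:K|lborel. h x)"
proof -
  have "(\<integral>\<^sup>+x. ennreal (h x) * indicator K x \<partial>lborel) = (\<integral>\<^sup>+x. ennreal (indicator K x *\<^sub>R h x) \<partial>lborel)"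
    by (intro nn_integral_cong) (auto simp: indicator_def)
  also have "\<dots> = ennreal (LINT x:K|lborel. h x)"
    unfolding set_lebesgue_integral_def
    by (rule nn_integral_eq_integral[OF set_integrable_compact[OF K, unfolded set_integrable_def]])
      (use h in \<open>auto simp: indicator_def\<close>)
  finally show ?thesis .
qed

text \<open>The tangent plane at \<open>b\<close> is nonpositive at
  \<open>p0\<close>, which lies between \<open>x\<close> and its image under the contracting reflection at \<open>p0\<close>;
  hence the two errors of the tangent plane at \<open>b\<close> bound \<open>f x\<close>. Then average over \<open>b\<close>.\<close>

lemma convex_integral_le_laplacian:
  fixes f :: "real^'n \<Rightarrow> real"
  assumes f: "convex_on P f" "Ck_on 2 (interior P) f" and K: "convex K" "compact K" "K \<subseteq> interior P"
    and p0: "p0 \<in> K" "f p0 = 0" and \<epsilon>: "0 < \<epsilon>" "\<epsilon> \<le> 1"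
    and refl: "\<And>x. x \<in> K \<Longrightarrow> (1 + \<epsilon>) *\<^sub>R p0 + (- \<epsilon>) *\<^sub>R x \<in> K"
    and d: "\<And>x y. x \<in> K \<Longrightarrow> y \<in> K \<Longrightarrow> norm (x - y) \<le> d"
    and f0: "\<And>x. x \<in> K \<Longrightarrow> f x \<ge> 0" and K0: "emeasure lborel K \<noteq> 0"
  shows "(LINT x:K|lborel. f x) \<le> (d\<^sup>2 * 2 ^ CARD('n) + d\<^sup>2 / \<epsilon> * (2 / \<epsilon>) ^ CARD('n))
    * (LINT x:K|lborel. \<Sum>a\<in>UNIV. hess f x $ a $ a)"
proof -
  let ?T = "\<lambda>x. \<Sum>a\<in>UNIV. hess f x $ a $ a"
  define w where "w x = ennreal (?T x) * indicator K x" for x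
  define S where "S k q b x = (\<integral>\<^sup>+t. w (b + t *\<^sub>R (q + k *\<^sub>R x - b)) * indicator {0..1} t \<partial>lborel)" for k q b x
  let ?q = "(1 + \<epsilon>) *\<^sub>R p0"
  let ?M = "emeasure lborel K"
  have c: "Ck_on (Suc 1) (interior P) f" using f(2) by (simp add: numeral_2_eq_2)
  have ch: "continuous_on K (hess f)"
    using continuous_on_subset[OF Ck_on_continuous[OF Ck_on_hess[OF open_interior, of 0 P f]] K(3)] f(2)
    by (simp add: numeral_2_eq_2)
  have cT: "continuous_on K ?T" by (intro continuous_intros ch)
  have cf: "continuous_on K f" using continuous_on_subset[OF Ck_on_continuous[OF c] K(3)] .
  have KP: "K \<subseteq> P" using K(3) interior_subset by blast
  have Kb[measurable]: "K \<in> sets borel" using K(2) by (simp add: borel_compact)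
  have T0: "?T x \<ge> 0" if "x \<in> K" for x
  proof (rule sum_nonneg)
    fix a
    show "0 \<le> hess f x $ a $ a"
      using convex_hessian_nonneg[OF f, of x "axis a 1"] that K(3)
      by (auto simp: inner_axis' matrix_vector_mul_component inner_axis)
  qed
  have w[measurable]: "w \<in> borel_measurable borel"
  proof -
    have "(\<lambda>x. ennreal (indicator K x *\<^sub>R ?T x)) \<in> borel_measurable borel"
      using borel_measurable_continuous_on_indicator[OF Kb cT] by measurable
    moreover have "(\<lambda>x. ennreal (indicator K x *\<^sub>R ?T x)) = w" by (auto simp: w_def fun_eq_iff indicator_def)
    ultimately show ?thesis by simp
  qed
  have S_meas[measurable]: "(\<lambda>(b, x). S k q b x) \<in> borel_measurable (borel \<Otimes>\<^sub>M borel)" for k q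
    unfolding S_def by measurable
  have W: "(\<integral>\<^sup>+x. w x \<partial>lborel) = ennreal (LINT x:K|lborel. ?T x)"
    unfolding w_def by (rule nn_integral_compact[OF K(2) cT T0])
  have F: "(\<integral>\<^sup>+x. ennreal (f x) * indicator K x \<partial>lborel) = ennreal (LINT x:K|lborel. f x)"
    by (rule nn_integral_compact[OF K(2) cf f0])
  have point: "ennreal (f x) \<le> ennreal (d\<^sup>2) * S 1 0 b x + ennreal (d\<^sup>2 / \<epsilon>) * S (- \<epsilon>) ?q b x"
    if x: "x \<in> K" and b: "b \<in> K" for x b
  proof -
    let ?D = "\<lambda>z. f z - (f b + grad f b \<bullet> (z - b))"
    let ?x = "?q + (- \<epsilon>) *\<^sub>R x"
    have bi: "b \<in> interior P" using b K(3) by blast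
    have D0: "?D z \<ge> 0" if "z \<in> K" for z using convex_gradient_ineq[OF f(1) c bi, of z] that KP by auto
    \<comment> \<open>\<open>p0\<close> divides the segment from \<open>x\<close> to
      \<open>?x\<close> in the ratio \<open>1 : \<epsilon>\<close>; with these weights the linear
      parts of the two tangent errors combine to the tangent plane at \<open>p0\<close>.\<close>
    have "(x - b) + (1 / \<epsilon>) *\<^sub>R (?x - b) = (1 + 1 / \<epsilon>) *\<^sub>R (p0 - b)"
      using \<epsilon> by (simp add: algebra_simps)
    then have "grad f b \<bullet> (x - b) + (1 / \<epsilon>) * (grad f b \<bullet> (?x - b)) = (1 + 1 / \<epsilon>) * (grad f b \<bullet> (p0 - b))"
      by (metis inner_add_right inner_scaleR_right)
    then have "?D x + (1 / \<epsilon>) * ?D ?x = f x + (1 / \<epsilon>) * f ?x - (1 + 1 / \<epsilon>) * (f b + grad f b \<bullet> (p0 - b))"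
      by (simp only: right_diff_distrib distrib_left distrib_right)
    moreover have "f b + grad f b \<bullet> (p0 - b) \<le> 0" using D0[OF p0(1)] p0(2) by simp
    then have "(1 + 1 / \<epsilon>) * (f b + grad f b \<bullet> (p0 - b)) \<le> 0" using \<epsilon> by (intro mult_nonneg_nonpos) auto
    moreover have "(1 / \<epsilon>) * f ?x \<ge> 0" using \<epsilon> f0[OF refl[OF x]] by simp
    ultimately have "f x \<le> ?D x + (1 / \<epsilon>) * ?D ?x" by linarith
    then have "ennreal (f x) \<le> ennreal (?D x + (1 / \<epsilon>) * ?D ?x)" by (rule ennreal_leI)
    also have "\<dots> = ennreal (?D x) + ennreal (1 / \<epsilon>) * ennreal (?D ?x)"
      using D0[OF x] D0[OF refl[OF x]] \<epsilon> by (simp only: ennreal_plus ennreal_mult' mult_nonneg_nonneg zero_le_divide_1_iff less_imp_le)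
    also have "\<dots> \<le> ennreal (d\<^sup>2) * S 1 0 b x + ennreal (1 / \<epsilon>) * (ennreal (d\<^sup>2) * S (- \<epsilon>) ?q b x)"
    proof (intro add_mono mult_left_mono)
      show "ennreal (?D x) \<le> ennreal (d\<^sup>2) * S 1 0 b x"
        using gradient_difference_integral[OF f K x b d[OF x b]] by (simp add: S_def w_def)
      show "ennreal (?D ?x) \<le> ennreal (d\<^sup>2) * S (- \<epsilon>) ?q b x"
        using gradient_difference_integral[OF f K refl[OF x] b d[OF refl[OF x] b]] by (simp only: S_def w_def)
    qed simp
    also have "\<dots> = ennreal (d\<^sup>2) * S 1 0 b x + ennreal (d\<^sup>2 / \<epsilon>) * S (- \<epsilon>) ?q b x"
      using \<epsilon> by (simp add: mult.assoc[symmetric] ennreal_mult'[symmetric])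
    finally show ?thesis .
  qed
  define J where "J k q = (\<integral>\<^sup>+b. \<integral>\<^sup>+x. S k q b x * indicator K x * indicator K b \<partial>lborel \<partial>lborel)" for k q
  have J: "J k q \<le> ennreal ((2 / \<bar>k\<bar>) ^ CARD('n)) * ?M * (\<integral>\<^sup>+x. w x \<partial>lborel)" if "k \<noteq> 0" "\<bar>k\<bar> \<le> 1" for k q
    using segment_average_bound[OF w Kb that, of q] by (simp add: J_def S_def)
  \<comment> \<open>Integration over \<open>b\<close> instead of averaging: the measure of
    \<open>K\<close> is carried along as a factor and cancelled at the end, being positive by
    \<open>K0\<close> and finite by compactness.\<close>
  have "?M * (\<integral>\<^sup>+x. ennreal (f x) * indicator K x \<partial>lborel)
      = (\<integral>\<^sup>+b. (\<integral>\<^sup>+x. ennreal (f x) * indicator K x \<partial>lborel) * indicator K b \<partial>lborel)"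
    by (subst nn_integral_cmult_indicator) (simp_all add: mult.commute)
  also have "\<dots> \<le> (\<integral>\<^sup>+b. \<integral>\<^sup>+x. ennreal (d\<^sup>2) * (S 1 0 b x * indicator K x * indicator K b)
      + ennreal (d\<^sup>2 / \<epsilon>) * (S (- \<epsilon>) ?q b x * indicator K x * indicator K b) \<partial>lborel \<partial>lborel)"
  proof (intro nn_integral_mono)
    fix b
    show "(\<integral>\<^sup>+x. ennreal (f x) * indicator K x \<partial>lborel) * indicator K b
      \<le> (\<integral>\<^sup>+x. ennreal (d\<^sup>2) * (S 1 0 b x * indicator K x * indicator K b)
      + ennreal (d\<^sup>2 / \<epsilon>) * (S (- \<epsilon>) ?q b x * indicator K x * indicator K b) \<partial>lborel)"
    proof (cases "b \<in> K")
      case True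
      have "(\<integral>\<^sup>+x. ennreal (f x) * indicator K x \<partial>lborel)
        \<le> (\<integral>\<^sup>+x. ennreal (d\<^sup>2) * (S 1 0 b x * indicator K x * indicator K b)
          + ennreal (d\<^sup>2 / \<epsilon>) * (S (- \<epsilon>) ?q b x * indicator K x * indicator K b) \<partial>lborel)"
      proof (intro nn_integral_mono)
        fix x
        show "ennreal (f x) * indicator K x \<le> ennreal (d\<^sup>2) * (S 1 0 b x * indicator K x * indicator K b)
          + ennreal (d\<^sup>2 / \<epsilon>) * (S (- \<epsilon>) ?q b x * indicator K x * indicator K b)"
          using point[OF _ True, of x] True by (cases "x \<in> K") simp_all
      qed
      then show ?thesis using True by simp
    qed simp
  qed
  also have "\<dots> = ennreal (d\<^sup>2) * J 1 0 + ennreal (d\<^sup>2 / \<epsilon>) * J (- \<epsilon>) ?q"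
    unfolding J_def by (simp add: nn_integral_add nn_integral_cmult)
  also have "\<dots> \<le> ennreal (d\<^sup>2) * (ennreal (2 ^ CARD('n)) * ?M * (\<integral>\<^sup>+x. w x \<partial>lborel))
      + ennreal (d\<^sup>2 / \<epsilon>) * (ennreal ((2 / \<epsilon>) ^ CARD('n)) * ?M * (\<integral>\<^sup>+x. w x \<partial>lborel))"
    using J[of 1 0] J[of "- \<epsilon>" ?q] \<epsilon> by (intro add_mono mult_left_mono) simp_all
  also have "\<dots> = ?M * (ennreal (d\<^sup>2 * 2 ^ CARD('n) + d\<^sup>2 / \<epsilon> * (2 / \<epsilon>) ^ CARD('n)) * (\<integral>\<^sup>+x. w x \<partial>lborel))"
  proof -
    have "ennreal (d\<^sup>2 * 2 ^ CARD('n) + d\<^sup>2 / \<epsilon> * (2 / \<epsilon>) ^ CARD('n))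
        = ennreal (d\<^sup>2) * ennreal (2 ^ CARD('n)) + ennreal (d\<^sup>2 / \<epsilon>) * ennreal ((2 / \<epsilon>) ^ CARD('n))"
    proof -
      have e: "ennreal (p * q + r * s) = ennreal p * ennreal q + ennreal r * ennreal s"
        if "p \<ge> 0" "q \<ge> 0" "r \<ge> 0" "s \<ge> 0" for p q r s
        using that by (simp add: ennreal_plus ennreal_mult)
      show ?thesis by (rule e) (use \<epsilon> in simp_all)
    qed
    then show ?thesis by (simp only: distrib_left distrib_right mult_ac)
  qed
  finally have "?M * (\<integral>\<^sup>+x. ennreal (f x) * indicator K x \<partial>lborel)
      \<le> ?M * (ennreal (d\<^sup>2 * 2 ^ CARD('n) + d\<^sup>2 / \<epsilon> * (2 / \<epsilon>) ^ CARD('n)) * (\<integral>\<^sup>+x. w x \<partial>lborel))" .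
  moreover have "?M < top" using emeasure_compact_finite[OF K(2)] by simp
  ultimately have "(\<integral>\<^sup>+x. ennreal (f x) * indicator K x \<partial>lborel)
      \<le> ennreal (d\<^sup>2 * 2 ^ CARD('n) + d\<^sup>2 / \<epsilon> * (2 / \<epsilon>) ^ CARD('n)) * (\<integral>\<^sup>+x. w x \<partial>lborel)"
    using K0 by (subst (asm) ennreal_mult_le_mult_iff) auto
  then have e: "ennreal (LINT x:K|lborel. f x)
      \<le> ennreal (d\<^sup>2 * 2 ^ CARD('n) + d\<^sup>2 / \<epsilon> * (2 / \<epsilon>) ^ CARD('n)) * ennreal (LINT x:K|lborel. ?T x)"
    by (simp only: W F)
  have A0: "d\<^sup>2 * 2 ^ CARD('n) + d\<^sup>2 / \<epsilon> * (2 / \<epsilon>) ^ CARD('n) \<ge> 0" using \<epsilon> by simp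
  have T1: "(LINT x:K|lborel. ?T x) \<ge> 0"
    unfolding set_lebesgue_integral_def using T0 by (intro Bochner_Integration.integral_nonneg) (auto simp: indicator_def)
  show ?thesis
    using e unfolding ennreal_mult[OF A0 T1, symmetric] ennreal_le_iff[OF mult_nonneg_nonneg[OF A0 T1]] .
qed

context delzant_polytope
begin

lemma facet_integral_nonneg:
  assumes "\<And>y. y \<in> P \<Longrightarrow> f y \<ge> 0"
  shows "facet_integral r f \<ge> 0"
proof -
  have "(LINT y:facet \<nu> c r|hyperplane_lborel (nv r) (c r). f y) \<ge> 0"
    unfolding set_lebesgue_integral_def using assms by (intro Bochner_Integration.integral_nonneg) (auto simp: indicator_def facet_def)
  then show ?thesis by (simp add: facet_integral_def)
qed

lemma const_C_nonneg: "const_C \<nu> c \<ge> 0"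
  unfolding const_C_def boundary_integral_facet_integral by (intro divide_nonneg_nonneg sum_nonneg facet_integral_nonneg) auto

section \<open>Mass outside a shrunk copy of the polytope\<close>

definition shrink :: "real^'n \<Rightarrow> real \<Rightarrow> real^'n \<Rightarrow> real^'n" where
  "shrink p0 t y = p0 + t *\<^sub>R (y - p0)"

lemma L_shrink: "L r (shrink p0 t y) = (1 - t) * L r p0 + t * L r y"
proof -
  have e: "nv r \<bullet> (y - p0) = L r y - L r p0" using L_add[of r p0 "y - p0"] by simp
  show ?thesis unfolding shrink_def L_add inner_scaleR_right e by (simp add: algebra_simps)
qed

lemma shrink_in: "p0 \<in> interior P \<Longrightarrow> y \<in> P \<Longrightarrow> 0 \<le> t \<Longrightarrow> t < 1 \<Longrightarrow> shrink p0 t y \<in> interior P"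
proof -
  assume a: "p0 \<in> interior P" "y \<in> P" "0 \<le> t" "t < 1"
  have "L r (shrink p0 t y) > 0" for r
  proof -
    have "L r p0 > 0" "L r y \<ge> 0" using a interior_P by (auto simp: moment_polytope_def)
    then show ?thesis unfolding L_shrink using a(3,4) by (intro add_pos_nonneg) auto
  qed
  then show ?thesis using interior_P by blast
qed

lemma shrink_convex: "p0 \<in> P \<Longrightarrow> y \<in> P \<Longrightarrow> 0 \<le> t \<Longrightarrow> t \<le> 1 \<Longrightarrow> shrink p0 t y \<in> P"
  using convexD_alt[OF P_convex, of p0 y t] by (simp add: shrink_def algebra_simps)

text \<open>A convex function with minimum \<open>0\<close> at \<open>p0\<close> loses little mass outside the shrunk polytope:
  compare \<open>f\<close> with its tangent plane along rays, and integrate the divergence of \<open>(y - p0) f\<close>.\<close>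

lemma integral_shrink:
  assumes f: "convex_on P f" "continuous_on P f" "Ck_on 1 (interior P) f"
    and p0: "p0 \<in> interior P" "f p0 = 0" and f0: "\<And>y. y \<in> P \<Longrightarrow> f y \<ge> 0" and t: "0 < t" "t < 1"
  shows "(LINT y:P|lborel. f y) - (LINT y:shrink p0 t ` P|lborel. f y) \<le> (1 - t) * (\<Sum>r\<in>UNIV. L r p0 * facet_integral r f)"
proof -
  have p0P: "p0 \<in> P" using p0(1) interior_subset by blast
  have c1: "Ck_on (Suc 0) (interior P) f" using f(3) by simp
  \<comment> \<open>In the variable of \<open>P\<close> the integral over the shrunk copy is that of
    the second term, so the loss of mass is the integral of \<open>?g\<close> over
    \<open>P\<close>.\<close>
  let ?g = "\<lambda>y. f y - t ^ CARD('n) * f (shrink p0 t y)"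
  have shc: "continuous_on S (shrink p0 t)" for S unfolding shrink_def[abs_def] by (intro continuous_intros)
  have fsc: "continuous_on P (\<lambda>y. f (shrink p0 t y))"
    by (rule continuous_on_compose2[OF f(2) shc]) (use shrink_convex[OF p0P] t in auto)
  have gc: "continuous_on P ?g" by (intro continuous_intros f(2) fsc)
  have KP: "inner_part (depth k) \<subseteq> P" for k using inner_part_subset[OF depth(1)] interior_subset by blast
  have point: "?g y \<le> (1 - t) * (grad f y \<bullet> (y - p0) + real CARD('n) * f y)" if y: "y \<in> interior P" for y
  proof -
    have yP: "y \<in> P" using y interior_subset by blast
    let ?G = "grad f y \<bullet> (y - p0)"
    have "f y + grad f y \<bullet> (shrink p0 t y - y) \<le> f (shrink p0 t y)"
      by (rule convex_gradient_ineq[OF f(1) c1 y shrink_convex[OF p0P yP]]) (use t in auto)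
    moreover have "shrink p0 t y - y = - ((1 - t) *\<^sub>R (y - p0))" by (simp add: shrink_def algebra_simps)
    ultimately have 1: "f y - (1 - t) * ?G \<le> f (shrink p0 t y)" by (simp only: inner_minus_right inner_scaleR_right)
    have "f y + grad f y \<bullet> (p0 - y) \<le> f p0" by (rule convex_gradient_ineq[OF f(1) c1 y p0P])
    then have G: "0 \<le> ?G" using f0[OF yP] p0(2) by (simp add: inner_diff_right)
    have tn: "0 \<le> t ^ CARD('n)" "t ^ CARD('n) \<le> 1" using t by (auto intro: power_le_one)
    \<comment> \<open>With Bernoulli's inequality both parts of \<open>?g\<close> carry the factor
      \<open>1 - t\<close>, in the proportion in which they occur in the divergence of
      \<open>(y - p0) f\<close>.\<close>
    have "1 + real CARD('n) * (t - 1) \<le> (1 + (t - 1)) ^ CARD('n)" by (rule Bernoulli_inequality) (use t in simp)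
    then have "1 - t ^ CARD('n) \<le> real CARD('n) * (1 - t)" by (simp add: algebra_simps)
    then have a: "f y * (1 - t ^ CARD('n)) \<le> f y * (real CARD('n) * (1 - t))" by (rule mult_left_mono) (rule f0[OF yP])
    have b: "t ^ CARD('n) * (f y - (1 - t) * ?G) \<le> t ^ CARD('n) * f (shrink p0 t y)" by (rule mult_left_mono[OF 1 tn(1)])
    have e: "t ^ CARD('n) * ((1 - t) * ?G) \<le> 1 * ((1 - t) * ?G)" by (rule mult_right_mono[OF tn(2)]) (use G t in simp)
    have "?g y \<le> f y * (1 - t ^ CARD('n)) + t ^ CARD('n) * ((1 - t) * ?G)" using b by (simp add: algebra_simps)
    also have "\<dots> \<le> f y * (real CARD('n) * (1 - t)) + (1 - t) * ?G" using a e by simp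
    also have "\<dots> = (1 - t) * (?G + real CARD('n) * f y)" by (simp add: algebra_simps)
    finally show ?thesis .
  qed
  have "(LINT y:P|lborel. ?g y) \<le> (1 - t) * (\<Sum>r\<in>UNIV. L r p0 * facet_integral r f)"
  proof (rule LIMSEQ_le)
    show "(\<lambda>k. LINT y:inner_part (depth k)|lborel. cut (depth k) y * ?g y) \<longlonglongrightarrow> (LINT y:P|lborel. ?g y)" by (rule cut_limit[OF gc])
    show "(\<lambda>k. (1 - t) * (LINT y:inner_part (depth k)|lborel. cut (depth k) y * (grad f y \<bullet> (y - p0) + real CARD('n) * f y)))
      \<longlonglongrightarrow> (1 - t) * (\<Sum>r\<in>UNIV. L r p0 * facet_integral r f)"
      by (rule tendsto_mult_left[OF radial_limit[OF f]])
    show "\<exists>N. \<forall>k\<ge>N. (LINT y:inner_part (depth k)|lborel. cut (depth k) y * ?g y)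
      \<le> (1 - t) * (LINT y:inner_part (depth k)|lborel. cut (depth k) y * (grad f y \<bullet> (y - p0) + real CARD('n) * f y))"
    proof (intro exI allI impI)
      fix k
      have K: "compact (inner_part (depth k))" "inner_part (depth k) \<subseteq> interior P" using inner_part_compact[OF depth(1)] inner_part_subset[OF depth(1)] by auto
      have cc: "continuous_on (inner_part (depth k)) (cut (depth k))"
        using Ck_on_continuous[OF Ck_on_cut] continuous_on_subset by blast
      have cf: "continuous_on (inner_part (depth k)) f" using f(2) KP continuous_on_subset by blast
      have cp: "continuous_on (inner_part (depth k)) (partial a f)" for a
        using Ck_on_continuous[OF Ck_on_partial[OF c1]] K(2) continuous_on_subset by blast
      have cg: "continuous_on (inner_part (depth k)) (grad f)" unfolding grad_def[abs_def] by (intro continuous_intros cp)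
      have "(LINT y:inner_part (depth k)|lborel. cut (depth k) y * ?g y)
        \<le> (LINT y:inner_part (depth k)|lborel. (1 - t) * (cut (depth k) y * (grad f y \<bullet> (y - p0) + real CARD('n) * f y)))"
      proof (rule set_integral_mono)
        show "set_integrable lborel (inner_part (depth k)) (\<lambda>y. cut (depth k) y * ?g y)"
          by (rule set_integrable_compact[OF K(1) continuous_on_mult[OF cc continuous_on_subset[OF gc KP]]])
        show "set_integrable lborel (inner_part (depth k)) (\<lambda>y. (1 - t) * (cut (depth k) y * (grad f y \<bullet> (y - p0) + real CARD('n) * f y)))"
          by (rule set_integrable_compact[OF K(1)]) (intro continuous_intros cc cf cg)
        fix y assume "y \<in> inner_part (depth k)"
        then have "y \<in> interior P" using K(2) by blast
        from mult_left_mono[OF point[OF this] cut_bounds(1)[of "depth k" y]]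
        show "cut (depth k) y * ?g y \<le> (1 - t) * (cut (depth k) y * (grad f y \<bullet> (y - p0) + real CARD('n) * f y))"
          by (simp add: mult.left_commute)
      qed
      then show "(LINT y:inner_part (depth k)|lborel. cut (depth k) y * ?g y)
        \<le> (1 - t) * (LINT y:inner_part (depth k)|lborel. cut (depth k) y * (grad f y \<bullet> (y - p0) + real CARD('n) * f y))"
        by (simp only: set_integral_mult_right)
    qed
  qed
  moreover have "(LINT y:P|lborel. ?g y) = (LINT y:P|lborel. f y) - (LINT y:P|lborel. t ^ CARD('n) * f (shrink p0 t y))"
    by (rule set_integral_diff) (intro set_integrable_compact P_compact f(2) continuous_on_mult continuous_on_const fsc)+
  moreover have "(LINT y:P|lborel. t ^ CARD('n) * f (shrink p0 t y)) = (LINT y:shrink p0 t ` P|lborel. f y)"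
  proof -
    let ?K = "shrink p0 t ` P"
    have Kc: "compact ?K" by (intro compact_continuous_image shc P_compact)
    have Ks: "?K \<subseteq> P" using shrink_convex[OF p0P] t by auto
    have inj: "shrink p0 t y \<in> ?K \<longleftrightarrow> y \<in> P" for y
      using t by (auto simp: shrink_def)
    have m: "(\<lambda>y. indicator ?K y *\<^sub>R f y) \<in> borel_measurable borel"
      using borel_measurable_continuous_on_indicator[of ?K f] Kc continuous_on_subset[OF f(2) Ks] by (simp add: borel_compact)
    have "(LINT y:?K|lborel. f y) = \<bar>t\<bar> ^ CARD('n) * (LINT y|lborel. indicator ?K ((p0 - t *\<^sub>R p0) + t *\<^sub>R y) *\<^sub>R f ((p0 - t *\<^sub>R p0) + t *\<^sub>R y))"
      unfolding set_lebesgue_integral_def using integral_lborel_affine[OF m, of t "p0 - t *\<^sub>R p0"] t by simp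
    also have "(\<lambda>y. (p0 - t *\<^sub>R p0) + t *\<^sub>R y) = shrink p0 t" by (auto simp: shrink_def fun_eq_iff algebra_simps)
    then have "(LINT y|lborel. indicator ?K ((p0 - t *\<^sub>R p0) + t *\<^sub>R y) *\<^sub>R f ((p0 - t *\<^sub>R p0) + t *\<^sub>R y)) = (LINT y:P|lborel. f (shrink p0 t y))"
      unfolding set_lebesgue_integral_def
      by (intro Bochner_Integration.integral_cong refl) (metis (no_types, lifting) indicator_simps inj)
    finally show ?thesis using t by simp
  qed
  ultimately show ?thesis by simp
qed

end

section \<open>The stability inequality\<close>

context toric_solution
begin

text \<open>Affine functions are convex with zero Hessian, so all approximating integrals in
  \<open>L_C_limit\<close> are 0.\<close>

lemma L_C_affine: "L_C \<nu> c (\<lambda>y. a \<bullet> y + b) = 0"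
proof -
  let ?f = "\<lambda>y. a \<bullet> y + b"
  have p: "partial i ?f x = a $ i" for i x
  proof -
    have "(?f has_derivative (\<lambda>h. a \<bullet> h)) (at x)" by (auto intro!: derivative_eq_intros)
    from partial_eq[OF this] show ?thesis by (simp add: inner_axis)
  qed
  have pf: "partial i ?f = (\<lambda>x. a $ i)" for i by (rule ext) (rule p)
  have "partial j (\<lambda>x::real^'n. a $ i) x = 0" for i j x using partial_eq[OF has_derivative_const] .
  then have h: "hess ?f x $ i $ j = 0" for x i j by (simp add: hess_def pf)
  have "convex_on P ?f" using P_convex by (auto simp: convex_on_def inner_add_right algebra_simps simp flip: distrib_right)
  moreover have "continuous_on P ?f" by (intro continuous_intros)
  ultimately have "(\<lambda>k. LINT y:inner_part (depth k)|lborel. cut (depth k) y * (\<Sum>i\<in>UNIV. \<Sum>j\<in>UNIV. real_coeff y $ i $ j * hess ?f y $ i $ j)) \<longlonglongrightarrow> L_C \<nu> c ?f"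
    by (rule L_C_limit) (rule Ck_on_affine[OF open_interior])
  then have "(\<lambda>k::nat. 0) \<longlonglongrightarrow> L_C \<nu> c ?f" by (simp add: h set_lebesgue_integral_def)
  then show ?thesis using LIMSEQ_unique tendsto_const by blast
qed

text \<open>The pairing of \<open>real_coeff\<close> with the Hessian is nonnegative everywhere, so
  restricting to \<open>K\<close> only decreases the integral; there the cutoff is eventually 1 and
  coercivity compares with the Laplacian.\<close>

lemma L_C_ge_laplacian:
  assumes f: "convex_on P f" "continuous_on P f" "Ck_on 2 (interior P) f"
    and K: "compact K" "K \<subseteq> interior P" "\<forall>\<^sub>F k in sequentially. K \<subseteq> inner_part (2 * depth k)"
    and \<alpha>: "\<alpha> > 0" "\<And>y x. y \<in> K \<Longrightarrow> \<alpha> * (norm x)\<^sup>2 \<le> x \<bullet> (real_coeff y *v x)"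
  shows "\<alpha> * (LINT y:K|lborel. \<Sum>a\<in>UNIV. hess f y $ a $ a) \<le> L_C \<nu> c f"
proof (rule tendsto_lowerbound[OF L_C_limit[OF f]])
  let ?R = "\<lambda>y. \<Sum>a\<in>UNIV. \<Sum>b\<in>UNIV. real_coeff y $ a $ b * hess f y $ a $ b"
  let ?T = "\<lambda>y. \<Sum>a\<in>UNIV. hess f y $ a $ a"
  have psd: "x \<bullet> (hess f y *v x) \<ge> 0" if "y \<in> interior P" for x y by (rule convex_hessian_nonneg[OF f(1,3) that])
  have R0: "?R y \<ge> 0" if y: "y \<in> interior P" for y
  proof (rule psd_trace_nonneg[OF real_coeff_sym[OF y] _ psd[OF y]])
    show "0 \<le> x \<bullet> (real_coeff y *v x)" for x using real_coeff_pos[OF y, of x] by (cases "x = 0") auto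
  qed
  have RT: "\<alpha> * ?T y \<le> ?R y" if "y \<in> K" for y
  proof -
    have y: "y \<in> interior P" using that K(2) by blast
    show ?thesis by (rule trace_lower_bound[OF real_coeff_sym[OF y] \<alpha>(2)[OF that] psd[OF y]])
  qed
  have ch: "continuous_on (interior P) (hess f)"
    using Ck_on_continuous[OF Ck_on_hess[OF open_interior, of 0 P f]] f(3) by (simp add: numeral_2_eq_2)
  have cR: "continuous_on (interior P) ?R"
    by (intro continuous_intros ch Ck_on_continuous[OF Ck_on_real_coeff[of 0]])
  show "\<forall>\<^sub>F k in sequentially. \<alpha> * (LINT y:K|lborel. ?T y) \<le> (LINT y:inner_part (depth k)|lborel. cut (depth k) y * ?R y)"
    using K(3)
  proof eventually_elim
    case (elim k)
    have D: "compact (inner_part (depth k))" "inner_part (depth k) \<subseteq> interior P" using inner_part_compact[OF depth(1)] inner_part_subset[OF depth(1)] by auto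
    have cc: "continuous_on (inner_part (depth k)) (cut (depth k))"
      using Ck_on_continuous[OF Ck_on_cut] continuous_on_subset by blast
    have KD: "K \<subseteq> inner_part (depth k)"
    proof
      fix y assume "y \<in> K"
      then have "2 * depth k \<le> L r y" for r using elim by (auto simp: inner_part_def)
      moreover have "depth k \<le> 2 * depth k" using depth(1)[of k] by simp
      ultimately show "y \<in> inner_part (depth k)" unfolding inner_part_def using order_trans by blast
    qed
    have "(LINT y:K|lborel. \<alpha> * ?T y) \<le> (LINT y:inner_part (depth k)|lborel. cut (depth k) y * ?R y)"
      unfolding set_lebesgue_integral_def
    proof (rule integral_mono)
      show "integrable lborel (\<lambda>y. indicator K y *\<^sub>R (\<alpha> * ?T y))"
        unfolding set_integrable_def[symmetric]
        by (rule set_integrable_compact[OF K(1)]) (intro continuous_intros continuous_on_subset[OF ch K(2)])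
      show "integrable lborel (\<lambda>y. indicator (inner_part (depth k)) y *\<^sub>R (cut (depth k) y * ?R y))"
        unfolding set_integrable_def[symmetric]
        by (rule set_integrable_compact[OF D(1) continuous_on_mult[OF cc continuous_on_subset[OF cR D(2)]]])
      fix y
      show "indicator K y *\<^sub>R (\<alpha> * ?T y) \<le> indicator (inner_part (depth k)) y *\<^sub>R (cut (depth k) y * ?R y)"
      proof (cases "y \<in> K")
        case True
        then have "cut (depth k) y = 1" "y \<in> inner_part (depth k)" using elim KD by (auto intro: cut_eq_1[OF depth(1)])
        then show ?thesis using True RT[OF True] by simp
      next
        case False
        have "0 \<le> cut (depth k) y * ?R y" if "y \<in> inner_part (depth k)"
          using that D(2) R0[of y] cut_bounds(1)[of "depth k" y] by (intro mult_nonneg_nonneg) auto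
        then show ?thesis using False by (cases "y \<in> inner_part (depth k)") simp_all
      qed
    qed
    then show ?case by (simp only: set_integral_mult_right)
  qed
qed simp

lemma uniform_stability:
  assumes p0: "p0 \<in> interior P"
  shows "uniformly_K_stable \<nu> c p0"
proof -
  have p0P: "p0 \<in> P" using p0 interior_subset by blast
  obtain M where M: "M > 0" "\<And>r y. y \<in> P \<Longrightarrow> L r y \<le> M" using L_bounded by blast
  define C where "C = const_C \<nu> c"
  have C0: "C \<ge> 0" using const_C_nonneg by (simp add: C_def)
  \<comment> \<open>The mass lost by shrinking is at most \<open>s * M * \<sigma>\<close>, so that
    \<open>C * (s * M) \<le> 1 / 2\<close> leaves half of the boundary integral after absorption.
    The \<open>+ 1\<close> keeps \<open>s\<close> well defined for \<open>C = 0\<close>.\<close>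
  define s where "s = 1 / (2 * (C * M + 1))"
  have CM: "C * M + 1 \<ge> 1" using C0 M(1) by simp
  have s: "0 < s" "s < 1" "C * (s * M) \<le> 1 / 2" using CM by (auto simp: s_def field_simps)
  define t where "t = 1 - s"
  have t: "0 < t" "t < 1" using s by (auto simp: t_def)
  define K where "K = shrink p0 t ` P"
  have shc: "continuous_on S (shrink p0 t)" for S unfolding shrink_def[abs_def] by (intro continuous_intros)
  have Kc: "compact K" unfolding K_def by (intro compact_continuous_image shc P_compact)
  have Ki: "K \<subseteq> interior P" using shrink_in[OF p0] t by (auto simp: K_def)
  have KP: "K \<subseteq> P" using Ki interior_subset by blast
  have Kx: "convex K"
  proof -
    have "K = (\<lambda>y. (p0 - t *\<^sub>R p0) + y) ` ((\<lambda>y. t *\<^sub>R y) ` P)"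
      unfolding K_def image_image shrink_def by (intro image_cong refl) (simp add: algebra_simps)
    then show ?thesis using convex_translation[OF convex_scaling[OF P_convex]] by metis
  qed
  have "shrink p0 t p0 = p0" by (simp add: shrink_def)
  then have p0K: "p0 \<in> K" unfolding K_def using p0P by (metis imageI)
  have Kd2: "\<forall>\<^sub>F k in sequentially. K \<subseteq> inner_part (2 * depth k)"
  proof -
    have "\<forall>\<^sub>F k in sequentially. \<forall>r. 2 * depth k < (1 - t) * L r p0"
    proof (rule eventually_all_finite)
      fix r
      have "(\<lambda>k. 2 * depth k) \<longlonglongrightarrow> 2 * 0" by (intro tendsto_intros depth)
      moreover have "2 * 0 < (1 - t) * L r p0" using p0 interior_P t by auto
      ultimately show "\<forall>\<^sub>F k in sequentially. 2 * depth k < (1 - t) * L r p0" by (rule order_tendstoD(2))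
    qed
    then show ?thesis
    proof eventually_elim
      case (elim k)
      have "2 * depth k \<le> L r (shrink p0 t y)" if "y \<in> P" for r y
      proof -
        have "0 \<le> t * L r y" using that t by (simp add: moment_polytope_def)
        then show ?thesis unfolding L_shrink using elim[rule_format, of r] by linarith
      qed
      then show ?case by (auto simp: K_def inner_part_def)
    qed
  qed
  obtain \<alpha> where \<alpha>: "\<alpha> > 0" "\<And>y x. y \<in> K \<Longrightarrow> \<alpha> * (norm x)\<^sup>2 \<le> x \<bullet> (real_coeff y *v x)" using real_coeff_coercive[OF Kc Ki] by blast
  obtain d where d: "d > 0" "\<And>x y. x \<in> P \<Longrightarrow> y \<in> P \<Longrightarrow> norm (x - y) \<le> d"
  proof -
    obtain B where B: "B > 0" "\<And>x. x \<in> P \<Longrightarrow> norm x \<le> B"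
      using compact_imp_bounded[OF P_compact] unfolding bounded_pos by blast
    have "norm (x - y) \<le> 2 * B" if "x \<in> P" "y \<in> P" for x y
      using norm_triangle_ineq4[of x y] B(2)[OF that(1)] B(2)[OF that(2)] by linarith
    then show ?thesis using that[of "2 * B"] B(1) by simp
  qed
  obtain \<rho> where \<rho>: "\<rho> > 0" "cball p0 \<rho> \<subseteq> P" using p0 mem_interior_cball by blast
  \<comment> \<open>\<open>P\<close> has diameter at most \<open>d\<close>, so the image of
    \<open>P\<close> under the reflection at \<open>p0\<close> contracted by
    \<open>\<epsilon>\<close> lies in the ball of radius \<open>\<rho>\<close>. The same map then
    preserves the homothetic copy \<open>K\<close>.\<close>
  define \<epsilon> where "\<epsilon> = min 1 (\<rho> / d)"
  have \<epsilon>: "0 < \<epsilon>" "\<epsilon> \<le> 1" "\<epsilon> * d \<le> \<rho>" using \<rho>(1) d(1) by (auto simp: \<epsilon>_def min_def field_simps)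
  have refl: "(1 + \<epsilon>) *\<^sub>R p0 + (- \<epsilon>) *\<^sub>R x \<in> K" if xK: "x \<in> K" for x
  proof -
    obtain y where y: "y \<in> P" "x = shrink p0 t y" using xK unfolding K_def by blast
    have "norm (\<epsilon> *\<^sub>R (y - p0)) \<le> \<epsilon> * d" using d(2)[OF y(1) p0P] \<epsilon>(1) by simp
    then have "p0 - \<epsilon> *\<^sub>R (y - p0) \<in> cball p0 \<rho>" using \<epsilon>(3) by (simp add: dist_norm)
    then have "p0 - \<epsilon> *\<^sub>R (y - p0) \<in> P" using \<rho>(2) by blast
    moreover have "(1 + \<epsilon>) *\<^sub>R p0 + (- \<epsilon>) *\<^sub>R x = shrink p0 t (p0 - \<epsilon> *\<^sub>R (y - p0))"
      unfolding y(2) shrink_def by (simp add: algebra_simps)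
    ultimately show ?thesis unfolding K_def by blast
  qed
  have K0: "emeasure lborel K \<noteq> 0"
  proof
    assume z: "emeasure lborel K = 0"
    obtain e where e: "e > 0" "ball p0 e \<subseteq> K"
    proof (rule that[of "t * \<rho>"])
      show "t * \<rho> > 0" using t \<rho> by simp
      show "ball p0 (t * \<rho>) \<subseteq> K"
      proof
        fix y assume "y \<in> ball p0 (t * \<rho>)"
        then have "norm (y - p0) \<le> t * \<rho>" by (simp add: dist_norm norm_minus_commute)
        then have "norm ((1 / t) *\<^sub>R (y - p0)) \<le> \<rho>" using t by (simp add: pos_divide_le_eq mult.commute)
        then have "p0 + (1 / t) *\<^sub>R (y - p0) \<in> cball p0 \<rho>" by (simp add: dist_norm)
        then have "p0 + (1 / t) *\<^sub>R (y - p0) \<in> P" using \<rho>(2) by blast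
        moreover have "shrink p0 t (p0 + (1 / t) *\<^sub>R (y - p0)) = y" using t by (simp add: shrink_def)
        ultimately show "y \<in> K" unfolding K_def by (metis imageI)
      qed
    qed
    have "emeasure lborel (ball p0 e) \<le> emeasure lborel K" using e(2) Kc by (intro emeasure_mono) (simp_all add: borel_compact)
    then have "measure lborel (ball p0 e) = 0" using z by (simp add: measure_def)
    then show False using content_ball_pos[OF e(1), of p0] by simp
  qed
  define A where "A = d\<^sup>2 * 2 ^ CARD('n) + d\<^sup>2 / \<epsilon> * (2 / \<epsilon>) ^ CARD('n)"
  have A0: "A \<ge> 0" using \<epsilon> by (simp add: A_def)
  \<comment> \<open>Read off from
    \<open>\<sigma> / 2 \<le> (1 + C * (A / \<alpha>)) * L_C \<nu> c f\<close>, where the 2 stems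
    from the absorbed half.\<close>
  define \<kappa> where "\<kappa> = 1 / (2 * (1 + C * (A / \<alpha>)))"
  have \<kappa>: "\<kappa> > 0" using C0 A0 \<alpha>(1) by (simp add: \<kappa>_def add_pos_nonneg)
  have "\<kappa> * boundary_integral \<nu> c f \<le> L_C \<nu> c f" if fC: "f \<in> C_infinity P p0" for f
  proof -
    have f: "convex_on P f" "continuous_on P f" "smooth_on (interior P) f" "f p0 = 0" "(f has_derivative (\<lambda>_. 0)) (at p0)"
      using fC by (auto simp: C_infinity_def)
    have c: "Ck_on k (interior P) f" for k using f(3) by (simp add: smooth_on_def)
    have g0: "grad f p0 = 0" using partial_eq[OF f(5)] by (simp add: grad_def vec_eq_iff)
    have f0: "f y \<ge> 0" if "y \<in> P" for y using convex_gradient_ineq[OF f(1) c[of "Suc 0"] p0 that] f(4) g0 by simp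
    define \<sigma> where "\<sigma> = boundary_integral \<nu> c f"
    have \<sigma>0: "facet_integral r f \<ge> 0" for r by (rule facet_integral_nonneg[OF f0])
    have "(LINT y:K|lborel. f y) \<le> A * (LINT y:K|lborel. \<Sum>a\<in>UNIV. hess f y $ a $ a)"
      unfolding A_def using KP f0
      by (intro convex_integral_le_laplacian[OF f(1) c Kx Kc Ki p0K f(4) \<epsilon>(1,2) refl _ _ K0] d(2)) auto
    also have "\<dots> \<le> A * (L_C \<nu> c f / \<alpha>)"
      using L_C_ge_laplacian[OF f(1,2) c Kc Ki Kd2 \<alpha>] \<alpha>(1) A0 by (intro mult_left_mono) (simp_all add: field_simps)
    finally have 1: "(LINT y:K|lborel. f y) \<le> (A / \<alpha>) * L_C \<nu> c f" by simp
    have "(LINT y:P|lborel. f y) - (LINT y:K|lborel. f y) \<le> (1 - t) * (\<Sum>r\<in>UNIV. L r p0 * facet_integral r f)"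
      unfolding K_def by (rule integral_shrink[OF f(1,2) c p0 f(4) f0 t])
    also have "\<dots> \<le> (1 - t) * (\<Sum>r\<in>UNIV. M * facet_integral r f)"
      using t by (intro mult_left_mono sum_mono mult_right_mono M(2)[OF p0P] \<sigma>0) auto
    also have "\<dots> = s * M * \<sigma>" by (simp add: \<sigma>_def boundary_integral_facet_integral sum_distrib_left t_def mult.assoc)
    finally have "(LINT y:P|lborel. f y) \<le> (A / \<alpha>) * L_C \<nu> c f + s * M * \<sigma>" using 1 by linarith
    then have "C * (LINT y:P|lborel. f y) \<le> C * ((A / \<alpha>) * L_C \<nu> c f + s * M * \<sigma>)" by (rule mult_left_mono[OF _ C0])
    moreover have "L_C \<nu> c f = \<sigma> - C * (LINT y:P|lborel. f y)" by (simp add: L_C_def \<sigma>_def C_def)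
    moreover have "C * (s * M) * \<sigma> \<le> 1 / 2 * \<sigma>"
      by (rule mult_right_mono[OF s(3)]) (simp add: \<sigma>_def boundary_integral_facet_integral sum_nonneg \<sigma>0)
    moreover have "C * ((A / \<alpha>) * L_C \<nu> c f + s * M * \<sigma>) = C * (A / \<alpha>) * L_C \<nu> c f + C * (s * M) * \<sigma>"
      by (simp only: distrib_left mult.assoc)
    moreover have "(1 + C * (A / \<alpha>)) * L_C \<nu> c f = L_C \<nu> c f + C * (A / \<alpha>) * L_C \<nu> c f"
      by (simp only: distrib_right mult_1)
    ultimately have le: "\<sigma> / 2 \<le> (1 + C * (A / \<alpha>)) * L_C \<nu> c f" by linarith
    have Z: "1 + C * (A / \<alpha>) > 0" using C0 A0 \<alpha>(1) by (simp add: add_pos_nonneg)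
    have "1 / (2 * Z) * \<sigma> \<le> X" if "\<sigma> / 2 \<le> Z * X" "Z > 0" for Z X :: real
      using that by (simp add: field_simps)
    from this[OF le Z] show ?thesis unfolding \<sigma>_def[symmetric] \<kappa>_def .
  qed
  then show ?thesis unfolding uniformly_K_stable_def using L_C_affine \<kappa> by blast
qed

end

theorem theorem1p16:
  fixes \<nu> :: "'r::finite \<Rightarrow> int^'n" and c :: "'r \<Rightarrow> real"
    and u :: "real^'n \<Rightarrow> real" and \<xi> :: "real^'n \<Rightarrow> complex^'n^'n" and p0 :: "real^'n"
  assumes "delzant \<nu> c"
    and "polarised (moment_polytope \<nu> c)"
    and "symplectic_potential \<nu> c u"
    and "higgs_tensor \<nu> c \<xi>"
    and "higgs_bound (moment_polytope \<nu> c) u \<xi>"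
    and "toric_HcscK \<nu> c u \<xi>"
    and "p0 \<in> interior (moment_polytope \<nu> c)"
  shows "uniformly_K_stable \<nu> c p0"
proof -
  interpret toric_solution \<nu> c u \<xi> by unfold_locales (fact assms)+
  show ?thesis by (rule uniform_stability[OF assms(7)])
qed

end
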